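(* Let $n\ge 1$, let $\beta'$ be a positive $n$-braid of length $c$, and let $\beta=\Delta_n^2\,\beta'\in B_n$, where $\Delta_n^2$ is the positive full twist. Let $N\ge 0$ be an integer with $N>n-2$. Then $$J'_{N+1}(\overline\beta;t)=(-1)^{N(n+c+1)}t^{\frac{N((n-1)^2+c)}{2}}\left(\sum_{i=0}^{n-1}t^{i(N+1)}+R(t)\right),$$ where $R(t)$ is a polynomial in $t$ all of whose terms have degree $\ge nN+1$.
   Context: $B_n$ is the braid group with standard generators $\sigma_i$ (positive crossings when strands are oriented in parallel); a positive braid of length $c$ is a product of $c$ generators $\sigma_i$ (no inverses). $\Delta_n^2=(\sigma_1\cdots\sigma_{n-1})^n$; $\overline\beta$ is the closure of $\beta$, with all strands oriented in parallel. Colored Jones polynomial: $J_N(L;t)$ is the colored Jones polynomial of the oriented link $L$, with every component colored by the $N$-dimensional irreducible representation of $\mathfrak{sl}_2(\mathbb C)$, normalized so that $J_2(L;t)=(t^{1/2}+t^{-1/2})V_L(t)$ and $J_N(\bigcirc;t)=[N]:=\frac{t^{N/2}-t^{-N/2}}{t^{1/2}-t^{-1/2}}$. Here $V_L$ is the Jones polynomial with $t^{-1}V_{L_+}-tV_{L_-}=(t^{1/2}-t^{-1/2})V_{L_0}$, $V_\bigcirc=1$. The normalized version is $J'_N(L;t)=J_N(L;t)/[N]$. Explicitly, let $D$ be a diagram of $L$ with writhe $w(D)$, and let $\langle\cdot\rangle$ be the Kauffman bracket: $\langle\text{crossing}\rangle=A\langle A\text{-smoothing}\rangle+A^{-1}\langle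 B\text{-smoothing}\rangle$, $\langle E\sqcup\bigcirc\rangle=\delta\langle E\rangle$, $\delta=-A^2-A^{-2}$, $\langle\bigcirc\rangle=1$, $\langle\emptyset\rangle=\delta^{-1}$, with conventions such that $V_L(A^{-4})=(-A^3)^{-w(D)}\langle D\rangle$ (with $t^{1/2}=A^{-2}$). Then $$J_{N+1}(L;A^{-4})=\bigl((-1)^NA^{N^2+2N}\bigr)^{-w(D)}(-1)^{N-1}(A^2+A^{-2})\,\langle S_N(D)\rangle .$$ Here $S_N(x)=\sum_{j=0}^{\lfloor N/2\rfloor}(-1)^j\binom{N-j}{j}x^{N-2j}$, and $S_N(D)$ is the linear combination of blackboard cablings of $D$ obtained by replacing each component by the combination $S_N$ of its parallel blackboard cables, where $x^r$ means $r$ parallel copies; this is extended multilinearly over the components. For a knot diagram, $S_N(D)=\sum_{j}(-1)^j\binom{N-j}{j}D^{(N-2j)}$, where $D^{(r)}$ is the blackboard $r$-cable. *)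

theory Defs
  imports "HOL-Computational_Algebra.Computational_Algebra" "HOL-Library.FuncSet"
begin

text \<open>
  A crossing is recorded by its sign and by the four arcs meeting there: the overstrand runs from
  \<open>over_in\<close> to \<open>over_out\<close>, the understrand from \<open>under_in\<close> to \<open>under_out\<close>.  The sign and the
  orientations determine the cyclic order of the four arcs in the plane.
\<close>

datatype 'e crossing =
  Crossing (is_positive: bool) (over_in: 'e) (over_out: 'e) (under_in: 'e) (under_out: 'e)

text \<open>
  An arc \<open>e\<close> runs between two consecutive vertices, which are crossings or bivalent vertices.
  The bivalent vertices are the pairs \<open>(e, f)\<close> in \<open>joins\<close>: the end of \<open>e\<close> is the start of \<open>f\<close>.
  A circle without crossings is, for example, an arc \<open>e\<close> with \<open>(e, e)\<close> in \<open>joins\<close>.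
\<close>

datatype 'e diagram =
  Diagram (arcs: "'e set") (crossings: "'e crossing list") (joins: "('e \<times> 'e) set")

definition writhe :: "'e diagram \<Rightarrow> int" where
  "writhe D = (\<Sum>x\<leftarrow>crossings D. if is_positive x then 1 else - 1)"

text \<open>
  Every arc has two ends, each glued to exactly one other end, so the closed curves obtained by
  gluing are the equivalence classes of arcs.
\<close>

definition curves :: "'e set \<Rightarrow> ('e \<times> 'e) set \<Rightarrow> 'e set set" where
  "curves E R = E // (R \<union> R\<inverse>)\<^sup>*"

definition strand_rel :: "'e diagram \<Rightarrow> ('e \<times> 'e) set" where
  "strand_rel D =
     (\<Union>x\<in>set (crossings D). {(over_in x, over_out x), (under_in x, under_out x)}) \<union> joins D"

definition components :: "'e diagram \<Rightarrow> 'e set set" where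
  "components D = curves (arcs D) (strand_rel D)"

definition component_of :: "'e diagram \<Rightarrow> 'e \<Rightarrow> 'e set" where
  "component_of D e = (strand_rel D \<union> (strand_rel D)\<inverse>)\<^sup>* `` {e}"


definition oriented_smoothing :: "'e crossing \<Rightarrow> ('e \<times> 'e) set" where
  "oriented_smoothing x = {(over_in x, under_out x), (under_in x, over_out x)}"

definition disoriented_smoothing :: "'e crossing \<Rightarrow> ('e \<times> 'e) set" where
  "disoriented_smoothing x = {(over_in x, under_in x), (over_out x, under_out x)}"

text \<open>
  The A-smoothing of a positive crossing is the oriented one.  Then a positive kink contributes
  \<open>A * \<delta> + A\<inverse> = - A\<^sup>3\<close>, as required by \<open>V = (- A\<^sup>3) powi (- w) * \<langle>D\<rangle>\<close>.
\<close>

definition A_smoothing :: "'e crossing \<Rightarrow> ('e \<times> 'e) set" where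
  "A_smoothing x = (if is_positive x then oriented_smoothing x else disoriented_smoothing x)"

definition B_smoothing :: "'e crossing \<Rightarrow> ('e \<times> 'e) set" where
  "B_smoothing x = (if is_positive x then disoriented_smoothing x else oriented_smoothing x)"

text \<open>
  The last argument collects the arc ends glued so far.  The exponent \<open>- 1\<close> in the base case gives
  \<open>\<langle>O\<rangle> = 1\<close> and \<open>\<langle>\<emptyset>\<rangle> = \<delta>\<inverse>\<close>.
\<close>

fun bracket_aux :: "'a::field \<Rightarrow> 'e set \<Rightarrow> 'e crossing list \<Rightarrow> ('e \<times> 'e) set \<Rightarrow> 'a" where
  "bracket_aux A E [] R = (- (A powi 2) - A powi (- 2)) powi (int (card (curves E R)) - 1)"
| "bracket_aux A E (x # xs) R =
     A * bracket_aux A E xs (A_smoothing x \<union> R) + A powi (- 1) * bracket_aux A E xs (B_smoothing x \<union> R)"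

definition bracket :: "'a::field \<Rightarrow> 'e diagram \<Rightarrow> 'a" where
  "bracket A D = bracket_aux A (arcs D) (crossings D) (joins D)"


text \<open>
  In the cable the arc \<open>e\<close> becomes \<open>r e\<close> parallel arcs \<open>Copy e 0, Copy e 1, \<dots>\<close>, numbered from left
  to right with respect to the orientation of \<open>e\<close>.  A crossing with \<open>a\<close> copies of the overstrand and
  \<open>b\<close> copies of the understrand becomes an \<open>a\<close> by \<open>b\<close> grid of crossings.  Inside the grid of the
  \<open>k\<close>-th crossing, copy \<open>i\<close> of the overstrand is cut into the segments
  \<open>Over k i 0, \<dots>, Over k i b\<close>, where \<open>Over k i j\<close> and \<open>Over k i (Suc j)\<close> are separated by copy \<open>j\<close>
  of the understrand; likewise \<open>Under k j 0, \<dots>, Under k j a\<close> for copy \<open>j\<close> of the understrand.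
  At a positive crossing the overstrand passes from the left to the right of the understrand, so it
  meets the copies \<open>0, 1, \<dots>\<close> in increasing order, whereas the understrand meets the copies of the
  overstrand in decreasing order; at a negative crossing it is the other way round.
\<close>

datatype 'e cable_arc = Copy 'e nat | Over nat nat nat | Under nat nat nat

definition cable_crossing :: "nat \<Rightarrow> bool \<Rightarrow> nat \<Rightarrow> nat \<Rightarrow> 'e cable_arc crossing" where
  "cable_crossing k pos i j =
     (if pos
      then Crossing True (Over k i j) (Over k i (Suc j)) (Under k j (Suc i)) (Under k j i)
      else Crossing False (Over k i (Suc j)) (Over k i j) (Under k j i) (Under k j (Suc i)))"

definition cable_grid :: "('e \<Rightarrow> nat) \<Rightarrow> nat \<Rightarrow> 'e crossing \<Rightarrow> 'e cable_arc crossing list" where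
  "cable_grid r k x =
     [cable_crossing k (is_positive x) i j. i \<leftarrow> [0..<r (over_in x)], j \<leftarrow> [0..<r (under_in x)]]"

definition cable_segments :: "('e \<Rightarrow> nat) \<Rightarrow> nat \<Rightarrow> 'e crossing \<Rightarrow> 'e cable_arc set" where
  "cable_segments r k x =
     (let a = r (over_in x); b = r (under_in x)
      in {Over k i j | i j. i < a \<and> j \<le> b} \<union> {Under k j i | j i. j < b \<and> i \<le> a})"

definition cable_joins ::
  "('e \<Rightarrow> nat) \<Rightarrow> nat \<Rightarrow> 'e crossing \<Rightarrow> ('e cable_arc \<times> 'e cable_arc) set" where
  "cable_joins r k x =
     (let a = r (over_in x); b = r (under_in x);
          (o_start, o_end) = (if is_positive x then (0, b) else (b, 0));
          (u_start, u_end) = (if is_positive x then (a, 0) else (0, a))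
      in (\<Union>i<a. {(Copy (over_in x) i, Over k i o_start), (Over k i o_end, Copy (over_out x) i)}) \<union>
         (\<Union>j<b. {(Copy (under_in x) j, Under k j u_start), (Under k j u_end, Copy (under_out x) j)}))"

text \<open>The number of copies \<open>r\<close> is meant to be constant on the components of \<open>D\<close>.\<close>

definition cable :: "('e \<Rightarrow> nat) \<Rightarrow> 'e diagram \<Rightarrow> 'e cable_arc diagram" where
  "cable r D =
     (let xs = crossings D; m = length xs
      in Diagram
           ({Copy e i | e i. e \<in> arcs D \<and> i < r e} \<union> (\<Union>k<m. cable_segments r k (xs ! k)))
           (concat (map (\<lambda>k. cable_grid r k (xs ! k)) [0..<m]))
           ((\<Union>(e, f)\<in>joins D. {(Copy e i, Copy f i) | i. i < r e}) \<union>
            (\<Union>k<m. cable_joins r k (xs ! k))))"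


text \<open>
  \<open>bracket_S A N D\<close> is \<open>\<langle>S\<^sub>N(D)\<rangle>\<close>: by multilinearity, the sum over all choices of a summand \<open>j C\<close> of
  \<open>S\<^sub>N\<close> for every component \<open>C\<close>.
\<close>

definition bracket_S :: "'a::field \<Rightarrow> nat \<Rightarrow> 'e diagram \<Rightarrow> 'a" where
  "bracket_S A N D =
     (\<Sum>j \<in> components D \<rightarrow>\<^sub>E {0..N div 2}.
        (\<Prod>C\<in>components D. (- 1) ^ j C * of_nat ((N - j C) choose j C)) *
        bracket A (cable (\<lambda>e. N - 2 * j (component_of D e)) D))"

text \<open>
  The value of the polynomial at \<open>t = A powi (- 4)\<close>, \<open>t\<^bsup>1/2\<^esup> = A powi (- 2)\<close>.  The first numeric
  argument is the dimension of the representation.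
\<close>

fun colored_jones :: "'a::field \<Rightarrow> nat \<Rightarrow> 'e diagram \<Rightarrow> 'a" where
  "colored_jones A 0 D = 0"
| "colored_jones A (Suc N) D =
     ((- 1) ^ N * A ^ (N\<^sup>2 + 2 * N)) powi (- writhe D) *
     (- 1) powi (int N - 1) * (A powi 2 + A powi (- 2)) * bracket_S A N D"

text \<open>The first argument of \<open>quantum_int\<close> stands for \<open>t\<^bsup>1/2\<^esup>\<close>.\<close>

definition quantum_int :: "'a::field \<Rightarrow> nat \<Rightarrow> 'a" where
  "quantum_int s d = (s powi int d - s powi (- int d)) / (s - s powi (- 1))"

definition normalized_colored_jones :: "'a::field \<Rightarrow> nat \<Rightarrow> 'e diagram \<Rightarrow> 'a" where
  "normalized_colored_jones A d D = colored_jones A d D / quantum_int (A powi (- 2)) d"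

definition A_var :: "int poly fract" where
  "A_var = to_fract [:0, 1:]"

definition sqrt_t :: "int poly fract" where
  "sqrt_t = A_var powi (- 2)"

definition t_var :: "int poly fract" where
  "t_var = A_var powi (- 4)"


text \<open>The letter \<open>(i, True)\<close> is \<open>\<sigma>\<^sub>i\<close>, the letter \<open>(i, False)\<close> its inverse, where \<open>1 \<le> i < n\<close>.\<close>

type_synonym braid_word = "(nat \<times> bool) list"

text \<open>
  Equality in \<open>B\<^sub>n\<close>.  The relations only involve generators of \<open>B\<^sub>n\<close>, so a word representing an
  element of \<open>B\<^sub>n\<close> is related only to words in these generators.
\<close>

inductive braid_eq :: "nat \<Rightarrow> braid_word \<Rightarrow> braid_word \<Rightarrow> bool" for n where
  refl: "braid_eq n u u"
| sym: "braid_eq n u v \<Longrightarrow> braid_eq n v u"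
| trans: "braid_eq n u v \<Longrightarrow> braid_eq n v w \<Longrightarrow> braid_eq n u w"
| append: "braid_eq n u u' \<Longrightarrow> braid_eq n v v' \<Longrightarrow> braid_eq n (u @ v) (u' @ v')"
| cancel: "1 \<le> i \<Longrightarrow> i < n \<Longrightarrow> braid_eq n [(i, s), (i, \<not> s)] []"
| far: "1 \<le> i \<Longrightarrow> i + 2 \<le> j \<Longrightarrow> j < n \<Longrightarrow>
    braid_eq n [(i, True), (j, True)] [(j, True), (i, True)]"
| braid: "1 \<le> i \<Longrightarrow> i + 1 < n \<Longrightarrow>
    braid_eq n [(i, True), (i + 1, True), (i, True)] [(i + 1, True), (i, True), (i + 1, True)]"

definition positive_braid_word :: "nat \<Rightarrow> braid_word \<Rightarrow> bool" where
  "positive_braid_word n w \<longleftrightarrow> (\<forall>(i, s)\<in>set w. 1 \<le> i \<and> i < n \<and> s)"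

definition full_twist :: "nat \<Rightarrow> braid_word" where
  "full_twist n = concat (replicate n (map (\<lambda>i. (i, True)) [1..<n]))"

text \<open>
  The strands run upwards; \<open>(p, l)\<close> is the arc at position \<open>p\<close> (from the left) below the \<open>l\<close>-th
  letter.  In \<open>\<sigma>\<^sub>i\<close> the overstrand goes from bottom left to top right, which is a positive crossing.
\<close>

fun braid_crossing :: "nat \<Rightarrow> nat \<times> bool \<Rightarrow> (nat \<times> nat) crossing" where
  "braid_crossing l (i, True) = Crossing True (i, l) (i + 1, l + 1) (i + 1, l) (i, l + 1)"
| "braid_crossing l (i, False) = Crossing False (i + 1, l) (i, l + 1) (i, l) (i + 1, l + 1)"

definition braid_closure :: "nat \<Rightarrow> braid_word \<Rightarrow> (nat \<times> nat) diagram" where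
  "braid_closure n w =
     (let m = length w
      in Diagram
           ({1..n} \<times> {0..m})
           (map (\<lambda>l. braid_crossing l (w ! l)) [0..<m])
           ((\<Union>l<m. {((p, l), (p, l + 1)) | p. p \<in> {1..n} - {fst (w ! l), fst (w ! l) + 1}}) \<union>
            {((p, m), (p, 0)) | p. p \<in> {1..n}}))"

end

theory Submission
  imports Defs
begin

text \<open>
  Put \<open>q = A powi (- 2)\<close>, so that \<open>t = q\<^sup>2\<close>.  The bracket of the closure of a word in crossings is a
  weighted trace of a vertex model on a tensor power of a two-dimensional space: both the number of
  curves of a smoothing and the trace of the Temperley--Lieb generators are Markov traces, and such a
  trace is unique.  The Chebyshev combination of cables turns this into a trace over
  Jones--Wenzl projections, one on every strand.  Since the lowering operator commutes with
  everything, one strand may be cut open, and the trace is \<open>\<plusminus> [N + 1]\<close> times a normalised trace \<open>G\<close>, which is a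
  polynomial in \<open>t\<close> up to a unit.

  On \<open>m = n * N\<close> points, modulo cups, a positive braid in the Hecke normalisation acts trivially on each of the
  \<open>m + 1\<close> sorted states, and these have the weights \<open>1, t, \<dots>, t ^ m\<close>.  What factors through a cup is
  multiplied by \<open>t ^ m\<close> when the cup is pulled through the full twist, and has weight divisible by \<open>t\<close>.
  Hence \<open>(1 + t + \<dots> + t ^ N) * G = 1 + t + \<dots> + t ^ m\<close> modulo \<open>t ^ (m + 1)\<close>, which determines \<open>G\<close>
  modulo \<open>t ^ (m + 1)\<close>.  Negative letters of \<open>\<beta>\<close> are harmless, because the vertex model respects the braid relations.
\<close>

section \<open>Matrices as operators on functions\<close>

text \<open>The map \<open>symz\<close> used on a strand is not the Jones-Wenzl idempotent itself
  but an oblique projection onto the same space, the functions killed by all caps. Its entries are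
  powers of q, while the idempotent has quantum integers in its denominators; so everything stays in
  Z[q]. The price: a crossing only preserves the image, and commutation is replaced by
  \<open>P X P = X P\<close> and cyclicity of the trace. Crossings occur in two normalisations. With
  the Kauffman factor A, where \<open>A * A * q = 1\<close>, caps slide past crossings without a
  scalar; this drives the Chebyshev recursion. With factor 1 a crossing fixes all functions killed
  by caps and has entries in Z[q]; this drives the estimate. There a cap pays q for each strand it
  passes, and the two curls in a full twist pay the remaining q^4. The number of curves in a
  smoothing is read off from a second vertex model, with loop value 2, which counts two-colourings.
  The parity of inversion numbers shows that G has only even powers of q. Dividing by 1 + t + ... +
  t^N loses no precision because its constant coefficient is 1.\<close>

definition fl :: "'s set \<Rightarrow> (('s \<Rightarrow> 'a::comm_ring_1) \<Rightarrow> 'a) \<Rightarrow> bool" where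
  "fl S \<phi> \<longleftrightarrow> finite S \<and> (\<exists>k. \<forall>f. \<phi> f = (\<Sum>s\<in>S. k s * f s))"

definition unit_fun :: "'s \<Rightarrow> 's \<Rightarrow> 'a::comm_ring_1" where
  "unit_fun s = (\<lambda>s'. if s' = s then 1 else 0)"

definition tr :: "'s set \<Rightarrow> (('s \<Rightarrow> 'a::comm_ring_1) \<Rightarrow> 's \<Rightarrow> 'a) \<Rightarrow> 'a" where
  "tr S X = (\<Sum>s\<in>S. X (unit_fun s) s)"

lemma fl_eval: "finite S \<Longrightarrow> s \<in> S \<Longrightarrow> fl S (\<lambda>f. f s)"
  unfolding fl_def
  by (rule conjI, assumption, rule exI[of _ "unit_fun s"]) (auto simp: unit_fun_def if_distrib[of "\<lambda>x. x * _"] cong: if_cong)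

lemma fl_zero: "finite S \<Longrightarrow> fl S (\<lambda>f. 0)"
  unfolding fl_def by (rule conjI, assumption, rule exI[of _ "\<lambda>_. 0"]) auto

lemma fl_add: "fl S \<phi> \<Longrightarrow> fl S \<psi> \<Longrightarrow> fl S (\<lambda>f. \<phi> f + \<psi> f)"
  unfolding fl_def
proof (elim conjE exE, intro conjI)
  fix k l assume "\<forall>f. \<phi> f = (\<Sum>s\<in>S. k s * f s)" "\<forall>f. \<psi> f = (\<Sum>s\<in>S. l s * f s)"
  then show "\<exists>k. \<forall>f. \<phi> f + \<psi> f = (\<Sum>s\<in>S. k s * f s)"
    by (intro exI[of _ "\<lambda>s. k s + l s"]) (auto simp: distrib_right sum.distrib)
qed

lemma fl_scale: "fl S \<phi> \<Longrightarrow> fl S (\<lambda>f. c * \<phi> f)"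
  unfolding fl_def
proof (elim conjE exE, intro conjI)
  fix k assume "\<forall>f. \<phi> f = (\<Sum>s\<in>S. k s * f s)"
  then show "\<exists>k. \<forall>f. c * \<phi> f = (\<Sum>s\<in>S. k s * f s)"
    by (intro exI[of _ "\<lambda>s. c * k s"]) (auto simp: sum_distrib_left mult.assoc)
qed

lemma fl_minus: "fl S \<phi> \<Longrightarrow> fl S \<psi> \<Longrightarrow> fl S (\<lambda>f. \<phi> f - \<psi> f)"
  using fl_add[of S \<phi> "\<lambda>f. (-1) * \<psi> f"] fl_scale[of S \<psi> "-1"] by simp

lemma fl_if: "(c \<Longrightarrow> fl S \<phi>) \<Longrightarrow> (\<not> c \<Longrightarrow> fl S \<psi>) \<Longrightarrow> fl S (\<lambda>f. if c then \<phi> f else \<psi> f)"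
  by (cases c) simp_all

lemma fl_sum: "finite I \<Longrightarrow> finite S \<Longrightarrow> (\<And>i. i \<in> I \<Longrightarrow> fl S (\<phi> i)) \<Longrightarrow> fl S (\<lambda>f. \<Sum>i\<in>I. \<phi> i f)"
  by (induction I rule: finite_induct) (auto intro: fl_zero fl_add)

lemma fl_comp:
  assumes "fl S \<phi>" "finite S'" "\<And>s. s \<in> S \<Longrightarrow> fl S' (\<psi> s)"
  shows "fl S' (\<lambda>f. \<phi> (\<lambda>s. \<psi> s f))"
proof -
  obtain k where k: "\<And>f. \<phi> f = (\<Sum>s\<in>S. k s * f s)" and "finite S" using assms(1) by (auto simp: fl_def)
  show ?thesis unfolding k by (rule fl_sum) (auto intro: fl_scale assms \<open>finite S\<close>)
qed

lemma fl_image: "fl S \<phi> \<Longrightarrow> finite S' \<Longrightarrow> h ` S \<subseteq> S' \<Longrightarrow> fl S' (\<lambda>f. \<phi> (\<lambda>s. f (h s)))"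
  by (rule fl_comp) (auto intro: fl_eval)

text \<open>The coefficients are recovered by evaluation at indicator functions. With
  \<open>fl_cong\<close> this allows operators to be functions on all states although only finitely
  many states matter.\<close>

lemma fl_kernel:
  assumes "fl S \<phi>" shows "\<phi> f = (\<Sum>s\<in>S. \<phi> (unit_fun s) * f s)"
proof -
  obtain k where k: "\<And>f. \<phi> f = (\<Sum>s\<in>S. k s * f s)" and "finite S" using assms(1) by (auto simp: fl_def)
  have "\<phi> (unit_fun s) = k s" if "s \<in> S" for s
    unfolding k unit_fun_def using \<open>finite S\<close> that
    by (auto simp: if_distrib[of "\<lambda>x. _ * x"] eq_commute cong: if_cong)
  with k[of f] show ?thesis by simp
qed

lemma fl_cong:
  assumes "fl S \<phi>" "\<And>s. s \<in> S \<Longrightarrow> f s = g s" shows "\<phi> f = \<phi> g"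
  using fl_kernel[OF assms(1), of f] fl_kernel[OF assms(1), of g] assms(2) by simp

lemma fl_sum_app: "fl S \<phi> \<Longrightarrow> \<phi> (\<lambda>s. \<Sum>i\<in>I. f i s) = (\<Sum>i\<in>I. \<phi> (f i))"
  unfolding fl_def by (auto simp: sum_distrib_left intro: sum.swap)

lemma fl_add_app: "fl S \<phi> \<Longrightarrow> \<phi> (\<lambda>s. f s + g s) = \<phi> f + \<phi> g"
  unfolding fl_def by (auto simp: distrib_left sum.distrib)

lemma fl_minus_app: "fl S \<phi> \<Longrightarrow> \<phi> (\<lambda>s. f s - g s) = \<phi> f - \<phi> g"
  unfolding fl_def by (auto simp: right_diff_distrib sum_subtractf)

lemma fl_scale_app: "fl S \<phi> \<Longrightarrow> \<phi> (\<lambda>s. c * f s) = c * \<phi> f"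
  unfolding fl_def by (auto simp: sum_distrib_left intro!: sum.cong)

lemma fl_zero_app: "fl S \<phi> \<Longrightarrow> \<phi> (\<lambda>s. 0) = 0"
  unfolding fl_def by auto

text \<open>Fubini for finite sums. This is why operators on different tensor factors commute, and
  it is the basic step whenever two strands are treated independently.\<close>

lemma fl_swap:
  assumes "fl S \<phi>" "fl S' \<psi>"
  shows "\<phi> (\<lambda>s. \<psi> (\<lambda>s'. f s s')) = \<psi> (\<lambda>s'. \<phi> (\<lambda>s. f s s'))"
proof -
  obtain k where k: "\<And>f. \<phi> f = (\<Sum>s\<in>S. k s * f s)" using assms(1) by (auto simp: fl_def)
  obtain l where l: "\<And>f. \<psi> f = (\<Sum>s\<in>S'. l s * f s)" using assms(2) by (auto simp: fl_def)
  show ?thesis unfolding k l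
    by (simp add: sum_distrib_left) (subst sum.swap, simp add: mult.left_commute)
qed

text \<open>The rectangular case, with two different state spaces, is needed when caps and cups
  change the number of points of a cable.\<close>

lemma tr_cyclic:
  assumes "\<And>s. s \<in> S \<Longrightarrow> fl S' (\<lambda>f. X f s)" "\<And>s. s \<in> S' \<Longrightarrow> fl S (\<lambda>f. Y f s)"
  shows "tr S (\<lambda>f. X (Y f)) = tr S' (\<lambda>f. Y (X f))"
proof -
  have "tr S (\<lambda>f. X (Y f)) = (\<Sum>s\<in>S. \<Sum>s'\<in>S'. X (unit_fun s') s * Y (unit_fun s) s')"
    unfolding tr_def by (intro sum.cong HOL.refl, subst fl_kernel[OF assms(1)]) auto
  also have "\<dots> = (\<Sum>s'\<in>S'. \<Sum>s\<in>S. Y (unit_fun s) s' * X (unit_fun s') s)"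
    by (subst sum.swap) (simp add: mult.commute)
  also have "\<dots> = tr S' (\<lambda>f. Y (X f))"
    unfolding tr_def by (intro sum.cong HOL.refl, subst fl_kernel[OF assms(2), symmetric]) auto
  finally show ?thesis .
qed

lemma tr_cong: "(\<And>s f. s \<in> S \<Longrightarrow> X f s = Y f s) \<Longrightarrow> tr S X = tr S Y"
  by (simp add: tr_def)

lemma tr_sum: "tr S (\<lambda>f s. \<Sum>i\<in>I. X i f s) = (\<Sum>i\<in>I. tr S (X i))"
  unfolding tr_def by (rule sum.swap)

lemma tr_scale: "tr S (\<lambda>f s. c * X f s) = c * tr S X"
  unfolding tr_def by (simp add: sum_distrib_left)

text \<open>Needed to pass from lists of cables to their concatenations.\<close>

lemma tr_reindex:
  assumes "bij_betw h S S'" "finite S" "\<And>s. s \<in> S \<Longrightarrow> fl S (\<lambda>f. Y f s)"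
    "\<And>f s. s \<in> S \<Longrightarrow> X f (h s) = Y (\<lambda>s. f (h s)) s"
  shows "tr S' X = tr S Y"
proof -
  have "tr S' X = (\<Sum>s\<in>S. X (unit_fun (h s)) (h s))"
    unfolding tr_def by (rule sum.reindex_bij_betw[OF assms(1), symmetric])
  also have "\<dots> = (\<Sum>s\<in>S. Y (unit_fun s) s)"
  proof (rule sum.cong[OF HOL.refl])
    fix s assume s: "s \<in> S"
    show "X (unit_fun (h s)) (h s) = Y (unit_fun s) s"
      unfolding assms(4)[OF s]
      by (rule fl_cong[OF assms(3)[OF s]]) (use assms(1) s in \<open>auto simp: unit_fun_def bij_betw_def inj_on_def\<close>)
  qed
  finally show ?thesis by (simp add: tr_def)
qed

subsection \<open>Operators acting on adjacent entries\<close>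

type_synonym ('s, 'a) pair_op = "('s \<Rightarrow> 's \<Rightarrow> 'a) \<Rightarrow> 's \<Rightarrow> 's \<Rightarrow> 'a"

text \<open>
  A matrix \<open>M\<close> acts on functions by \<open>(M f) s = (\<Sum>s'. M s s' * f s')\<close>, so the state \<open>s\<close> in \<open>actw P Q w f s\<close>
  meets the letters of \<open>w\<close> from the first to the last.
\<close>

fun act :: "('s, 'a) pair_op \<Rightarrow> nat \<Rightarrow> ('s list \<Rightarrow> 'a) \<Rightarrow> 's list \<Rightarrow> 'a" where
  "act R 0 f (x # y # s) = R (\<lambda>u v. f (u # v # s)) x y"
| "act R (Suc i) f (x # s) = act R i (\<lambda>s. f (x # s)) s"
| "act R i f s = f s"

fun actw :: "('s, 'a) pair_op \<Rightarrow> ('s, 'a) pair_op \<Rightarrow> (nat \<times> bool) list \<Rightarrow> ('s list \<Rightarrow> 'a) \<Rightarrow> 's list \<Rightarrow> 'a" where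
  "actw P Q [] f = f"
| "actw P Q ((i, b) # w) f = act (if b then P else Q) i (actw P Q w f)"

fun swp :: "nat \<Rightarrow> 'b list \<Rightarrow> 'b list" where
  "swp 0 (x # y # s) = y # x # s"
| "swp (Suc i) (x # s) = x # swp i s"
| "swp i s = s"

fun swps :: "(nat \<times> bool) list \<Rightarrow> 'b list \<Rightarrow> 'b list" where
  "swps [] s = s"
| "swps ((i, b) # w) s = swps w (swp i s)"

lemma length_swp [simp]: "length (swp i s) = length s"
  by (induction i s rule: swp.induct) auto

lemma mset_swp [simp]: "mset (swp i s) = mset s"
  by (induction i s rule: swp.induct) auto

lemma set_swp [simp]: "set (swp i s) = set s"
  by (metis mset_swp set_mset_mset)

lemma map_swp: "map h (swp i s) = swp i (map h s)"
  by (induction i s rule: swp.induct) auto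

lemma swp_swp [simp]: "swp i (swp i s) = s"
  by (induction i s rule: swp.induct) auto

lemma nth_swp: "Suc i < length s \<Longrightarrow> p < length s \<Longrightarrow>
  swp i s ! p = (if p = i then s ! Suc i else if p = Suc i then s ! i else s ! p)"
proof (induction i s arbitrary: p rule: swp.induct)
  case (1 x y s) then show ?case by (auto simp: nth_Cons split: nat.splits)
next
  case (2 i x s) then show ?case by (cases p) auto
qed auto

lemma length_swps [simp]: "length (swps w s) = length s"
  by (induction w s rule: swps.induct) auto

lemma mset_swps [simp]: "mset (swps w s) = mset s"
  by (induction w s rule: swps.induct) auto

lemma map_swps: "map h (swps w s) = swps w (map h s)"
  by (induction w s rule: swps.induct) (auto simp: map_swp)

lemma swps_append: "swps (v @ w) s = swps w (swps v s)"
  by (induction v s rule: swps.induct) auto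

lemma swps_surj: "\<exists>s'. length s' = length s \<and> swps w s' = s"
proof (induction w arbitrary: s)
  case (Cons l w)
  obtain i b where l: "l = (i, b)" by force
  obtain s' where "length s' = length s" "swps w s' = s" using Cons by blast
  then show ?case by (intro exI[of _ "swp i s'"]) (auto simp: l)
qed auto

lemma actw_append: "actw P Q (v @ w) f = actw P Q v (actw P Q w f)"
  by (induction v) auto

definition shapes :: "nat list \<Rightarrow> bool list list set" where
  "shapes ls = {s. map length s = ls}"

definition blists :: "nat \<Rightarrow> bool list set" where
  "blists n = {s. length s = n}"

lemma finite_blists [simp]: "finite (blists n)"
  using finite_lists_length_eq[of "UNIV :: bool set" n] by (simp add: blists_def)

lemma blists_0 [simp]: "blists 0 = {[]}" by (auto simp: blists_def)

lemma blists_Suc: "blists (Suc n) = (\<lambda>(x, s). x # s) ` (UNIV \<times> blists n)"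
  by (force simp: blists_def image_def length_Suc_conv)

lemma shapes_Nil [simp]: "shapes [] = {[]}" by (auto simp: shapes_def)

lemma shapes_Cons: "shapes (l # ls) = (\<lambda>(x, s). x # s) ` (blists l \<times> shapes ls)"
  by (force simp: shapes_def blists_def image_def map_eq_Cons_conv)

lemma finite_shapes [simp]: "finite (shapes ls)"
  by (induction ls) (auto simp: shapes_Cons)

lemma sum_shapes_Cons: "(\<Sum>s\<in>shapes (l # ls). F s) = (\<Sum>x\<in>blists l. \<Sum>s\<in>shapes ls. F (x # s))"
  unfolding shapes_Cons by (subst sum.reindex) (auto simp: inj_on_def sum.cartesian_product case_prod_beta intro!: sum.cong)

lemma sum_blists_Suc: "(\<Sum>s\<in>blists (Suc l). F s) = (\<Sum>x\<in>UNIV. \<Sum>s\<in>blists l. F (x # s))"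
  unfolding blists_Suc by (subst sum.reindex) (auto simp: inj_on_def sum.cartesian_product case_prod_beta intro!: sum.cong)

text \<open>The curried form of \<open>fl\<close> on pairs. It matches the type
  \<open>pair_op\<close>, so that operators can be nested without pairing their arguments.\<close>

definition fl2 :: "'s set \<Rightarrow> 't set \<Rightarrow> (('s \<Rightarrow> 't \<Rightarrow> 'a::comm_ring_1) \<Rightarrow> 'a) \<Rightarrow> bool" where
  "fl2 S S' \<phi> \<longleftrightarrow> finite S' \<and> fl (S \<times> S') (\<lambda>f. \<phi> (\<lambda>u v. f (u, v)))"

lemma fl2_fl: "fl2 S S' \<phi> \<Longrightarrow> fl (S \<times> S') (\<lambda>f. \<phi> (\<lambda>u v. f (u, v)))"
  by (simp add: fl2_def)

lemma fl2_comp: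
  assumes "fl2 S S' \<phi>" "finite U" "\<And>s t. s \<in> S \<Longrightarrow> t \<in> S' \<Longrightarrow> fl U (\<psi> s t)"
  shows "fl U (\<lambda>f. \<phi> (\<lambda>s t. \<psi> s t f))"
  using fl_comp[OF fl2_fl[OF assms(1)] assms(2), of "\<lambda>(s, t). \<psi> s t"] assms(3) by auto

lemma fl2_swap:
  assumes "fl2 S S' \<phi>" "fl U \<psi>"
  shows "\<phi> (\<lambda>u v. \<psi> (\<lambda>s'. f u v s')) = \<psi> (\<lambda>s'. \<phi> (\<lambda>u v. f u v s'))"
  using fl_swap[OF fl2_fl[OF assms(1)] assms(2), of "\<lambda>(u, v). f u v"] by simp

lemma fl2_swap2:
  assumes "fl2 S S' \<phi>" "fl2 U U' \<psi>"
  shows "\<phi> (\<lambda>u v. \<psi> (\<lambda>s t. f u v s t)) = \<psi> (\<lambda>s t. \<phi> (\<lambda>u v. f u v s t))"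
  using fl2_swap[OF assms(1) fl2_fl[OF assms(2)], of "\<lambda>u v (s, t). f u v s t"] by simp

lemma fl2_cong:
  assumes "fl2 S S' \<phi>" "\<And>u v. u \<in> S \<Longrightarrow> v \<in> S' \<Longrightarrow> f u v = g u v" shows "\<phi> f = \<phi> g"
  using fl_cong[OF fl2_fl[OF assms(1)], of "\<lambda>(u, v). f u v" "\<lambda>(u, v). g u v"] assms(2) by auto

lemma fl2_zero_app: "fl2 S S' \<phi> \<Longrightarrow> \<phi> (\<lambda>u v. 0) = 0"
  using fl_zero_app[OF fl2_fl] by fastforce

lemma fl2_scale_app: "fl2 S S' \<phi> \<Longrightarrow> \<phi> (\<lambda>u v. c * f u v) = c * \<phi> f"
  using fl_scale_app[OF fl2_fl, of S S' \<phi> c "\<lambda>(u, v). f u v"] by auto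

lemma fl2_add_app: "fl2 S S' \<phi> \<Longrightarrow> \<phi> (\<lambda>u v. f u v + g u v) = \<phi> f + \<phi> g"
  using fl_add_app[OF fl2_fl, of S S' \<phi> "\<lambda>(u, v). f u v" "\<lambda>(u, v). g u v"] by auto

lemma fl2_minus_app: "fl2 S S' \<phi> \<Longrightarrow> \<phi> (\<lambda>u v. f u v - g u v) = \<phi> f - \<phi> g"
  using fl_minus_app[OF fl2_fl, of S S' \<phi> "\<lambda>(u, v). f u v" "\<lambda>(u, v). g u v"] by auto

definition lin2 :: "(bool, 'a::comm_ring_1) pair_op \<Rightarrow> bool" where
  "lin2 R \<longleftrightarrow> (\<forall>x y. fl2 UNIV UNIV (\<lambda>g. R g x y))"

lemma lin2D: "lin2 R \<Longrightarrow> fl2 UNIV UNIV (\<lambda>g. R g x y)" by (simp add: lin2_def)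

lemma fl_act_bool:
  assumes R: "lin2 R" shows "s \<in> blists n \<Longrightarrow> fl (blists n) (\<lambda>f. act R i f s)"
proof (induction i arbitrary: s n)
  case 0
  show ?case
  proof (cases "\<exists>x y s'. s = x # y # s'")
    case True
    then obtain x y s' where s: "s = x # y # s'" by blast
    show ?thesis unfolding s act.simps
      by (rule fl2_comp[OF lin2D[OF R]]) (use 0 s in \<open>auto intro!: fl_eval, auto simp: blists_def\<close>)
  next
    case False
    then have "act R 0 f s = f s" for f by (cases "(R, 0 :: nat, f, s)" rule: act.cases) auto
    then show ?thesis using 0 by (simp add: fl_eval)
  qed
next
  case (Suc i)
  show ?case
  proof (cases s)
    case Nil then show ?thesis using Suc.prems by (simp add: fl_eval)
  next
    case (Cons x s')
    obtain m where m: "n = Suc m" "s' \<in> blists m" using Suc.prems Cons by (cases n) (auto simp: blists_def)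
    have "fl (blists n) (\<lambda>f. (\<lambda>g. act R i g s') (\<lambda>s. f (x # s)))"
      by (rule fl_image[OF Suc.IH[OF m(2)]]) (auto, auto simp: m blists_def)
    then show ?thesis by (simp add: Cons)
  qed
qed

lemma fl_actw_bool:
  assumes "lin2 P" "lin2 Q" shows "s \<in> blists n \<Longrightarrow> fl (blists n) (\<lambda>f. actw P Q w f s)"
proof (induction w arbitrary: s)
  case Nil then show ?case by (simp add: fl_eval)
next
  case (Cons l w)
  obtain i b where l: "l = (i, b)" by force
  show ?case using fl_comp[OF fl_act_bool[OF assms(1) Cons.prems, of i] _ Cons.IH]
     fl_comp[OF fl_act_bool[OF assms(2) Cons.prems, of i] _ Cons.IH]
    by (auto simp: l)
qed

section \<open>Operators that exchange two cables of possibly different lengths\<close>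

definition strand_op :: "(bool list, 'a::comm_ring_1) pair_op \<Rightarrow> bool" where
  "strand_op R \<longleftrightarrow> (\<forall>x y. fl2 (blists (length y)) (blists (length x)) (\<lambda>g. R g x y))"

lemma strand_opD: "strand_op R \<Longrightarrow> fl2 (blists (length y)) (blists (length x)) (\<lambda>g. R g x y)"
  by (simp add: strand_op_def)

lemma fl_act_strand:
  assumes R: "strand_op R" shows "s \<in> shapes ls \<Longrightarrow> fl (shapes (swp i ls)) (\<lambda>f. act R i f s)"
proof (induction i arbitrary: s ls)
  case 0
  show ?case
  proof (cases "\<exists>x y s'. s = x # y # s'")
    case True
    then obtain x y s' where s: "s = x # y # s'" by blast
    show ?thesis unfolding s act.simps
      by (rule fl2_comp[OF strand_opD[OF R]]) (use 0 s in \<open>auto intro!: fl_eval, auto simp: shapes_def blists_def\<close>)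
  next
    case False
    then have "act R 0 f s = f s" for f by (cases "(R, 0 :: nat, f, s)" rule: act.cases) auto
    moreover have "swp 0 ls = ls" using 0 False
      by (cases "(0::nat, ls)" rule: swp.cases) (auto simp: shapes_def Cons_eq_map_conv map_eq_Cons_conv)
    ultimately show ?thesis using 0 by (simp add: fl_eval)
  qed
next
  case (Suc i)
  show ?case
  proof (cases s)
    case Nil then show ?thesis using Suc.prems by (simp add: fl_eval shapes_def)
  next
    case (Cons x s')
    obtain l ls' where m: "ls = l # ls'" "s' \<in> shapes ls'" "x \<in> blists l"
      using Suc.prems Cons by (auto simp: shapes_def blists_def)
    have "fl (shapes (swp (Suc i) ls)) (\<lambda>f. (\<lambda>g. act R i g s') (\<lambda>s. f (x # s)))"
      by (rule fl_image[OF Suc.IH[OF m(2)]]) (use m in \<open>auto, auto simp: shapes_def blists_def\<close>)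
    then show ?thesis by (simp add: Cons)
  qed
qed

lemma fl_actw_strand:
  assumes "strand_op P" "strand_op Q"
  shows "s \<in> shapes ls \<Longrightarrow> fl (shapes (swps w ls)) (\<lambda>f. actw P Q w f s)"
proof (induction w arbitrary: s ls)
  case Nil then show ?case by (simp add: fl_eval)
next
  case (Cons l w)
  obtain i b where l: "l = (i, b)" by force
  show ?case using fl_comp[OF fl_act_strand[OF assms(1) Cons.prems, of i] _ Cons.IH]
     fl_comp[OF fl_act_strand[OF assms(2) Cons.prems, of i] _ Cons.IH]
    by (auto simp: l)
qed

subsection \<open>Operators acting on every strand\<close>

type_synonym 'a strand_map = "(bool list \<Rightarrow> 'a) \<Rightarrow> bool list \<Rightarrow> 'a"

fun tens :: "'a strand_map list \<Rightarrow> (bool list list \<Rightarrow> 'a) \<Rightarrow> bool list list \<Rightarrow> 'a" where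
  "tens (P # Ps) f (x # s) = P (\<lambda>x. tens Ps (\<lambda>s. f (x # s)) s) x"
| "tens _ f s = f s"

definition maps_to :: "nat \<Rightarrow> nat \<Rightarrow> 'a::comm_ring_1 strand_map \<Rightarrow> bool" where
  "maps_to a b P \<longleftrightarrow> (\<forall>x\<in>blists a. fl (blists b) (\<lambda>f. P f x))"

lemma maps_toD: "maps_to a b P \<Longrightarrow> x \<in> blists a \<Longrightarrow> fl (blists b) (\<lambda>f. P f x)"
  by (simp add: maps_to_def)

lemma fl_tens:
  "(\<And>c. c \<in> set cs \<Longrightarrow> maps_to (\<alpha> c) (\<beta> c) (P c)) \<Longrightarrow> s \<in> shapes (map \<alpha> cs) \<Longrightarrow>
   fl (shapes (map \<beta> cs)) (\<lambda>f. tens (map P cs) f s)"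
proof (induction cs arbitrary: s)
  case Nil then show ?case by (simp add: fl_eval)
next
  case (Cons c cs)
  obtain x s' where s: "s = x # s'" "x \<in> blists (\<alpha> c)" "s' \<in> shapes (map \<alpha> cs)"
    using Cons.prems by (auto simp: shapes_Cons)
  have "fl (shapes (map \<beta> (c # cs))) (\<lambda>f. (\<lambda>g. P c g x) (\<lambda>x. tens (map P cs) (\<lambda>s. f (x # s)) s'))"
  proof (rule fl_comp[where \<phi> = "\<lambda>g. P c g x" and S = "blists (\<beta> c)"])
    show "fl (blists (\<beta> c)) (\<lambda>g. P c g x)" using Cons.prems(1) s by (auto simp: maps_to_def)
    fix x' assume "x' \<in> blists (\<beta> c)"
    moreover have "fl (shapes (map \<beta> cs)) (\<lambda>f. tens (map P cs) f s')"
      by (rule Cons.IH[OF _ s(3)]) (simp add: Cons.prems)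
    ultimately show "fl (shapes (map \<beta> (c # cs))) (\<lambda>f. tens (map P cs) (\<lambda>s. f (x' # s)) s')"
      by (rule_tac fl_image) (auto simp: shapes_Cons)
  qed simp
  then show ?case by (simp add: s(1))
qed

text \<open>Functoriality of the tensor product. The map \<open>Q\<close> on the first strand has to
  be pulled out of the maps \<open>P\<close> on the later strands, which is an instance of
  \<open>fl_swap\<close>.\<close>

lemma tens_tens:
  "(\<And>c. c \<in> set cs \<Longrightarrow> maps_to (\<alpha> c) (\<beta> c) (P c)) \<Longrightarrow> (\<And>c. c \<in> set cs \<Longrightarrow> maps_to (\<beta> c) (\<gamma> c) (Q c)) \<Longrightarrow>
   s \<in> shapes (map \<alpha> cs) \<Longrightarrow>
   tens (map P cs) (tens (map Q cs) f) s = tens (map (\<lambda>c f. P c (Q c f)) cs) f s"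
proof (induction cs arbitrary: s f)
  case Nil then show ?case by simp
next
  case (Cons c cs)
  obtain x s' where s: "s = x # s'" "x \<in> blists (\<alpha> c)" "s' \<in> shapes (map \<alpha> cs)"
    using Cons.prems by (auto simp: shapes_Cons)
  have P: "\<And>c. c \<in> set cs \<Longrightarrow> maps_to (\<alpha> c) (\<beta> c) (P c)"
   and Q: "\<And>c. c \<in> set cs \<Longrightarrow> maps_to (\<beta> c) (\<gamma> c) (Q c)" using Cons.prems by auto
  have "tens (map P (c # cs)) (tens (map Q (c # cs)) f) s =
     P c (\<lambda>x. tens (map P cs) (\<lambda>s. Q c (\<lambda>x. tens (map Q cs) (\<lambda>s. f (x # s)) s) x) s') x"
    by (simp add: s)
  also have "\<dots> = P c (\<lambda>x. Q c (\<lambda>x. tens (map P cs) (\<lambda>s. tens (map Q cs) (\<lambda>s. f (x # s)) s) s') x) x"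
  proof (rule fl_cong[where \<phi> = "\<lambda>g. P c g x" and S = "blists (\<beta> c)"])
    show "fl (blists (\<beta> c)) (\<lambda>g. P c g x)" using Cons.prems(1) s by (auto simp: maps_to_def)
    fix x assume "x \<in> blists (\<beta> c)"
    then have "fl (blists (\<gamma> c)) (\<lambda>g. Q c g x)" using Cons.prems(2) by (auto simp: maps_to_def)
    from fl_swap[where \<phi> = "\<lambda>f. tens (map P cs) f s'", OF fl_tens[OF P s(3)] this]
    show "tens (map P cs) (\<lambda>s. Q c (\<lambda>x. tens (map Q cs) (\<lambda>s. f (x # s)) s) x) s' =
       Q c (\<lambda>x. tens (map P cs) (\<lambda>s. tens (map Q cs) (\<lambda>s. f (x # s)) s) s') x"
      by simp
  qed
  also have "\<dots> = P c (Q c (\<lambda>x. tens (map (\<lambda>c f. P c (Q c f)) cs) (\<lambda>s. f (x # s)) s')) x"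
  proof -
    have "tens (map P cs) (\<lambda>s. tens (map Q cs) (\<lambda>s. f (x # s)) s) s' =
      tens (map (\<lambda>c f. P c (Q c f)) cs) (\<lambda>s. f (x # s)) s'" for x
      by (rule Cons.IH[OF P Q s(3)])
    then show ?thesis by (simp only:)
  qed
  also have "\<dots> = tens (map (\<lambda>c f. P c (Q c f)) (c # cs)) f s"
    unfolding s by simp
  finally show ?case .
qed

lemma tens_cong:
  "(\<And>c f x. c \<in> set cs \<Longrightarrow> x \<in> blists (\<alpha> c) \<Longrightarrow> P c f x = Q c f x) \<Longrightarrow>
   s \<in> shapes (map \<alpha> cs) \<Longrightarrow> tens (map P cs) f s = tens (map Q cs) f s"
proof (induction cs arbitrary: s f)
  case Nil then show ?case by simp
next
  case (Cons c cs)
  obtain x s' where s: "s = x # s'" "x \<in> blists (\<alpha> c)" "s' \<in> shapes (map \<alpha> cs)"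
    using Cons.prems by (auto simp: shapes_Cons)
  have "(\<lambda>x. tens (map P cs) (\<lambda>s. f (x # s)) s') = (\<lambda>x. tens (map Q cs) (\<lambda>s. f (x # s)) s')"
    using Cons.IH[OF _ s(3)] Cons.prems(1) by auto
  then show ?case using Cons.prems(1) s by simp
qed

lemma tens_zero:
  "(\<And>c. c \<in> set cs \<Longrightarrow> maps_to (\<alpha> c) (\<beta> c) (P c)) \<Longrightarrow> s \<in> shapes (map \<alpha> cs) \<Longrightarrow>
   d \<in> set cs \<Longrightarrow> (\<And>f x. x \<in> blists (\<alpha> d) \<Longrightarrow> P d f x = 0) \<Longrightarrow> tens (map P cs) f s = 0"
proof (induction cs arbitrary: s f)
  case (Cons c cs)
  obtain x s' where s: "s = x # s'" "x \<in> blists (\<alpha> c)" "s' \<in> shapes (map \<alpha> cs)"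
    using Cons.prems by (auto simp: shapes_Cons)
  show ?case
  proof (cases "c = d")
    case True then show ?thesis using Cons.prems s by simp
  next
    case False
    then have "(\<lambda>x. tens (map P cs) (\<lambda>s. f (x # s)) s') = (\<lambda>x. 0)"
      using Cons.IH[OF _ s(3)] Cons.prems by auto
    moreover have "fl (blists (\<beta> c)) (\<lambda>g. P c g x)" using Cons.prems(1) s by (auto simp: maps_to_def)
    ultimately show ?thesis using fl_zero_app[where \<phi> = "\<lambda>g. P c g x"] by (simp add: s)
  qed
qed auto

text \<open>A product of sums is expanded over all choices; the Boolean list \<open>b\<close>
  records which summand is taken on each strand.\<close>

lemma tens_sum:
  "(\<And>c. c \<in> set cs \<Longrightarrow> maps_to (\<alpha> c) (\<beta> c) (P c)) \<Longrightarrow> (\<And>c. c \<in> set cs \<Longrightarrow> maps_to (\<alpha> c) (\<beta> c) (Q c)) \<Longrightarrow>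
   s \<in> shapes (map \<alpha> cs) \<Longrightarrow>
   tens (map (\<lambda>c f x. P c f x + Q c f x) cs) f s =
   (\<Sum>b\<in>blists (length cs). tens (map (\<lambda>(c, b). if b then Q c else P c) (zip cs b)) f s)"
proof (induction cs arbitrary: s f)
  case Nil then show ?case by simp
next
  case (Cons c cs)
  obtain x s' where s: "s = x # s'" "x \<in> blists (\<alpha> c)" "s' \<in> shapes (map \<alpha> cs)"
    using Cons.prems by (auto simp: shapes_Cons)
  let ?T = "\<lambda>x. \<Sum>b\<in>blists (length cs). tens (map (\<lambda>(c, b). if b then Q c else P c) (zip cs b)) (\<lambda>s. f (x # s)) s'"
  have fl: "fl (blists (\<beta> c)) (\<lambda>g. P c g x)" "fl (blists (\<beta> c)) (\<lambda>g. Q c g x)"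
    using Cons.prems(1,2) s by (auto simp: maps_to_def)
  have h1: "tens (map (\<lambda>c f x. P c f x + Q c f x) (c # cs)) f s = P c ?T x + Q c ?T x"
  proof -
    have P: "\<And>c. c \<in> set cs \<Longrightarrow> maps_to (\<alpha> c) (\<beta> c) (P c)"
     and Q: "\<And>c. c \<in> set cs \<Longrightarrow> maps_to (\<alpha> c) (\<beta> c) (Q c)" using Cons.prems by auto
    have "(\<lambda>x. tens (map (\<lambda>c f x. P c f x + Q c f x) cs) (\<lambda>s. f (x # s)) s') = ?T"
      by (rule ext, rule Cons.IH[OF P Q s(3)])
    then show ?thesis unfolding s list.map tens.simps by (rule arg_cong)
  qed
  have h2: "P c ?T x = (\<Sum>b\<in>blists (length cs). P c (\<lambda>x. tens (map (\<lambda>(c, b). if b then Q c else P c) (zip cs b)) (\<lambda>s. f (x # s)) s') x)"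
    by (rule fl_sum_app[OF fl(1)])
  have h3: "Q c ?T x = (\<Sum>b\<in>blists (length cs). Q c (\<lambda>x. tens (map (\<lambda>(c, b). if b then Q c else P c) (zip cs b)) (\<lambda>s. f (x # s)) s') x)"
    by (rule fl_sum_app[OF fl(2)])
  have h4: "(\<Sum>b\<in>blists (length (c # cs)). tens (map (\<lambda>(c, b). if b then Q c else P c) (zip (c # cs) b)) f s) =
     (\<Sum>b\<in>blists (length cs). P c (\<lambda>x. tens (map (\<lambda>(c, b). if b then Q c else P c) (zip cs b)) (\<lambda>s. f (x # s)) s') x) +
     (\<Sum>b\<in>blists (length cs). Q c (\<lambda>x. tens (map (\<lambda>(c, b). if b then Q c else P c) (zip cs b)) (\<lambda>s. f (x # s)) s') x)"
    unfolding list.size add_0_right add_Suc_right sum_blists_Suc s UNIV_bool by simp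
  show ?case unfolding h4 h1 h2 h3 by (rule HOL.refl)
qed

section \<open>Crossings of cables\<close>

text \<open>One strand enters on the left and passes over the points of \<open>y\<close> in turn;
  \<open>g\<close> receives the new \<open>y\<close> first and the strand last.\<close>

fun ov :: "(bool, 'a) pair_op \<Rightarrow> (bool list \<Rightarrow> bool \<Rightarrow> 'a) \<Rightarrow> bool \<Rightarrow> bool list \<Rightarrow> 'a" where
  "ov R g a [] = g [] a"
| "ov R g a (b # y) = R (\<lambda>b' a'. ov R (\<lambda>u a''. g (b' # u) a'') a' y) a b"

text \<open>Planarity fixes the order: the strands of the left cable next to \<open>y\<close> cross
  first, so the state meets the crossings of \<open>x\<close> before those of
  \<open>a\<close>.\<close>

fun xr :: "(bool, 'a) pair_op \<Rightarrow> (bool list, 'a) pair_op" where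
  "xr R g [] y = g y []"
| "xr R g (a # x) y = xr R (\<lambda>u x'. ov R (\<lambda>u' a'. g u' (a' # x')) a u) x y"

text \<open>The mirror image of \<open>ov\<close>: the strand enters on the right and passes to the
  left, so that \<open>un\<close> of the inverse crossing undoes \<open>ov\<close>.\<close>

fun un :: "(bool, 'a) pair_op \<Rightarrow> (bool \<Rightarrow> bool list \<Rightarrow> 'a) \<Rightarrow> bool list \<Rightarrow> bool \<Rightarrow> 'a" where
  "un R g [] a = g a []"
| "un R g (b # y) a = un R (\<lambda>a' y'. R (\<lambda>a'' b'. g a'' (b' # y')) b a') y a"

fun xl :: "(bool, 'a) pair_op \<Rightarrow> (bool list, 'a) pair_op" where
  "xl R g y [] = g [] y"
| "xl R g y (a # x) = un R (\<lambda>a' y'. xl R (\<lambda>x' y''. g (a' # x') y'') y' x) y a"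

lemma fl2I: "finite S' \<Longrightarrow> fl (S \<times> S') (\<lambda>f. \<phi> (\<lambda>u v. f (u, v))) \<Longrightarrow> fl2 S S' \<phi>"
  by (simp add: fl2_def)

lemma fl2_comp2:
  assumes "fl2 S S' \<phi>" "finite U" "finite U'" "\<And>s t. s \<in> S \<Longrightarrow> t \<in> S' \<Longrightarrow> fl2 U U' (\<psi> s t)"
  shows "fl2 U U' (\<lambda>f. \<phi> (\<lambda>s t. \<psi> s t f))"
  by (rule fl2I[OF assms(3)], rule fl2_comp[OF assms(1), where \<psi> = "\<lambda>s t f. \<psi> s t (\<lambda>u v. f (u, v))"])
     (use assms in \<open>auto simp: fl2_def\<close>)

lemma fl2_image:
  assumes "fl2 S S' \<phi>" "finite U" "finite U'" "\<And>s t. s \<in> S \<Longrightarrow> t \<in> S' \<Longrightarrow> h s t \<in> U \<and> k s t \<in> U'"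
  shows "fl2 U U' (\<lambda>f. \<phi> (\<lambda>s t. f (h s t) (k s t)))"
  by (rule fl2_comp2[OF assms(1), where \<psi> = "\<lambda>s t f. f (h s t) (k s t)"])
     (use assms in \<open>auto simp: fl2_def intro!: fl_eval\<close>)

lemma fl2_ov:
  assumes R: "lin2 R" shows "fl2 (blists (length y)) UNIV (\<lambda>g. ov R g a y)"
proof (induction y arbitrary: a)
  case Nil then show ?case by (auto intro!: fl2I fl_eval)
next
  case (Cons b y)
  show ?case unfolding ov.simps
  proof (rule fl2_comp2[OF lin2D[OF R], where \<psi> = "\<lambda>b' a' g. ov R (\<lambda>u a''. g (b' # u) a'') a' y"])
    fix b' a' show "fl2 (blists (length (b # y))) UNIV (\<lambda>g. ov R (\<lambda>u a''. g (b' # u) a'') a' y)"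
      by (rule fl2_image[OF Cons.IH, where h = "\<lambda>u a. b' # u" and k = "\<lambda>u a. a"]) (auto, auto simp: blists_def)
  qed auto
qed

lemma fl2_xr:
  assumes R: "lin2 R" shows "fl2 (blists (length y)) (blists (length x)) (\<lambda>g. xr R g x y)"
proof (induction x arbitrary: y)
  case Nil then show ?case by (auto intro!: fl2I fl_eval, auto simp: blists_def)
next
  case (Cons a x)
  show ?case unfolding xr.simps
  proof (rule fl2_comp2[OF Cons.IH, where \<psi> = "\<lambda>u x' g. ov R (\<lambda>u' a'. g u' (a' # x')) a u"])
    fix u x' assume u: "u \<in> blists (length y)" "x' \<in> blists (length x)"
    then show "fl2 (blists (length y)) (blists (length (a # x))) (\<lambda>g. ov R (\<lambda>u' a'. g u' (a' # x')) a u)"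
      by (intro fl2_image[OF fl2_ov[OF R], where h = "\<lambda>u a. u" and k = "\<lambda>u a. a # x'"]) (auto, auto simp: blists_def)
  qed auto
qed

lemma fl2_un:
  assumes R: "lin2 R" shows "fl2 UNIV (blists (length y)) (\<lambda>g. un R g y a)"
proof (induction y arbitrary: a)
  case Nil then show ?case by (auto intro!: fl2I fl_eval)
next
  case (Cons b y)
  show ?case unfolding un.simps
  proof (rule fl2_comp2[OF Cons.IH, where \<psi> = "\<lambda>a' y' g. R (\<lambda>a'' b'. g a'' (b' # y')) b a'"])
    fix a' and y' :: "bool list" assume y: "y' \<in> blists (length y)"
    show "fl2 UNIV (blists (length (b # y))) (\<lambda>g. R (\<lambda>a'' b'. g a'' (b' # y')) b a')"
      by (rule fl2_image[OF lin2D[OF R], where h = "\<lambda>u a. u" and k = "\<lambda>u a. a # y'"]) (use y in \<open>auto, auto simp: blists_def\<close>)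
  qed auto
qed

lemma fl2_xl:
  assumes R: "lin2 R" shows "fl2 (blists (length x)) (blists (length y)) (\<lambda>g. xl R g y x)"
proof (induction x arbitrary: y)
  case Nil then show ?case by (auto intro!: fl2I fl_eval, auto simp: blists_def)
next
  case (Cons a x)
  show ?case unfolding xl.simps
  proof (rule fl2_comp2[OF fl2_un[OF R], where \<psi> = "\<lambda>a' y' g. xl R (\<lambda>x' y''. g (a' # x') y'') y' x"])
    fix a' y' assume y: "y' \<in> blists (length y)"
    then have "length y' = length y" by (simp add: blists_def)
    then show "fl2 (blists (length (a # x))) (blists (length y)) (\<lambda>g. xl R (\<lambda>x' y''. g (a' # x') y'') y' x)"
      by (intro fl2_image[OF Cons.IH[of y'], where h = "\<lambda>u a. a' # u" and k = "\<lambda>u a. a"]) (auto, auto simp: blists_def)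
  qed auto
qed

lemma strand_op_xr: "lin2 R \<Longrightarrow> strand_op (xr R)" by (simp add: strand_op_def fl2_xr)
lemma strand_op_xl: "lin2 R \<Longrightarrow> strand_op (xl R)" by (simp add: strand_op_def fl2_xl)

lemma lin2I: "(\<And>g x y. R g x y = k1 x y * g True True + k2 x y * g True False + k3 x y * g False True + k4 x y * g False False) \<Longrightarrow> lin2 R"
proof -
  assume R: "\<And>g x y. R g x y = k1 x y * g True True + k2 x y * g True False + k3 x y * g False True + k4 x y * g False False"
  have "\<exists>k. \<forall>f. R (\<lambda>u v. f (u, v)) x y = (\<Sum>s\<in>UNIV. k s * f s)" for x y
    by (rule exI[of _ "\<lambda>(u, v). if u then if v then k1 x y else k2 x y else if v then k3 x y else k4 x y"])
       (simp add: R UNIV_bool add_ac flip: UNIV_Times_UNIV)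
  then show "lin2 R" by (simp add: lin2_def fl2_def fl_def)
qed

subsection \<open>Crossings as words\<close>

text \<open>The positions of the crossings when \<open>a\<close> strands pass \<open>b\<close>
  strands, in the order in which \<open>xr\<close> meets them.\<close>

fun wd :: "nat \<Rightarrow> nat \<Rightarrow> nat list" where
  "wd 0 b = []"
| "wd (Suc a) b = map Suc (wd a b) @ [0..<b]"

definition shift :: "nat \<Rightarrow> (nat \<times> bool) list \<Rightarrow> (nat \<times> bool) list" where
  "shift o' w = map (\<lambda>(i, s). (o' + i, s)) w"

lemma act_shift: "act R (length pre + i) f (pre @ s) = act R i (\<lambda>s. f (pre @ s)) s"
  by (induction pre arbitrary: f) auto

lemma actw_shift: "actw P Q (shift (length pre) w) f (pre @ s) = actw P Q w (\<lambda>s. f (pre @ s)) s"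
proof (induction w arbitrary: s)
  case Nil then show ?case by (simp add: shift_def)
next
  case (Cons l w)
  obtain i b where l: "l = (i, b)" by force
  show ?case using Cons by (simp add: l shift_def act_shift)
qed

definition pos :: "nat list \<Rightarrow> (nat \<times> bool) list" where "pos w = map (\<lambda>p. (p, True)) w"
definition neg :: "nat list \<Rightarrow> (nat \<times> bool) list" where "neg w = map (\<lambda>p. (p, False)) (rev w)"

lemma pos_append: "pos (v @ w) = pos v @ pos w" by (simp add: pos_def)
lemma neg_append: "neg (v @ w) = neg w @ neg v" by (simp add: neg_def)
lemma pos_Suc: "pos (map Suc w) = shift 1 (pos w)" by (simp add: pos_def shift_def)
lemma neg_Suc: "neg (map Suc w) = shift 1 (neg w)" by (simp add: neg_def shift_def rev_map)

lemma actw_Suc: "actw P Q (shift 1 w) f (a # s) = actw P Q w (\<lambda>s. f (a # s)) s"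
  using actw_shift[of P Q "[a]" w f s] by simp

lemma upt_Suc0: "[0..<Suc b] = 0 # map Suc [0..<b]"
  by (simp add: map_Suc_upt upt_conv_Cons del: upt_Suc)

lemma actw_ov: "actw R R' (pos [0..<length y]) f (a # y @ s) = ov R (\<lambda>u a'. f (u @ a' # s)) a y"
proof (induction y arbitrary: a f)
  case Nil then show ?case by (simp add: pos_def)
next
  case (Cons b y)
  have "pos [0..<length (b # y)] = (0, True) # shift 1 (pos [0..<length y])"
    by (simp only: list.size add_0_right add_Suc_right upt_Suc0) (simp add: pos_def shift_def)
  then show ?case using Cons.IH by (simp add: actw_Suc del: upt_Suc One_nat_def)
qed

text \<open>Identifies the recursive crossing of two cables with a braid word on single points, so
  that properties of words carry over to cables.\<close>

lemma actw_xr: "actw R R' (pos (wd (length x) (length y))) f (x @ y @ s) = xr R (\<lambda>u w. f (u @ w @ s)) x y"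
  if "\<And>x y. lin2 R"
proof (induction x arbitrary: f)
  case Nil then show ?case by (simp add: pos_def)
next
  case (Cons a x)
  let ?w = "pos (wd (length x) (length y))" and ?v = "pos [0..<length y]"
  have "pos (wd (length (a # x)) (length y)) = shift 1 ?w @ ?v"
    by (simp add: pos_append pos_Suc)
  then have "actw R R' (pos (wd (length (a # x)) (length y))) f ((a # x) @ y @ s) =
     actw R R' ?w (\<lambda>s. actw R R' ?v f (a # s)) (x @ y @ s)"
    by (simp add: actw_append actw_Suc del: One_nat_def)
  also have "\<dots> = xr R (\<lambda>u w. actw R R' ?v f (a # u @ w @ s)) x y"
    by (rule Cons.IH)
  also have "\<dots> = xr R (\<lambda>u w. ov R (\<lambda>u a'. f (u @ a' # w @ s)) a u) x y"
  proof (rule fl2_cong[OF fl2_xr[OF that]])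
    fix u v assume "u \<in> blists (length y)"
    then have "length y = length u" by (simp add: blists_def)
    then show "actw R R' ?v f (a # u @ v @ s) = ov R (\<lambda>u a'. f (u @ a' # v @ s)) a u"
      by (simp only: actw_ov)
  qed
  finally show ?case by simp
qed

lemma actw_un: "actw R' R (neg [0..<length y]) f (y @ a # s) = un R (\<lambda>a' y'. f (a' # y' @ s)) y a"
proof (induction y arbitrary: a f)
  case Nil then show ?case by (simp add: neg_def)
next
  case (Cons b y)
  have "neg [0..<length (b # y)] = shift 1 (neg [0..<length y]) @ [(0, False)]"
    by (simp only: list.size add_0_right add_Suc_right upt_Suc0) (simp add: neg_def shift_def rev_map)
  then have "actw R' R (neg [0..<length (b # y)]) f ((b # y) @ a # s) =
     actw R' R (neg [0..<length y]) (\<lambda>s. act R 0 f (b # s)) (y @ a # s)"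
    by (simp add: actw_append actw_Suc del: upt_Suc One_nat_def)
  also have "\<dots> = un R (\<lambda>a' y'. act R 0 f (b # a' # y' @ s)) y a"
    by (rule Cons.IH)
  finally show ?case by simp
qed

lemma actw_xl: "actw R' R (neg (wd (length x) (length y))) f (y @ x @ s) = xl R (\<lambda>x' y'. f (x' @ y' @ s)) y x"
  if R: "\<And>x y. lin2 R"
proof (induction x arbitrary: f y)
  case Nil then show ?case by (simp add: neg_def)
next
  case (Cons a x)
  have "neg (wd (length (a # x)) (length y)) = neg [0..<length y] @ shift 1 (neg (wd (length x) (length y)))"
    by (simp add: neg_append neg_Suc)
  then have "actw R' R (neg (wd (length (a # x)) (length y))) f (y @ (a # x) @ s) =
     un R (\<lambda>a' y'. actw R' R (shift 1 (neg (wd (length x) (length y)))) f (a' # y' @ x @ s)) y a"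
    by (simp add: actw_append actw_un del: One_nat_def)
  also have "\<dots> = un R (\<lambda>a' y'. xl R (\<lambda>x' y''. f (a' # x' @ y'' @ s)) y' x) y a"
  proof (rule fl2_cong[OF fl2_un[OF R]])
    fix u v assume "v \<in> blists (length y)"
    then have l: "length y = length v" by (simp add: blists_def)
    show "actw R' R (shift 1 (neg (wd (length x) (length y)))) f (u # v @ x @ s) = xl R (\<lambda>x' y''. f (u # x' @ y'' @ s)) v x"
      unfolding actw_Suc l by (rule Cons.IH)
  qed
  finally show ?case by simp
qed

subsection \<open>The quantum vertex model\<close>

text \<open>
  \<open>tw q\<close> is the Hecke normalisation, with eigenvalues \<open>1\<close> and \<open>- q\<^sup>2\<close> and with entries polynomial in \<open>q\<close>.
  For \<open>q = A powi (- 2)\<close> the Kauffman crossing \<open>A + A\<inverse> e\<close> is \<open>A * tw q\<close>.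
\<close>

definition tw :: "'a::field \<Rightarrow> (bool, 'a) pair_op" where
  "tw q g x y = (if x = y then g x y else if x then q * g y x + (1 - q * q) * g x y else q * g y x)"

definition tw' :: "'a::field \<Rightarrow> (bool, 'a) pair_op" where
  "tw' q g x y = (if x = y then g x y else if x then g y x / q else g y x / q + (1 - 1 / (q * q)) * g x y)"

definition sig :: "'a::field \<Rightarrow> 'a \<Rightarrow> (bool, 'a) pair_op" where
  "sig c q g x y = c * tw q g x y"

definition sig' :: "'a::field \<Rightarrow> 'a \<Rightarrow> (bool, 'a) pair_op" where
  "sig' c q g x y = tw' q g x y / c"

lemma lin2_tw: "lin2 (tw q)"
  by (rule lin2I[where ?k1.0 = "\<lambda>x y. if x \<and> y then 1 else 0" and ?k4.0 = "\<lambda>x y. if \<not> x \<and> \<not> y then 1 else 0"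
    and ?k2.0 = "\<lambda>x y. if x \<and> \<not> y then 1 - q * q else if \<not> x \<and> y then q else 0"
    and ?k3.0 = "\<lambda>x y. if x \<and> \<not> y then q else 0"]) (auto simp: tw_def)

lemma lin2_tw': "lin2 (tw' q)"
  by (rule lin2I[where ?k1.0 = "\<lambda>x y. if x \<and> y then 1 else 0" and ?k4.0 = "\<lambda>x y. if \<not> x \<and> \<not> y then 1 else 0"
    and ?k2.0 = "\<lambda>x y. if \<not> x \<and> y then 1 / q else 0"
    and ?k3.0 = "\<lambda>x y. if x \<and> \<not> y then 1 / q else if \<not> x \<and> y then 1 - 1 / (q * q) else 0"]) (auto simp: tw'_def)

lemma lin2_scale: "lin2 R \<Longrightarrow> lin2 (\<lambda>g x y. c * R g x y)"
  by (auto simp: lin2_def fl2_def intro: fl_scale)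

lemma lin2_sig: "lin2 (sig c q)"
  using lin2_scale[OF lin2_tw, of c q] by (simp add: sig_def[abs_def])

lemma lin2_sig': "lin2 (sig' c q)"
  using lin2_scale[OF lin2_tw', of "1/c" q] by (simp add: sig'_def[abs_def])

fun cap :: "'a::field \<Rightarrow> nat \<Rightarrow> 'a strand_map" where
  "cap q 0 f x = f (False # True # x) - q * f (True # False # x)"
| "cap q (Suc i) f (a # x) = cap q i (\<lambda>x. f (a # x)) x"
| "cap q (Suc i) f [] = 0"

lemma fl_cap: "x \<in> blists n \<Longrightarrow> fl (blists (Suc (Suc n))) (\<lambda>f. cap q i f x)"
proof (induction i arbitrary: x n)
  case 0 then show ?case by (auto intro!: fl_minus fl_scale fl_eval, auto simp: blists_def)
next
  case (Suc i)
  show ?case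
  proof (cases x)
    case Nil then show ?thesis by (simp add: fl_zero)
  next
    case (Cons a x')
    then obtain m where n: "n = Suc m" "x' \<in> blists m" using Suc.prems by (cases n) (auto simp: blists_def)
    have "fl (blists (Suc (Suc n))) (\<lambda>f. (\<lambda>g. cap q i g x') (\<lambda>x. f (a # x)))"
      by (rule fl_image[where \<phi> = "\<lambda>g. cap q i g x'", OF Suc.IH[OF n(2)]]) (auto, auto simp: blists_def n)
    then show ?thesis by (simp add: Cons)
  qed
qed

lemma maps_to_cap: "maps_to n (Suc (Suc n)) (cap q i)"
  by (simp add: maps_to_def fl_cap)

text \<open>The local move behind all naturality: a strand lying over a cap is moved off it at the
  cost of \<open>c * c * q\<close>. In the Kauffman normalisation this scalar is 1.\<close>

lemma sig_cap: "sig c q (\<lambda>b' a'. sig c q (\<lambda>b'' a''. h b' b'' a'') a' True) a False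
   - q * sig c q (\<lambda>b' a'. sig c q (\<lambda>b'' a''. h b' b'' a'') a' False) a True =
   c * c * q * (h False True a - q * h True False a)"
  by (cases a) (simp_all add: sig_def tw_def algebra_simps)

lemma cap_ov: "cap q i (ov (sig c q) g a) y = c * c * q * ov (sig c q) (\<lambda>u a'. cap q i (\<lambda>u. g u a') u) a y"
proof (induction i arbitrary: g a y)
  case 0
  have "cap q 0 (ov (sig c q) g a) y = c * c * q * (ov (sig c q) (\<lambda>u a'. g (False # True # u) a') a y - q * ov (sig c q) (\<lambda>u a'. g (True # False # u) a') a y)"
    using sig_cap[of c q "\<lambda>b' b'' a''. ov (sig c q) (\<lambda>u a'. g (b' # b'' # u) a') a'' y" a] by simp
  also have "ov (sig c q) (\<lambda>u a'. g (False # True # u) a') a y - q * ov (sig c q) (\<lambda>u a'. g (True # False # u) a') a y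
    = ov (sig c q) (\<lambda>u a'. cap q 0 (\<lambda>u. g u a') u) a y"
    using fl2_minus_app[OF fl2_ov[OF lin2_sig], where f = "\<lambda>u a'. g (False # True # u) a'" and g = "\<lambda>u a'. q * g (True # False # u) a'"]
     fl2_scale_app[OF fl2_ov[OF lin2_sig], where f = "\<lambda>u a'. g (True # False # u) a'" and c = q]
    by simp
  finally show ?case .
next
  case (Suc i)
  show ?case
  proof (cases y)
    case Nil then show ?thesis by simp
  next
    case (Cons b y')
    have fc: "fl (blists (Suc (Suc (length y')))) (\<lambda>f. cap q i f y')" by (rule fl_cap) (simp add: blists_def)
    have "cap q (Suc i) (ov (sig c q) g a) y =
       sig c q (\<lambda>b' a'. cap q i (ov (sig c q) (\<lambda>u a''. g (b' # u) a'') a') y') a b"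
      using fl2_swap[OF lin2D[OF lin2_sig] fc, of c q "\<lambda>b' a'. ov (sig c q) (\<lambda>u a''. g (b' # u) a'') a'" a b]
      by (simp add: Cons)
    also have "\<dots> = c * c * q * sig c q (\<lambda>b' a'. ov (sig c q) (\<lambda>u a''. cap q i (\<lambda>u. g (b' # u) a'') u) a' y') a b"
      unfolding Suc.IH by (rule fl2_scale_app[OF lin2D[OF lin2_sig]])
    finally show ?thesis by (simp add: Cons)
  qed
qed

lemma cap_xr_under: "cap q i (xr (sig c q) g x) y =
  (c * c * q) ^ length x * xr (sig c q) (\<lambda>u x'. cap q i (\<lambda>u. g u x') u) x y"
proof (induction x arbitrary: g)
  case Nil then show ?case by simp
next
  case (Cons a x)
  have "cap q i (xr (sig c q) g (a # x)) y =
     (c * c * q) ^ length x * xr (sig c q) (\<lambda>u x'. cap q i (ov (sig c q) (\<lambda>u' a'. g u' (a' # x')) a) u) x y"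
  proof -
    have "xr (sig c q) g (a # x) = xr (sig c q) (\<lambda>u x'. ov (sig c q) (\<lambda>u' a'. g u' (a' # x')) a u) x"
      by (rule ext) simp
    then show ?thesis using Cons.IH[of "\<lambda>u x'. ov (sig c q) (\<lambda>u' a'. g u' (a' # x')) a u"] by (simp only:)
  qed
  also have "xr (sig c q) (\<lambda>u x'. cap q i (ov (sig c q) (\<lambda>u' a'. g u' (a' # x')) a) u) x y =
     c * c * q * xr (sig c q) (\<lambda>u x'. ov (sig c q) (\<lambda>u a'. cap q i (\<lambda>u. g u (a' # x')) u) a u) x y"
    unfolding cap_ov by (rule fl2_scale_app[OF fl2_xr[OF lin2_sig]])
  finally show ?case by (simp add: algebra_simps)
qed

text \<open>Two overstrands are rearranged so that both cross the point \<open>c\<close> before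
  either reaches \<open>y\<close>; then \<open>sig_cap2\<close> applies to \<open>c\<close>.\<close>

lemma ov_ov_Cons:
  assumes R: "lin2 R"
  shows "ov R (\<lambda>u b'. ov R (\<lambda>u a'. G u a' b') a u) b (c # y) =
   R (\<lambda>c' b'. R (\<lambda>c'' a'. ov R (\<lambda>u b'. ov R (\<lambda>u a'. G (c'' # u) a' b') a' u) b' y) a c') b c"
proof -
  have "ov R (\<lambda>u b'. ov R (\<lambda>u a'. G u a' b') a u) b (c # y) =
    R (\<lambda>c' b'. ov R (\<lambda>u b''. R (\<lambda>c'' a''. ov R (\<lambda>u a'. G (c'' # u) a' b'') a'' u) a c') b' y) b c"
    by simp
  also have "\<dots> = R (\<lambda>c' b'. R (\<lambda>c'' a'. ov R (\<lambda>u b'. ov R (\<lambda>u a'. G (c'' # u) a' b') a' u) b' y) a c') b c"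
    by (subst fl2_swap2[OF fl2_ov[OF R] lin2D[OF R]]) (rule HOL.refl)
  finally show ?thesis .
qed

lemma sig_cap2: "sig c q (\<lambda>c' b'. sig c q (\<lambda>c'' a'. h c'' a' b') False c') True d
   - q * sig c q (\<lambda>c' b'. sig c q (\<lambda>c'' a'. h c'' a' b') True c') False d =
   c * c * q * (h d False True - q * h d True False)"
  by (cases d) (simp_all add: sig_def tw_def algebra_simps)

text \<open>Here the cap sits on the two overstrands, and every point of \<open>y\<close> below them
  contributes one scalar.\<close>

lemma pair_ov: "ov (sig c q) (\<lambda>u b'. ov (sig c q) (\<lambda>u a'. G u a' b') False u) True y
   - q * ov (sig c q) (\<lambda>u b'. ov (sig c q) (\<lambda>u a'. G u a' b') True u) False y =
   (c * c * q) ^ length y * (G y False True - q * G y True False)"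
proof (induction y arbitrary: G)
  case Nil then show ?case by simp
next
  case (Cons d y)
  let ?H = "\<lambda>c'' a' b'. ov (sig c q) (\<lambda>u b'. ov (sig c q) (\<lambda>u a'. G (c'' # u) a' b') a' u) b' y"
  show ?case unfolding ov_ov_Cons[OF lin2_sig] sig_cap2[of c q ?H] Cons.IH by (simp add: algebra_simps)
qed

lemma cap_xr_over: "cap q i (\<lambda>x. xr (sig c q) g x y) x =
  (c * c * q) ^ length y * xr (sig c q) (\<lambda>u x'. cap q i (g u) x') x y"
proof (induction i arbitrary: g x)
  case 0
  let ?R = "sig c q"
  let ?G = "\<lambda>a b u x. ov ?R (\<lambda>u b'. ov ?R (\<lambda>u a'. g u (a' # b' # x)) a u) b u"
  have "cap q 0 (\<lambda>x. xr ?R g x y) x = xr ?R (?G False True) x y - q * xr ?R (?G True False) x y"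
    by simp
  also have "\<dots> = xr ?R (\<lambda>u x. ?G False True u x - q * ?G True False u x) x y"
    using fl2_minus_app[OF fl2_xr[OF lin2_sig], where f = "?G False True" and g = "\<lambda>u x. q * ?G True False u x"]
     fl2_scale_app[OF fl2_xr[OF lin2_sig], where f = "?G True False" and c = q] by simp
  also have "\<dots> = xr ?R (\<lambda>u x. (c * c * q) ^ length u * cap q 0 (g u) x) x y"
    unfolding pair_ov by simp
  also have "\<dots> = xr ?R (\<lambda>u x. (c * c * q) ^ length y * cap q 0 (g u) x) x y"
    by (rule fl2_cong[OF fl2_xr[OF lin2_sig]]) (simp add: blists_def)
  also have "\<dots> = (c * c * q) ^ length y * xr ?R (\<lambda>u x. cap q 0 (g u) x) x y"
    by (rule fl2_scale_app[OF fl2_xr[OF lin2_sig]])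
  finally show ?case .
next
  case (Suc i)
  show ?case
  proof (cases x)
    case Nil then show ?thesis by simp
  next
    case (Cons a x')
    have "cap q (Suc i) (\<lambda>x. xr (sig c q) g x y) x =
      (c * c * q) ^ length y * xr (sig c q) (\<lambda>u x'. cap q i (\<lambda>x'. ov (sig c q) (\<lambda>u' a'. g u' (a' # x')) a u) x') x' y"
      using Suc.IH[of "\<lambda>u x'. ov (sig c q) (\<lambda>u' a'. g u' (a' # x')) a u" x'] by (simp add: Cons)
    also have "(\<lambda>u x'. cap q i (\<lambda>x'. ov (sig c q) (\<lambda>u' a'. g u' (a' # x')) a u) x') =
      (\<lambda>u x'. ov (sig c q) (\<lambda>u' a'. cap q i (\<lambda>x'. g u' (a' # x')) x') a u)"
    proof (intro ext)
      fix u x'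
      have fc: "fl (blists (Suc (Suc (length x')))) (\<lambda>f. cap q i f x')" by (rule fl_cap) (simp add: blists_def)
      show "cap q i (\<lambda>x'. ov (sig c q) (\<lambda>u' a'. g u' (a' # x')) a u) x' =
         ov (sig c q) (\<lambda>u' a'. cap q i (\<lambda>x'. g u' (a' # x')) x') a u"
        by (rule fl2_swap[OF fl2_ov[OF lin2_sig] fc, symmetric])
    qed
    finally show ?thesis by (simp add: Cons)
  qed
qed

subsection \<open>Inverse crossings\<close>

definition inverse_ops :: "('s, 'a) pair_op \<Rightarrow> ('s, 'a) pair_op \<Rightarrow> bool" where
  "inverse_ops P Q \<longleftrightarrow> (\<forall>g x y. P (Q g) x y = g x y) \<and> (\<forall>g x y. Q (P g) x y = g x y)"

lemma inverse_sig:
  assumes "q \<noteq> 0" "c \<noteq> 0" shows "inverse_ops (sig c q) (sig' c q)"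
  using assms unfolding inverse_ops_def by (intro conjI allI) (auto simp: sig_def sig'_def tw_def tw'_def field_simps)

lemma inverse_opsD: "inverse_ops P Q \<Longrightarrow> P (\<lambda>u v. Q g u v) x y = g x y" "inverse_ops P Q \<Longrightarrow> Q (\<lambda>u v. P g u v) x y = g x y"
  by (auto simp: inverse_ops_def)

lemma ov_un: "inverse_ops R R' \<Longrightarrow> ov R (\<lambda>u a'. un R' h u a') a y = h a y"
proof (induction y arbitrary: h a)
  case (Cons b y)
  have "un R' h (b' # u) = un R' (\<lambda>a1 y1. R' (\<lambda>a2 b2. h a2 (b2 # y1)) b' a1) u" for b' u
    by (rule ext) simp
  then have "ov R (\<lambda>u a'. un R' h u a') a (b # y) = R (\<lambda>b' a'. R' (\<lambda>a2 b2. h a2 (b2 # y)) b' a') a b"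
    using Cons.IH[OF Cons.prems, of "\<lambda>a1 y1. R' (\<lambda>a2 b2. h a2 (b2 # y1)) _ a1"] by simp
  then show ?case using inverse_opsD(1)[OF Cons.prems, of "\<lambda>a2 b2. h a2 (b2 # y)"] by simp
qed simp

lemma un_ov: "inverse_ops R R' \<Longrightarrow> un R' (\<lambda>a' y'. ov R g a' y') y a = g y a"
proof (induction y arbitrary: g a)
  case (Cons b y)
  have "un R' (\<lambda>a' y'. ov R g a' y') (b # y) a =
    un R' (\<lambda>a' y'. R' (\<lambda>a'' b'. R (\<lambda>b2 a2. ov R (\<lambda>u a3. g (b2 # u) a3) a2 y') a'' b') b a') y a" by simp
  also have "\<dots> = un R' (\<lambda>a' y'. ov R (\<lambda>u a3. g (b # u) a3) a' y') y a"
    using inverse_opsD(2)[OF Cons.prems, of "\<lambda>b2 a2. ov R (\<lambda>u a3. g (b2 # u) a3) a2 _"] by simp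
  finally show ?case using Cons.IH[OF Cons.prems, of "\<lambda>u. g (b # u)"] by simp
qed simp

lemma inverse_xr_xl:
  assumes "inverse_ops R R'" shows "inverse_ops (xr R) (xl R')"
proof -
  have 1: "xr R (xl R' g) x y = g x y" for g x y
  proof (induction x arbitrary: g y)
    case (Cons a x)
    show ?case using Cons.IH[of "\<lambda>x'. g (a # x')" ]
      by (simp add: ov_un[OF assms, of "\<lambda>a' u. xl R' (\<lambda>x' y''. g (a' # x') y'') u _"])
  qed simp
  have 2: "xl R' (xr R g) y x = g y x" for g x y
  proof (induction x arbitrary: g y)
    case (Cons a x)
    have "xl R' (\<lambda>x'. xr R g (a' # x')) y' x = ov R (\<lambda>u' a3. g u' (a3 # x)) a' y'" for a' y'
    proof -
      have "(\<lambda>x'. xr R g (a' # x')) = xr R (\<lambda>u x''. ov R (\<lambda>u' a3. g u' (a3 # x'')) a' u)"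
        by (intro ext) simp
      then show ?thesis using Cons.IH by simp
    qed
    then show ?case by (simp add: un_ov[OF assms])
  qed simp
  show ?thesis using 1 2 by (simp add: inverse_ops_def)
qed

lemma act_inverse: "(\<And>g x y. P (Q g) x y = g x y) \<Longrightarrow> act P i (act Q i f) s = f s"
proof (induction i arbitrary: f s)
  case 0
  then show ?case by (cases "(P, 0::nat, f, s)" rule: act.cases) auto
next
  case (Suc i) then show ?case by (cases s) auto
qed

subsection \<open>Splitting cables\<close>

lemma ov_append: "ov R g a (y @ z) = ov R (\<lambda>u a'. ov R (\<lambda>v a''. g (u @ v) a'') a' z) a y"
  by (induction y arbitrary: g a) auto

lemma xr_append2:
  assumes R: "lin2 R"
  shows "xr R g x (y @ z) = xr R (\<lambda>u x'. xr R (\<lambda>v x''. g (u @ v) x'') x' z) x y"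
proof (induction x arbitrary: g)
  case Nil then show ?case by simp
next
  case (Cons a x)
  show ?case
    by (simp add: Cons.IH ov_append) (subst fl2_swap2[OF fl2_ov[OF R] fl2_xr[OF R]], rule HOL.refl)
qed

subsection \<open>The Yang--Baxter equation\<close>

lemma tw_yb: "tw q (\<lambda>u v. tw q (\<lambda>b' a'. tw q (\<lambda>b'' a''. h b' b'' a'') a' v) a u) b0 b1 =
  tw q (\<lambda>b' a'. tw q (\<lambda>b'' a''. tw q (\<lambda>u v. h u v a'') b' b'') a' b1) a b0"
  by (cases a; cases b0; cases b1) (simp_all add: tw_def algebra_simps)

lemma sig_yb: "sig c q (\<lambda>u v. sig c q (\<lambda>b' a'. sig c q (\<lambda>b'' a''. h b' b'' a'') a' v) a u) b0 b1 =
  sig c q (\<lambda>b' a'. sig c q (\<lambda>b'' a''. sig c q (\<lambda>u v. h u v a'') b' b'') a' b1) a b0"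
proof -
  have t: "tw q (\<lambda>u v. c * f u v) x y = c * tw q f x y" for f x y
    by (simp add: tw_def algebra_simps)
  show ?thesis unfolding sig_def t tw_yb[of q h] by simp
qed

text \<open>The third Reidemeister move: a crossing between points below an overstrand slides along
  it.\<close>

lemma act_ov: "act (sig c q) i (ov (sig c q) g a) y = ov (sig c q) (\<lambda>u a'. act (sig c q) i (\<lambda>u. g u a') u) a y"
proof (induction i arbitrary: g a y)
  case 0
  let ?R = "sig c q"
  show ?case
  proof (cases y)
    case (Cons b0 y1)
    show ?thesis
    proof (cases y1)
      case Nil then show ?thesis by (simp add: Cons)
    next
      case (Cons b1 y')
      have 1: "ov ?R (\<lambda>u' a'. ?R (\<lambda>p r. g (p # r # u') a') b' b'') a'' y' =
         ?R (\<lambda>p r. ov ?R (\<lambda>u' a'. g (p # r # u') a') a'' y') b' b''" for b' b'' a''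
        by (rule fl2_swap2[OF fl2_ov[OF lin2_sig] lin2D[OF lin2_sig]])
      show ?thesis
        using sig_yb[of c q "\<lambda>b' b'' a''. ov ?R (\<lambda>u a'. g (b' # b'' # u) a') a'' y'" a b0 b1]
        by (simp add: \<open>y = b0 # y1\<close> Cons 1)
    qed
  qed simp
next
  case (Suc i)
  let ?R = "sig c q"
  show ?case
  proof (cases y)
    case (Cons b y')
    have fa: "fl (blists (length y')) (\<lambda>f. act ?R i f y')" by (rule fl_act_bool[OF lin2_sig]) (simp add: blists_def)
    have "act ?R (Suc i) (ov ?R g a) y = ?R (\<lambda>b' a'. act ?R i (ov ?R (\<lambda>u a''. g (b' # u) a'') a') y') a b"
      using fl2_swap[OF lin2D[OF lin2_sig] fa, of c q "\<lambda>b' a'. ov ?R (\<lambda>u a''. g (b' # u) a'') a'" a b]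
      by (simp add: Cons)
    then show ?thesis by (simp add: Suc.IH Cons)
  qed simp
qed

lemma act_xr_under: "act (sig c q) i (xr (sig c q) g x) y = xr (sig c q) (\<lambda>u x'. act (sig c q) i (\<lambda>u. g u x') u) x y"
proof (induction x arbitrary: g)
  case Nil then show ?case by simp
next
  case (Cons a x)
  have "xr (sig c q) g (a # x) = xr (sig c q) (\<lambda>u x'. ov (sig c q) (\<lambda>u' a'. g u' (a' # x')) a u) x"
    by (rule ext) simp
  then show ?case using act_ov[of c q i "\<lambda>u' a'. g u' (a' # _)" a] by (simp add: Cons.IH)
qed

lemma actw_xr_under:
  "actw (sig c q) Q (pos w) (xr (sig c q) g x) y = xr (sig c q) (\<lambda>u x'. actw (sig c q) Q (pos w) (\<lambda>u. g u x') u) x y"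
proof (induction w arbitrary: y)
  case Nil then show ?case by (simp add: pos_def)
next
  case (Cons i w)
  have "actw (sig c q) Q (pos w) (xr (sig c q) g x) = xr (sig c q) (\<lambda>u x'. actw (sig c q) Q (pos w) (\<lambda>u. g u x') u) x"
    by (rule ext, rule Cons.IH)
  then show ?case
    using act_xr_under[of c q i "\<lambda>u x'. actw (sig c q) Q (pos w) (\<lambda>u. g u x') u" x y] by (simp add: pos_def)
qed

text \<open>The cable \<open>x\<close> passes over \<open>y\<close> and \<open>z\<close> together.
  The crossing of \<open>y\<close> with \<open>z\<close> is a word of elementary crossings below
  \<open>x\<close>, so it slides along by \<open>actw_xr_under\<close>; no induction over three
  cables is required.\<close>

lemma xr_yb:
  fixes c q defines "X \<equiv> xr (sig c q)"
  shows "X (\<lambda>y1 x1. X (\<lambda>z1 x2. X (\<lambda>z2 y2. f z2 y2 x2) y1 z1) x1 z) x y =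
         X (\<lambda>z1 y1. X (\<lambda>z2 x1. X (\<lambda>y2 x2. f z2 y2 x2) x1 y1) x z1) y z"
proof -
  let ?m = "length y" and ?n = "length z"
  let ?w = "pos (wd ?m ?n)"
  let ?W = "actw (sig c q) (sig c q) ?w"
  \<comment> \<open>A function of two cables is regarded as one of their concatenation. The cut is
    at the length of \<open>z\<close>, since \<open>z\<close> comes first after the
    crossing.\<close>
  define g where "g u x2 = f (take ?n u) (drop ?n u) x2" for u x2
  note fX = fl2_xr[OF lin2_sig, of _ _ c q, folded X_def]
  have W: "?W h (u @ v) = X (\<lambda>u' v'. h (u' @ v')) u v" if "length u = ?m" "length v = ?n" for h u v
    using actw_xr[OF lin2_sig, of c q "sig c q" u v h "[]"] that by (simp add: X_def)
  have "X (\<lambda>z1 y1. X (\<lambda>z2 x1. X (\<lambda>y2 x2. f z2 y2 x2) x1 y1) x z1) y z = X (\<lambda>z1 y1. X g x (z1 @ y1)) y z"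
  proof (rule fl2_cong[OF fX])
    fix z1 y1 assume z1: "z1 \<in> blists ?n" "y1 \<in> blists ?m"
    have "X g x (z1 @ y1) = X (\<lambda>u x'. X (\<lambda>v x''. g (u @ v) x'') x' y1) x z1"
      unfolding X_def by (rule xr_append2[OF lin2_sig])
    also have "\<dots> = X (\<lambda>z2 x1. X (\<lambda>y2 x2. f z2 y2 x2) x1 y1) x z1"
      by (rule fl2_cong[OF fX]) (use z1 in \<open>auto simp: g_def blists_def\<close>)
    finally show "X (\<lambda>z2 x1. X (\<lambda>y2 x2. f z2 y2 x2) x1 y1) x z1 = X g x (z1 @ y1)" ..
  qed
  also have "\<dots> = ?W (X g x) (y @ z)" by (simp add: W)
  also have "\<dots> = X (\<lambda>u x'. ?W (\<lambda>u. g u x') u) x (y @ z)"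
    unfolding X_def by (rule actw_xr_under)
  also have "\<dots> = X (\<lambda>u x'. X (\<lambda>v x''. ?W (\<lambda>u. g u x'') (u @ v)) x' z) x y"
    unfolding X_def by (rule xr_append2[OF lin2_sig])
  also have "\<dots> = X (\<lambda>u x'. X (\<lambda>v x''. X (\<lambda>z2 y2. f z2 y2 x'') u v) x' z) x y"
  proof (rule fl2_cong[OF fX], rule fl2_cong[OF fX])
    fix u x' v x'' assume u: "u \<in> blists ?m" "v \<in> blists ?n"
    then have "?W (\<lambda>u. g u x'') (u @ v) = X (\<lambda>z2 y2. g (z2 @ y2) x'') u v" by (intro W) (auto simp: blists_def)
    also have "\<dots> = X (\<lambda>z2 y2. f z2 y2 x'') u v"
      by (rule fl2_cong[OF fX]) (use u in \<open>auto simp: g_def blists_def\<close>)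
    finally show "?W (\<lambda>u. g u x'') (u @ v) = X (\<lambda>z2 y2. f z2 y2 x'') u v" .
  qed
  finally show ?thesis ..
qed

lemma act_braid:
  assumes "\<And>f x y z. X (\<lambda>y1 x1. X (\<lambda>z1 x2. X (\<lambda>z2 y2. f z2 y2 x2) y1 z1) x1 z) x y =
         X (\<lambda>z1 y1. X (\<lambda>z2 x1. X (\<lambda>y2 x2. f z2 y2 x2) x1 y1) x z1) y z"
  shows "Suc (Suc i) < length s \<Longrightarrow> act X i (act X (Suc i) (act X i f)) s = act X (Suc i) (act X i (act X (Suc i) f)) s"
proof (induction i arbitrary: f s)
  case 0
  obtain x s1 where s1: "s = x # s1" "Suc 0 < length s1" using 0 by (cases s) auto
  obtain y s2 where s2: "s1 = y # s2" "0 < length s2" using s1 by (cases s1) auto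
  obtain z s' where "s2 = z # s'" using s2 by (cases s2) auto
  with s1 s2 have "s = x # y # z # s'" by simp
  then show ?case by (simp only: act.simps) (rule assms)
next
  case (Suc i)
  then obtain x s' where "s = x # s'" by (cases s) auto
  with Suc show ?case by simp
qed

lemma act_far:
  assumes "strand_op P" "strand_op Q"
  shows "Suc (Suc i) \<le> j \<Longrightarrow> act P i (act Q j f) s = act Q j (act P i f) s"
proof (induction i arbitrary: f s j)
  case 0
  then have "j = Suc (Suc (j - 2))" by simp
  then obtain j' where j: "j = Suc (Suc j')" by blast
  show ?case
  proof (cases "\<exists>x y s'. s = x # y # s'")
    case True
    then obtain x y s' where s: "s = x # y # s'" by blast
    have "fl (shapes (swp j' (map length s'))) (\<lambda>f. act Q j' f s')"
      by (rule fl_act_strand[OF assms(2)]) (simp add: shapes_def)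
    then show ?thesis
      using fl2_swap[OF strand_opD[OF assms(1)], of _ "\<lambda>f. act Q j' f s'" "\<lambda>u v s'. f (u # v # s')" x y]
      by (simp add: s j)
  next
    case False
    then have "act P 0 f s = f s" for f by (cases "(P, 0 :: nat, f, s)" rule: act.cases) auto
    moreover have "act Q j f s = f s" for f using False
      by (cases s; cases "tl s") (auto simp: j)
    ultimately show ?thesis by simp
  qed
next
  case (Suc i)
  then have "j = Suc (j - 1)" "Suc (Suc i) \<le> j - 1" by auto
  then obtain j' where j: "j = Suc j'" "Suc (Suc i) \<le> j'" by blast
  show ?case by (cases s) (auto simp: j Suc.IH[OF j(2)])
qed

subsection \<open>Symmetrization\<close>

definition ones :: "bool list \<Rightarrow> nat" where "ones x = length (filter id x)"

lemma ones_simps [simp]: "ones [] = 0" "ones (a # x) = (if a then 1 else 0) + ones x" "ones (x @ y) = ones x + ones y"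
  "ones (replicate n b) = (if b then n else 0)"
  by (auto simp: ones_def)

lemma ones_le: "ones x \<le> length x" by (simp add: ones_def)

text \<open>The inversion number for the order in which \<open>True\<close> precedes
  \<open>False\<close>.\<close>

fun iv :: "bool list \<Rightarrow> nat" where
  "iv [] = 0" | "iv (a # x) = (if a then 0 else ones x) + iv x"

lemma iv_append: "iv (x @ y) = iv x + iv y + (length x - ones x) * ones y"
proof (induction x)
  case (Cons a x) then show ?case using ones_le[of x] by (auto simp: Suc_diff_le)
qed simp

definition st :: "bool list \<Rightarrow> bool list" where
  "st u = replicate (ones u) True @ replicate (length u - ones u) False"

lemma length_st [simp]: "length (st u) = length u" using ones_le[of u] by (simp add: st_def)
lemma ones_st [simp]: "ones (st u) = ones u" by (simp add: st_def)
lemma iv_replicate [simp]: "iv (replicate n b) = 0" by (induction n) (auto simp: ones_def)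
lemma iv_st [simp]: "iv (st u) = 0" by (simp add: st_def iv_append)
lemma st_cong: "ones u = ones v \<Longrightarrow> length u = length v \<Longrightarrow> st u = st v" by (simp add: st_def)

text \<open>
  The Jones--Wenzl projection on the first \<open>k\<close> entries: a function annihilated by all caps is
  determined by its values at the sorted words.
\<close>

definition symz :: "'a::field \<Rightarrow> nat \<Rightarrow> 'a strand_map" where
  "symz q k f x = q ^ iv (take k x) * f (st (take k x) @ drop k x)"

lemma maps_to_sym: "maps_to a a (symz q k)"
  unfolding maps_to_def symz_def by (auto intro!: fl_scale fl_eval, auto simp: blists_def)

lemma sym_0: "symz q 0 f x = f x" by (simp add: symz_def st_def)

lemma sym_1: "symz q (Suc 0) f x = f x"
  by (cases x) (auto simp: symz_def st_def ones_def)

lemma cap_append: "cap q (length p) f (p @ z) = f (p @ False # True # z) - q * f (p @ True # False # z)"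
  by (induction p arbitrary: f) auto

lemma iv_swap: "iv (p @ False # True # z) = Suc (iv (p @ True # False # z))"
  by (simp add: iv_append)

text \<open>Exchanging an adjacent \<open>False\<close>, \<open>True\<close> changes the inversion
  number by one and leaves the sorted word alone, so the two terms of the cap cancel.\<close>

lemma cap_sym:
  assumes "Suc i < k" "k \<le> Suc (Suc (length x))" shows "cap q i (symz q k f) x = 0"
proof -
  define p z where "p = take i x" and "z = drop i x"
  have x: "x = p @ z" and l: "length p = i" using assms by (auto simp: p_def z_def)
  define z1 z2 where "z1 = take (k - 2 - i) z" and "z2 = drop (k - 2 - i) z"
  have z: "z = z1 @ z2" by (simp add: z1_def z2_def)
  have lz: "length p + Suc (Suc (length z1)) = k" using assms l x by (auto simp: z1_def)
  have t: "take k (p @ a # b # z) = p @ a # b # z1" "drop k (p @ a # b # z) = z2" for a b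
    using lz by (auto simp: z)
  have s: "st (p @ False # True # z1) = st (p @ True # False # z1)" by (rule st_cong) auto
  show ?thesis
    unfolding x l[symmetric] cap_append symz_def t iv_swap s by simp
qed

text \<open>Sorting uses no scalar other than \<open>q\<close>, so closure under multiplication by
  \<open>q\<close> is enough. The instances are the zero ideal and the multiples of
  \<open>q ^ (2 * m)\<close> in a subring.\<close>

definition q_ideal :: "'a::field \<Rightarrow> 'a set \<Rightarrow> bool" where
  "q_ideal q I \<longleftrightarrow> 0 \<in> I \<and> (\<forall>a\<in>I. \<forall>b\<in>I. a + b \<in> I) \<and> (\<forall>a\<in>I. q * a \<in> I)"

lemma q_idealD: "q_ideal q I \<Longrightarrow> 0 \<in> I" "q_ideal q I \<Longrightarrow> a \<in> I \<Longrightarrow> b \<in> I \<Longrightarrow> a + b \<in> I"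
  "q_ideal q I \<Longrightarrow> a \<in> I \<Longrightarrow> q ^ n * a \<in> I"
  by (auto simp: q_ideal_def) (induction n, auto simp: mult.assoc)

text \<open>The entry \<open>False\<close> moves right past a block of \<open>True\<close>; each
  exchange costs a factor \<open>q\<close> and an error that is a cap of \<open>f\<close>.\<close>

lemma sort_insert:
  assumes I: "q_ideal q I"
  shows "(\<And>i y. i < p \<Longrightarrow> Suc (length y) = p + length w \<Longrightarrow> cap q i f y \<in> I) \<Longrightarrow>
   f (False # replicate p True @ w) - q ^ p * f (replicate p True @ False # w) \<in> I"
proof (induction p arbitrary: f)
  case 0 then show ?case using I by (simp add: q_idealD)
next
  case (Suc p)
  let ?g = "\<lambda>x. f (True # x)"
  have 1: "f (False # True # replicate p True @ w) - q * f (True # False # replicate p True @ w) \<in> I"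
    using Suc.prems[of 0 "replicate p True @ w"] by simp
  have "?g (False # replicate p True @ w) - q ^ p * ?g (replicate p True @ False # w) \<in> I"
  proof (rule Suc.IH)
    fix i and y :: "bool list" assume "i < p" "Suc (length y) = p + length w"
    then show "cap q i ?g y \<in> I" using Suc.prems[of "Suc i" "True # y"] by simp
  qed
  from q_idealD(3)[OF I this, of 1]
  have "q * f (True # False # replicate p True @ w) - q ^ Suc p * f (replicate (Suc p) True @ False # w) \<in> I"
    by (simp add: algebra_simps)
  from q_idealD(2)[OF I 1 this] show ?case by simp
qed

text \<open>Insertion sort with control of the error. The zero ideal yields the description of the
  image of \<open>symz\<close>; the multiples of \<open>q ^ (2 * m)\<close> yield the estimate for
  the full twist.\<close>

lemma sort_ideal:
  assumes I: "q_ideal q I"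
  shows "k \<le> length x \<Longrightarrow> (\<And>i y. Suc i < k \<Longrightarrow> Suc (Suc (length y)) = length x \<Longrightarrow> cap q i f y \<in> I) \<Longrightarrow>
   f x - symz q k f x \<in> I"
proof (induction k arbitrary: x f)
  case 0 then show ?case using I by (simp add: sym_0 q_idealD)
next
  case (Suc k)
  then obtain a x' where x: "x = a # x'" by (cases x) auto
  let ?g = "\<lambda>x. f (a # x)"
  define u w where "u = take k x'" and "w = drop k x'"
  have 1: "?g x' - symz q k ?g x' \<in> I"
  proof (rule Suc.IH)
    show "k \<le> length x'" using Suc.prems x by simp
    fix i and y :: "bool list" assume "Suc i < k" "Suc (Suc (length y)) = length x'"
    then show "cap q i ?g y \<in> I" using Suc.prems(2)[of "Suc i" "a # y"] by (simp add: x)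
  qed
  have lu: "length u = k" "length x' = k + length w" using Suc.prems x by (auto simp: u_def w_def)
  have st0: "st (False # u) = replicate (ones u) True @ False # replicate (k - ones u) False"
    using ones_le[of u] lu by (simp add: st_def Suc_diff_le)
  have st1: "st (True # u) = True # st u" by (simp add: st_def)
  \<comment> \<open>Inserts the new first entry \<open>a\<close> into the sorted block
    \<open>st u\<close>; nothing moves if \<open>a\<close> is \<open>True\<close>.\<close>
  have 2: "q ^ iv u * (?g (st u @ w) - q ^ (if a then 0 else ones u) * f (st (a # u) @ w)) \<in> I"
  proof (rule q_idealD(3)[OF I], cases a)
    case True then show "?g (st u @ w) - q ^ (if a then 0 else ones u) * f (st (a # u) @ w) \<in> I"
      using I by (simp add: st1 q_idealD)
  next
    case False
    have "f (False # replicate (ones u) True @ replicate (k - ones u) False @ w) -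
       q ^ ones u * f (replicate (ones u) True @ False # replicate (k - ones u) False @ w) \<in> I"
    proof (rule sort_insert[OF I])
      fix i and y :: "bool list" assume "i < ones u" "Suc (length y) = ones u + length (replicate (k - ones u) False @ w)"
      then show "cap q i f y \<in> I" using Suc.prems(2)[of i y] ones_le[of u] lu by (simp add: x)
    qed
    then show "?g (st u @ w) - q ^ (if a then 0 else ones u) * f (st (a # u) @ w) \<in> I"
      using False lu by (simp add: st0) (simp add: st_def)
  qed
  have "f x - symz q (Suc k) f x = (?g x' - symz q k ?g x') + q ^ iv u * (?g (st u @ w) - q ^ (if a then 0 else ones u) * f (st (a # u) @ w))"
    by (simp add: x symz_def u_def[symmetric] w_def[symmetric] algebra_simps power_add)
  also have "\<dots> \<in> I" by (rule q_idealD(2)[OF I 1 2])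
  finally show ?case .
qed

lemma sym_fixed:
  assumes "k \<le> length x" "\<And>i y. Suc i < k \<Longrightarrow> Suc (Suc (length y)) = length x \<Longrightarrow> cap q i f y = 0"
  shows "symz q k f x = f x"
  using sort_ideal[of q "{0}" k x f] assms by (auto simp: q_ideal_def)

text \<open>Symmetrising more points gives a smaller image, on which the projection on fewer points
  is the identity.\<close>

lemma sym_sym:
  assumes "k \<le> l" "l \<le> length x" shows "symz q k (symz q l f) x = symz q l f x"
  by (rule sym_fixed) (use assms in \<open>auto intro!: cap_sym\<close>)

section \<open>Cabling by symmetric powers\<close>

definition commutes :: "'a strand_map \<Rightarrow> (bool list, 'a) pair_op \<Rightarrow> bool" where
  "commutes \<kappa> X \<longleftrightarrow> (\<forall>g x y. \<kappa> (\<lambda>x. X g x y) x = X (\<lambda>u w. \<kappa> (g u) w) x y) \<and>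
     (\<forall>g x y. \<kappa> (X g x) y = X (\<lambda>u w. \<kappa> (\<lambda>u. g u w) u) x y)"

lemma commutesD:
  assumes "commutes \<kappa> X"
  shows "\<kappa> (\<lambda>x. X g x y) x = X (\<lambda>u w. \<kappa> (g u) w) x y"
    "\<kappa> (\<lambda>y. X g x y) y = X (\<lambda>u w. \<kappa> (\<lambda>u. g u w) u) x y"
  using assms by (auto simp: commutes_def)

definition natural :: "'a::field \<Rightarrow> (bool list, 'a) pair_op \<Rightarrow> bool" where
  "natural q X \<longleftrightarrow> strand_op X \<and> (\<forall>i. commutes (cap q i) X)"

text \<open>The hypothesis makes the scalar of \<open>cap_xr_under\<close> and
  \<open>cap_xr_over\<close> equal to 1; this is the Kauffman normalisation.\<close>

lemma natural_xr: "c * c * q = 1 \<Longrightarrow> natural q (xr (sig c q))"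
  by (simp add: natural_def commutes_def strand_op_xr lin2_sig cap_xr_under cap_xr_over)

text \<open>Conjugating the naturality of \<open>X\<close> by its inverse replaces a separate
  computation for negative crossings; over and under exchange their roles.\<close>

lemma natural_inverse:
  assumes "natural q X" "strand_op Y" "inverse_ops X Y" shows "natural q Y"
proof -
  have XY: "X (Y g) = g" for g using assms(3) by (intro ext) (auto simp: inverse_ops_def)
  have "cap q i (\<lambda>x. Y g x y) x = Y (\<lambda>u w. cap q i (g u) w) x y" for i g x y
  proof -
    have "Y (\<lambda>a b. cap q i (g a) b) x y = Y (\<lambda>a b. cap q i (X (Y g) a) b) x y"
      by (simp add: XY)
    also have "\<dots> = Y (\<lambda>a b. X (\<lambda>u w. cap q i (\<lambda>u. Y g u w) u) a b) x y"
      using commutesD(2)[of "cap q i" X "Y g"] assms(1) by (simp add: natural_def)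
    also have "\<dots> = cap q i (\<lambda>u. Y g u y) x"
      by (rule inverse_opsD(2)[OF assms(3)])
    finally show ?thesis ..
  qed
  moreover have "cap q i (Y g x) y = Y (\<lambda>u w. cap q i (\<lambda>u. g u w) u) x y" for i g x y
  proof -
    have "Y (\<lambda>a b. cap q i (\<lambda>a. g a b) a) x y = Y (\<lambda>a b. cap q i (\<lambda>a. X (Y g) a b) a) x y"
      by (simp add: XY)
    also have "\<dots> = Y (\<lambda>a b. X (\<lambda>u w. cap q i (Y g u) w) a b) x y"
      using commutesD(1)[of "cap q i" X "Y g"] assms(1) by (simp add: natural_def)
    also have "\<dots> = cap q i (Y g x) y"
      by (rule inverse_opsD(2)[OF assms(3)])
    finally show ?thesis ..
  qed
  ultimately show ?thesis using assms(2) by (simp add: natural_def commutes_def)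
qed

lemma act_tens:
  assumes X: "strand_op X"
  shows "(\<And>c. c \<in> set cs \<Longrightarrow> maps_to (\<alpha> c) (\<beta> c) (\<kappa> c)) \<Longrightarrow> (\<And>c. c \<in> set cs \<Longrightarrow> commutes (\<kappa> c) X) \<Longrightarrow>
    s \<in> shapes (map \<alpha> cs) \<Longrightarrow> tens (map \<kappa> cs) (act X i f) s = act X i (tens (map \<kappa> (swp i cs)) f) s"
proof (induction i cs arbitrary: s f rule: swp.induct)
  case (1 c d cs)
  obtain x y s' where s: "s = x # y # s'" "x \<in> blists (\<alpha> c)" "y \<in> blists (\<alpha> d)" "s' \<in> shapes (map \<alpha> cs)"
    using 1 by (auto simp: shapes_Cons)
  let ?T = "\<lambda>\<phi>. tens (map \<kappa> cs) \<phi> s'"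
  have T: "fl (shapes (map \<beta> cs)) ?T" by (rule fl_tens[OF _ s(4)]) (use 1 in auto)
  have "tens (map \<kappa> (c # d # cs)) (act X 0 f) s = \<kappa> c (\<lambda>x. \<kappa> d (\<lambda>y. ?T (\<lambda>s. X (\<lambda>u v. f (u # v # s)) x y)) y) x"
    by (simp add: s)
  also have "\<dots> = \<kappa> c (\<lambda>x. \<kappa> d (\<lambda>y. X (\<lambda>u v. ?T (\<lambda>s. f (u # v # s))) x y) y) x"
    using fl2_swap[OF strand_opD[OF X] T, where f = "\<lambda>u v s. f (u # v # s)"] by simp
  also have "\<dots> = X (\<lambda>u v. \<kappa> c (\<lambda>v. \<kappa> d (\<lambda>u. ?T (\<lambda>s. f (u # v # s))) u) v) x y"
    using 1(2)[of c] 1(2)[of d] by (simp add: commutesD)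
  also have "\<dots> = X (\<lambda>u v. \<kappa> d (\<lambda>u. \<kappa> c (\<lambda>v. ?T (\<lambda>s. f (u # v # s))) v) u) x y"
  proof (rule fl2_cong[OF strand_opD[OF X]])
    fix u v :: "bool list" assume "u \<in> blists (length y)" "v \<in> blists (length x)"
    then have "u \<in> blists (\<alpha> d)" "v \<in> blists (\<alpha> c)" using s by (auto simp: blists_def)
    then have "fl (blists (\<beta> d)) (\<lambda>f. \<kappa> d f u)" "fl (blists (\<beta> c)) (\<lambda>f. \<kappa> c f v)"
      using 1(1)[of c] 1(1)[of d] by (auto dest: maps_toD)
    from fl_swap[OF this]
    show "\<kappa> c (\<lambda>v. \<kappa> d (\<lambda>u. ?T (\<lambda>s. f (u # v # s))) u) v = \<kappa> d (\<lambda>u. \<kappa> c (\<lambda>v. ?T (\<lambda>s. f (u # v # s))) v) u" by simp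
  qed
  finally show ?case by (simp add: s)
next
  case (2 i c cs)
  obtain x s' where s: "s = x # s'" "x \<in> blists (\<alpha> c)" "s' \<in> shapes (map \<alpha> cs)"
    using 2 by (auto simp: shapes_Cons)
  have "fl (blists (\<beta> c)) (\<lambda>f. \<kappa> c f x)" using 2(2)[of c] s by (auto dest: maps_toD)
  from fl_swap[OF this fl_act_strand[OF X s(3), of i], of "\<lambda>x s. tens (map \<kappa> (swp i cs)) (\<lambda>s. f (x # s)) s"]
  have "\<kappa> c (\<lambda>x. act X i (tens (map \<kappa> (swp i cs)) (\<lambda>s. f (x # s))) s') x =
      act X i (\<lambda>s. \<kappa> c (\<lambda>x. tens (map \<kappa> (swp i cs)) (\<lambda>s. f (x # s)) s) x) s'" by simp
  moreover have "tens (map \<kappa> cs) (act X i (\<lambda>s. f (x # s))) s' = act X i (tens (map \<kappa> (swp i cs)) (\<lambda>s. f (x # s))) s'" for x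
    by (rule 2(1)[OF _ _ s(3)]) (use 2(2,3) in auto)
  ultimately show ?case by (simp add: s)
next
  case ("3_1" i) then show ?case by auto
next
  case ("3_2" i) then show ?case by (cases i) auto
next
  case ("3_3" c) then obtain x where "s = [x]" by (auto simp: shapes_Cons)
  then show ?case by simp
qed

text \<open>Labels travel with their strands: maps placed along the labels \<open>cs\<close> at one
  end of the braid leave it along \<open>swps w cs\<close>.\<close>

lemma actw_tens:
  assumes X: "strand_op P" "strand_op Q"
  shows "(\<And>c. c \<in> set cs \<Longrightarrow> maps_to (\<alpha> c) (\<beta> c) (\<kappa> c)) \<Longrightarrow> (\<And>c. c \<in> set cs \<Longrightarrow> commutes (\<kappa> c) P \<and> commutes (\<kappa> c) Q) \<Longrightarrow>
    s \<in> shapes (map \<alpha> cs) \<Longrightarrow> tens (map \<kappa> cs) (actw P Q w f) s = actw P Q w (tens (map \<kappa> (swps w cs)) f) s"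
proof (induction w arbitrary: cs s)
  case Nil then show ?case by simp
next
  case (Cons l w)
  obtain i b where l: "l = (i, b)" by force
  let ?X = "if b then P else Q"
  have X: "strand_op ?X" using assms by simp
  have "tens (map \<kappa> cs) (actw P Q (l # w) f) s = act ?X i (tens (map \<kappa> (swp i cs)) (actw P Q w f)) s"
    unfolding l actw.simps by (rule act_tens[OF X Cons.prems(1) _ Cons.prems(3)]) (use Cons.prems(2) in auto)
  also have "\<dots> = act ?X i (actw P Q w (tens (map \<kappa> (swps w (swp i cs))) f)) s"
  proof (rule fl_cong[OF fl_act_strand[OF X Cons.prems(3)]])
    fix s' assume "s' \<in> shapes (swp i (map \<alpha> cs))"
    then show "tens (map \<kappa> (swp i cs)) (actw P Q w f) s' = actw P Q w (tens (map \<kappa> (swps w (swp i cs))) f) s'"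
      by (intro Cons.IH) (use Cons.prems in \<open>auto simp: map_swp\<close>)
  qed
  finally show ?case by (simp add: l)
qed

text \<open>The rule \<open>P X P = X P\<close>: a crossing sends the image of the projections into
  their image. Full commutation would be too much, as it fails for the oblique projections
  \<open>symz\<close>.\<close>

definition preserves :: "('c \<Rightarrow> nat) \<Rightarrow> ('c \<Rightarrow> 'a strand_map) \<Rightarrow> (bool list, 'a) pair_op \<Rightarrow> 'c set \<Rightarrow> bool" where
  "preserves \<alpha> \<pi> X C \<longleftrightarrow> (\<forall>c\<in>C. \<forall>d\<in>C. \<forall>g. \<forall>x\<in>blists (\<alpha> c). \<forall>y\<in>blists (\<alpha> d).
     \<pi> c (\<lambda>x. \<pi> d (\<lambda>y. X (\<lambda>u w. \<pi> d (\<lambda>u. \<pi> c (g u) w) u) x y) y) x = X (\<lambda>u w. \<pi> d (\<lambda>u. \<pi> c (g u) w) u) x y)"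

text \<open>Only the two cables at the crossing need \<open>preserves\<close>. On all other cables
  the projections act on another tensor factor and are absorbed by idempotence.\<close>

lemma act_tens_proj:
  fixes \<pi> :: "'c \<Rightarrow> 'a::comm_ring_1 strand_map"
  assumes X: "strand_op X"
  shows "(\<And>c. c \<in> set cs \<Longrightarrow> maps_to (\<alpha> c) (\<alpha> c) (\<pi> c)) \<Longrightarrow>
    (\<And>c f x. c \<in> set cs \<Longrightarrow> x \<in> blists (\<alpha> c) \<Longrightarrow> \<pi> c (\<pi> c f) x = \<pi> c f x) \<Longrightarrow>
    preserves \<alpha> \<pi> X (set cs) \<Longrightarrow> s \<in> shapes (map \<alpha> cs) \<Longrightarrow>
    tens (map \<pi> cs) (act X i (tens (map \<pi> (swp i cs)) f)) s = act X i (tens (map \<pi> (swp i cs)) f) s"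
proof (induction i cs arbitrary: s f rule: swp.induct)
  case (1 c d cs)
  obtain x y s' where s: "s = x # y # s'" "x \<in> blists (\<alpha> c)" "y \<in> blists (\<alpha> d)" "s' \<in> shapes (map \<alpha> cs)"
    using 1 by (auto simp: shapes_Cons)
  let ?T = "\<lambda>\<phi>. tens (map \<pi> cs) \<phi> s'"
  let ?F = "tens (map \<pi> (swp 0 (c # d # cs))) f"
  have mcs: "\<And>c. c \<in> set cs \<Longrightarrow> maps_to (\<alpha> c) (\<alpha> c) (\<pi> c)" using 1 by auto
  have T: "fl (shapes (map \<alpha> cs)) ?T" by (rule fl_tens[OF mcs s(4)])
  have TT: "?T (tens (map \<pi> cs) h) = ?T h" for h
    by (subst tens_tens[OF mcs mcs s(4)]) (auto intro!: tens_cong[OF _ s(4)] simp: 1)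
  have F: "?F (u # w # s') = \<pi> d (\<lambda>u. \<pi> c (\<lambda>w. ?T (\<lambda>s. f (u # w # s))) w) u" for u w by simp
  have TF: "?T (\<lambda>s. ?F (u # w # s)) = ?F (u # w # s')" if "u \<in> blists (\<alpha> d)" "w \<in> blists (\<alpha> c)" for u w
  proof -
    have fd: "fl (blists (\<alpha> d)) (\<lambda>f. \<pi> d f u)" and fc: "fl (blists (\<alpha> c)) (\<lambda>f. \<pi> c f w)"
      using 1(1)[of c] 1(1)[of d] that by (auto dest: maps_toD)
    have "?T (\<lambda>s. ?F (u # w # s)) = \<pi> d (\<lambda>u. ?T (\<lambda>s. \<pi> c (\<lambda>w. tens (map \<pi> cs) (\<lambda>s. f (u # w # s)) s) w)) u"
      using fl_swap[OF fd T, of "\<lambda>u s. \<pi> c (\<lambda>w. tens (map \<pi> cs) (\<lambda>s. f (u # w # s)) s) w"] by simp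
    also have "\<dots> = \<pi> d (\<lambda>u. \<pi> c (\<lambda>w. ?T (\<lambda>s. tens (map \<pi> cs) (\<lambda>s. f (u # w # s)) s)) w) u"
      using fl_swap[OF fc T, of "\<lambda>w s. tens (map \<pi> cs) (\<lambda>s. f (_ # w # s)) s"] by simp
    also have "\<dots> = ?F (u # w # s')" using TT by simp
    finally show ?thesis .
  qed
  have L: "?T (\<lambda>s. X (\<lambda>u v. ?F (u # v # s)) x y) = X (\<lambda>u v. \<pi> d (\<lambda>u. \<pi> c (\<lambda>w. ?T (\<lambda>s. f (u # w # s))) v) u) x y"
    if xy: "x \<in> blists (\<alpha> c)" "y \<in> blists (\<alpha> d)" for x y
  proof -
    have "?T (\<lambda>s. X (\<lambda>u v. ?F (u # v # s)) x y) = X (\<lambda>u v. ?T (\<lambda>s. ?F (u # v # s))) x y"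
      by (rule fl2_swap[OF strand_opD[OF X] T, symmetric])
    also have "\<dots> = X (\<lambda>u v. \<pi> d (\<lambda>u. \<pi> c (\<lambda>w. ?T (\<lambda>s. f (u # w # s))) v) u) x y"
    proof (rule fl2_cong[OF strand_opD[OF X]])
      fix u v :: "bool list" assume "u \<in> blists (length y)" "v \<in> blists (length x)"
      then have "u \<in> blists (\<alpha> d)" "v \<in> blists (\<alpha> c)" using xy by (auto simp: blists_def)
      from TF[OF this] show "?T (\<lambda>s. ?F (u # v # s)) = \<pi> d (\<lambda>u. \<pi> c (\<lambda>w. ?T (\<lambda>s. f (u # w # s))) v) u" by simp
    qed
    finally show ?thesis .
  qed
  have pc: "fl (blists (\<alpha> c)) (\<lambda>f. \<pi> c f x)" using 1(1)[of c] s by (auto dest: maps_toD)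
  have pd: "fl (blists (\<alpha> d)) (\<lambda>f. \<pi> d f y)" using 1(1)[of d] s by (auto dest: maps_toD)
  have "tens (map \<pi> (c # d # cs)) (act X 0 ?F) s = \<pi> c (\<lambda>x. \<pi> d (\<lambda>y. ?T (\<lambda>s. X (\<lambda>u v. ?F (u # v # s)) x y)) y) x"
    by (simp add: s)
  also have "\<dots> = \<pi> c (\<lambda>x. \<pi> d (\<lambda>y. X (\<lambda>u v. \<pi> d (\<lambda>u. \<pi> c (\<lambda>w. ?T (\<lambda>s. f (u # w # s))) v) u) x y) y) x"
    by (rule fl_cong[OF pc], rule fl_cong[OF pd]) (rule L)
  also have "\<dots> = X (\<lambda>u v. \<pi> d (\<lambda>u. \<pi> c (\<lambda>w. ?T (\<lambda>s. f (u # w # s))) v) u) x y"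
    using 1(3) s unfolding preserves_def by simp
  also have "\<dots> = act X 0 ?F s" by (simp add: s)
  finally show ?case .
next
  case (2 i c cs)
  obtain x s' where s: "s = x # s'" "x \<in> blists (\<alpha> c)" "s' \<in> shapes (map \<alpha> cs)"
    using 2 by (auto simp: shapes_Cons)
  let ?F = "tens (map \<pi> (swp (Suc i) (c # cs))) f"
  have pc: "fl (blists (\<alpha> c)) (\<lambda>f. \<pi> c f x)" if "x \<in> blists (\<alpha> c)" for x using 2(2)[of c] that by (auto dest: maps_toD)
  have mcs: "\<And>c. c \<in> set (swp i cs) \<Longrightarrow> maps_to (\<alpha> c) (\<alpha> c) (\<pi> c)" using 2 by auto
  have F: "?F (x # s) = tens (map \<pi> (swp i cs)) (\<lambda>s. \<pi> c (\<lambda>x. f (x # s)) x) s"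
    if "x \<in> blists (\<alpha> c)" "s \<in> shapes (map \<alpha> (swp i cs))" for x s
    using fl_swap[OF fl_tens[OF mcs that(2)] pc[OF that(1)], of "\<lambda>s x. f (x # s)"] by simp
  have A: "tens (map \<pi> cs) (act X i (\<lambda>s. ?F (x # s))) s' = act X i (\<lambda>s. ?F (x # s)) s'" if x: "x \<in> blists (\<alpha> c)" for x
  proof -
    let ?h = "tens (map \<pi> (swp i cs)) (\<lambda>s. \<pi> c (\<lambda>x. f (x # s)) x)"
    have e: "act X i (\<lambda>s. ?F (x # s)) s = act X i ?h s" if "s \<in> shapes (map \<alpha> cs)" for s
      by (rule fl_cong[OF fl_act_strand[OF X that]]) (use F[OF x] in \<open>simp add: map_swp\<close>)
    have "tens (map \<pi> cs) (act X i (\<lambda>s. ?F (x # s))) s' = tens (map \<pi> cs) (act X i ?h) s'"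
      by (rule fl_cong[where S = "shapes (map \<alpha> cs)" and \<phi> = "\<lambda>f. tens (map \<pi> cs) f s'"])
         (use 2(2) e in \<open>auto intro!: fl_tens s(3)\<close>)
    also have "\<dots> = act X i ?h s'"
      by (rule 2(1)[OF _ _ _ s(3)]) (use 2(2,3,4) in \<open>auto simp: preserves_def\<close>)
    finally show ?thesis using e[OF s(3)] by simp
  qed
  have "tens (map \<pi> (c # cs)) (act X (Suc i) ?F) s = \<pi> c (\<lambda>x. tens (map \<pi> cs) (act X i (\<lambda>s. ?F (x # s))) s') x"
    by (simp add: s)
  also have "\<dots> = \<pi> c (\<lambda>x. act X i (\<lambda>s. ?F (x # s)) s') x"
    by (rule fl_cong[OF pc[OF s(2)]]) (rule A)
  also have "\<dots> = act X i (\<lambda>s. \<pi> c (\<lambda>x. ?F (x # s)) x) s'"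
    by (rule fl_swap[OF pc[OF s(2)] fl_act_strand[OF X s(3)]])
  also have "\<dots> = act X i (\<lambda>s. ?F (x # s)) s'"
    using 2(3)[of c] s(2) by simp
  finally show ?case by (simp add: s)
next
  case ("3_1" i) then show ?case by auto
next
  case ("3_2" i) then show ?case by (cases i) auto
next
  case ("3_3" c) then obtain x where "s = [x]" "x \<in> blists (\<alpha> c)" by (auto simp: shapes_Cons)
  then show ?case using "3_3"(2)[of c] by simp
qed

lemma actw_tens_proj:
  fixes \<pi> :: "'c \<Rightarrow> 'a::comm_ring_1 strand_map"
  assumes X: "strand_op P" "strand_op Q"
  shows "(\<And>c. c \<in> set cs \<Longrightarrow> maps_to (\<alpha> c) (\<alpha> c) (\<pi> c)) \<Longrightarrow>
    (\<And>c f x. c \<in> set cs \<Longrightarrow> x \<in> blists (\<alpha> c) \<Longrightarrow> \<pi> c (\<pi> c f) x = \<pi> c f x) \<Longrightarrow>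
    preserves \<alpha> \<pi> P (set cs) \<Longrightarrow> preserves \<alpha> \<pi> Q (set cs) \<Longrightarrow> s \<in> shapes (map \<alpha> cs) \<Longrightarrow>
    tens (map \<pi> cs) (actw P Q w (tens (map \<pi> (swps w cs)) f)) s = actw P Q w (tens (map \<pi> (swps w cs)) f) s"
proof (induction w arbitrary: cs s)
  case Nil
  then show ?case using tens_tens[OF Nil(1) Nil(1) Nil(5), of f] tens_cong[OF _ Nil(5), of "\<lambda>c f. \<pi> c (\<pi> c f)" \<pi> f] by simp
next
  case (Cons l w)
  obtain i b where l: "l = (i, b)" by force
  let ?X = "if b then P else Q"
  have X: "strand_op ?X" using assms by simp
  let ?g = "actw P Q w (tens (map \<pi> (swps w (swp i cs))) f)"
  have IH: "tens (map \<pi> (swp i cs)) ?g s' = ?g s'" if "s' \<in> shapes (map \<alpha> (swp i cs))" for s'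
    by (rule Cons.IH) (use Cons.prems that in auto)
  have e: "act ?X i ?g s = act ?X i (tens (map \<pi> (swp i cs)) ?g) s" if "s \<in> shapes (map \<alpha> cs)" for s
    by (rule fl_cong[OF fl_act_strand[OF X that]]) (use IH in \<open>simp add: map_swp\<close>)
  have "tens (map \<pi> cs) (act ?X i ?g) s = tens (map \<pi> cs) (act ?X i (tens (map \<pi> (swp i cs)) ?g)) s"
    by (rule fl_cong[where S = "shapes (map \<alpha> cs)" and \<phi> = "\<lambda>f. tens (map \<pi> cs) f s"])
       (use Cons.prems e in \<open>auto intro!: fl_tens\<close>)
  also have "\<dots> = act ?X i (tens (map \<pi> (swp i cs)) ?g) s"
    by (rule act_tens_proj[OF X]) (use Cons.prems in auto)
  finally show ?case using e Cons.prems by (simp add: l)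
qed

text \<open>By naturality a function killed by caps is still killed by them after the crossing, and
  \<open>sym_fixed\<close> recognises it as fixed.\<close>

lemma preserves_symz:
  fixes kk :: "'c \<Rightarrow> nat"
  assumes X: "natural q X" and k: "\<And>c. c \<in> C \<Longrightarrow> kk c \<le> \<alpha> c"
  shows "preserves \<alpha> (\<lambda>c. symz q (kk c)) X C"
  unfolding preserves_def
proof (intro ballI allI)
  fix c d g and x y :: "bool list"
  assume cd: "c \<in> C" "d \<in> C" and xy: "x \<in> blists (\<alpha> c)" "y \<in> blists (\<alpha> d)"
  have SX: "strand_op X" using X by (simp add: natural_def)
  let ?P = "symz q (kk c)" and ?Q = "symz q (kk d)"
  let ?h = "\<lambda>u w. ?Q (\<lambda>u. ?P (g u) w) u"
  have h': "?h u w = ?P (\<lambda>w. ?Q (\<lambda>u. g u w) u) w" for u w by (simp add: symz_def)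
  have 1: "?Q (X ?h x) y = X ?h x y" if "x \<in> blists (\<alpha> c)" "y \<in> blists (\<alpha> d)" for x y :: "bool list"
  proof (rule sym_fixed)
    show "kk d \<le> length y" using k cd that by (auto simp: blists_def)
    fix i and y' :: "bool list" assume i: "Suc i < kk d" "Suc (Suc (length y')) = length y"
    have "cap q i (X ?h x) y' = X (\<lambda>u w. cap q i (\<lambda>u. ?h u w) u) x y'"
      using X commutesD(2)[of "cap q i" X ?h] by (simp add: natural_def)
    also have "\<dots> = X (\<lambda>u w. 0) x y'"
      by (rule fl2_cong[OF strand_opD[OF SX]], rule cap_sym[OF i(1)])
         (use i k[OF cd(2)] that in \<open>auto simp: blists_def\<close>)
    also have "\<dots> = 0" by (rule fl2_zero_app[OF strand_opD[OF SX]])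
    finally show "cap q i (X ?h x) y' = 0" .
  qed
  have 2: "?P (\<lambda>x. X ?h x y) x = X ?h x y"
  proof (rule sym_fixed)
    show "kk c \<le> length x" using k cd xy by (auto simp: blists_def)
    fix i and x' :: "bool list" assume i: "Suc i < kk c" "Suc (Suc (length x')) = length x"
    have "cap q i (\<lambda>x. X ?h x y) x' = X (\<lambda>u w. cap q i (?h u) w) x' y"
      using X commutesD(1)[of "cap q i" X ?h] by (simp add: natural_def)
    also have "\<dots> = X (\<lambda>u w. 0) x' y"
      unfolding h'
      by (rule fl2_cong[OF strand_opD[OF SX]], rule cap_sym[OF i(1)])
         (use i k[OF cd(1)] xy in \<open>auto simp: blists_def\<close>)
    also have "\<dots> = 0" by (rule fl2_zero_app[OF strand_opD[OF SX]])
    finally show "cap q i (\<lambda>x. X ?h x y) x' = 0" .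
  qed
  have "fl (blists (\<alpha> c)) (\<lambda>f. ?P f x)" using maps_to_sym xy(1) by (rule maps_toD)
  then have "?P (\<lambda>x. ?Q (X ?h x) y) x = ?P (\<lambda>x. X ?h x y) x"
    by (rule fl_cong) (use 1 xy in auto)
  then show "?P (\<lambda>x. ?Q (\<lambda>y. X ?h x y) y) x = X ?h x y" using 2 by simp
qed

subsection \<open>Quantum traces\<close>

text \<open>With these weights a closed loop contributes \<open>- q - 1 / q = - A\<^sup>2 - A powi (- 2)\<close>.\<close>

definition kp :: "'a::field \<Rightarrow> bool \<Rightarrow> 'a" where "kp q b = (if b then - q else - (1 / q))"
definition kapl :: "'a::field \<Rightarrow> bool list \<Rightarrow> 'a" where "kapl q x = prod_list (map (kp q) x)"
definition kaps :: "'a::field \<Rightarrow> bool list list \<Rightarrow> 'a" where "kaps q s = prod_list (map (kapl q) s)"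

lemma kapl_simps [simp]: "kapl q [] = 1" "kapl q (a # x) = kp q a * kapl q x" "kapl q (x @ y) = kapl q x * kapl q y"
  by (auto simp: kapl_def)

lemma kaps_simps [simp]: "kaps q [] = 1" "kaps q (a # x) = kapl q a * kaps q x"
  by (auto simp: kaps_def)

lemma kapl_ones: "kapl q x = (- q) ^ ones x * (- (1 / q)) ^ (length x - ones x)"
proof (induction x)
  case (Cons a x) then show ?case using ones_le[of x] by (auto simp: kp_def Suc_diff_le)
qed simp

text \<open>Commutation with the weight of the quantum trace; it lets a map be carried around the
  closure by \<open>tr_cyclic\<close>.\<close>

definition balanced :: "'a::field \<Rightarrow> 'a strand_map \<Rightarrow> bool" where
  "balanced q P \<longleftrightarrow> (\<forall>f x. P (\<lambda>x. kapl q x * f x) x = kapl q x * P f x)"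

lemma balanced_symz: "balanced q (symz q k)"
proof -
  have "kapl q (st (take k x) @ drop k x) = kapl q x" for x
  proof -
    have "kapl q (st (take k x)) = kapl q (take k x)" by (simp only: kapl_ones ones_st length_st)
    then show ?thesis using kapl_simps(3)[of q "take k x" "drop k x"] by simp
  qed
  then show ?thesis by (simp add: balanced_def symz_def)
qed

text \<open>The weights at the two ends of a cap multiply to 1.\<close>

lemma balanced_cap:
  assumes "q \<noteq> 0" shows "balanced q (cap q i)"
proof -
  have "cap q i (\<lambda>x. kapl q x * f x) x = kapl q x * cap q i f x" for f x
  proof (induction i arbitrary: f x)
    case 0 then show ?case using assms by (simp add: kp_def algebra_simps)
  next
    case (Suc i)
    have lin: "cap q i (\<lambda>x. c * f x) x = c * cap q i f x" for c f x
      using fl_scale_app[OF fl_cap[of x "length x"]] by (fastforce simp: blists_def)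
    show ?case
    proof (cases x)
      case (Cons a x')
      then show ?thesis using lin[of "kp q a" "\<lambda>x. kapl q x * f (a # x)" x'] Suc.IH[of "\<lambda>x. f (a # x)" x']
        by (simp add: mult.assoc)
    qed simp
  qed
  then show ?thesis by (simp add: balanced_def)
qed

lemma tens_kaps:
  "(\<And>c. c \<in> set cs \<Longrightarrow> maps_to (\<alpha> c) (\<beta> c) (\<kappa> c)) \<Longrightarrow> (\<And>c. c \<in> set cs \<Longrightarrow> balanced q (\<kappa> c)) \<Longrightarrow>
   s \<in> shapes (map \<alpha> cs) \<Longrightarrow> tens (map \<kappa> cs) (\<lambda>s. kaps q s * f s) s = kaps q s * tens (map \<kappa> cs) f s"
proof (induction cs arbitrary: s f)
  case Nil then show ?case by simp
next
  case (Cons c cs)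
  obtain x s' where s: "s = x # s'" "x \<in> blists (\<alpha> c)" "s' \<in> shapes (map \<alpha> cs)"
    using Cons.prems by (auto simp: shapes_Cons)
  have m: "\<And>c. c \<in> set cs \<Longrightarrow> maps_to (\<alpha> c) (\<beta> c) (\<kappa> c)" using Cons.prems by auto
  have 1: "fl (blists (\<beta> c)) (\<lambda>f. \<kappa> c f x)" using Cons.prems(1)[of c] s by (auto dest: maps_toD)
  have "tens (map \<kappa> (c # cs)) (\<lambda>s. kaps q s * f s) s =
    \<kappa> c (\<lambda>x. tens (map \<kappa> cs) (\<lambda>s. kapl q x * (kaps q s * f (x # s))) s') x"
    by (simp add: s mult.assoc)
  also have "\<dots> = \<kappa> c (\<lambda>x. kaps q s' * (kapl q x * tens (map \<kappa> cs) (\<lambda>s. f (x # s)) s')) x"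
  proof (rule fl_cong[OF 1])
    fix x
    have "tens (map \<kappa> cs) (\<lambda>s. kapl q x * (kaps q s * f (x # s))) s' = kapl q x * tens (map \<kappa> cs) (\<lambda>s. kaps q s * f (x # s)) s'"
      by (rule fl_scale_app[where \<phi> = "\<lambda>f. tens (map \<kappa> cs) f s'", OF fl_tens[OF m s(3)]])
    also have "tens (map \<kappa> cs) (\<lambda>s. kaps q s * f (x # s)) s' = kaps q s' * tens (map \<kappa> cs) (\<lambda>s. f (x # s)) s'"
      by (rule Cons.IH[OF m _ s(3)]) (use Cons.prems in auto)
    finally show "tens (map \<kappa> cs) (\<lambda>s. kapl q x * (kaps q s * f (x # s))) s' =
        kaps q s' * (kapl q x * tens (map \<kappa> cs) (\<lambda>s. f (x # s)) s')" by (simp only: mult_ac)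
  qed
  also have "\<dots> = kaps q s' * \<kappa> c (\<lambda>x. kapl q x * tens (map \<kappa> cs) (\<lambda>s. f (x # s)) s') x"
    by (rule fl_scale_app[OF 1])
  also have "\<kappa> c (\<lambda>x. kapl q x * tens (map \<kappa> cs) (\<lambda>s. f (x # s)) s') x = kapl q x * \<kappa> c (\<lambda>x. tens (map \<kappa> cs) (\<lambda>s. f (x # s)) s') x"
    using Cons.prems(2)[of c] by (simp add: balanced_def)
  finally show ?case by (simp only: s list.map tens.simps kaps_simps mult_ac)
qed

subsection \<open>Splitting off one cup\<close>

text \<open>One half of a Wenzl recursion for \<open>p_k = symz q k\<close>: the difference
  \<open>p_k - p_(k+1)\<close> is \<open>cupm\<close> after a cap after \<open>p_k\<close>
  (\<open>symz_diff\<close>), and a cap after \<open>cupm\<close> is \<open>p_(k-1)\<close>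
  (\<open>cap_cupm\<close>). The formula is read off from sorting a word with one new entry at
  position \<open>k\<close>.\<close>

definition cupm :: "'a::field \<Rightarrow> nat \<Rightarrow> 'a strand_map" where
  "cupm q k h x = (let u = take k x in
     if x ! k \<and> ones u < k then q ^ iv u * h (replicate (ones u) True @ replicate (k - 1 - ones u) False @ drop (Suc k) x)
     else 0)"

lemma maps_to_cupm:
  assumes "k \<le> n" "0 < k" shows "maps_to (Suc n) (n - 1) (cupm q k)"
  unfolding maps_to_def cupm_def Let_def
proof
  fix x assume "x \<in> blists (Suc n)"
  then show "fl (blists (n - 1)) (\<lambda>h. if x ! k \<and> ones (take k x) < k then q ^ iv (take k x) * h (replicate (ones (take k x)) True @ replicate (k - 1 - ones (take k x)) False @ drop (Suc k) x) else 0)"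
    using assms by (cases "x ! k \<and> ones (take k x) < k") (auto intro!: fl_scale fl_eval fl_zero, auto simp: blists_def)
qed

lemma cupm_append: "length u = k \<Longrightarrow> cupm q k h (u @ b # v) =
   (if b \<and> ones u < k then q ^ iv u * h (replicate (ones u) True @ replicate (k - 1 - ones u) False @ v) else 0)"
  by (simp add: cupm_def nth_append)

lemma split_at: "k < length x \<Longrightarrow> \<exists>u b v. x = u @ b # v \<and> length u = k"
  by (intro exI[of _ "take k x"] exI[of _ "x ! k"] exI[of _ "drop (Suc k) x"]) (auto simp: id_take_nth_drop[symmetric])

lemma symz_append: "length u = k \<Longrightarrow> symz q k f (u @ v) = q ^ iv u * f (st u @ v)"
  by (simp add: symz_def)

text \<open>Both sides vanish unless position \<open>k\<close> carries a \<open>True\<close> that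
  follows some \<open>False\<close>. Sorting then moves this \<open>True\<close> left past
  \<open>Suc d\<close> entries \<open>False\<close>: the first exchange is the cap, the other
  \<open>d\<close> are absorbed by \<open>symz q k\<close>.\<close>

lemma symz_diff:
  assumes "k < length x" "0 < k"
  shows "symz q k f x - symz q (Suc k) f x = cupm q k (cap q (k - 1) (symz q k f)) x"
proof -
  obtain u b v where x: "x = u @ b # v" and u: "length u = k" using split_at[OF assms(1)] by blast
  have 1: "symz q k f x = q ^ iv u * f (st u @ b # v)" using u by (simp add: x symz_append)
  have 2: "symz q (Suc k) f x = q ^ iv (u @ [b]) * f (st (u @ [b]) @ v)"
    using symz_append[of "u @ [b]" "Suc k" q f v] u by (simp add: x)
  have 3: "cupm q k h x = (if b \<and> ones u < k then q ^ iv u * h (replicate (ones u) True @ replicate (k - 1 - ones u) False @ v) else 0)" for h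
    using u by (simp add: x cupm_append)
  show ?thesis
  proof (cases b)
    case False
    have "st (u @ [b]) = st u @ [b]" using False ones_le[of u] by (simp add: st_def Suc_diff_le replicate_append_same)
    then show ?thesis unfolding 1 2 3 using False by (simp add: iv_append)
  next
    case b: True
    show ?thesis
    proof (cases "ones u = k")
      case True
      then have "st (u @ [b]) = st u @ [b]" using b u by (simp add: st_def replicate_append_same)
      then show ?thesis unfolding 1 2 3 using True u by (simp add: iv_append)
    next
      case False
      \<comment> \<open>The first \<open>k\<close> entries contain \<open>a\<close> times
        \<open>True\<close> and \<open>Suc d\<close> times \<open>False\<close>; the
        \<open>False\<close> that meets the new \<open>True\<close> is counted apart.\<close>
      define a d where "a = ones u" and "d = k - 1 - a"
      have k: "k = Suc (a + d)" using ones_le[of u] False u by (simp add: a_def d_def)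
      let ?p = "replicate a True @ replicate d False"
      have s1: "st u = ?p @ [False]" using u k by (simp add: st_def a_def[symmetric] replicate_append_same)
      have s2: "st (u @ [b]) = replicate (Suc a) True @ replicate (Suc d) False"
        using u k b by (simp add: st_def a_def[symmetric])
      have "cap q (k - 1) (symz q k f) (?p @ v) = symz q k f (?p @ False # True # v) - q * symz q k f (?p @ True # False # v)"
        using cap_append[of q ?p "symz q k f" v] k by simp
      also have "symz q k f (?p @ False # True # v) = f (?p @ False # True # v)"
        using symz_append[of "?p @ [False]" k q f "True # v"] k
        by (simp add: iv_append) (simp add: st_def replicate_append_same[symmetric] )
      also have "symz q k f (?p @ True # False # v) = q ^ d * f (replicate (Suc a) True @ replicate (Suc d) False @ v)"
        using symz_append[of "?p @ [True]" k q f "False # v"] k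
        by (simp add: iv_append) (simp add: st_def replicate_app_Cons_same)
      finally have c: "cap q (k - 1) (symz q k f) (?p @ v) = f (?p @ False # True # v) - q ^ Suc d * f (replicate (Suc a) True @ replicate (Suc d) False @ v)"
        by simp
      have "cupm q k (cap q (k - 1) (symz q k f)) x = q ^ iv u * cap q (k - 1) (symz q k f) (?p @ v)"
        unfolding 3 a_def[symmetric] using b k by simp
      moreover have "iv (u @ [b]) = iv u + Suc d" using b u k by (simp add: iv_append a_def[symmetric])
      ultimately show ?thesis unfolding 1 2 c s1 s2 using b by (simp add: algebra_simps power_add)
    qed
  qed
qed

text \<open>Of the two terms of the cap, the one with \<open>True\<close> before
  \<open>False\<close> vanishes, since \<open>cupm\<close> demands a \<open>True\<close> at position
  \<open>k\<close>.\<close>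

lemma cap_cupm:
  assumes "0 < k" "k \<le> Suc (length x)"
  shows "cap q (k - 1) (cupm q k h) x = symz q (k - 1) h x"
proof -
  obtain j where k: "k = Suc j" using assms by (cases k) auto
  define u v where "u = take j x" and "v = drop j x"
  have x: "x = u @ v" "length u = j" using assms k by (auto simp: u_def v_def)
  have "cap q (k - 1) (cupm q k h) x = cupm q k h (u @ False # True # v) - q * cupm q k h (u @ True # False # v)"
    using cap_append[of q u "cupm q k h" v] by (simp add: x k)
  also have "cupm q k h (u @ True # False # v) = 0"
    using cupm_append[of "u @ [True]" k q h False v] x k by simp
  also have "cupm q k h (u @ False # True # v) = q ^ iv u * h (st u @ v)"
    using cupm_append[of "u @ [False]" k q h True v] x k ones_le[of u] by (simp add: iv_append st_def)
  finally show ?thesis using x k by (simp add: symz_append)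
qed

lemma symz_cupm:
  assumes "k < length x" shows "symz q k (cupm q k h) x = cupm q k h x"
proof -
  obtain u b v where x: "x = u @ b # v" and u: "length u = k" using split_at[OF assms(1)] by blast
  show ?thesis using u by (simp add: x symz_append cupm_append)
qed

subsection \<open>Traces of coloured braids\<close>

text \<open>The list \<open>cs\<close> names the component of each strand; \<open>\<alpha>\<close>
  is the number of parallels and \<open>\<pi>\<close> the projection chosen for a component.\<close>

definition ztr :: "'a::field \<Rightarrow> (bool list, 'a) pair_op \<Rightarrow> (bool list, 'a) pair_op \<Rightarrow> (nat \<times> bool) list \<Rightarrow> 'c list \<Rightarrow>
    ('c \<Rightarrow> nat) \<Rightarrow> ('c \<Rightarrow> 'a strand_map) \<Rightarrow> 'a" where
  "ztr q P Q w cs \<alpha> \<pi> = tr (shapes (map \<alpha> cs)) (\<lambda>f s. kaps q s * actw P Q w (tens (map \<pi> cs) f) s)"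

lemma ztr_cong:
  assumes "strand_op P" "strand_op Q" "swps w cs = cs"
   and "\<And>c. c \<in> set cs \<Longrightarrow> \<alpha> c = \<beta> c" "\<And>c f x. c \<in> set cs \<Longrightarrow> x \<in> blists (\<alpha> c) \<Longrightarrow> \<pi> c f x = \<rho> c f x"
  shows "ztr q P Q w cs \<alpha> \<pi> = ztr q P Q w cs \<beta> \<rho>"
proof -
  have m: "map \<alpha> cs = map \<beta> cs" using assms(4) by simp
  show ?thesis unfolding ztr_def m
  proof (rule tr_cong)
    fix s f assume s: "s \<in> shapes (map \<beta> cs)"
    have "actw P Q w (tens (map \<pi> cs) f) s = actw P Q w (tens (map \<rho> cs) f) s"
    proof (rule fl_cong[OF fl_actw_strand[OF assms(1,2) s]])
      fix s' assume "s' \<in> shapes (swps w (map \<beta> cs))"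
      then have "s' \<in> shapes (map \<alpha> cs)" by (simp add: map_swps[symmetric] assms(3) m)
      from tens_cong[OF assms(5) this] show "tens (map \<pi> cs) f s' = tens (map \<rho> cs) f s'" .
    qed
    then show "kaps q s * actw P Q w (tens (map \<pi> cs) f) s = kaps q s * actw P Q w (tens (map \<rho> cs) f) s" by simp
  qed
qed

lemma swp_zip: "length xs = length ys \<Longrightarrow> swp i (zip xs ys) = zip (swp i xs) (swp i ys)"
proof (induction i xs arbitrary: ys rule: swp.induct)
  case (1 x y s)
  then obtain a b t where "ys = a # b # t" by (cases ys; cases "tl ys") auto
  then show ?case by simp
next
  case (2 i x s) then show ?case by (cases ys) auto
next
  case ("3_3" v) then show ?case by (cases ys) auto
qed auto

lemma swps_zip: "length xs = length ys \<Longrightarrow> swps w (zip xs ys) = zip (swps w xs) (swps w ys)"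
  by (induction w arbitrary: xs ys) (auto simp: swp_zip)

lemma count_le_eq:
  "length b = length b' \<Longrightarrow> (\<And>p. p < length b \<Longrightarrow> b ! p \<Longrightarrow> b' ! p) \<Longrightarrow> ones b \<le> ones b' \<and> (ones b = ones b' \<longrightarrow> b = b')"
proof (induction b b' rule: list_induct2)
  case (Cons x xs y ys)
  have "ones xs \<le> ones ys \<and> (ones xs = ones ys \<longrightarrow> xs = ys)"
    by (rule Cons.IH) (use Cons.prems[of "Suc _"] in auto)
  with Cons.prems[of 0] show ?case by auto
qed simp

lemma ones_swps [simp]: "ones (swps w b) = ones b"
proof -
  have "mset (filter id (swps w b)) = mset (filter id b)" by simp
  then have "size (mset (filter id (swps w b))) = size (mset (filter id b))" by (rule arg_cong)
  then show ?thesis unfolding size_mset ones_def .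
qed

text \<open>Two hypotheses say that labels and components match: \<open>cs\<close> is invariant
  under the permutation of the braid, and by \<open>comps\<close> every invariant marking of strands
  is constant on each label, so that no label covers two components.\<close>

context
  fixes q :: "'a::field" and P Q :: "(bool list, 'a) pair_op" and w :: "(nat \<times> bool) list" and cs :: "'c list"
  assumes q: "q \<noteq> 0" and P: "natural q P" and Q: "natural q Q" and cs: "swps w cs = cs"
  and comps: "\<And>b :: bool list. length b = length cs \<Longrightarrow> swps w b = b \<Longrightarrow>
     (\<forall>p<length cs. \<forall>p'<length cs. cs ! p = cs ! p' \<longrightarrow> b ! p = b ! p')"
begin

lemma SP: "strand_op P" and SQ: "strand_op Q" using P Q by (auto simp: natural_def)

lemma fl_X: "s \<in> shapes (map \<alpha> cs) \<Longrightarrow> fl (shapes (map \<alpha> cs)) (\<lambda>f. actw P Q w f s)"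
  using fl_actw_strand[OF SP SQ, of s "map \<alpha> cs" w] by (simp add: map_swps[symmetric] cs)

text \<open>On each strand of \<open>C0\<close> either \<open>symz q (Suc k)\<close> or its
  complement in \<open>symz q k\<close> is chosen. The braid carries the image belonging to the
  pattern \<open>b\<close> into the image belonging to \<open>b0\<close>; by cyclicity the
  projections for \<open>b0\<close> come to stand next to the chosen maps, and complement times
  \<open>symz q (Suc k)\<close> is zero. So marks of \<open>b\<close> are marks of
  \<open>b0\<close>, and both have equally many.\<close>

lemma ztr_mixed:
  assumes m: "\<And>c. c \<in> set cs \<Longrightarrow> kk c \<le> \<alpha> c" "Suc k \<le> \<alpha> C0" "kk C0 = k"
    and b: "length b = length cs"
    and O: "\<And>c. c \<noteq> C0 \<Longrightarrow> O' c False = symz q (kk c)" "\<And>c f x. c \<noteq> C0 \<Longrightarrow> O' c True f x = 0"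
       "O' C0 False = symz q (Suc k)" "\<And>f x. O' C0 True f x = symz q k f x - symz q (Suc k) f x"
    and mO: "\<And>c b. maps_to (\<alpha> c) (\<alpha> c) (O' c b)"
    and nz: "tr (shapes (map \<alpha> cs)) (\<lambda>f s. kaps q s * actw P Q w (tens (map (\<lambda>(c, b). O' c b) (zip cs b)) f) s) \<noteq> 0"
  shows "swps w b = b \<and> (\<forall>p<length cs. b ! p \<longrightarrow> cs ! p = C0)"
proof -
  obtain b0 where b0: "length b0 = length b" "swps w b0 = b" using swps_surj by blast
  define R where "R = (\<lambda>(c, b). symz q (if c = C0 \<and> \<not> b then Suc k else kk c))"
  define \<alpha>' where "\<alpha>' = (\<lambda>(c :: 'c, b :: bool). \<alpha> c)"
  let ?O = "\<lambda>(c, b). O' c b" and ?S = "shapes (map \<alpha> cs)"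
  have sh: "shapes (map \<alpha>' (zip cs b')) = ?S" if "length b' = length cs" for b'
    using that by (intro arg_cong[where f = shapes] nth_equalityI) (auto simp: \<alpha>'_def)
  have zs: "swps w (zip cs b0) = zip cs b" using b0 b by (simp add: swps_zip cs)
  have RR: "symz q j (symz q j f) x = symz q j f x" if "j \<le> length x" for j f and x :: "bool list"
    using sym_sym[of j j x q f] that by simp
  have RO: "R d (?O d f) x = ?O d f x" if d: "fst d \<in> set cs" "x \<in> blists (\<alpha>' d)" for d f x
  proof -
    obtain c t where [simp]: "d = (c, t)" by force
    have lx: "length x = \<alpha> c" using d by (simp add: \<alpha>'_def blists_def)
    have z: "symz q j (\<lambda>x. 0) x = 0" for j by (simp add: symz_def)
    have df: "symz q j (\<lambda>x. g x - h x) x = symz q j g x - symz q j h x" for j g h by (simp add: symz_def algebra_simps)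
    show ?thesis
    proof (cases "c = C0")
      case True
      have O4: "O' C0 True f = (\<lambda>x. symz q k f x - symz q (Suc k) f x)" for f by (rule ext) (rule O(4))
      show ?thesis using True m lx by (cases t) (auto simp: R_def O(3) O4 df RR sym_sym)
    next
      case False
      have O2: "O' c True f = (\<lambda>x. 0)" for f using False by (intro ext O(2))
      show ?thesis using False m d lx by (cases t) (auto simp: R_def O O2 z RR)
    qed
  qed
  have mR: "maps_to (\<alpha>' d) (\<alpha>' d) (R d)" for d by (auto simp: R_def \<alpha>'_def maps_to_sym split: prod.splits)
  have mO': "maps_to (\<alpha>' d) (\<alpha>' d) (?O d)" for d using mO by (auto simp: \<alpha>'_def split: prod.splits)
  let ?X = "actw P Q w" and ?R = "\<lambda>b. tens (map R (zip cs b))" and ?T = "tens (map ?O (zip cs b))"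
  have flR: "fl ?S (\<lambda>f. ?R b' f s)" if "s \<in> ?S" "length b' = length cs" for b' s
    using fl_tens[of "zip cs b'" \<alpha>' \<alpha>' R s] mR that sh by simp
  have flT: "fl ?S (\<lambda>f. ?T f s)" if "s \<in> ?S" for s
    using fl_tens[of "zip cs b" \<alpha>' \<alpha>' ?O s] mO' that sh b by simp
  have T: "?T f s = ?R b (?T f) s" if "s \<in> ?S" for f s
  proof -
    have "?R b (?T f) s = tens (map (\<lambda>d f. R d (?O d f)) (zip cs b)) f s"
      by (rule tens_tens[where \<alpha> = \<alpha>' and \<beta> = \<alpha>' and \<gamma> = \<alpha>']) (use mR mO' that sh b in auto)
    also have "\<dots> = ?T f s"
      by (rule tens_cong[where \<alpha> = \<alpha>']) (use RO that sh b in \<open>auto dest: set_zip_leftD\<close>)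
    finally show ?thesis ..
  qed
  have XT: "?X (?T f) s = ?R b0 (?X (?T f)) s" if s: "s \<in> ?S" for f s
  proof -
    have e: "?X (?T f) s = ?X (?R b (?T f)) s" if "s \<in> ?S" for s
      by (rule fl_cong[OF fl_X[OF that]]) (rule T)
    have pr: "preserves \<alpha>' R X (set (zip cs b0))" if "natural q X" for X
    proof -
      have "R = (\<lambda>d. symz q (if fst d = C0 \<and> \<not> snd d then Suc k else kk (fst d)))" by (auto simp: R_def)
      moreover have "(if fst d = C0 \<and> \<not> snd d then Suc k else kk (fst d)) \<le> \<alpha>' d" if "d \<in> set (zip cs b0)" for d
      proof -
        have "fst d \<in> set cs" using that by (metis prod.collapse set_zip_leftD)
        then show ?thesis using m by (auto simp: \<alpha>'_def split: prod.splits)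
      qed
      ultimately show ?thesis
        using preserves_symz[OF that, of "set (zip cs b0)" "\<lambda>d. if fst d = C0 \<and> \<not> snd d then Suc k else kk (fst d)" \<alpha>']
        by presburger
    qed
    have "?R b0 (?X (tens (map R (swps w (zip cs b0))) (?T f))) s = ?X (tens (map R (swps w (zip cs b0))) (?T f)) s"
    proof (rule actw_tens_proj[OF SP SQ, where \<alpha> = \<alpha>'])
      fix d f x assume d: "d \<in> set (zip cs b0)" "x \<in> blists (\<alpha>' d)"
      then show "R d (R d f) x = R d f x"
        using m by (auto simp: R_def \<alpha>'_def blists_def intro!: RR split: prod.splits dest: set_zip_leftD)
    qed (use mR pr P Q s sh b b0 in auto)
    moreover have "?R b0 (?X (?T f)) s = ?R b0 (?X (?R b (?T f))) s"
      by (rule fl_cong[OF flR]) (use s e b b0 in auto)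
    ultimately show ?thesis using e[OF s] zs by simp
  qed
  have K: "kaps q s * ?R b0 g s = ?R b0 (\<lambda>s. kaps q s * g s) s" if "s \<in> ?S" for g s
    by (rule tens_kaps[where \<alpha> = \<alpha>' and \<beta> = \<alpha>', symmetric])
      (use mR that sh b b0 balanced_symz in \<open>auto simp: R_def\<close>)
  have "tr ?S (\<lambda>f s. kaps q s * ?X (?T f) s) = tr ?S (\<lambda>f. ?R b0 (\<lambda>s. kaps q s * ?X (?T f) s))"
  proof (rule tr_cong)
    fix s f assume s: "s \<in> ?S"
    show "kaps q s * ?X (?T f) s = ?R b0 (\<lambda>s. kaps q s * ?X (?T f) s) s"
      unfolding K[OF s, symmetric] XT[OF s, symmetric] ..
  qed
  also have "\<dots> = tr ?S (\<lambda>f s. kaps q s * ?X (?T (?R b0 f)) s)"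
  proof (rule tr_cyclic[where Y = "\<lambda>f s. kaps q s * ?X (?T f) s"])
    fix s assume s: "s \<in> ?S"
    show "fl ?S (\<lambda>f. ?R b0 f s)" by (rule flR) (use s b b0 in auto)
    show "fl ?S (\<lambda>f. kaps q s * ?X (?T f) s)"
      by (rule fl_scale, rule fl_comp[OF fl_X[OF s]]) (auto intro: flT)
  qed
  finally have nz': "tr ?S (\<lambda>f s. kaps q s * ?X (?T (?R b0 f)) s) \<noteq> 0" using nz by simp
  have TR: "?T (?R b0 f) s = tens (map (\<lambda>(c, t, t0) f. O' c t (R (c, t0) f)) (zip cs (zip b b0))) f s" if s: "s \<in> ?S" for f s
  proof -
    have z1: "map ?O (zip cs b) = map (\<lambda>(c, t, t0). O' c t) (zip cs (zip b b0))"
      using b b0 by (intro nth_equalityI) auto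
    have z2: "map R (zip cs b0) = map (\<lambda>(c, t, t0). R (c, t0)) (zip cs (zip b b0))"
      using b b0 by (intro nth_equalityI) auto
    have z3: "map \<alpha> cs = map (\<lambda>(c, t, t0). \<alpha> c) (zip cs (zip b b0))"
      using b b0 by (intro nth_equalityI) auto
    have "?T (?R b0 f) s = tens (map (\<lambda>d f. (\<lambda>(c, t, t0). O' c t) d ((\<lambda>(c, t, t0). R (c, t0)) d f)) (zip cs (zip b b0))) f s"
      unfolding z1 z2
      by (rule tens_tens[where \<alpha> = "\<lambda>(c, t, t0). \<alpha> c" and \<beta> = "\<lambda>(c, t, t0). \<alpha> c" and \<gamma> = "\<lambda>(c, t, t0). \<alpha> c"])
         (use mO mR s z3 in \<open>auto simp: \<alpha>'_def split: prod.splits\<close>)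
    also have "(\<lambda>d f. (\<lambda>(c, t, t0). O' c t) d ((\<lambda>(c, t, t0). R (c, t0)) d f)) = (\<lambda>(c, t, t0) f. O' c t (R (c, t0) f))"
      by (auto simp: fun_eq_iff)
    finally show ?thesis .
  qed
  \<comment> \<open>At a bad position the factor is zero: either a strand outside \<open>C0\<close>
    is marked, or the complement meets \<open>symz q (Suc k)\<close>.\<close>
  have good: "b ! p \<longrightarrow> cs ! p = C0 \<and> b0 ! p" if p: "p < length cs" for p
  proof (rule ccontr)
    assume bad: "\<not> (b ! p \<longrightarrow> cs ! p = C0 \<and> b0 ! p)"
    let ?d = "(cs ! p, b ! p, b0 ! p)"
    have dz: "O' (cs ! p) (b ! p) (R (cs ! p, b0 ! p) f) x = 0" if x: "x \<in> blists (\<alpha> (cs ! p))" for f x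
    proof (cases "cs ! p = C0")
      case False then show ?thesis using bad O(2) by auto
    next
      case True
      then have "\<not> b0 ! p" "b ! p" using bad by auto
      moreover have "symz q k (symz q (Suc k) f) x = symz q (Suc k) f x" "symz q (Suc k) (symz q (Suc k) f) x = symz q (Suc k) f x"
        using x True m by (auto simp: blists_def intro!: sym_sym)
      ultimately show ?thesis using True O(4) by (simp add: R_def)
    qed
    have z3: "map \<alpha> cs = map (\<lambda>(c, t, t0). \<alpha> c) (zip cs (zip b b0))"
      using b b0 by (intro nth_equalityI) auto
    have "?T (?R b0 f) s = 0" if s: "s \<in> ?S" for f s
      unfolding TR[OF s]
    proof (rule tens_zero[where d = ?d and \<alpha> = "\<lambda>(c, t, t0). \<alpha> c" and \<beta> = "\<lambda>(c, t, t0). \<alpha> c"])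
      fix d assume "d \<in> set (zip cs (zip b b0))"
      obtain c t t0 where [simp]: "d = (c, t, t0)" by (cases d) auto
      have "fl (blists (\<alpha> c)) (\<lambda>f. O' c t (R (c, t0) f) x)" if "x \<in> blists (\<alpha> c)" for x
        by (rule fl_comp[OF maps_toD[OF mO that]]) (use mR[of "(c, t0)"] in \<open>auto simp: \<alpha>'_def dest: maps_toD\<close>)
      then show "maps_to (case d of (c, t, t0) \<Rightarrow> \<alpha> c) (case d of (c, t, t0) \<Rightarrow> \<alpha> c) (case d of (c, t, t0) \<Rightarrow> \<lambda>f. O' c t (R (c, t0) f))"
        by (simp add: maps_to_def)
    next
      show "?d \<in> set (zip cs (zip b b0))" using p b b0 by (auto simp: in_set_zip)
    qed (use s z3 dz in auto)
    then have "?X (?T (?R b0 f)) s = 0" if s: "s \<in> ?S" for f s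
      using fl_cong[OF fl_X[OF s], of "?T (?R b0 f)" "\<lambda>s. 0"] fl_zero_app[OF fl_X[OF s]] by simp
    with nz' show False by (simp add: tr_def)
  qed
  have "b = b0"
    using count_le_eq[of b b0] good b b0 by (metis ones_swps)
  then show ?thesis using b0 good by simp
qed

text \<open>On all strands of \<open>C0\<close> the projection on \<open>k\<close> points is split
  into the one on \<open>Suc k\<close> points and a complement; mixed choices do not contribute. The
  complement factors through cups and caps, and carrying the caps around the closure leaves the
  projection on \<open>k - 1\<close> points of a cable with two points fewer.\<close>

lemma ztr_step:
  assumes C0: "C0 \<in> set cs" and m: "\<And>c. kk c \<le> \<alpha> c" "kk C0 = k" "0 < k" "k < \<alpha> C0"
  shows "ztr q P Q w cs \<alpha> (\<lambda>c. symz q (kk c)) =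
    ztr q P Q w cs \<alpha> (\<lambda>c. symz q ((kk(C0 := Suc k)) c)) +
    ztr q P Q w cs (\<alpha>(C0 := \<alpha> C0 - 2)) (\<lambda>c. symz q ((kk(C0 := k - 1)) c))"
proof -
  define p0 where "p0 = (\<lambda>c. symz q (if c = C0 then Suc k else kk c))"
  define p1 where "p1 = (\<lambda>c f x. if c = C0 then symz q k f x - symz q (Suc k) f x else 0)"
  define O' where "O' = (\<lambda>c b. if b then p1 c else p0 c)"
  let ?S = "shapes (map \<alpha> cs)" and ?n = "length cs"
  let ?X = "actw P Q w"
  have mp0: "maps_to (\<alpha> c) (\<alpha> c) (p0 c)" for c by (simp add: p0_def maps_to_sym)
  have mp1: "maps_to (\<alpha> c) (\<alpha> c) (p1 c)" for c
    unfolding p1_def maps_to_def by (auto intro!: fl_if fl_minus fl_zero maps_toD[OF maps_to_sym])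
  define F where "F b = tr ?S (\<lambda>f s. kaps q s * ?X (tens (map (\<lambda>(c, b). O' c b) (zip cs b)) f) s)" for b
  have "ztr q P Q w cs \<alpha> (\<lambda>c. symz q (kk c)) = ztr q P Q w cs \<alpha> (\<lambda>c f x. p0 c f x + p1 c f x)"
    by (rule ztr_cong[OF SP SQ cs]) (use m in \<open>auto simp: p0_def p1_def\<close>)
  also have "\<dots> = tr ?S (\<lambda>f s. \<Sum>b\<in>blists ?n. kaps q s * ?X (tens (map (\<lambda>(c, b). O' c b) (zip cs b)) f) s)"
    unfolding ztr_def
  proof (rule tr_cong)
    fix s f assume s: "s \<in> ?S"
    have "?X (tens (map (\<lambda>c f x. p0 c f x + p1 c f x) cs) f) s = ?X (\<lambda>s. \<Sum>b\<in>blists ?n. tens (map (\<lambda>(c, b). O' c b) (zip cs b)) f s) s"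
    proof (rule fl_cong[OF fl_X[OF s]])
      fix s' assume s': "s' \<in> ?S"
      show "tens (map (\<lambda>c f x. p0 c f x + p1 c f x) cs) f s' = (\<Sum>b\<in>blists ?n. tens (map (\<lambda>(c, b). O' c b) (zip cs b)) f s')"
        unfolding O'_def by (rule tens_sum[OF mp0 mp1 s'])
    qed
    also have "\<dots> = (\<Sum>b\<in>blists ?n. ?X (tens (map (\<lambda>(c, b). O' c b) (zip cs b)) f) s)"
      by (rule fl_sum_app[OF fl_X[OF s]])
    finally show "kaps q s * ?X (tens (map (\<lambda>c f x. p0 c f x + p1 c f x) cs) f) s =
       (\<Sum>b\<in>blists ?n. kaps q s * ?X (tens (map (\<lambda>(c, b). O' c b) (zip cs b)) f) s)"
      by (simp add: sum_distrib_left)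
  qed
  also have "\<dots> = (\<Sum>b\<in>blists ?n. F b)" unfolding F_def by (rule tr_sum)
  \<comment> \<open>A surviving marking is invariant by \<open>ztr_mixed\<close>, hence by
    \<open>comps\<close> it is empty or all of \<open>C0\<close>.\<close>
  also have "\<dots> = (\<Sum>b\<in>{replicate ?n False, map (\<lambda>c. c = C0) cs}. F b)"
  proof (rule sum.mono_neutral_right)
    show "\<forall>b\<in>blists ?n - {replicate ?n False, map (\<lambda>c. c = C0) cs}. F b = 0"
    proof (rule ballI, rule ccontr)
      fix b assume b: "b \<in> blists ?n - {replicate ?n False, map (\<lambda>c. c = C0) cs}" and nz: "F b \<noteq> 0"
      have lb: "length b = ?n" using b by (simp add: blists_def)
      have g: "swps w b = b \<and> (\<forall>p<?n. b ! p \<longrightarrow> cs ! p = C0)"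
        by (rule ztr_mixed[where O' = O' and kk = kk and k = k and \<alpha> = \<alpha>, OF _ _ _ lb])
           (use m nz mp0 mp1 in \<open>auto simp: F_def O'_def p0_def p1_def\<close>)
      then have cst: "\<forall>p<?n. \<forall>p'<?n. cs ! p = cs ! p' \<longrightarrow> b ! p = b ! p'" using comps[OF lb] by blast
      show False
      proof (cases "\<exists>p<?n. b ! p")
        case True
        then obtain p where p: "p < ?n" "b ! p" by blast
        have "b ! p' = (cs ! p' = C0)" if "p' < ?n" for p' using g cst p that by metis
        then have "b = map (\<lambda>c. c = C0) cs" using lb by (intro nth_equalityI) auto
        with b show False by simp
      next
        case False
        then have "b = replicate ?n False" using lb by (intro nth_equalityI) auto
        with b show False by simp
      qed
    qed
  qed (simp, simp add: blists_def)
  also have "\<dots> = F (replicate ?n False) + F (map (\<lambda>c. c = C0) cs)"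
  proof -
    obtain p where p: "p < ?n" "cs ! p = C0" using C0 by (auto simp: in_set_conv_nth)
    have "replicate ?n False \<noteq> map (\<lambda>c. c = C0) cs"
    proof
      assume "replicate ?n False = map (\<lambda>c. c = C0) cs"
      then have "replicate ?n False ! p = map (\<lambda>c. c = C0) cs ! p" by simp
      then show False using p by simp
    qed
    then show ?thesis by simp
  qed
  also have "F (replicate ?n False) = ztr q P Q w cs \<alpha> (\<lambda>c. symz q ((kk(C0 := Suc k)) c))"
  proof -
    have "map (\<lambda>(c, b). O' c b) (zip cs (replicate ?n False)) = map (\<lambda>c. symz q ((kk(C0 := Suc k)) c)) cs"
      by (intro nth_equalityI) (auto simp: O'_def p0_def)
    then show ?thesis by (simp add: F_def ztr_def)
  qed
  also have "F (map (\<lambda>c. c = C0) cs) = ztr q P Q w cs (\<alpha>(C0 := \<alpha> C0 - 2)) (\<lambda>c. symz q ((kk(C0 := k - 1)) c))"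
  proof -
    define \<beta> where "\<beta> = \<alpha>(C0 := \<alpha> C0 - 2)"
    define J where "J = (\<lambda>c. if c = C0 then cupm q k else symz q (kk c))"
    define \<kappa> where "\<kappa> = (\<lambda>c. if c = C0 then cap q (k - 1) else (\<lambda>f. f))"
    define R where "R = (\<lambda>c. symz q (kk c))"
    let ?J = "tens (map J cs)" and ?\<kappa> = "tens (map \<kappa> cs)" and ?R = "tens (map R cs)" and ?S' = "shapes (map \<beta> cs)"
    have mJ: "maps_to (\<alpha> c) (\<beta> c) (J c)" for c
      using m maps_to_cupm[of k "\<alpha> C0 - 1" q] by (auto simp: J_def \<beta>_def maps_to_sym numeral_2_eq_2)
    have m\<kappa>: "maps_to (\<beta> c) (\<alpha> c) (\<kappa> c)" for c
    proof (cases "c = C0")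
      case True
      have "Suc (Suc (\<alpha> C0 - 2)) = \<alpha> C0" using m by simp
      then show ?thesis using maps_to_cap[of "\<alpha> C0 - 2" q "k - 1"] True by (simp add: \<kappa>_def \<beta>_def)
    next
      case False then show ?thesis by (simp add: \<kappa>_def \<beta>_def maps_to_def fl_eval)
    qed
    have mR: "maps_to (\<alpha> c) (\<alpha> c) (R c)" for c by (simp add: R_def maps_to_sym)
    note flJ = fl_tens[of cs, OF mJ] and fl\<kappa> = fl_tens[of cs, OF m\<kappa>] and flR = fl_tens[of cs, OF mR]
    have e: "tens (map (\<lambda>(c, b). O' c b) (zip cs (map (\<lambda>c. c = C0) cs))) f s = ?J (?\<kappa> (?R f)) s" if s: "s \<in> ?S" for f s
    proof -
      have "?J (?\<kappa> (?R f)) s = ?J (tens (map (\<lambda>c f. \<kappa> c (R c f)) cs) f) s"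
        by (rule fl_cong[OF flJ[OF s]], rule tens_tens[of cs, OF m\<kappa> mR])
      also have "\<dots> = tens (map (\<lambda>c f. J c (\<kappa> c (R c f))) cs) f s"
      proof (rule tens_tens[of cs, OF mJ _ s])
        fix c
        show "maps_to (\<beta> c) (\<alpha> c) (\<lambda>f. \<kappa> c (R c f))"
          unfolding maps_to_def by (intro ballI fl_comp[OF maps_toD[OF m\<kappa>]] maps_toD[OF mR]) auto
      qed
      also have "\<dots> = tens (map (\<lambda>c. O' c (c = C0)) cs) f s"
      proof (rule tens_cong[OF _ s])
        fix c f x assume x: "c \<in> set cs" "x \<in> blists (\<alpha> c)"
        show "J c (\<kappa> c (R c f)) x = O' c (c = C0) f x"
        proof (cases "c = C0")
          case True
          have "k < length x" using x m True by (simp add: blists_def)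
          from symz_diff[OF this m(3), of q f] show ?thesis using True m(2) by (simp add: J_def \<kappa>_def R_def O'_def p1_def)
        next
          case False
          then show ?thesis using x m sym_sym[of "kk c" "kk c" x q f] by (simp add: J_def \<kappa>_def R_def O'_def p0_def blists_def)
        qed
      qed
      also have "map (\<lambda>c. O' c (c = C0)) cs = map (\<lambda>(c, b). O' c b) (zip cs (map (\<lambda>c. c = C0) cs))"
        by (intro nth_equalityI) auto
      finally show ?thesis ..
    qed
    have RJ: "?R (?J f) s = ?J f s" if s: "s \<in> ?S" for f s
    proof -
      have "?R (?J f) s = tens (map (\<lambda>c f. R c (J c f)) cs) f s" by (rule tens_tens[of cs, OF mR mJ s])
      also have "\<dots> = ?J f s"
      proof (rule tens_cong[OF _ s])
        fix c f x assume x: "c \<in> set cs" "x \<in> blists (\<alpha> c)"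
        show "R c (J c f) x = J c f x"
        proof (cases "c = C0")
          case True
          have "k < length x" using x m True by (simp add: blists_def)
          from symz_cupm[OF this, of q f] show ?thesis using True m(2) by (simp add: J_def R_def)
        next
          case False
          then show ?thesis using x m sym_sym[of "kk c" "kk c" x q f] by (simp add: J_def R_def blists_def)
        qed
      qed
      finally show ?thesis .
    qed
    have XRJ: "?X (?R (?J f)) s = ?X (?J f) s" if "s \<in> ?S" for f s
      by (rule fl_cong[OF fl_X[OF that]]) (rule RJ)
    have RXJ: "?R (?X (?J f)) s = ?X (?J f) s" if s: "s \<in> ?S" for f s
    proof -
      have "?R (?X (?J f)) s = ?R (?X (?R (?J f))) s"
        by (rule fl_cong[OF flR[OF s]]) (rule XRJ[symmetric])
      also have "\<dots> = ?X (?R (?J f)) s"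
        using actw_tens_proj[OF SP SQ, of cs \<alpha> R s w "?J f"] mR s
          preserves_symz[OF P, of "set cs" kk \<alpha>] preserves_symz[OF Q, of "set cs" kk \<alpha>] m
        by (simp add: cs R_def sym_sym blists_def)
      also have "\<dots> = ?X (?J f) s" by (rule XRJ[OF s])
      finally show ?thesis .
    qed
    have K: "?\<kappa> (?R (\<lambda>s. kaps q s * g s)) s = kaps q s * ?\<kappa> (?R g) s" if s: "s \<in> ?S'" for g s
    proof -
      have "?\<kappa> (?R (\<lambda>s. kaps q s * g s)) s = ?\<kappa> (\<lambda>s. kaps q s * ?R g s) s"
        by (rule fl_cong[OF fl\<kappa>[OF s]], rule tens_kaps[of cs, OF mR]) (auto simp: R_def balanced_symz)
      also have "\<dots> = kaps q s * ?\<kappa> (?R g) s"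
        by (rule tens_kaps[of cs, OF m\<kappa> _ s]) (use q in \<open>auto simp: \<kappa>_def balanced_cap balanced_def[of q "\<lambda>f. f"]\<close>)
      finally show ?thesis .
    qed
    have fX': "fl ?S' (\<lambda>f. ?X f s)" if "s \<in> ?S'" for s using fl_X that .
    have "F (map (\<lambda>c. c = C0) cs) = tr ?S (\<lambda>f s. kaps q s * ?X (?J (?\<kappa> (?R f))) s)"
      unfolding F_def
    proof (rule tr_cong)
      fix s f assume s: "s \<in> ?S"
      show "kaps q s * ?X (tens (map (\<lambda>(c, b). O' c b) (zip cs (map (\<lambda>c. c = C0) cs))) f) s = kaps q s * ?X (?J (?\<kappa> (?R f))) s"
        by (rule arg_cong[where f = "\<lambda>z. kaps q s * z"], rule fl_cong[OF fl_X[OF s]]) (rule e)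
    qed
    also have "\<dots> = tr ?S' (\<lambda>f. ?\<kappa> (?R (\<lambda>s. kaps q s * ?X (?J f) s)))"
    proof (rule tr_cyclic[where X = "\<lambda>f s. kaps q s * ?X (?J f) s" and Y = "\<lambda>f. ?\<kappa> (?R f)"])
      fix s assume s: "s \<in> ?S"
      show "fl ?S' (\<lambda>f. kaps q s * ?X (?J f) s)"
        by (rule fl_scale, rule fl_comp[OF fl_X[OF s]]) (auto intro: flJ)
    next
      fix s assume s: "s \<in> ?S'"
      show "fl ?S (\<lambda>f. ?\<kappa> (?R f) s)"
        by (rule fl_comp[OF fl\<kappa>[OF s]]) (auto intro: flR)
    qed
    also have "\<dots> = tr ?S' (\<lambda>f s. kaps q s * ?X (tens (map (\<lambda>c. symz q ((kk(C0 := k - 1)) c)) cs) f) s)"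
    proof (rule tr_cong)
      fix s f assume s: "s \<in> ?S'"
      have "?\<kappa> (?R (\<lambda>s. kaps q s * ?X (?J f) s)) s = kaps q s * ?\<kappa> (?R (?X (?J f))) s" by (rule K[OF s])
      also have "?\<kappa> (?R (?X (?J f))) s = ?\<kappa> (?X (?J f)) s"
        by (rule fl_cong[OF fl\<kappa>[OF s]]) (rule RXJ)
      also have "\<dots> = ?X (?\<kappa> (?J f)) s"
      proof -
        have "?\<kappa> (?X (?J f)) s = ?X (tens (map \<kappa> (swps w cs)) (?J f)) s"
          by (rule actw_tens[OF SP SQ m\<kappa> _ s]) (use P Q in \<open>auto simp: \<kappa>_def natural_def commutes_def\<close>)
        then show ?thesis by (simp add: cs)
      qed
      also have "\<dots> = ?X (tens (map (\<lambda>c. symz q ((kk(C0 := k - 1)) c)) cs) f) s"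
      proof (rule fl_cong[OF fX'[OF s]])
        fix s assume s: "s \<in> ?S'"
        have "?\<kappa> (?J f) s = tens (map (\<lambda>c f. \<kappa> c (J c f)) cs) f s" by (rule tens_tens[of cs, OF m\<kappa> mJ s])
        also have "\<dots> = tens (map (\<lambda>c. symz q ((kk(C0 := k - 1)) c)) cs) f s"
        proof (rule tens_cong[OF _ s])
          fix c f x assume x: "c \<in> set cs" "x \<in> blists (\<beta> c)"
          show "\<kappa> c (J c f) x = symz q ((kk(C0 := k - 1)) c) f x"
          proof (cases "c = C0")
            case True
            have "k \<le> Suc (length x)" using x m True by (simp add: blists_def \<beta>_def)
            from cap_cupm[OF m(3) this, of q f] show ?thesis using True by (simp add: J_def \<kappa>_def)
          next
            case False
            then show ?thesis by (simp add: J_def \<kappa>_def)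
          qed
        qed
        finally show "?\<kappa> (?J f) s = tens (map (\<lambda>c. symz q ((kk(C0 := k - 1)) c)) cs) f s" .
      qed
      finally show "?\<kappa> (?R (\<lambda>s. kaps q s * ?X (?J f) s)) s = kaps q s * ?X (tens (map (\<lambda>c. symz q ((kk(C0 := k - 1)) c)) cs) f) s" .
    qed
    finally show ?thesis by (simp only: ztr_def \<beta>_def)
  qed
  finally show ?thesis .
qed

end

text \<open>Here \<open>z k r\<close> stands for \<open>k\<close> symmetrised points next to
  \<open>r\<close> free ones. Both sides satisfy the Chebyshev recursion, in which multiplication by
  the variable means one more free point; the coefficients satisfy it by Pascal's rule.\<close>

lemma chebyshev_sum:
  fixes z :: "nat \<Rightarrow> nat \<Rightarrow> 'a::comm_ring_1"
  assumes z0: "\<And>r. z 0 (Suc r) = z 1 r" and z1: "\<And>k r. z (Suc k) (Suc r) = z (Suc (Suc k)) r + z k r"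
  shows "(\<Sum>j\<in>{0..N div 2}. (-1) ^ j * of_nat ((N - j) choose j) * z 0 (N - 2 * j + r)) = z N r"
proof -
  \<comment> \<open>The free upper bound \<open>M\<close> avoids a distinction by the parity of
    \<open>N\<close>; the summands beyond \<open>N div 2\<close> vanish.\<close>
  define S where "S M N r = (\<Sum>j\<le>M. (-1) ^ j * of_nat ((N - j) choose j) * z 0 (N - 2 * j + r))" for M N r
  have ext: "(\<Sum>j\<in>{0..N div 2}. (-1) ^ j * of_nat ((N - j) choose j) * z 0 (N - 2 * j + r)) = S M N r" if "N \<le> M" for N M r
    unfolding S_def
  proof (rule sum.mono_neutral_left)
    show "\<forall>j\<in>{..M} - {0..N div 2}. (-1) ^ j * of_nat ((N - j) choose j) * z 0 (N - 2 * j + r) = 0"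
    proof
      fix j assume "j \<in> {..M} - {0..N div 2}"
      then have "N - j < j" by auto
      then show "(-1) ^ j * of_nat ((N - j) choose j) * z 0 (N - 2 * j + r) = 0" by (simp add: binomial_eq_0)
    qed
  qed (use that in auto)
  have rec: "S (Suc M) (Suc (Suc N)) r = S (Suc M) (Suc N) (Suc r) - S M N r" for M N r
  proof -
    have t: "(-1) ^ Suc j * of_nat ((Suc (Suc N) - Suc j) choose Suc j) * z 0 (Suc (Suc N) - 2 * Suc j + r) =
       (-1) ^ Suc j * of_nat ((Suc N - Suc j) choose Suc j) * z 0 (Suc N - 2 * Suc j + Suc r) -
       (-1) ^ j * of_nat ((N - j) choose j) * z 0 (N - 2 * j + r)" for j
    \<comment> \<open>In the second case truncated subtraction disturbs the indices of
      \<open>z\<close>; there the affected binomial coefficients vanish.\<close>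
    proof (cases "2 * Suc j \<le> Suc N")
      case True
      then have e: "Suc (Suc N) - Suc j = Suc (N - j)" "Suc N - 2 * Suc j + Suc r = N - 2 * j + r"
         "Suc (Suc N) - 2 * Suc j + r = N - 2 * j + r" "Suc N - Suc j = N - j" by auto
      show ?thesis unfolding e binomial_Suc_Suc by (simp add: algebra_simps)
    next
      case False
      then have "2 * j \<ge> N" by simp
      show ?thesis
      proof (cases "2 * j = N")
        case True
        then have e: "Suc (Suc N) - Suc j = Suc (N - j)" "Suc N - Suc j = N - j" "Suc (Suc N) - 2 * Suc j + r = N - 2 * j + r" by auto
        have b: "(N - j) choose Suc j = 0" using True by (simp add: binomial_eq_0)
        show ?thesis unfolding e binomial_Suc_Suc b by simp
      next
        case False
        then have "N - j < j" "Suc N - j < Suc j" using \<open>2 * j \<ge> N\<close> by auto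
        then show ?thesis by (simp add: binomial_eq_0)
      qed
    qed
    show ?thesis unfolding S_def sum.atMost_Suc_shift t
      by (simp add: sum_subtractf)
  qed
  have "S N N r = z N r" for r
  proof (induction N arbitrary: r rule: less_induct)
    case (less N)
    consider "N = 0" | "N = 1" | n where "N = Suc (Suc n)" by (metis One_nat_def nat.exhaust)
    then show ?case
    proof cases
      case 1 then show ?thesis by (simp add: S_def)
    next
      case 2 then show ?thesis by (simp add: S_def z0)
    next
      case (3 n)
      have "S (Suc (Suc n)) (Suc (Suc n)) r = S (Suc (Suc n)) (Suc n) (Suc r) - S (Suc n) n r" by (rule rec)
      also have "S (Suc (Suc n)) (Suc n) (Suc r) = S (Suc n) (Suc n) (Suc r)"
        using ext[of "Suc n" "Suc (Suc n)" "Suc r"] ext[of "Suc n" "Suc n" "Suc r"] by simp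
      also have "S (Suc n) n r = S n n r"
        using ext[of n "Suc n" r] ext[of n n r] by simp
      finally show ?thesis using less[of "Suc n" "Suc r"] less[of n r] z1[of n r] 3 by simp
    qed
  qed
  then show ?thesis using ext[of N N r] by simp
qed

context
  fixes q :: "'a::field" and P Q :: "(bool list, 'a) pair_op" and w :: "(nat \<times> bool) list" and cs :: "'c list"
  assumes q: "q \<noteq> 0" and P: "natural q P" and Q: "natural q Q" and cs: "swps w cs = cs"
  and comps: "\<And>b :: bool list. length b = length cs \<Longrightarrow> swps w b = b \<Longrightarrow>
     (\<forall>p<length cs. \<forall>p'<length cs. cs ! p = cs ! p' \<longrightarrow> b ! p = b ! p')"
begin

text \<open>A colour \<open>(k, r)\<close> stands for \<open>k\<close> symmetrised points followed
  by \<open>r\<close> free points on every strand of a component.\<close>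

definition zc :: "('c \<Rightarrow> nat \<times> nat) \<Rightarrow> 'a" where
  "zc col = ztr q P Q w cs (\<lambda>c. fst (col c) + snd (col c)) (\<lambda>c. symz q (fst (col c)))"

lemma zc_step:
  assumes C: "C \<in> set cs"
  shows "zc (col(C := (Suc k, Suc r))) = zc (col(C := (Suc (Suc k), r))) + zc (col(C := (k, r)))"
proof -
  let ?col = "col(C := (Suc k, Suc r))"
  have "zc ?col = ztr q P Q w cs (\<lambda>c. fst (?col c) + snd (?col c)) (\<lambda>c. symz q ((\<lambda>c. fst (?col c)) c))"
    by (simp add: zc_def)
  also have "\<dots> = ztr q P Q w cs (\<lambda>c. fst (?col c) + snd (?col c)) (\<lambda>c. symz q (((\<lambda>c. fst (?col c))(C := Suc (Suc k))) c)) +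
    ztr q P Q w cs ((\<lambda>c. fst (?col c) + snd (?col c))(C := fst (?col C) + snd (?col C) - 2)) (\<lambda>c. symz q (((\<lambda>c. fst (?col c))(C := Suc k - 1)) c))"
    by (rule ztr_step[OF q P Q cs comps C]) auto
  also have "\<dots> = zc (col(C := (Suc (Suc k), r))) + zc (col(C := (k, r)))"
  proof -
    have S: "strand_op P" "strand_op Q" using P Q by (auto simp: natural_def)
    have 1: "ztr q P Q w cs (\<lambda>c. fst (?col c) + snd (?col c)) (\<lambda>c. symz q (((\<lambda>c. fst (?col c))(C := Suc (Suc k))) c)) =
       zc (col(C := (Suc (Suc k), r)))"
      unfolding zc_def by (rule ztr_cong[OF S cs]) (simp_all add: fun_upd_def)
    have 2: "ztr q P Q w cs ((\<lambda>c. fst (?col c) + snd (?col c))(C := fst (?col C) + snd (?col C) - 2)) (\<lambda>c. symz q (((\<lambda>c. fst (?col c))(C := Suc k - 1)) c)) =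
       zc (col(C := (k, r)))"
      unfolding zc_def by (rule ztr_cong[OF S cs]) (simp_all add: fun_upd_def)
    show ?thesis unfolding 1 2 ..
  qed
  finally show ?thesis .
qed

lemma zc_step0: "zc (col(C := (0, Suc r))) = zc (col(C := (1, r)))"
  unfolding zc_def
  by (rule ztr_cong) (use P Q cs in \<open>auto simp: natural_def sym_0 sym_1\<close>)

lemma zc_component:
  assumes C: "C \<in> set cs"
  shows "(\<Sum>j\<in>{0..N div 2}. (-1) ^ j * of_nat ((N - j) choose j) * zc (col(C := (0, N - 2 * j)))) = zc (col(C := (N, 0)))"
  using chebyshev_sum[of "\<lambda>k r. zc (col(C := (k, r)))" N 0] zc_step[OF C] zc_step0 by simp

text \<open>Components are treated one at a time; the colours of the others are arbitrary, which
  keeps the induction going.\<close>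

lemma zc_components:
  assumes "finite D" "D \<subseteq> set cs"
  shows "(\<Sum>j\<in>D \<rightarrow>\<^sub>E {0..N div 2}. (\<Prod>C\<in>D. (-1) ^ j C * of_nat ((N - j C) choose j C)) *
     zc (\<lambda>C. if C \<in> D then (0, N - 2 * j C) else col C)) = zc (\<lambda>C. if C \<in> D then (N, 0) else col C)"
  using assms
proof (induction D arbitrary: col rule: finite_induct)
  case empty then show ?case by simp
next
  case (insert C D)
  let ?a = "\<lambda>j. (-1) ^ j * of_nat ((N - j) choose j) :: 'a" and ?I = "{0..N div 2}"
  have "(\<Sum>j\<in>insert C D \<rightarrow>\<^sub>E ?I. (\<Prod>C\<in>insert C D. ?a (j C)) * zc (\<lambda>C'. if C' \<in> insert C D then (0, N - 2 * j C') else col C')) =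
    (\<Sum>(y, g)\<in>?I \<times> (D \<rightarrow>\<^sub>E ?I). (\<Prod>C'\<in>insert C D. ?a ((g(C := y)) C')) *
       zc (\<lambda>C'. if C' \<in> insert C D then (0, N - 2 * (g(C := y)) C') else col C'))"
    unfolding PiE_insert_eq
    by (subst sum.reindex) (use insert.hyps in \<open>auto intro!: inj_combinator sum.cong\<close>)
  also have "\<dots> = (\<Sum>(y, g)\<in>?I \<times> (D \<rightarrow>\<^sub>E ?I). ?a y * ((\<Prod>C'\<in>D. ?a (g C')) *
       zc (\<lambda>C'. if C' \<in> D then (0, N - 2 * g C') else (col(C := (0, N - 2 * y))) C')))"
  proof (rule sum.cong[OF HOL.refl], clarify)
    fix y g
    have "(\<Prod>C'\<in>insert C D. ?a ((g(C := y)) C')) = ?a y * (\<Prod>C'\<in>D. ?a ((g(C := y)) C'))"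
      using insert.hyps by simp
    also have "(\<Prod>C'\<in>D. ?a ((g(C := y)) C')) = (\<Prod>C'\<in>D. ?a (g C'))"
      using insert.hyps by (intro prod.cong) auto
    moreover have "(\<lambda>C'. if C' \<in> insert C D then (0, N - 2 * (g(C := y)) C') else col C') =
       (\<lambda>C'. if C' \<in> D then (0, N - 2 * g C') else (col(C := (0, N - 2 * y))) C')"
      using insert.hyps by auto
    ultimately show "(\<Prod>C'\<in>insert C D. ?a ((g(C := y)) C')) *
       zc (\<lambda>C'. if C' \<in> insert C D then (0, N - 2 * (g(C := y)) C') else col C') =
       ?a y * ((\<Prod>C'\<in>D. ?a (g C')) * zc (\<lambda>C'. if C' \<in> D then (0, N - 2 * g C') else (col(C := (0, N - 2 * y))) C'))"
      by (simp only: mult.assoc)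
  qed
  also have "\<dots> = (\<Sum>y\<in>?I. ?a y * zc (\<lambda>C'. if C' \<in> D then (N, 0) else (col(C := (0, N - 2 * y))) C'))"
    using insert.IH insert.prems by (simp add: sum.cartesian_product[symmetric] sum_distrib_left[symmetric])
  also have "\<dots> = (\<Sum>y\<in>?I. ?a y * zc ((\<lambda>C'. if C' \<in> D then (N, 0) else col C')(C := (0, N - 2 * y))))"
  proof (rule sum.cong[OF HOL.refl])
    fix y
    have "(\<lambda>C'. if C' \<in> D then (N, 0) else (col(C := (0, N - 2 * y))) C') = (\<lambda>C'. if C' \<in> D then (N, 0) else col C')(C := (0, N - 2 * y))"
      using insert.hyps by auto
    then show "?a y * zc (\<lambda>C'. if C' \<in> D then (N, 0) else (col(C := (0, N - 2 * y))) C') = ?a y * zc ((\<lambda>C'. if C' \<in> D then (N, 0) else col C')(C := (0, N - 2 * y)))"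
      by simp
  qed
  also have "\<dots> = zc ((\<lambda>C'. if C' \<in> D then (N, 0) else col C')(C := (N, 0)))"
    by (rule zc_component) (use insert.prems in simp)
  also have "(\<lambda>C'. if C' \<in> D then (N, 0) else col C')(C := (N, 0)) = (\<lambda>C'. if C' \<in> insert C D then (N, 0) else col C')"
    by auto
  finally show ?case .
qed

lemma zc_sum:
  "(\<Sum>j\<in>set cs \<rightarrow>\<^sub>E {0..N div 2}. (\<Prod>C\<in>set cs. (-1) ^ j C * of_nat ((N - j C) choose j C)) *
     tr (shapes (map (\<lambda>C. N - 2 * j C) cs)) (\<lambda>f s. kaps q s * actw P Q w f s)) =
   tr (shapes (map (\<lambda>C. N) cs)) (\<lambda>f s. kaps q s * actw P Q w (tens (map (\<lambda>C. symz q N) cs) f) s)"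
proof -
  have 1: "zc (\<lambda>C. if C \<in> set cs then (0, N - 2 * j C) else (N, 0)) =
      tr (shapes (map (\<lambda>C. N - 2 * j C) cs)) (\<lambda>f s. kaps q s * actw P Q w f s)" for j
  proof -
    have S: "strand_op P" "strand_op Q" using P Q by (auto simp: natural_def)
    have "zc (\<lambda>C. if C \<in> set cs then (0, N - 2 * j C) else (N, 0)) = ztr q P Q w cs (\<lambda>C. N - 2 * j C) (\<lambda>C f. f)"
      unfolding zc_def by (rule ztr_cong[OF S cs]) (auto simp: sym_0)
    moreover have "tens (map (\<lambda>C f. f) cs) f = f" for f :: "bool list list \<Rightarrow> 'a"
    proof (rule ext)
      fix s show "tens (map (\<lambda>C f. f) cs) f s = f s"
      proof (induction cs arbitrary: f s)
        case (Cons c cs) then show ?case by (cases s) auto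
      qed simp
    qed
    ultimately show ?thesis by (simp add: ztr_def)
  qed
  have 2: "zc (\<lambda>C. if C \<in> set cs then (N, 0) else (N, 0)) =
     tr (shapes (map (\<lambda>C. N) cs)) (\<lambda>f s. kaps q s * actw P Q w (tens (map (\<lambda>C. symz q N) cs) f) s)"
    by (simp add: zc_def ztr_def)
  show ?thesis using zc_components[of "set cs" N "\<lambda>_. (N, 0)"] unfolding 1 2 by simp
qed

end

section \<open>Invariance under the braid relations\<close>

text \<open>Braid generators are counted from 1, list positions from 0.\<close>

definition zb :: "braid_word \<Rightarrow> (nat \<times> bool) list" where "zb w = map (\<lambda>(i, s). (i - 1, s)) w"

lemma zb_simps [simp]: "zb [] = []" "zb ((i, s) # w) = (i - 1, s) # zb w" "zb (u @ v) = zb u @ zb v"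
  by (auto simp: zb_def)

lemma actw_cong_length:
  assumes "strand_op P" "strand_op Q" "\<And>s. length s = n \<Longrightarrow> f s = g s" "length s = n"
  shows "actw P Q w f s = actw P Q w g s"
proof (rule fl_cong[OF fl_actw_strand[OF assms(1,2)]])
  show "s \<in> shapes (map length s)" by (simp add: shapes_def)
  fix s' assume "s' \<in> shapes (swps w (map length s))"
  then have "map length s' = swps w (map length s)" by (simp add: shapes_def)
  then have "length (map length s') = length (swps w (map length s))" by (rule arg_cong)
  then have "length s' = n" using assms(4) by simp
  then show "f s' = g s'" by (rule assms(3))
qed

text \<open>Inverse letters act by the inverse crossing, so the operator depends on the braid only
  and may be computed from the positive word.\<close>

lemma braid_eq_actw:
  assumes "q \<noteq> 0" "A \<noteq> 0"
  shows "braid_eq n u v \<Longrightarrow> length s = n \<Longrightarrow>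
    actw (xr (sig A q)) (xl (sig' A q)) (zb u) f s = actw (xr (sig A q)) (xl (sig' A q)) (zb v) f s"
proof (induction arbitrary: f s rule: braid_eq.induct)
  case (append u u' v v')
  have S: "strand_op (xr (sig A q))" "strand_op (xl (sig' A q))"
    by (simp_all add: strand_op_xr strand_op_xl lin2_sig lin2_sig')
  show ?case unfolding zb_simps actw_append
    by (subst append.IH(1)[OF append.prems], rule actw_cong_length[OF S _ append.prems]) (rule append.IH(2))
next
  case (cancel i b)
  have I: "inverse_ops (xr (sig A q)) (xl (sig' A q))" by (rule inverse_xr_xl[OF inverse_sig[OF assms]])
  show ?case using act_inverse[of "xr (sig A q)" "xl (sig' A q)"] act_inverse[of "xl (sig' A q)" "xr (sig A q)"] I
    by (auto simp: inverse_ops_def)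
next
  case (far i j)
  then have "Suc (Suc (i - 1)) \<le> j - 1" by linarith
  from act_far[OF strand_op_xr strand_op_xr this, OF lin2_sig lin2_sig] show ?case by simp
next
  case (braid i)
  then have "Suc (Suc (i - 1)) < length s" by simp
  then have "act (xr (sig A q)) (i - 1) (act (xr (sig A q)) (Suc (i - 1)) (act (xr (sig A q)) (i - 1) f)) s =
      act (xr (sig A q)) (Suc (i - 1)) (act (xr (sig A q)) (i - 1) (act (xr (sig A q)) (Suc (i - 1)) f)) s"
    by (rule act_braid[rotated]) (rule xr_yb)
  with braid show ?case by simp
qed auto

section \<open>The action of the lowering operator\<close>

subsection \<open>Weights\<close>

text \<open>For \<open>\<chi>\<close> arbitrary on points this says that a crossing conserves the
  number of entries \<open>True\<close>.\<close>

definition weight_op :: "('s \<Rightarrow> 'a::comm_ring_1) \<Rightarrow> ('s, 'a) pair_op \<Rightarrow> bool" where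
  "weight_op \<chi> R \<longleftrightarrow> (\<forall>g x y. R (\<lambda>u v. \<chi> u * \<chi> v * g u v) x y = \<chi> x * \<chi> y * R g x y)"

lemma weight_sig: "weight_op \<chi> (sig c q)"
  by (auto simp: weight_op_def sig_def tw_def algebra_simps)

definition wtl :: "(bool \<Rightarrow> 'a::comm_ring_1) \<Rightarrow> bool list \<Rightarrow> 'a" where "wtl \<chi> x = prod_list (map \<chi> x)"

lemma wtl_simps [simp]: "wtl \<chi> [] = 1" "wtl \<chi> (a # x) = \<chi> a * wtl \<chi> x" "wtl \<chi> (x @ y) = wtl \<chi> x * wtl \<chi> y"
  by (auto simp: wtl_def)

lemma weight_ov:
  assumes R: "weight_op \<chi> R" "lin2 R"
  shows "ov R (\<lambda>u a. wtl \<chi> u * \<chi> a * g u a) a y = \<chi> a * wtl \<chi> y * ov R g a y"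
proof (induction y arbitrary: g a)
  case (Cons b y)
  have "ov R (\<lambda>u a'. wtl \<chi> (b' # u) * \<chi> a' * g (b' # u) a') a1 y = \<chi> b' * \<chi> a1 * (wtl \<chi> y * ov R (\<lambda>u a'. g (b' # u) a') a1 y)" for b' a1
  proof -
    have "ov R (\<lambda>u a'. wtl \<chi> (b' # u) * \<chi> a' * g (b' # u) a') a1 y = ov R (\<lambda>u a'. \<chi> b' * (wtl \<chi> u * \<chi> a' * g (b' # u) a')) a1 y"
      by (simp add: mult_ac)
    also have "\<dots> = \<chi> b' * ov R (\<lambda>u a'. wtl \<chi> u * \<chi> a' * g (b' # u) a') a1 y"
      by (rule fl2_scale_app[OF fl2_ov[OF R(2)]])
    finally show ?thesis using Cons.IH[of "\<lambda>u. g (b' # u)" a1] by (simp add: mult_ac)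
  qed
  then have "ov R (\<lambda>u a. wtl \<chi> u * \<chi> a * g u a) a (b # y) = R (\<lambda>b' a1. \<chi> b' * \<chi> a1 * (wtl \<chi> y * ov R (\<lambda>u a'. g (b' # u) a') a1 y)) a b"
    by simp
  also have "\<dots> = \<chi> a * \<chi> b * R (\<lambda>b' a1. wtl \<chi> y * ov R (\<lambda>u a'. g (b' # u) a') a1 y) a b"
    using R(1) by (simp add: weight_op_def)
  also have "R (\<lambda>b' a1. wtl \<chi> y * ov R (\<lambda>u a'. g (b' # u) a') a1 y) a b = wtl \<chi> y * R (\<lambda>b' a1. ov R (\<lambda>u a'. g (b' # u) a') a1 y) a b"
    by (rule fl2_scale_app[OF lin2D[OF R(2)]])
  finally show ?case by (simp add: mult_ac)
qed (simp add: mult_ac)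

lemma weight_xr:
  assumes R: "weight_op \<chi> R" "lin2 R"
  shows "weight_op (wtl \<chi>) (xr R)"
proof -
  have "xr R (\<lambda>u w. wtl \<chi> u * wtl \<chi> w * g u w) x y = wtl \<chi> x * wtl \<chi> y * xr R g x y" for g x y
  proof (induction x arbitrary: g)
    case (Cons a x)
    have "xr R (\<lambda>u w. wtl \<chi> u * wtl \<chi> w * g u w) (a # x) y =
       xr R (\<lambda>u x'. ov R (\<lambda>u' a'. wtl \<chi> u' * \<chi> a' * (wtl \<chi> x' * g u' (a' # x'))) a u) x y"
      by (simp add: mult_ac)
    also have "\<dots> = xr R (\<lambda>u x'. \<chi> a * wtl \<chi> u * ov R (\<lambda>u' a'. wtl \<chi> x' * g u' (a' # x')) a u) x y"
      by (simp only: weight_ov[OF R])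
    also have "\<dots> = xr R (\<lambda>u x'. wtl \<chi> u * wtl \<chi> x' * (\<chi> a * ov R (\<lambda>u' a'. g u' (a' # x')) a u)) x y"
      by (subst fl2_scale_app[OF fl2_ov[OF R(2)]]) (simp add: mult_ac)
    also have "\<dots> = wtl \<chi> x * wtl \<chi> y * xr R (\<lambda>u x'. \<chi> a * ov R (\<lambda>u' a'. g u' (a' # x')) a u) x y"
      by (rule Cons.IH)
    also have "xr R (\<lambda>u x'. \<chi> a * ov R (\<lambda>u' a'. g u' (a' # x')) a u) x y = \<chi> a * xr R g (a # x) y"
      using fl2_scale_app[OF fl2_xr[OF R(2)], where f = "\<lambda>u x'. ov R (\<lambda>u' a'. g u' (a' # x')) a u"] by simp
    finally show ?case by (simp add: mult_ac)
  qed (simp add: mult_ac)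
  then show ?thesis by (simp add: weight_op_def)
qed

definition wts :: "('s \<Rightarrow> 'a::comm_ring_1) \<Rightarrow> 's list \<Rightarrow> 'a" where "wts \<chi> x = prod_list (map \<chi> x)"

lemma wts_simps [simp]: "wts \<chi> [] = 1" "wts \<chi> (a # x) = \<chi> a * wts \<chi> x"
  by (auto simp: wts_def)

lemma weight_act:
  assumes R: "weight_op \<chi> R" "\<And>f c x y. R (\<lambda>u v. c * f u v) x y = c * R f x y"
  shows "act R i (\<lambda>s. wts \<chi> s * f s) s = wts \<chi> s * act R i f s"
proof -
  have lin: "act R i (\<lambda>s. c * f s) s = c * act R i f s" for c f i s
  proof (induction i arbitrary: f s)
    case 0 then show ?case by (cases "(R, 0 :: nat, f, s)" rule: act.cases) (auto simp: R(2))
  next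
    case (Suc i) then show ?case by (cases s) auto
  qed
  show ?thesis
  proof (induction i arbitrary: f s)
    case 0
    show ?case
    proof (cases "\<exists>x y s'. s = x # y # s'")
      case True
      then obtain x y s' where s: "s = x # y # s'" by blast
      have "act R 0 (\<lambda>s. wts \<chi> s * f s) s = R (\<lambda>u v. \<chi> u * \<chi> v * (wts \<chi> s' * f (u # v # s'))) x y"
        by (simp add: s mult_ac)
      also have "\<dots> = \<chi> x * \<chi> y * R (\<lambda>u v. wts \<chi> s' * f (u # v # s')) x y"
        using R(1) by (simp add: weight_op_def)
      finally show ?thesis by (simp add: s R(2) mult_ac)
    next
      case False
      then have "act R 0 f s = f s" for f by (cases "(R, 0 :: nat, f, s)" rule: act.cases) auto
      then show ?thesis by simp
    qed
  next
    case (Suc i)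
    show ?case
    proof (cases s)
      case (Cons x s')
      have "act R i (\<lambda>s. wts \<chi> (x # s) * f (x # s)) s' = \<chi> x * act R i (\<lambda>s. wts \<chi> s * f (x # s)) s'"
        using lin[of i "\<chi> x" "\<lambda>s. wts \<chi> s * f (x # s)" s'] by (simp add: mult_ac)
      then show ?thesis using Suc.IH[of "\<lambda>s. f (x # s)" s'] by (simp add: Cons mult_ac)
    qed simp
  qed
qed

subsection \<open>The lowering operator\<close>

definition bq :: "'a::field \<Rightarrow> bool \<Rightarrow> 'a" where "bq q a = (if a then 1 / q else q)"

text \<open>A generator of quantum sl2 acting through the coproduct: one \<open>False\<close>
  becomes \<open>True\<close>, and each point to its left contributes the group-like weight
  \<open>bq\<close>.\<close>

fun low :: "'a::field \<Rightarrow> 'a strand_map" where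
  "low q f [] = 0"
| "low q f (a # x) = (if a then 0 else f (True # x)) + bq q a * low q (\<lambda>x. f (a # x)) x"

fun lows :: "'a::field \<Rightarrow> (bool list list \<Rightarrow> 'a) \<Rightarrow> bool list list \<Rightarrow> 'a" where
  "lows q f [] = 0"
| "lows q f (x # s) = low q (\<lambda>x. f (x # s)) x + wtl (bq q) x * lows q (\<lambda>s. f (x # s)) s"

lemma fl_low: "x \<in> blists n \<Longrightarrow> fl (blists n) (\<lambda>f. low q f x)"
proof (induction x arbitrary: n)
  case Nil then show ?case by (simp add: fl_zero)
next
  case (Cons a x)
  obtain m where n: "n = Suc m" "x \<in> blists m" using Cons.prems by (cases n) (auto simp: blists_def)
  have 1: "fl (blists n) (\<lambda>f. (\<lambda>g. low q g x) (\<lambda>x. f (a # x)))"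
    by (rule fl_image[where \<phi> = "\<lambda>g. low q g x", OF Cons.IH[OF n(2)]]) (auto, auto simp: blists_def n)
  have 2: "fl (blists n) (\<lambda>f. if a then 0 else f (True # x))"
    by (rule fl_if) (use n in \<open>auto intro!: fl_zero fl_eval, auto simp: blists_def\<close>)
  show ?case using fl_add[OF 2 fl_scale[OF 1]] by simp
qed

lemma fl_lows: "s \<in> shapes ls \<Longrightarrow> fl (shapes ls) (\<lambda>f. lows q f s)"
proof (induction s arbitrary: ls)
  case Nil then show ?case by (simp add: fl_zero)
next
  case (Cons x s)
  obtain l ls' where ls: "ls = l # ls'" "x \<in> blists l" "s \<in> shapes ls'" using Cons.prems by (auto simp: shapes_def blists_def)
  have 1: "fl (shapes ls) (\<lambda>f. (\<lambda>g. lows q g s) (\<lambda>s. f (x # s)))"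
    by (rule fl_image[where \<phi> = "\<lambda>g. lows q g s", OF Cons.IH[OF ls(3)]]) (use ls in \<open>auto simp: shapes_Cons\<close>)
  have 2: "fl (shapes ls) (\<lambda>f. (\<lambda>g. low q g x) (\<lambda>x. f (x # s)))"
    by (rule fl_image[where \<phi> = "\<lambda>g. low q g x", OF fl_low[OF ls(2)]]) (use ls in \<open>auto simp: shapes_Cons\<close>)
  show ?case using fl_add[OF 2 fl_scale[OF 1]] by simp
qed

text \<open>The crossing intertwines the coproduct on two points; all further commutation rules for
  the lowering operator come from this case.\<close>

lemma tw_low:
  assumes "q \<noteq> 0"
  shows "tw q (\<lambda>u v. (if u then 0 else g True v) + bq q u * (if v then 0 else g u True)) x y =
     (if x then 0 else tw q g True y) + bq q x * (if y then 0 else tw q g x True)"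
  using assms by (cases x; cases y) (auto simp: tw_def bq_def field_simps)

lemma act_low:
  assumes q: "q \<noteq> 0"
  shows "act (sig 1 q) i (low q f) s = low q (act (sig 1 q) i f) s"
proof (induction i arbitrary: f s)
  case 0
  let ?R = "sig 1 q"
  show ?case
  proof (cases "\<exists>x y s'. s = x # y # s'")
    case True
    then obtain x y s' where s: "s = x # y # s'" by blast
    have 1: "?R (\<lambda>u v. (if u then 0 else g True v) + bq q u * (if v then 0 else g u True)) x y =
       (if x then 0 else ?R g True y) + bq q x * (if y then 0 else ?R g x True)" for g
      using tw_low[OF q, of g x y] by (simp add: sig_def)
    have fll: "fl (blists (length s')) (\<lambda>f. low q f s')" by (rule fl_low) (simp add: blists_def)
    have 2: "?R (\<lambda>u v. bq q u * bq q v * low q (\<lambda>x. f (u # v # x)) s') x y = bq q x * bq q y * low q (\<lambda>z. ?R (\<lambda>u v. f (u # v # z)) x y) s'"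
      using weight_sig[of "bq q" 1 q] fl2_swap[OF lin2D[OF lin2_sig] fll, of 1 q "\<lambda>u v x. f (u # v # x)" x y]
      by (simp add: weight_op_def)
    have "act ?R 0 (low q f) s = ?R (\<lambda>u v. ((if u then 0 else f (True # v # s')) + bq q u * (if v then 0 else f (u # True # s')))
        + bq q u * bq q v * low q (\<lambda>x. f (u # v # x)) s') x y"
      by (simp add: s algebra_simps)
    also have "\<dots> = ?R (\<lambda>u v. ((if u then 0 else f (True # v # s')) + bq q u * (if v then 0 else f (u # True # s')))) x y
       + ?R (\<lambda>u v. bq q u * bq q v * low q (\<lambda>x. f (u # v # x)) s') x y"
      by (rule fl2_add_app[OF lin2D[OF lin2_sig]])
    finally show ?thesis
      using 1[of "\<lambda>u v. f (u # v # s')"] 2 by (simp add: s algebra_simps)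
  next
    case False
    then have e: "act ?R 0 f s = f s" for f by (cases "(?R, 0 :: nat, f, s)" rule: act.cases) auto
    have "low q (act ?R 0 f) s = low q f s"
    proof (cases s)
      case (Cons x s')
      with False have "s = [x]" by (cases s') auto
      then show ?thesis by simp
    qed simp
    then show ?thesis by (simp add: e)
  qed
next
  case (Suc i)
  let ?R = "sig 1 q"
  show ?case
  proof (cases s)
    case (Cons x s')
    have fa: "fl (blists (length s')) (\<lambda>f. act ?R i f s')" by (rule fl_act_bool[OF lin2_sig]) (simp add: blists_def)
    have "act ?R (Suc i) (low q f) s = act ?R i (\<lambda>s. (if x then 0 else f (True # s)) + bq q x * low q (\<lambda>s. f (x # s)) s) s'"
      by (simp add: Cons)
    also have "\<dots> = act ?R i (\<lambda>s. if x then 0 else f (True # s)) s' + bq q x * act ?R i (low q (\<lambda>s. f (x # s))) s'"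
      using fl_add_app[OF fa, of "\<lambda>s. if x then 0 else f (True # s)" "\<lambda>s. bq q x * low q (\<lambda>s. f (x # s)) s"]
        fl_scale_app[OF fa, of "bq q x" "low q (\<lambda>s. f (x # s))"] by simp
    also have "act ?R i (\<lambda>s. if x then 0 else f (True # s)) s' = (if x then 0 else act ?R i (\<lambda>s. f (True # s)) s')"
      using fl_zero_app[OF fa] by simp
    finally show ?thesis by (simp add: Cons Suc.IH)
  qed simp
qed

lemma actw_low:
  assumes q: "q \<noteq> 0"
  shows "actw (sig 1 q) Q (pos w) (low q f) s = low q (actw (sig 1 q) Q (pos w) f) s"
proof (induction w arbitrary: s)
  case (Cons i w)
  have "actw (sig 1 q) Q (pos w) (low q f) = low q (actw (sig 1 q) Q (pos w) f)" by (rule ext) (rule Cons)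
  then show ?case by (simp add: pos_def act_low[OF q])
qed (simp add: pos_def)

lemma low_append: "low q f (x @ y) = low q (\<lambda>x. f (x @ y)) x + wtl (bq q) x * low q (\<lambda>y. f (x @ y)) y"
  by (induction x arbitrary: f) (auto simp: algebra_simps)

text \<open>Two cables are read as one concatenated word, on which the crossing is a word of
  elementary crossings by \<open>actw_xr\<close>.\<close>

lemma xr_low:
  assumes q: "q \<noteq> 0"
  shows "xr (sig 1 q) (\<lambda>u w. low q (\<lambda>u. g u w) u + wtl (bq q) u * low q (g u) w) x y =
    low q (\<lambda>x. xr (sig 1 q) g x y) x + wtl (bq q) x * low q (xr (sig 1 q) g x) y"
proof -
  define f where "f z = g (take (length y) z) (drop (length y) z)" for z
  let ?W = "actw (sig 1 q) (sig 1 q) (pos (wd (length x) (length y)))" and ?X = "xr (sig 1 q)"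
  have W: "?W h (x' @ y') = ?X (\<lambda>u w. h (u @ w)) x' y'" if "length x' = length x" "length y' = length y" for h x' y'
    using actw_xr[OF lin2_sig, of 1 q "sig 1 q" x' y' h "[]"] that by simp
  have Wf: "?W f (x' @ y') = ?X g x' y'" if l: "length x' = length x" "length y' = length y" for x' y'
    unfolding W[OF l] by (rule fl2_cong[OF fl2_xr[OF lin2_sig]]) (use l in \<open>simp add: f_def blists_def\<close>)
  have "?X (\<lambda>u w. low q (\<lambda>u. g u w) u + wtl (bq q) u * low q (g u) w) x y = ?X (\<lambda>u w. low q f (u @ w)) x y"
  proof (rule fl2_cong[OF fl2_xr[OF lin2_sig]])
    fix u w assume u: "u \<in> blists (length y)" "w \<in> blists (length x)"
    have "low q (\<lambda>u. f (u @ w)) u = low q (\<lambda>u. g u w) u"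
      by (rule fl_cong[OF fl_low[OF u(1)]]) (simp add: f_def blists_def)
    moreover have "low q (\<lambda>w. f (u @ w)) w = low q (g u) w"
      by (rule fl_cong[OF fl_low[OF u(2)]]) (use u in \<open>simp add: f_def blists_def\<close>)
    ultimately show "low q (\<lambda>u. g u w) u + wtl (bq q) u * low q (g u) w = low q f (u @ w)"
      by (simp add: low_append)
  qed
  also have "\<dots> = ?W (low q f) (x @ y)" by (simp add: W)
  also have "\<dots> = low q (?W f) (x @ y)" by (rule actw_low[OF q])
  also have "\<dots> = low q (\<lambda>x. ?W f (x @ y)) x + wtl (bq q) x * low q (\<lambda>y. ?W f (x @ y)) y" by (rule low_append)
  also have "low q (\<lambda>x. ?W f (x @ y)) x = low q (\<lambda>x. ?X g x y) x"
    by (rule fl_cong[OF fl_low[of x "length x"]]) (auto simp: blists_def Wf)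
  also have "low q (\<lambda>y. ?W f (x @ y)) y = low q (?X g x) y"
    by (rule fl_cong[OF fl_low[of y "length y"]]) (auto simp: blists_def Wf)
  finally show ?thesis .
qed

lemma act_lows:
  assumes q: "q \<noteq> 0"
  shows "act (xr (sig 1 q)) i (lows q f) s = lows q (act (xr (sig 1 q)) i f) s"
proof (induction i arbitrary: f s)
  case 0
  let ?R = "xr (sig 1 q)"
  show ?case
  proof (cases "\<exists>x y s'. s = x # y # s'")
    case True
    then obtain x y s' where s: "s = x # y # s'" by blast
    let ?b = "wtl (bq q)"
    have fll: "fl (shapes (map length s')) (\<lambda>f. lows q f s')" by (rule fl_lows) (simp add: shapes_def)
    have 2: "?R (\<lambda>u v. ?b u * ?b v * lows q (\<lambda>x. f (u # v # x)) s') x y = ?b x * ?b y * lows q (\<lambda>z. ?R (\<lambda>u v. f (u # v # z)) x y) s'"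
      using weight_xr[OF weight_sig lin2_sig, of "bq q" 1 q] fl2_swap[OF fl2_xr[OF lin2_sig] fll, of 1 q "\<lambda>u v x. f (u # v # x)" x y]
      by (simp add: weight_op_def)
    have "act ?R 0 (lows q f) s = ?R (\<lambda>u v. (low q (\<lambda>u. f (u # v # s')) u + ?b u * low q (\<lambda>v. f (u # v # s')) v)
        + ?b u * ?b v * lows q (\<lambda>x. f (u # v # x)) s') x y"
      by (simp add: s algebra_simps)
    also have "\<dots> = ?R (\<lambda>u v. (low q (\<lambda>u. f (u # v # s')) u + ?b u * low q (\<lambda>v. f (u # v # s')) v)) x y
       + ?R (\<lambda>u v. ?b u * ?b v * lows q (\<lambda>x. f (u # v # x)) s') x y"
      by (rule fl2_add_app[OF fl2_xr[OF lin2_sig]])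
    finally show ?thesis
      using xr_low[OF q, of "\<lambda>u v. f (u # v # s')"] 2 by (simp add: s algebra_simps)
  next
    case False
    then have e: "act ?R 0 f s = f s" for f by (cases "(?R, 0 :: nat, f, s)" rule: act.cases) auto
    have "lows q (act ?R 0 f) s = lows q f s"
    proof (cases s)
      case (Cons x s')
      with False have "s = [x]" by (cases s') auto
      then show ?thesis by simp
    qed simp
    then show ?thesis by (simp add: e)
  qed
next
  case (Suc i)
  let ?R = "xr (sig 1 q)"
  show ?case
  proof (cases s)
    case (Cons x s')
    have fa: "fl (shapes (swp i (map length s'))) (\<lambda>f. act ?R i f s')"
      by (rule fl_act_strand[OF strand_op_xr[OF lin2_sig]]) (simp add: shapes_def)
    have fx: "fl (blists (length x)) (\<lambda>f. low q f x)" by (rule fl_low) (simp add: blists_def)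
    have "act ?R (Suc i) (lows q f) s = act ?R i (\<lambda>s. low q (\<lambda>x. f (x # s)) x + wtl (bq q) x * lows q (\<lambda>s. f (x # s)) s) s'"
      by (simp add: Cons)
    also have "\<dots> = act ?R i (\<lambda>s. low q (\<lambda>x. f (x # s)) x) s' + wtl (bq q) x * act ?R i (lows q (\<lambda>s. f (x # s))) s'"
      using fl_add_app[OF fa, of "\<lambda>s. low q (\<lambda>x. f (x # s)) x" "\<lambda>s. wtl (bq q) x * lows q (\<lambda>s. f (x # s)) s"]
        fl_scale_app[OF fa, of "wtl (bq q) x" "lows q (\<lambda>s. f (x # s))"] by simp
    also have "act ?R i (\<lambda>s. low q (\<lambda>x. f (x # s)) x) s' = low q (\<lambda>x. act ?R i (\<lambda>s. f (x # s)) s') x"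
      by (rule fl_swap[OF fa fx])
    finally show ?thesis by (simp add: Cons Suc.IH)
  qed simp
qed

lemma actw_lows:
  assumes q: "q \<noteq> 0"
  shows "actw (xr (sig 1 q)) Q (pos w) (lows q f) s = lows q (actw (xr (sig 1 q)) Q (pos w) f) s"
proof (induction w arbitrary: s)
  case (Cons i w)
  have "actw (xr (sig 1 q)) Q (pos w) (lows q f) = lows q (actw (xr (sig 1 q)) Q (pos w) f)" by (rule ext) (rule Cons)
  then show ?case by (simp add: pos_def act_lows[OF q])
qed (simp add: pos_def)

section \<open>Opening one strand\<close>

definition ST :: "nat \<Rightarrow> nat \<Rightarrow> bool list list set" where "ST N n = shapes (replicate n N)"

definition symp :: "'a::field \<Rightarrow> nat \<Rightarrow> nat \<Rightarrow> (bool list list \<Rightarrow> 'a) \<Rightarrow> bool list list \<Rightarrow> 'a" where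
  "symp q N n = tens (replicate n (symz q N))"

lemma finite_ST [simp]: "finite (ST N n)" by (simp add: ST_def)

lemma ST_Cons: "x # s \<in> ST N (Suc n) \<longleftrightarrow> x \<in> blists N \<and> s \<in> ST N n"
  by (auto simp: ST_def shapes_Cons)

lemma ST_Suc: "ST N (Suc n) = (\<lambda>(x, s). x # s) ` (blists N \<times> ST N n)"
  by (simp add: ST_def shapes_Cons)

lemma ST_0 [simp]: "ST N 0 = {[]}" by (simp add: ST_def)

lemma sum_ST_Suc: "(\<Sum>s\<in>ST N (Suc n). F s) = (\<Sum>x\<in>blists N. \<Sum>s\<in>ST N n. F (x # s))"
  by (simp add: ST_def sum_shapes_Cons)

lemma st_st [simp]: "st (st x) = st x" by (rule st_cong) simp_all

lemma map_st_ST: "s \<in> ST N n \<Longrightarrow> map st s \<in> ST N n"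
proof -
  have "map length (map st s) = map length s" by (induction s) auto
  then show "s \<in> ST N n \<Longrightarrow> map st s \<in> ST N n" unfolding ST_def shapes_def by simp
qed

lemma symz_full: "x \<in> blists N \<Longrightarrow> symz q N f x = q ^ iv x * f (st x)"
  by (simp add: symz_def blists_def)

lemma symp_explicit: "s \<in> ST N n \<Longrightarrow> symp q N n f s = q ^ sum_list (map iv s) * f (map st s)"
proof (induction n arbitrary: s f)
  case 0 then show ?case by (simp add: symp_def)
next
  case (Suc n)
  then obtain x s' where s: "s = x # s'" "x \<in> blists N" "s' \<in> ST N n" by (auto simp: ST_Suc)
  have "symp q N (Suc n) f s = symz q N (\<lambda>x. symp q N n (\<lambda>s. f (x # s)) s') x" by (simp add: symp_def s)
  also have "\<dots> = q ^ iv x * (q ^ sum_list (map iv s') * f (st x # map st s'))"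
    unfolding symz_full[OF s(2)] Suc.IH[OF s(3)] ..
  finally show ?case by (simp add: s power_add mult_ac)
qed

lemma iv_comp_st [simp]: "iv \<circ> st = (\<lambda>_. 0)" by auto
lemma st_comp_st [simp]: "st \<circ> st = st" by auto

lemma wtl_ones: "wtl \<chi> x = \<chi> True ^ ones x * \<chi> False ^ (length x - ones x)"
proof (induction x)
  case (Cons a x) then show ?case using ones_le[of x] by (auto simp: Suc_diff_le)
qed simp

lemma wtl_st [simp]: "wtl \<chi> (st x) = wtl \<chi> x" by (simp only: wtl_ones ones_st length_st)

lemma kapl_wtl: "kapl q = wtl (kp q)" by (auto simp: kapl_def wtl_def)
text \<open>The \<open>N + 1\<close> sorted words; the values at them are the coordinates on the
  symmetric power.\<close>

definition xk :: "nat \<Rightarrow> nat \<Rightarrow> bool list" where "xk N k = replicate k True @ replicate (N - k) False"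

lemma st_xk: "x \<in> blists N \<Longrightarrow> st x = xk N (ones x)" by (simp add: st_def xk_def blists_def)

lemma ones_xk [simp]: "ones (xk N k) = k" by (simp add: xk_def)
lemma iv_xk [simp]: "iv (xk N k) = 0" by (simp add: xk_def iv_append)
lemma xk_blists: "k \<le> N \<Longrightarrow> xk N k \<in> blists N" by (simp add: xk_def blists_def)
lemma st_xk' [simp]: "k \<le> N \<Longrightarrow> st (xk N k) = xk N k" by (metis st_xk xk_blists ones_xk)
lemma xk_inj: "xk N k = xk N l \<longleftrightarrow> k = l" by (metis ones_xk)

section \<open>Functions killed by all caps, and the lowering operator on them\<close>

definition sym_fun :: "'a::field \<Rightarrow> nat \<Rightarrow> (bool list \<Rightarrow> 'a) \<Rightarrow> bool" where
  "sym_fun q N u \<longleftrightarrow> (\<forall>x\<in>blists N. u x = q ^ iv x * u (st x))"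

text \<open>The quantum integer of \<open>N - k\<close> up to a power of \<open>q\<close>: the
  matrix coefficient of the lowering operator between neighbouring weights.\<close>

definition cfac :: "'a::field \<Rightarrow> nat \<Rightarrow> nat \<Rightarrow> 'a" where
  "cfac q N k = (1 / q) ^ k * (\<Sum>j<N - k. q ^ j * q ^ j)"

lemma low_ones: "low q f (replicate k True) = 0"
  by (induction k arbitrary: f) auto

lemma low_zeros: "low q g (replicate r False) = (\<Sum>j<r. q ^ j * g (replicate j False @ True # replicate (r - Suc j) False))"
proof (induction r arbitrary: g)
  case (Suc r)
  show ?case unfolding sum.lessThan_Suc_shift
    by (simp add: Suc.IH bq_def sum_distrib_left mult_ac)
qed simp

text \<open>A \<open>True\<close> placed behind \<open>j\<close> entries \<open>False\<close> costs
  \<open>q ^ j\<close> from the weights \<open>bq\<close> and another \<open>q ^ j\<close> from its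
  inversions.\<close>

lemma low_sorted:
  assumes u: "sym_fun q N u" and k: "k < N"
  shows "low q u (xk N k) = cfac q N k * u (xk N (Suc k))"
proof -
  have "low q u (xk N k) = (1 / q) ^ k * low q (\<lambda>z. u (replicate k True @ z)) (replicate (N - k) False)"
    unfolding xk_def low_append by (simp add: low_ones wtl_ones bq_def)
  also have "low q (\<lambda>z. u (replicate k True @ z)) (replicate (N - k) False) = (\<Sum>j<N - k. q ^ j * q ^ j) * u (xk N (Suc k))"
    unfolding low_zeros sum_distrib_right
  proof (rule sum.cong[OF HOL.refl])
    fix j assume j: "j \<in> {..<N - k}"
    let ?x = "replicate k True @ replicate j False @ True # replicate (N - k - Suc j) False"
    have x: "?x \<in> blists N" using j k by (simp add: blists_def)
    have "ones ?x = Suc k" "iv ?x = j" using j by (simp_all add: iv_append)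
    then have "u ?x = q ^ j * u (xk N (Suc k))" using u x st_xk[OF x] by (simp add: sym_fun_def)
    then show "q ^ j * u ?x = q ^ j * q ^ j * u (xk N (Suc k))" by (simp add: mult_ac)
  qed
  finally show ?thesis by (simp add: cfac_def)
qed

text \<open>With factor 1 the crossing is the identity plus a multiple of a cup after the cap. So to
  be fixed by it and to be killed by the cap are the same; \<open>cap_zero_act\<close> is the
  converse.\<close>

lemma act_fixed_cap:
  "(\<And>z. length z = Suc (Suc (length x)) \<Longrightarrow> act (sig 1 q) i f z = f z) \<Longrightarrow> Suc i < Suc (Suc (length x)) \<Longrightarrow> cap q i f x = 0"
proof (induction i arbitrary: f x)
  case 0
  from 0(1)[of "False # True # x"] show ?case by (simp add: sig_def tw_def)
next
  case (Suc i)
  then obtain a x' where x: "x = a # x'" by (cases x) auto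
  have "cap q i (\<lambda>x. f (a # x)) x' = 0"
  proof (rule Suc.IH)
    fix z :: "bool list" assume "length z = Suc (Suc (length x'))"
    then show "act (sig 1 q) i (\<lambda>x. f (a # x)) z = f (a # z)" using Suc.prems(1)[of "a # z"] x by simp
  qed (use Suc.prems x in simp)
  then show ?case by (simp add: x)
qed

lemma cap_zero_act:
  "(\<And>x. Suc (Suc (length x)) = length z \<Longrightarrow> cap q i f x = 0) \<Longrightarrow> act (sig 1 q) i f z = f z"
proof (induction i arbitrary: f z)
  case 0
  show ?case
  proof (cases "\<exists>x y s'. z = x # y # s'")
    case True
    then obtain x y s' where s: "z = x # y # s'" by blast
    have "f (False # True # s') = q * f (True # False # s')" using 0[of s'] s by simp
    then show ?thesis by (simp add: s sig_def tw_def algebra_simps)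
  next
    case False
    then show ?thesis by (cases "(sig 1 q, 0 :: nat, f, z)" rule: act.cases) auto
  qed
next
  case (Suc i)
  show ?case
  proof (cases z)
    case (Cons a z')
    have "act (sig 1 q) i (\<lambda>x. f (a # x)) z' = f (a # z')"
    proof (rule Suc.IH)
      fix x :: "bool list" assume "Suc (Suc (length x)) = length z'"
      then show "cap q i (\<lambda>x. f (a # x)) x = 0" using Suc.prems[of "a # x"] Cons by simp
    qed
    then show ?thesis by (simp add: Cons)
  qed simp
qed

lemma sym_fun_cap:
  assumes u: "sym_fun q N u" "Suc i < N" "Suc (Suc (length x)) = N"
  shows "cap q i u x = 0"
proof -
  have x: "x \<in> blists (N - 2)" using assms by (auto simp: blists_def)
  have "cap q i u x = cap q i (symz q N u) x"
    by (rule fl_cong[OF fl_cap[OF x]]) (use u in \<open>auto simp: sym_fun_def symz_full\<close>)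
  also have "\<dots> = 0" by (rule cap_sym) (use assms in auto)
  finally show ?thesis .
qed

lemma cap_sym_fun:
  assumes "\<And>i x. Suc i < N \<Longrightarrow> Suc (Suc (length x)) = N \<Longrightarrow> cap q i u x = 0"
  shows "sym_fun q N u"
  unfolding sym_fun_def
proof
  fix x assume x: "x \<in> blists N"
  have "symz q N u x = u x" by (rule sym_fixed) (use assms x in \<open>auto simp: blists_def\<close>)
  then show "u x = q ^ iv x * u (st x)" using x by (simp add: symz_full)
qed

text \<open>Being killed by caps is being fixed by crossings, and the lowering operator commutes
  with crossings.\<close>

lemma sym_fun_low:
  assumes q: "q \<noteq> 0" and u: "sym_fun q N u" shows "sym_fun q N (low q u)"
proof (rule cap_sym_fun)
  fix i and x :: "bool list" assume i: "Suc i < N" "Suc (Suc (length x)) = N"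
  show "cap q i (low q u) x = 0"
  proof (rule act_fixed_cap)
    fix z :: "bool list" assume z: "length z = Suc (Suc (length x))"
    have "act (sig 1 q) i (low q u) z = low q (act (sig 1 q) i u) z" by (rule act_low[OF q])
    also have "\<dots> = low q u z"
    proof (rule fl_cong[OF fl_low])
      show "z \<in> blists N" using z i by (simp add: blists_def)
      fix y assume "y \<in> blists N"
      then show "act (sig 1 q) i u y = u y"
        by (intro cap_zero_act sym_fun_cap[OF u]) (use i in \<open>auto simp: blists_def\<close>)
    qed
    finally show "act (sig 1 q) i (low q u) z = low q u z" .
  qed (use i in simp)
qed

definition symp_fun :: "'a::field \<Rightarrow> nat \<Rightarrow> nat \<Rightarrow> (bool list list \<Rightarrow> 'a) \<Rightarrow> bool" where
  "symp_fun q N n f \<longleftrightarrow> (\<forall>s\<in>ST N n. f s = q ^ sum_list (map iv s) * f (map st s))"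

lemma symp_funD: "symp_fun q N n f \<Longrightarrow> s \<in> ST N n \<Longrightarrow> f s = q ^ sum_list (map iv s) * f (map st s)"
  by (simp add: symp_fun_def)

lemma symp_fun_symp: "symp_fun q N n (symp q N n f)"
  unfolding symp_fun_def by (auto simp: symp_explicit map_st_ST)

lemma symp_fixed: "symp_fun q N n f \<Longrightarrow> s \<in> ST N n \<Longrightarrow> symp q N n f s = f s"
  by (simp add: symp_explicit symp_fun_def)

lemma symp_fun_fixed: "(\<And>s. s \<in> ST N n \<Longrightarrow> symp q N n f s = f s) \<Longrightarrow> symp_fun q N n f"
  by (simp add: symp_explicit symp_fun_def)

lemma symp_fun_Cons:
  assumes f: "symp_fun q N (Suc n) f"
  shows "s \<in> ST N n \<Longrightarrow> sym_fun q N (\<lambda>x. f (x # s))" "x \<in> blists N \<Longrightarrow> symp_fun q N n (\<lambda>s. f (x # s))"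
proof -
  { fix x s assume xs: "x \<in> blists N" "s \<in> ST N n"
    have "f (x # s) = q ^ iv x * (q ^ sum_list (map iv s) * f (st x # map st s))"
      using symp_funD[OF f, of "x # s"] xs by (simp add: ST_Cons power_add mult_ac)
    moreover have "f (st x # s) = q ^ sum_list (map iv s) * f (st x # map st s)"
      using symp_funD[OF f, of "st x # s"] xs by (simp add: ST_Cons blists_def)
    moreover have "f (x # map st s) = q ^ iv x * f (st x # map st s)"
      using symp_funD[OF f, of "x # map st s"] xs by (simp add: ST_Cons map_st_ST comp_def)
    ultimately have "f (x # s) = q ^ iv x * f (st x # s)" "f (x # s) = q ^ sum_list (map iv s) * f (x # map st s)"
      by (simp_all add: mult_ac) }
  then show "s \<in> ST N n \<Longrightarrow> sym_fun q N (\<lambda>x. f (x # s))" "x \<in> blists N \<Longrightarrow> symp_fun q N n (\<lambda>s. f (x # s))"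
    by (auto simp: sym_fun_def symp_fun_def)
qed

lemma symp_fun_lows:
  assumes q: "q \<noteq> 0"
  shows "symp_fun q N n f \<Longrightarrow> symp_fun q N n (lows q f)"
proof (induction n arbitrary: f)
  case 0 then show ?case by (simp add: symp_fun_def)
next
  case (Suc n)
  show ?case unfolding symp_fun_def
  proof
    fix s assume "s \<in> ST N (Suc n)"
    then obtain x s' where s: "s = x # s'" "x \<in> blists N" "s' \<in> ST N n" by (auto simp: ST_Suc)
    have sx: "st x \<in> blists N" using s by (simp add: blists_def)
    have "low q (\<lambda>x. f (x # s')) x = q ^ iv x * low q (\<lambda>x. f (x # s')) (st x)"
      using sym_fun_low[OF q symp_fun_Cons(1)[OF Suc.prems s(3)]] s(2) by (simp add: sym_fun_def)
    also have "low q (\<lambda>x. f (x # s')) (st x) = low q (\<lambda>x. q ^ sum_list (map iv s') * f (x # map st s')) (st x)"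
      by (rule fl_cong[OF fl_low[OF sx]]) (rule symp_funD[OF symp_fun_Cons(2)[OF Suc.prems] s(3)])
    also have "\<dots> = q ^ sum_list (map iv s') * low q (\<lambda>x. f (x # map st s')) (st x)"
      by (rule fl_scale_app[OF fl_low[OF sx]])
    finally have 1: "low q (\<lambda>x. f (x # s')) x = q ^ sum_list (map iv s) * low q (\<lambda>x. f (x # map st s')) (st x)"
      by (simp add: s power_add mult_ac)
    have "lows q (\<lambda>s. f (x # s)) s' = q ^ sum_list (map iv s') * lows q (\<lambda>s. f (x # s)) (map st s')"
      by (rule symp_funD[OF Suc.IH[OF symp_fun_Cons(2)[OF Suc.prems s(2)]] s(3)])
    also have "lows q (\<lambda>s. f (x # s)) (map st s') = lows q (\<lambda>s. q ^ iv x * f (st x # s)) (map st s')"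
      by (rule fl_cong[OF fl_lows])
         (use map_st_ST[OF s(3)] symp_fun_Cons(1)[OF Suc.prems] s(2) in \<open>auto simp: ST_def sym_fun_def\<close>)
    also have "\<dots> = q ^ iv x * lows q (\<lambda>s. f (st x # s)) (map st s')"
      by (rule fl_scale_app[OF fl_lows]) (use map_st_ST[OF s(3)] in \<open>auto simp: ST_def\<close>)
    finally have 2: "lows q (\<lambda>s. f (x # s)) s' = q ^ sum_list (map iv s) * lows q (\<lambda>s. f (st x # s)) (map st s')"
      by (simp add: s power_add mult_ac)
    show "lows q f s = q ^ sum_list (map iv s) * lows q f (map st s)"
      using 1 2 by (simp add: s algebra_simps)
  qed
qed

section \<open>Closing all strands but one: a form of Schur's lemma\<close>

context
  fixes q :: "'a::field" and N n :: nat and v :: "nat list" and Q :: "(bool list, 'a) pair_op"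
  assumes q: "q \<noteq> 0" and Q: "strand_op Q"
begin

definition bop :: "(bool list list \<Rightarrow> 'a) \<Rightarrow> bool list list \<Rightarrow> 'a" where
  "bop = actw (xr (sig 1 q)) Q (pos v)"

lemma swps_replicate [simp]: "swps u (replicate m y) = replicate m y"
proof -
  have "swps u (replicate m y) = replicate (length (swps u (replicate m y))) y"
    by (rule replicate_eqI) (auto simp flip: set_mset_mset split: if_splits)
  then show ?thesis by simp
qed

lemma fl_bop: "s \<in> ST N m \<Longrightarrow> fl (ST N m) (\<lambda>f. bop f s)"
proof -
  assume "s \<in> ST N m"
  then have "fl (shapes (swps (pos v) (replicate m N))) (\<lambda>f. bop f s)"
    unfolding bop_def by (intro fl_actw_strand[OF strand_op_xr[OF lin2_sig] Q]) (simp add: ST_def)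
  then show ?thesis by (simp add: ST_def)
qed

text \<open>With factor 1 the crossing is natural only up to powers of \<open>q\<close>, so
  \<open>preserves_symz\<close> does not apply; but such scalars do not disturb the vanishing of
  caps.\<close>

lemma xr_preserves: "preserves (\<lambda>_. N) (\<lambda>_. symz q N) (xr (sig 1 q)) {()}"
  unfolding preserves_def
proof (intro ballI allI)
  fix c d :: unit and g and x y :: "bool list"
  assume xy: "x \<in> blists N" "y \<in> blists N"
  let ?P = "symz q N" and ?X = "xr (sig 1 q)"
  let ?h = "\<lambda>u w. ?P (\<lambda>u. ?P (g u) w) u"
  note flX = fl2_xr[OF lin2_sig]
  have h': "?h u w = ?P (\<lambda>w. ?P (\<lambda>u. g u w) u) w" for u w by (simp add: symz_def)
  have 1: "?P (?X ?h x) y = ?X ?h x y" if "x \<in> blists N" "y \<in> blists N" for x y :: "bool list"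
  proof (rule sym_fixed)
    show "N \<le> length y" using that by (auto simp: blists_def)
    fix i and y' :: "bool list" assume i: "Suc i < N" "Suc (Suc (length y')) = length y"
    have "?X (\<lambda>u w. cap q i (\<lambda>u. ?h u w) u) x y' = ?X (\<lambda>u w. 0) x y'"
      by (rule fl2_cong[OF flX], rule cap_sym[OF i(1)]) (use i that in \<open>auto simp: blists_def\<close>)
    also have "\<dots> = 0" by (rule fl2_zero_app[OF flX])
    finally show "cap q i (?X ?h x) y' = 0" by (simp add: cap_xr_under)
  qed
  have 2: "?P (\<lambda>x. ?X ?h x y) x = ?X ?h x y"
  proof (rule sym_fixed)
    show "N \<le> length x" using xy by (auto simp: blists_def)
    fix i and x' :: "bool list" assume i: "Suc i < N" "Suc (Suc (length x')) = length x"
    have "?X (\<lambda>u w. cap q i (?h u) w) x' y = ?X (\<lambda>u w. 0) x' y"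
      unfolding h'
      by (rule fl2_cong[OF flX], rule cap_sym[OF i(1)]) (use i xy in \<open>auto simp: blists_def\<close>)
    also have "\<dots> = 0" by (rule fl2_zero_app[OF flX])
    finally show "cap q i (\<lambda>x. ?X ?h x y) x' = 0" by (simp add: cap_xr_over)
  qed
  have "fl (blists N) (\<lambda>f. ?P f x)" using maps_to_sym xy(1) by (rule maps_toD)
  then have "?P (\<lambda>x. ?P (?X ?h x) y) x = ?P (\<lambda>x. ?X ?h x y) x"
    by (rule fl_cong) (use 1 xy in auto)
  then show "?P (\<lambda>x. ?P (\<lambda>y. ?X ?h x y) y) x = ?X ?h x y" using 2 by simp
qed

text \<open>All cables have the same length and the same projection, so the unit type serves as the
  type of labels.\<close>

lemma act_symp_fun:
  assumes "symp_fun q N m f" shows "symp_fun q N m (act (xr (sig 1 q)) i f)"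
proof (rule symp_fun_fixed)
  fix s assume s: "s \<in> ST N m"
  have s': "s \<in> shapes (map (\<lambda>_. N) (replicate m ()))" using s by (simp add: ST_def)
  have sw: "swp i (replicate m y) = replicate m y" for y :: 'b and m
    using swps_replicate[of "[(i, True)]" m y] by (simp only: swps.simps)
  have fX: "fl (ST N m) (\<lambda>f. act (xr (sig 1 q)) i f s)" if "s \<in> ST N m" for s
  proof -
    have "fl (shapes (swp i (replicate m N))) (\<lambda>f. act (xr (sig 1 q)) i f s)"
      by (rule fl_act_strand[OF strand_op_xr[OF lin2_sig]]) (use that in \<open>simp add: ST_def\<close>)
    then show ?thesis by (simp add: ST_def sw)
  qed
  have fs: "fl (ST N m) (\<lambda>f. symp q N m f s)"
    using fl_tens[of "replicate m ()" "\<lambda>_. N" "\<lambda>_. N" "\<lambda>_. symz q N" s] s' by (simp add: ST_def symp_def maps_to_sym)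
  have e: "act (xr (sig 1 q)) i (symp q N m f) s = act (xr (sig 1 q)) i f s" if "s \<in> ST N m" for s
    by (rule fl_cong[OF fX[OF that]]) (rule symp_fixed[OF assms])
  have "symp q N m (act (xr (sig 1 q)) i f) s = symp q N m (act (xr (sig 1 q)) i (symp q N m f)) s"
    by (rule fl_cong[OF fs]) (simp add: e)
  also have "\<dots> = act (xr (sig 1 q)) i (symp q N m f) s"
  proof -
    have "tens (map (\<lambda>_. symz q N) (replicate m ())) (act (xr (sig 1 q)) i (tens (map (\<lambda>_. symz q N) (swp i (replicate m ()))) f)) s =
      act (xr (sig 1 q)) i (tens (map (\<lambda>_. symz q N) (swp i (replicate m ()))) f) s"
    proof (rule act_tens_proj[OF strand_op_xr[OF lin2_sig], where \<alpha> = "\<lambda>_. N"])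
      show "preserves (\<lambda>_. N) (\<lambda>_. symz q N) (xr (sig 1 q)) (set (replicate m ()))"
        using xr_preserves by (auto simp: preserves_def)
    qed (use s' in \<open>auto simp: maps_to_sym blists_def intro!: sym_sym\<close>)
    then show ?thesis by (simp add: sw symp_def)
  qed
  finally show "symp q N m (act (xr (sig 1 q)) i f) s = act (xr (sig 1 q)) i f s" by (simp add: e[OF s])
qed

lemma bop_symp_fun:
  assumes "symp_fun q N m f" shows "symp_fun q N m (bop f)"
  unfolding bop_def
proof (induction v)
  case Nil then show ?case using assms by (simp add: pos_def)
next
  case (Cons i v) then show ?case by (simp add: pos_def act_symp_fun)
qed

definition mop :: "(bool list list \<Rightarrow> 'a) \<Rightarrow> bool list list \<Rightarrow> 'a" where
  "mop f = bop (symp q N (Suc n) f)"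

text \<open>\<open>emb\<close> and \<open>Mk\<close> cut an operator into blocks indexed by the
  weight of the first cable.\<close>

definition emb :: "nat \<Rightarrow> (bool list list \<Rightarrow> 'a) \<Rightarrow> bool list list \<Rightarrow> 'a" where
  "emb k h = (\<lambda>s. if hd s = xk N k then h (tl s) else 0)"

definition Mk :: "nat \<Rightarrow> nat \<Rightarrow> (bool list list \<Rightarrow> 'a) \<Rightarrow> bool list list \<Rightarrow> 'a" where
  "Mk k l h Y = mop (emb l h) (xk N k # Y)"

text \<open>The projection inside \<open>mop\<close> reads its argument at sorted cables
  only.\<close>

lemma mop_cong:
  assumes "\<And>k Y. k \<le> N \<Longrightarrow> Y \<in> ST N n \<Longrightarrow> f (xk N k # map st Y) = g (xk N k # map st Y)" and s: "s \<in> ST N (Suc n)"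
  shows "mop f s = mop g s"
  unfolding mop_def
proof (rule fl_cong[OF fl_bop[OF s]])
  fix s' assume s': "s' \<in> ST N (Suc n)"
  then obtain x Y where xY: "s' = x # Y" "x \<in> blists N" "Y \<in> ST N n" by (auto simp: ST_Suc)
  have "ones x \<le> N" using ones_le[of x] xY by (simp add: blists_def)
  then show "symp q N (Suc n) f s' = symp q N (Suc n) g s'"
    using assms(1) xY s' by (simp add: symp_explicit st_xk)
qed

lemma symp_fun_mop: "symp_fun q N (Suc n) (mop f)"
  unfolding mop_def by (rule bop_symp_fun[OF symp_fun_symp])

lemma fl_mop: "s \<in> ST N (Suc n) \<Longrightarrow> fl (ST N (Suc n)) (\<lambda>f. mop f s)"
  unfolding mop_def
proof (rule fl_comp[OF fl_bop])
  fix s assume s: "s \<in> ST N (Suc n)"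
  show "fl (ST N (Suc n)) (\<lambda>f. symp q N (Suc n) f s)"
    using fl_tens[of "replicate (Suc n) ()" "\<lambda>_. N" "\<lambda>_. N" "\<lambda>_. symz q N" s] s by (simp add: ST_def symp_def maps_to_sym)
qed auto

lemma fl_symp: "s \<in> ST N n \<Longrightarrow> fl (ST N n) (\<lambda>f. symp q N n f s)"
  using fl_tens[of "replicate n ()" "\<lambda>_. N" "\<lambda>_. N" "\<lambda>_. symz q N" s] by (simp add: ST_def symp_def maps_to_sym)

lemma fl_Mk:
  assumes "k \<le> N" "Y \<in> ST N n" shows "fl (ST N n) (\<lambda>h. Mk k l h Y)"
  unfolding Mk_def
proof (rule fl_comp[OF fl_mop])
  show "xk N k # Y \<in> ST N (Suc n)" using assms by (simp add: ST_Cons xk_blists)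
  fix s assume "s \<in> ST N (Suc n)"
  then show "fl (ST N n) (\<lambda>h. emb l h s)"
    unfolding emb_def by (intro fl_if fl_zero fl_eval) (auto simp: ST_Suc)
qed simp

lemma Mk_symp_fun: "k \<le> N \<Longrightarrow> symp_fun q N n (Mk k l h)"
  using symp_fun_Cons(2)[OF symp_fun_mop xk_blists, of k "emb l h"] by (simp add: Mk_def[abs_def])

lemma Mk_symp:
  assumes "k \<le> N" "Y \<in> ST N n" shows "Mk k l (symp q N n h) Y = Mk k l h Y"
  unfolding Mk_def
  by (rule mop_cong) (use assms in \<open>auto simp: emb_def symp_explicit map_st_ST ST_Cons xk_blists comp_def\<close>)

text \<open>The block with indices \<open>k\<close> and \<open>Suc k\<close> of the relation that
  \<open>lows\<close> and \<open>mop\<close> commute. The lowering operator acts either on the first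
  cable, changing its weight with coefficient \<open>cfac\<close>, or on the other cables, with the
  group-like weight of the first in front.\<close>

lemma lows_identity:
  assumes k: "k < N" and Y: "Y \<in> ST N n"
  shows "cfac q N k * Mk (Suc k) (Suc k) h Y + wtl (bq q) (xk N k) * lows q (Mk k (Suc k) h) Y =
    cfac q N k * Mk k k h Y + wtl (bq q) (xk N (Suc k)) * Mk k (Suc k) (lows q (symp q N n h)) Y"
proof -
  let ?f = "emb (Suc k) h" and ?S = "ST N (Suc n)"
  let ?s = "xk N k # Y"
  have s: "?s \<in> ?S" using k Y by (simp add: ST_Cons xk_blists)
  let ?G = "lows q (symp q N (Suc n) ?f)"
  have "cfac q N k * Mk (Suc k) (Suc k) h Y + wtl (bq q) (xk N k) * lows q (Mk k (Suc k) h) Y = lows q (mop ?f) ?s"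
    using low_sorted[OF symp_fun_Cons(1)[OF symp_fun_mop Y] k] by (simp add: Mk_def[abs_def])
  also have "\<dots> = bop ?G ?s" unfolding mop_def bop_def by (rule actw_lows[OF q, symmetric])
  also have "\<dots> = mop ?G ?s"
    unfolding mop_def by (rule fl_cong[OF fl_bop[OF s]], rule symp_fixed[symmetric]) (rule symp_fun_lows[OF q symp_fun_symp])
  also have "\<dots> = mop (\<lambda>s. cfac q N k * emb k (symp q N n h) s + wtl (bq q) (xk N (Suc k)) * emb (Suc k) (lows q (symp q N n h)) s) ?s"
  proof (rule mop_cong[OF _ s])
    fix l Y' assume l: "l \<le> N" and Y': "Y' \<in> ST N n"
    let ?Y = "map st Y'"
    have Y: "?Y \<in> ST N n" by (rule map_st_ST[OF Y'])
    have sf: "symp q N (Suc n) ?f (xk N j # Z) = (if j = Suc k then symp q N n h Z else 0)" if "j \<le> N" "Z \<in> ST N n" for j Z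
      using that by (simp add: symp_explicit ST_Cons xk_blists emb_def xk_inj)
    have 1: "low q (\<lambda>x. symp q N (Suc n) ?f (x # ?Y)) (xk N l) = (if l = k then cfac q N k * symp q N n h ?Y else 0)"
    proof (cases "l < N")
      case True
      from low_sorted[OF symp_fun_Cons(1)[OF symp_fun_symp[where f = ?f] Y] True] show ?thesis
        using sf[of "Suc l" ?Y] True Y by simp
    next
      case False
      then have "l = N" using l by simp
      then show ?thesis using k by (simp add: xk_def low_ones)
    qed
    have "lows q (\<lambda>s. symp q N (Suc n) ?f (xk N l # s)) ?Y = lows q (\<lambda>s. if l = Suc k then symp q N n h s else 0) ?Y"
      by (rule fl_cong[OF fl_lows]) (use Y sf l in \<open>auto simp: ST_def\<close>)
    also have "\<dots> = (if l = Suc k then lows q (symp q N n h) ?Y else 0)"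
      using fl_zero_app[OF fl_lows, of ?Y "replicate n N" q] Y by (auto simp: ST_def)
    finally show "?G (xk N l # ?Y) = cfac q N k * emb k (symp q N n h) (xk N l # ?Y) +
        wtl (bq q) (xk N (Suc k)) * emb (Suc k) (lows q (symp q N n h)) (xk N l # ?Y)"
      using 1 by (simp add: emb_def xk_inj)
  qed
  also have "\<dots> = cfac q N k * Mk k k (symp q N n h) Y + wtl (bq q) (xk N (Suc k)) * Mk k (Suc k) (lows q (symp q N n h)) Y"
    unfolding Mk_def by (simp only: fl_add_app[OF fl_mop[OF s]] fl_scale_app[OF fl_mop[OF s]])
  finally show ?thesis using Mk_symp[of k Y k h] k Y by simp
qed

text \<open>All strands but the first are closed; the first one is held at weight
  \<open>k\<close>.\<close>

definition gtr :: "nat \<Rightarrow> 'a" where "gtr k = tr (ST N n) (\<lambda>h Y. kaps q Y * Mk k k h Y)"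

text \<open>The weights of \<open>True\<close> and \<open>False\<close> in the quantum trace have
  the quotient \<open>q * q\<close>.\<close>

lemma low_kapl: "low q (\<lambda>x. kapl q x * f x) x = q * q * kapl q x * low q f x"
proof (induction x arbitrary: f)
  case (Cons a x)
  have "low q (\<lambda>x. kapl q (a # x) * f (a # x)) x = kp q a * low q (\<lambda>x. kapl q x * f (a # x)) x"
    using fl_scale_app[OF fl_low[of x "length x" q], of "kp q a" "\<lambda>x. kapl q x * f (a # x)"] by (simp add: blists_def mult_ac)
  then show ?case using Cons.IH[of "\<lambda>x. f (a # x)"] q by (auto simp: kp_def field_simps)
qed simp

lemma lows_kaps: "lows q (\<lambda>s. kaps q s * f s) s = q * q * kaps q s * lows q f s"
proof (induction s arbitrary: f)
  case (Cons x s)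
  have fll: "fl (shapes (map length s)) (\<lambda>f. lows q f s)" by (rule fl_lows) (simp add: shapes_def)
  have "lows q (\<lambda>s. kaps q (x # s) * f (x # s)) s = kapl q x * lows q (\<lambda>s. kaps q s * f (x # s)) s"
    using fl_scale_app[OF fll, of "kapl q x" "\<lambda>s. kaps q s * f (x # s)"] by (simp add: mult_ac)
  moreover have "low q (\<lambda>x. kaps q (x # s) * f (x # s)) x = kaps q s * low q (\<lambda>x. kapl q x * f (x # s)) x"
    using fl_scale_app[OF fl_low[of x "length x" q], of "kaps q s" "\<lambda>x. kapl q x * f (x # s)"] by (simp add: blists_def mult_ac)
  ultimately show ?case using Cons.IH[of "\<lambda>s. f (x # s)"] low_kapl[of "\<lambda>x. f (x # s)" x] by (simp add: algebra_simps)
qed simp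

lemma symp_kaps: "s \<in> ST N m \<Longrightarrow> symp q N m (\<lambda>s. kaps q s * f s) s = kaps q s * symp q N m f s"
proof -
  have "kaps q (map st s) = kaps q s" for s by (induction s) (auto simp: kapl_wtl)
  then show "s \<in> ST N m \<Longrightarrow> symp q N m (\<lambda>s. kaps q s * f s) s = kaps q s * symp q N m f s"
    by (simp add: symp_explicit)
qed

text \<open>The trace of \<open>lows_identity\<close> over the other strands. By cyclicity the two
  off-diagonal terms agree up to \<open>q * q\<close>, which is also the quotient of the two
  group-like weights; so they cancel and \<open>cfac\<close> remains as a common factor.\<close>

lemma gtr_step:
  assumes k: "k < N" and c: "cfac q N k \<noteq> 0"
  shows "gtr (Suc k) = gtr k"
proof -
  let ?S = "ST N n" and ?b = "wtl (bq q) (xk N k)" and ?b' = "wtl (bq q) (xk N (Suc k))" and ?Mo = "Mk k (Suc k)"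
  have flo: "fl ?S (\<lambda>f. lows q f Y)" if "Y \<in> ?S" for Y using fl_lows[of Y "replicate n N" q] that by (simp add: ST_def)
  have fMo: "fl ?S (\<lambda>f. ?Mo f Y)" if "Y \<in> ?S" for Y using fl_Mk[of k Y "Suc k"] that k by simp
  have b: "?b = q * q * ?b'"
  proof -
    have "N - k = Suc (N - Suc k)" using k by simp
    then show ?thesis using q k by (simp add: wtl_ones bq_def xk_def field_simps)
  qed
  have A: "tr ?S (\<lambda>h Y. kaps q Y * lows q (?Mo h) Y) = (1 / (q * q)) * tr ?S (\<lambda>h Y. kaps q Y * ?Mo (lows q h) Y)"
  proof -
    have "tr ?S (\<lambda>h Y. kaps q Y * lows q (?Mo h) Y) = tr ?S (\<lambda>h Y. (1 / (q * q)) * lows q (\<lambda>Y. kaps q Y * ?Mo h Y) Y)"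
      using q by (intro tr_cong) (simp add: lows_kaps)
    also have "\<dots> = (1 / (q * q)) * tr ?S (\<lambda>h. lows q (\<lambda>Y. kaps q Y * ?Mo h Y))" by (rule tr_scale)
    also have "tr ?S (\<lambda>h. lows q (\<lambda>Y. kaps q Y * ?Mo h Y)) = tr ?S (\<lambda>h Y. kaps q Y * ?Mo (lows q h) Y)"
      by (rule tr_cyclic[where X = "lows q" and Y = "\<lambda>h Y. kaps q Y * ?Mo h Y"]) (auto intro: flo fl_scale fMo)
    finally show ?thesis .
  qed
  have B: "tr ?S (\<lambda>h Y. kaps q Y * ?Mo (lows q (symp q N n h)) Y) = tr ?S (\<lambda>h Y. kaps q Y * ?Mo (lows q h) Y)"
  proof -
    have "tr ?S (\<lambda>h Y. kaps q Y * ?Mo (lows q (symp q N n h)) Y) = tr ?S (\<lambda>h. symp q N n (\<lambda>Y. kaps q Y * ?Mo (lows q h) Y))"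
      by (rule tr_cyclic[where X = "\<lambda>h Y. kaps q Y * ?Mo (lows q h) Y" and Y = "symp q N n"])
         (auto intro!: fl_scale fl_symp fl_comp[OF fMo] flo)
    also have "\<dots> = tr ?S (\<lambda>h Y. kaps q Y * ?Mo (lows q h) Y)"
      by (rule tr_cong) (simp add: symp_kaps symp_fixed[OF Mk_symp_fun] k less_imp_le)
    finally show ?thesis .
  qed
  have "tr ?S (\<lambda>h Y. kaps q Y * (c * U h Y + d * V h Y)) = c * tr ?S (\<lambda>h Y. kaps q Y * U h Y) + d * tr ?S (\<lambda>h Y. kaps q Y * V h Y)" for c d U V
    by (simp add: tr_def sum_distrib_left sum.distrib algebra_simps)
  note lin = this
  have "cfac q N k * gtr (Suc k) + ?b * tr ?S (\<lambda>h Y. kaps q Y * lows q (?Mo h) Y) =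
     cfac q N k * gtr k + ?b' * tr ?S (\<lambda>h Y. kaps q Y * ?Mo (lows q (symp q N n h)) Y)"
    unfolding gtr_def lin[symmetric] by (rule tr_cong) (simp add: lows_identity[OF k])
  then have "cfac q N k * gtr (Suc k) + ?b * ((1 / (q * q)) * tr ?S (\<lambda>h Y. kaps q Y * ?Mo (lows q h) Y)) =
     cfac q N k * gtr k + ?b' * tr ?S (\<lambda>h Y. kaps q Y * ?Mo (lows q h) Y)"
    unfolding A B .
  then show ?thesis using c q by (simp add: b)
qed

lemma gtr_const: "(\<And>k. k < N \<Longrightarrow> cfac q N k \<noteq> 0) \<Longrightarrow> k \<le> N \<Longrightarrow> gtr k = gtr 0"
  by (induction k) (auto simp: gtr_step)

text \<open>On the first cable only sorted words contribute to the trace. Each of them contributes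
  its weight times the same scalar, by \<open>gtr_const\<close>.\<close>

lemma tr_open:
  assumes "\<And>k. k < N \<Longrightarrow> cfac q N k \<noteq> 0"
  shows "tr (ST N (Suc n)) (\<lambda>f s. kaps q s * mop f s) = (\<Sum>k\<le>N. kapl q (xk N k)) * gtr 0"
proof -
  let ?F = "\<lambda>x. \<Sum>Y\<in>ST N n. kaps q (x # Y) * mop (unit_fun (x # Y)) (x # Y)"
  have "tr (ST N (Suc n)) (\<lambda>f s. kaps q s * mop f s) = (\<Sum>x\<in>blists N. ?F x)"
    unfolding tr_def sum_ST_Suc ..
  also have "\<dots> = (\<Sum>x\<in>xk N ` {..N}. ?F x)"
  proof (rule sum.mono_neutral_right)
    show "\<forall>x\<in>blists N - xk N ` {..N}. ?F x = 0"
    proof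
      fix x assume x: "x \<in> blists N - xk N ` {..N}"
      have "mop (unit_fun (x # Y)) (x # Y) = 0" if "Y \<in> ST N n" for Y
      proof -
        have s: "x # Y \<in> ST N (Suc n)" using x that by (simp add: ST_Cons)
        have "mop (unit_fun (x # Y)) (x # Y) = mop (\<lambda>_. 0) (x # Y)"
          by (rule mop_cong[OF _ s]) (use x in \<open>auto simp: unit_fun_def\<close>)
        then show ?thesis using fl_zero_app[OF fl_mop[OF s]] by simp
      qed
      then show "?F x = 0" by simp
    qed
  qed (auto simp: xk_blists)
  also have "\<dots> = (\<Sum>k\<le>N. ?F (xk N k))" by (subst sum.reindex) (auto simp: inj_on_def xk_inj)
  also have "\<dots> = (\<Sum>k\<le>N. kapl q (xk N k) * gtr k)"
  proof (rule sum.cong[OF HOL.refl])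
    fix k assume k: "k \<in> {..N}"
    have "mop (unit_fun (xk N k # Y)) (xk N k # Y) = Mk k k (unit_fun Y) Y" if Y: "Y \<in> ST N n" for Y
      unfolding Mk_def
      by (rule mop_cong) (use Y k in \<open>auto simp: unit_fun_def emb_def xk_inj ST_Cons xk_blists\<close>)
    then show "?F (xk N k) = kapl q (xk N k) * gtr k"
      by (simp add: gtr_def tr_def sum_distrib_left mult.assoc)
  qed
  also have "\<dots> = (\<Sum>k\<le>N. kapl q (xk N k) * gtr 0)"
  proof (rule sum.cong[OF HOL.refl])
    fix k assume "k \<in> {..N}"
    then have "gtr k = gtr 0" by (intro gtr_const assms) auto
    then show "kapl q (xk N k) * gtr k = kapl q (xk N k) * gtr 0" by (simp only:)
  qed
  finally show ?thesis by (simp add: sum_distrib_right)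
qed

end

section \<open>The full twist\<close>

subsection \<open>Words acting on functions without cups\<close>

lemma actw_bool_cong:
  assumes "lin2 P" "lin2 Q" "\<And>z. length z = n \<Longrightarrow> f z = g z" "length z = n"
  shows "actw P Q w f z = actw P Q w g z"
  by (rule fl_cong[OF fl_actw_bool[OF assms(1,2)]]) (use assms in \<open>auto simp: blists_def\<close>)

lemma cap_zero_actw:
  assumes Q: "lin2 Q" and "\<And>i x. Suc (Suc (length x)) = L \<Longrightarrow> cap q i f x = 0"
  shows "length z = L \<Longrightarrow> actw (sig 1 q) Q (pos w) f z = f z"
proof (induction w arbitrary: z)
  case Nil then show ?case by (simp add: pos_def)
next
  case (Cons i w)
  have "act (sig 1 q) i (actw (sig 1 q) Q (pos w) f) z = act (sig 1 q) i f z"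
    by (rule fl_cong[OF fl_act_bool[OF lin2_sig]]) (use Cons in \<open>auto simp: blists_def\<close>)
  also have "\<dots> = f z" by (rule cap_zero_act) (use assms(2) Cons.prems in auto)
  finally show ?case by (simp add: pos_def)
qed

text \<open>The first point passes over all others to the last place. On \<open>L\<close> points the
  \<open>L\<close>-th power is the full twist.\<close>

definition rot :: "'a::field \<Rightarrow> (bool list \<Rightarrow> 'a) \<Rightarrow> bool list \<Rightarrow> 'a" where
  "rot q f z = actw (sig 1 q) (sig 1 q) (pos [0..<length z - 1]) f z"

lemma rot_Cons: "rot q f (a # z) = ov (sig 1 q) (\<lambda>u a'. f (u @ [a'])) a z"
  using actw_ov[of "sig 1 q" "sig 1 q" z f a "[]"] by (simp add: rot_def)

lemma rot_cong: "(\<And>z. length z = n \<Longrightarrow> f z = g z) \<Longrightarrow> length z = n \<Longrightarrow> rot q f z = rot q g z"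
  unfolding rot_def by (rule actw_bool_cong[OF lin2_sig lin2_sig])

lemma rots_cong: "(\<And>z. length z = n \<Longrightarrow> f z = g z) \<Longrightarrow> length z = n \<Longrightarrow> (rot q ^^ k) f z = (rot q ^^ k) g z"
proof (induction k arbitrary: z)
  case (Suc k)
  then show ?case using rot_cong[of n "(rot q ^^ k) f" "(rot q ^^ k) g" z q] by simp
qed simp

lemma rot_scale: "rot q (\<lambda>z. c * f z) z = c * rot q f z"
  unfolding rot_def by (rule fl_scale_app[OF fl_actw_bool[OF lin2_sig lin2_sig]]) (simp add: blists_def)

lemma rots_scale: "(rot q ^^ k) (\<lambda>z. c * f z) z = c * (rot q ^^ k) f z"
proof (induction k arbitrary: z)
  case (Suc k)
  have "(rot q ^^ k) (\<lambda>z. c * f z) = (\<lambda>z. c * (rot q ^^ k) f z)" by (rule ext) (rule Suc)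
  then show ?case by (simp add: rot_scale)
qed simp

text \<open>Moving the points of a block around one after the other differs from moving the block as
  a whole by a twist inside the block. Functions killed by the caps inside the block do not see this
  twist.\<close>

lemma rot_block:
  assumes "\<And>v i y. length v = length s \<Longrightarrow> Suc i < j \<Longrightarrow> Suc (Suc (length y)) = j \<Longrightarrow> cap q i (\<lambda>x. f (v @ x)) y = 0"
  shows "length x = j \<Longrightarrow> (rot q ^^ j) f (x @ s) = xr (sig 1 q) (\<lambda>u x'. f (u @ x')) x s"
  using assms
proof (induction j arbitrary: x s f)
  case 0 then show ?case by simp
next
  case (Suc j)
  let ?R = "sig 1 q"
  let ?X = "xr ?R" and ?W = "actw ?R ?R (pos [0..<length s])"
  note flX = fl2_xr[OF lin2_sig, of _ _ 1 q] and flO = fl2_ov[OF lin2_sig, of _ 1 q]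
  obtain a x1 where x: "x = a # x1" "length x1 = j" using Suc.prems(1) by (cases x) auto
  have IH: "(rot q ^^ j) f (y @ t) = ?X (\<lambda>u x'. f (u @ x')) y t" if l: "length y = j" "length t = Suc (length s)" for y t
  proof (rule Suc.IH[OF l(1)])
    fix v :: "bool list" and i and y :: "bool list"
    assume v: "length v = length t" and i: "Suc i < j" "Suc (Suc (length y)) = j"
    obtain v' b where v': "v = v' @ [b]" using v l(2) by (cases v rule: rev_cases) auto
    have "cap q (Suc i) (\<lambda>x. f (v' @ x)) (b # y) = 0" by (rule Suc.prems(2)) (use i v v' l in auto)
    then show "cap q i (\<lambda>x. f (v @ x)) y = 0" by (simp add: v')
  qed
  let ?F = "\<lambda>p x'. f (p @ x')"
  \<comment> \<open>The value after the whole block has passed \<open>s\<close>, as a function of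
    the block; it is again killed by caps.\<close>
  define h where "h z = ?X ?F z s" for z
  have hcap: "cap q i h y = 0" if y: "Suc (Suc (length y)) = Suc j" for i y
  proof (cases "i < j")
    case False
    \<comment> \<open>Caps beyond the end of the list have the default value zero.\<close>
    have "cap q i h y = 0" if "length y < i" for i h and y :: "bool list"
      using that by (induction q i h y rule: cap.induct) auto
    then show ?thesis using False y by simp
  next
    case True
    have "cap q i h y = q ^ length s * ?X (\<lambda>u x'. cap q i (?F u) x') y s"
      unfolding h_def by (simp add: cap_xr_over)
    also have "?X (\<lambda>u x'. cap q i (?F u) x') y s = ?X (\<lambda>u x'. 0) y s"
      by (rule fl2_cong[OF flX], rule Suc.prems(2)) (use True y in \<open>auto simp: blists_def\<close>)
    also have "\<dots> = 0" by (rule fl2_zero_app[OF flX])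
    finally show ?thesis by simp
  qed
  have W: "?W g (c # p) = ov ?R (\<lambda>v a'. g (v @ [a'])) c p" if "length p = length s" for g c p
    using actw_ov[of ?R ?R p g c "[]"] that by simp
  have inner: "ov ?R (\<lambda>v1 a2. (rot q ^^ j) f (u1 @ v1 @ [a2])) a1 s = ?X (\<lambda>p1 x1. h (p1 @ x1)) u1 [a1]"
    if u1: "length u1 = j" for u1 a1
  proof -
    have "ov ?R (\<lambda>v1 a2. (rot q ^^ j) f (u1 @ v1 @ [a2])) a1 s = ov ?R (\<lambda>v1 a2. ?X ?F u1 (v1 @ [a2])) a1 s"
      by (rule fl2_cong[OF flO]) (use IH u1 in \<open>auto simp: blists_def\<close>)
    also have "\<dots> = ?W (?X ?F u1) ([a1] @ s)" by (simp add: W)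
    also have "\<dots> = ?X (\<lambda>p x'. ?W (\<lambda>p. ?F p x') p) u1 ([a1] @ s)" by (rule actw_xr_under)
    also have "\<dots> = ?X (\<lambda>p1 x1. ?X (\<lambda>p2 x2. ?W (\<lambda>p. ?F p x2) (p1 @ p2)) x1 s) u1 [a1]"
      by (rule xr_append2[OF lin2_sig])
    also have "\<dots> = ?X (\<lambda>p1 x1. h (p1 @ x1)) u1 [a1]"
    proof (rule fl2_cong[OF flX])
      fix p1 x1 :: "bool list" assume "p1 \<in> blists (length [a1])" "x1 \<in> blists (length u1)"
      then obtain c where c: "p1 = [c]" by (cases p1) (auto simp: blists_def)
      have "?X (\<lambda>p2 x2. ?W (\<lambda>p. ?F p x2) (p1 @ p2)) x1 s = ?X (\<lambda>p2 x2. ov ?R (\<lambda>v a'. f (v @ a' # x2)) c p2) x1 s"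
        by (rule fl2_cong[OF flX]) (simp add: c W blists_def)
      then show "?X (\<lambda>p2 x2. ?W (\<lambda>p. ?F p x2) (p1 @ p2)) x1 s = h (p1 @ x1)"
        by (simp add: h_def c)
    qed
    finally show ?thesis .
  qed
  have "(rot q ^^ Suc j) f (x @ s) = ov ?R (\<lambda>u a'. (rot q ^^ j) f (u @ [a'])) a (x1 @ s)"
    by (simp add: x rot_Cons)
  also have "\<dots> = ov ?R (\<lambda>u1 a1. ov ?R (\<lambda>v1 a2. (rot q ^^ j) f (u1 @ v1 @ [a2])) a1 s) a x1"
    by (simp add: ov_append)
  also have "\<dots> = ov ?R (\<lambda>u1 a1. ?X (\<lambda>p1 x1. h (p1 @ x1)) u1 [a1]) a x1"
    by (rule fl2_cong[OF flO]) (use x inner in \<open>auto simp: blists_def\<close>)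
  also have "\<dots> = actw ?R ?R (pos [0..<length x1]) (actw ?R ?R (pos (wd j 1)) h) (a # x1)"
  proof -
    have "actw ?R ?R (pos (wd j 1)) h (u1 @ [a1]) = ?X (\<lambda>p1 x1. h (p1 @ x1)) u1 [a1]" if "length u1 = j" for u1 a1
      using actw_xr[OF lin2_sig, of 1 q ?R u1 "[a1]" h "[]"] that by simp
    then have "ov ?R (\<lambda>u1 a1. ?X (\<lambda>p1 x1. h (p1 @ x1)) u1 [a1]) a x1 = ov ?R (\<lambda>u1 a1. actw ?R ?R (pos (wd j 1)) h (u1 @ [a1])) a x1"
      by (intro fl2_cong[OF flO]) (use x in \<open>auto simp: blists_def\<close>)
    then show ?thesis using actw_ov[of ?R ?R x1 "actw ?R ?R (pos (wd j 1)) h" a "[]"] by simp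
  qed
  also have "\<dots> = actw ?R ?R (pos ([0..<length x1] @ wd j 1)) h (a # x1)"
    by (simp add: pos_append actw_append)
  \<comment> \<open>What is left of the rotation is a word inside the block, and it acts trivially
    on \<open>h\<close>.\<close>
  also have "\<dots> = h (a # x1)"
    by (rule cap_zero_actw[OF lin2_sig, where L = "Suc j"]) (use hcap x in auto)
  finally show ?case by (simp add: h_def x)
qed

subsection \<open>Rotation of strands\<close>

lemma actw_pass:
  "actw (xr (sig 1 q)) Q (pos [0..<length s]) (\<lambda>s. f (concat s)) (x # s) = xr (sig 1 q) (\<lambda>u x'. f (u @ x')) x (concat s)"
proof (induction s arbitrary: f x)
  case Nil
  have "xr R g x [] = g [] x" for R and g :: "bool list \<Rightarrow> bool list \<Rightarrow> 'a"
    by (induction x arbitrary: g) auto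
  then show ?case by (simp add: pos_def)
next
  case (Cons y s)
  let ?X = "xr (sig 1 q)"
  have "pos [0..<length (y # s)] = (0, True) # shift 1 (pos [0..<length s])"
    by (simp only: list.size add_0_right add_Suc_right upt_Suc0) (simp add: pos_def shift_def)
  moreover have "actw ?X Q (shift 1 (pos [0..<length s])) (\<lambda>s. f (concat s)) (u # x' # s) =
     ?X (\<lambda>v x''. f (u @ v @ x'')) x' (concat s)" for u x'
  proof -
    have "actw ?X Q (shift 1 w) f (a # s) = actw ?X Q w (\<lambda>s. f (a # s)) s" for w f a s
    proof (induction w arbitrary: s)
      case (Cons l w)
      obtain i b where l: "l = (i, b)" by force
      have "actw ?X Q (shift 1 w) f = (\<lambda>s'. actw ?X Q (shift 1 w) f s')" by simp
      show ?case using Cons by (simp add: l shift_def)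
    qed (simp add: shift_def)
    then show ?thesis using Cons.IH[of "\<lambda>z. f (u @ z)" x'] by simp
  qed
  ultimately have "actw ?X Q (pos [0..<length (y # s)]) (\<lambda>s. f (concat s)) (x # y # s) =
      ?X (\<lambda>u x'. ?X (\<lambda>v x''. f (u @ v @ x'')) x' (concat s)) x y" by (simp del: upt_Suc One_nat_def)
  then show ?case using xr_append2[OF lin2_sig, of 1 q "\<lambda>u x'. f (u @ x')" x y "concat s"] by simp
qed

lemma ST_replicate: "s \<in> ST N n \<Longrightarrow> length s = n" "s \<in> ST N n \<Longrightarrow> length (concat s) = N * n"
proof -
  assume "s \<in> ST N n"
  then have m: "map length s = replicate n N" by (simp add: ST_def shapes_def)
  then have "length (map length s) = n" by simp
  then show "length s = n" by simp
  show "length (concat s) = N * n" using m by (simp add: length_concat sum_list_replicate)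
qed

lemma symp_fun_last:
  "symp_fun q N (Suc n) f \<Longrightarrow> v \<in> ST N n \<Longrightarrow> sym_fun q N (\<lambda>x. f (v @ [x]))"
proof (induction n arbitrary: f v)
  case 0 then show ?case using symp_fun_Cons(1)[OF 0(1), of "[]"] by simp
next
  case (Suc n)
  obtain y v' where v: "v = y # v'" "y \<in> blists N" "v' \<in> ST N n" using Suc.prems by (auto simp: ST_Suc)
  show ?case using Suc.IH[OF symp_fun_Cons(2)[OF Suc.prems(1) v(2)] v(3)] by (simp add: v)
qed

fun chunks :: "nat \<Rightarrow> nat \<Rightarrow> bool list \<Rightarrow> bool list list" where
  "chunks N 0 z = []" | "chunks N (Suc n) z = take N z # chunks N n (drop N z)"

lemma chunks_concat: "s \<in> ST N n \<Longrightarrow> chunks N n (concat s) = s"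
  by (induction n arbitrary: s) (auto simp: ST_Suc blists_def)

lemma chunks_ST: "length z = N * n \<Longrightarrow> chunks N n z \<in> ST N n"
  by (induction n arbitrary: z) (auto simp: ST_Suc blists_def image_iff)

lemma concat_chunks: "length z = N * n \<Longrightarrow> concat (chunks N n z) = z"
  by (induction n arbitrary: z) auto

text \<open>One cable passing over all the others is \<open>N\<close> steps of \<open>rot\<close> on
  single points, by \<open>rot_block\<close> with the first cable as block.\<close>

lemma strand_rotation:
  assumes q: "q \<noteq> 0" and Q: "strand_op Q" and f: "symp_fun q N (Suc n) (\<lambda>s. f (concat s))" and s: "s \<in> ST N (Suc n)"
  shows "actw (xr (sig 1 q)) Q (pos [0..<n]) (\<lambda>s. f (concat s)) s = (rot q ^^ N) f (concat s)"
proof -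
  obtain x s' where x: "s = x # s'" "x \<in> blists N" "s' \<in> ST N n" using s by (auto simp: ST_Suc)
  have l: "length s' = n" using x ST_replicate by blast
  have "(rot q ^^ N) f (x @ concat s') = xr (sig 1 q) (\<lambda>u x'. f (u @ x')) x (concat s')"
  proof (rule rot_block)
    show "length x = N" using x by (simp add: blists_def)
    fix v :: "bool list" and i and y :: "bool list"
    assume v: "length v = length (concat s')" and i: "Suc i < N" "Suc (Suc (length y)) = N"
    have lv: "length v = N * n" using v ST_replicate(2)[OF x(3)] by simp
    have "sym_fun q N (\<lambda>x. f (v @ x))"
      using symp_fun_last[OF f chunks_ST[OF lv]] concat_chunks[OF lv] by simp
    then show "cap q i (\<lambda>x. f (v @ x)) y = 0" by (rule sym_fun_cap) (use i in auto)
  qed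
  then show ?thesis using actw_pass[of q Q s' f x] by (simp add: x l)
qed

text \<open>Each passage keeps the function symmetric on the cables, so
  \<open>strand_rotation\<close> can be iterated. For \<open>j = Suc n\<close> the right-hand side
  is the full twist on all \<open>N * Suc n\<close> points, which no longer refers to the division
  into cables.\<close>

lemma strand_full_twist:
  assumes q: "q \<noteq> 0" and Q: "strand_op Q" and f: "symp_fun q N (Suc n) (\<lambda>s. f (concat s))" and s: "s \<in> ST N (Suc n)"
  shows "actw (xr (sig 1 q)) Q (pos (concat (replicate j [0..<n]))) (\<lambda>s. f (concat s)) s = (rot q ^^ (N * j)) f (concat s)"
  using s
proof (induction j arbitrary: s)
  case 0 then show ?case by (simp add: pos_def)
next
  case (Suc j)
  let ?A = "\<lambda>v. actw (xr (sig 1 q)) Q (pos v)" and ?v = "concat (replicate j [0..<n])"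
  let ?g = "(rot q ^^ (N * j)) f"
  have g: "symp_fun q N (Suc n) (\<lambda>s. ?g (concat s))"
  proof -
    have 1: "symp_fun q N (Suc n) (bop q ?v Q (\<lambda>s. f (concat s)))" by (rule bop_symp_fun[OF q Q f])
    have 2: "bop q ?v Q (\<lambda>s. f (concat s)) s = ?g (concat s)" if "s \<in> ST N (Suc n)" for s
      using Suc.IH[OF that] by (simp only: bop_def[OF q Q])
    show ?thesis unfolding symp_fun_def
    proof
      fix s assume s: "s \<in> ST N (Suc n)"
      show "?g (concat s) = q ^ sum_list (map iv s) * ?g (concat (map st s))"
        unfolding 2[OF s, symmetric] 2[OF map_st_ST[OF s], symmetric] by (rule symp_funD[OF 1 s])
    qed
  qed
  have "?A (concat (replicate (Suc j) [0..<n])) (\<lambda>s. f (concat s)) s = ?A [0..<n] (?A ?v (\<lambda>s. f (concat s))) s"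
    by (simp add: pos_append actw_append)
  also have "\<dots> = ?A [0..<n] (\<lambda>s. ?g (concat s)) s"
    using fl_cong[OF fl_bop[OF q Q Suc.prems, of "[0..<n]"], of "?A ?v (\<lambda>s. f (concat s))" "\<lambda>s. ?g (concat s)"] Suc.IH
    by (simp add: bop_def[OF q Q])
  also have "\<dots> = (rot q ^^ N) ?g (concat s)" by (rule strand_rotation[OF q Q g Suc.prems])
  finally show ?case by (simp add: funpow_add)
qed

subsection \<open>Pulling a cap through the full twist\<close>

text \<open>The rotating point passes over the cap, which pays \<open>q\<close> and changes its
  position by one.\<close>

lemma cap_rot_Suc:
  assumes "i \<le> length z" shows "cap q (Suc i) (rot q f) (a # z) = q * rot q (cap q i f) (a # z)"
proof -
  have c: "cap q i (\<lambda>u. f (u @ [a'])) u = cap q i f (u @ [a'])" if "i \<le> length u" for u a' f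
    using that
  proof (induction i arbitrary: u f)
    case (Suc i) then show ?case by (cases u) auto
  qed simp
  have "(\<lambda>z. rot q f (a # z)) = ov (sig 1 q) (\<lambda>u a'. f (u @ [a'])) a" by (rule ext) (rule rot_Cons)
  then have "cap q (Suc i) (rot q f) (a # z) = q * ov (sig 1 q) (\<lambda>u a'. cap q i (\<lambda>u. f (u @ [a'])) u) a z"
    using cap_ov[of q i 1 "\<lambda>u a'. f (u @ [a'])" a z] by simp
  also have "ov (sig 1 q) (\<lambda>u a'. cap q i (\<lambda>u. f (u @ [a'])) u) a z = ov (sig 1 q) (\<lambda>u a'. cap q i f (u @ [a'])) a z"
    by (rule fl2_cong[OF fl2_ov[OF lin2_sig]]) (use assms c in \<open>auto simp: blists_def\<close>)
  finally show ?thesis by (simp add: rot_Cons)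
qed

text \<open>The two ends of the cap rotate in turn. They cross each other before and after passing
  the rest; each time this is a curl with eigenvalue \<open>- q * q\<close>, while each of the other
  points contributes \<open>q\<close>.\<close>

lemma cap_rot_rot: "cap q 0 (rot q (rot q f)) z = q ^ (4 + length z) * cap q (length z) f z"
proof -
  let ?R = "sig 1 q"
  define W where "W v b1 a2 = ?R (\<lambda>a3 b3. f (v @ [a3, b3])) b1 a2" for v b1 a2
  define h where "h b' a1 = ov ?R (\<lambda>u a2. ov ?R (\<lambda>v1 b1. W v1 b1 a2) b' u) a1 z" for b' a1
  have r2: "rot q (rot q f) (a # b # z) = ?R h a b" for a b
  proof -
    have "rot q f (b' # u @ [a2]) = ov ?R (\<lambda>v1 b1. W v1 b1 a2) b' u" for b' u a2
      by (simp add: rot_Cons ov_append W_def)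
    then have "rot q (rot q f) (a # b # z) = ?R (\<lambda>b' a1. ov ?R (\<lambda>u a2. ov ?R (\<lambda>v1 b1. W v1 b1 a2) b' u) a1 z) a b" by (simp add: rot_Cons[of q _ a])
    also have "(\<lambda>b' a1. ov ?R (\<lambda>u a2. ov ?R (\<lambda>v1 b1. W v1 b1 a2) b' u) a1 z) = h" by (intro ext) (simp add: h_def)
    finally show ?thesis .
  qed
  have "cap q 0 (rot q (rot q f)) z = ?R h False True - q * ?R h True False" by (simp add: r2)
  also have "\<dots> = - q * q * (h False True - q * h True False)" by (simp add: sig_def tw_def algebra_simps)
  also have "h False True - q * h True False = q ^ length z * (W z False True - q * W z True False)"
    unfolding h_def using pair_ov[of 1 q "\<lambda>u b1 a2. W u b1 a2" z] by simp
  also have "W z False True - q * W z True False = - q * q * cap q (length z) f z"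
  proof -
    have c: "cap q (length z) f z = f (z @ [False, True]) - q * f (z @ [True, False])" using cap_append[of q z f "[]"] by simp
    show ?thesis unfolding c by (simp add: W_def sig_def tw_def algebra_simps)
  qed
  finally show ?thesis by (simp add: power_add eval_nat_numeral mult_ac)
qed

lemma cap_rots: "i + k \<le> length z \<Longrightarrow> cap q (i + k) ((rot q ^^ k) f) z = q ^ k * (rot q ^^ k) (cap q i f) z"
proof (induction k arbitrary: z)
  case (Suc k)
  then obtain a z' where z: "z = a # z'" by (cases z) auto
  have "cap q (i + Suc k) ((rot q ^^ Suc k) f) z = q * rot q (cap q (i + k) ((rot q ^^ k) f)) z"
    using cap_rot_Suc[of "i + k" z' q "(rot q ^^ k) f" a] Suc.prems by (simp add: z)
  also have "rot q (cap q (i + k) ((rot q ^^ k) f)) z = rot q (\<lambda>z. q ^ k * (rot q ^^ k) (cap q i f) z) z"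
    by (rule rot_cong[where n = "length z"]) (use Suc in auto)
  finally show ?case by (simp add: rot_scale mult_ac)
qed simp

text \<open>From position \<open>i\<close> the cap reaches the left end after \<open>i\<close>
  rotations, wraps around during the next two, and is back at \<open>i\<close> after the remaining
  \<open>j\<close>. The exponents of \<open>q\<close> add up to two per point.\<close>

lemma cap_full_twist:
  assumes i: "i \<le> length z"
  shows "cap q i ((rot q ^^ (Suc (Suc (length z)))) f) z = q ^ (2 * Suc (Suc (length z))) * (rot q ^^ length z) (cap q i f) z"
proof -
  let ?l = "length z"
  define j where "j = ?l - i"
  have l: "?l = i + j" using i by (simp add: j_def)
  have "Suc (Suc ?l) = i + (2 + j)" using l by simp
  then have e: "(rot q ^^ (Suc (Suc ?l))) f = (rot q ^^ i) (rot q (rot q ((rot q ^^ j) f)))"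
    by (simp only: funpow_add) (simp add: numeral_2_eq_2)
  have "cap q i ((rot q ^^ (Suc (Suc ?l))) f) z = q ^ i * (rot q ^^ i) (cap q 0 (rot q (rot q ((rot q ^^ j) f)))) z"
    unfolding e using cap_rots[of 0 i z q "rot q (rot q ((rot q ^^ j) f))"] i by simp
  also have "(rot q ^^ i) (cap q 0 (rot q (rot q ((rot q ^^ j) f)))) z = (rot q ^^ i) (\<lambda>z. (q ^ (4 + ?l) * q ^ j) * (rot q ^^ j) (cap q i f) z) z"
  proof (rule rots_cong[where n = ?l])
    fix z' :: "bool list" assume z': "length z' = ?l"
    show "cap q 0 (rot q (rot q ((rot q ^^ j) f))) z' = (q ^ (4 + ?l) * q ^ j) * (rot q ^^ j) (cap q i f) z'"
      unfolding cap_rot_rot using cap_rots[of i j z' q f] l z' by simp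
  qed simp
  also have "\<dots> = (q ^ (4 + ?l) * q ^ j) * (rot q ^^ i) ((rot q ^^ j) (cap q i f)) z" by (rule rots_scale)
  also have "(rot q ^^ i) ((rot q ^^ j) (cap q i f)) = (rot q ^^ ?l) (cap q i f)" unfolding l by (simp add: funpow_add)
  finally have "cap q i ((rot q ^^ (Suc (Suc ?l))) f) z = q ^ (i + (4 + ?l + j)) * (rot q ^^ ?l) (cap q i f) z"
    by (simp only: power_add mult_ac)
  moreover have "i + (4 + ?l + j) = 2 * Suc (Suc ?l)" using l by simp
  ultimately show ?thesis by (simp only:)
qed

section \<open>Integrality\<close>

text \<open>For constant \<open>cls\<close> this expresses integrality; otherwise \<open>cls b\<close> records the parity of the exponent of \<open>q\<close>.\<close>

definition graded :: "'a::field \<Rightarrow> (bool \<Rightarrow> 'a set) \<Rightarrow> bool" where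
  "graded q cls \<longleftrightarrow> (\<forall>b. 0 \<in> cls b \<and> (\<forall>x\<in>cls b. \<forall>y\<in>cls b. x + y \<in> cls b) \<and>
     (\<forall>x\<in>cls b. q * x \<in> cls (\<not> b) \<and> (1 - q * q) * x \<in> cls b))"

lemma gradedD: "graded q cls \<Longrightarrow> 0 \<in> cls b" "graded q cls \<Longrightarrow> x \<in> cls b \<Longrightarrow> y \<in> cls b \<Longrightarrow> x + y \<in> cls b"
  "graded q cls \<Longrightarrow> x \<in> cls (\<not> b) \<Longrightarrow> q * x \<in> cls b" "graded q cls \<Longrightarrow> x \<in> cls b \<Longrightarrow> (1 - q * q) * x \<in> cls b"
proof -
  assume g: "graded q cls"
  show "0 \<in> cls b" "x \<in> cls b \<Longrightarrow> y \<in> cls b \<Longrightarrow> x + y \<in> cls b" "x \<in> cls b \<Longrightarrow> (1 - q * q) * x \<in> cls b"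
    using g unfolding graded_def by blast+
  assume "x \<in> cls (\<not> b)"
  then have "q * x \<in> cls (\<not> \<not> b)" using g unfolding graded_def by blast
  then show "q * x \<in> cls b" by simp
qed

text \<open>An off-diagonal entry of the crossing carries one factor \<open>q\<close> and exchanges
  two different neighbours, so the parity of the exponent of \<open>q\<close> follows any such
  function.\<close>

definition flips :: "(bool list \<Rightarrow> bool) \<Rightarrow> bool" where
  "flips \<pi> \<longleftrightarrow> (\<forall>p x y s. x \<noteq> y \<longrightarrow> \<pi> (p @ x # y # s) = (\<not> \<pi> (p @ y # x # s)))"

lemma flips_Cons: "flips \<pi> \<Longrightarrow> flips (\<lambda>s. \<pi> (a # s))"
  unfolding flips_def by (metis append_Cons)

lemma flips_context: "flips \<pi> \<Longrightarrow> flips (\<lambda>s. \<pi> (p @ s @ r))"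
  unfolding flips_def by (metis append.assoc append_Cons)

definition graded_fun :: "(bool \<Rightarrow> 'a set) \<Rightarrow> (bool list \<Rightarrow> bool) \<Rightarrow> (bool list \<Rightarrow> 'a) \<Rightarrow> bool" where
  "graded_fun cls \<pi> f \<longleftrightarrow> (\<forall>z. f z \<in> cls (\<pi> z))"

lemma graded_act:
  assumes g: "graded q cls"
  shows "graded_fun cls \<pi> f \<Longrightarrow> flips \<pi> \<Longrightarrow> graded_fun cls \<pi> (act (sig 1 q) i f)"
proof (induction i arbitrary: f \<pi>)
  case 0
  show ?case unfolding graded_fun_def
  proof
    fix z
    show "act (sig 1 q) 0 f z \<in> cls (\<pi> z)"
    proof (cases "\<exists>x y s'. z = x # y # s'")
      case True
      then obtain x y s' where s: "z = x # y # s'" by blast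
      have 1: "f (u # v # s') \<in> cls (\<pi> (u # v # s'))" for u v using 0 by (simp add: graded_fun_def)
      have 2: "\<pi> (False # True # s') = (\<not> \<pi> (True # False # s'))" "\<pi> (True # False # s') = (\<not> \<pi> (False # True # s'))"
        using 0(2)[unfolded flips_def, rule_format, of False True "[]" s'] by auto
      have 3: "q * f (True # False # s') \<in> cls (\<pi> (False # True # s'))"
        by (rule gradedD(3)[OF g]) (use 1[of True False] 2(2) in simp)
      have 4: "q * f (False # True # s') \<in> cls (\<pi> (True # False # s'))"
        by (rule gradedD(3)[OF g]) (use 1[of False True] 2(1) in simp)
      from gradedD(2)[OF g 4 gradedD(4)[OF g 1[of True False]]]
      show ?thesis using 1 3 by (cases x; cases y) (simp_all add: s sig_def tw_def)
    next
      case False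
      then have "act (sig 1 q) 0 f z = f z" by (cases "(sig 1 q, 0 :: nat, f, z)" rule: act.cases) auto
      then show ?thesis using 0 by (simp add: graded_fun_def)
    qed
  qed
next
  case (Suc i)
  show ?case unfolding graded_fun_def
  proof
    fix z
    show "act (sig 1 q) (Suc i) f z \<in> cls (\<pi> z)"
    proof (cases z)
      case Nil then show ?thesis using Suc.prems by (simp add: graded_fun_def)
    next
      case (Cons a z')
      have "graded_fun cls (\<lambda>s. \<pi> (a # s)) (act (sig 1 q) i (\<lambda>s. f (a # s)))"
        by (rule Suc.IH) (use Suc.prems in \<open>auto simp: graded_fun_def flips_Cons\<close>)
      then show ?thesis by (simp add: Cons graded_fun_def)
    qed
  qed
qed

lemma graded_actw:
  assumes g: "graded q cls" "graded_fun cls \<pi> f" "flips \<pi>"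
  shows "graded_fun cls \<pi> (actw (sig 1 q) Q (pos w) f)"
proof (induction w)
  case (Cons i w) then show ?case using graded_act[OF g(1) Cons g(3)] by (simp add: pos_def)
qed (simp add: pos_def g)

lemma graded_rots:
  assumes g: "graded q cls" "graded_fun cls \<pi> f" "flips \<pi>"
  shows "graded_fun cls \<pi> ((rot q ^^ k) f)"
proof (induction k)
  case (Suc k)
  then show ?case using graded_actw[OF g(1) Suc g(3)] by (simp add: graded_fun_def rot_def)
qed (simp add: g)

lemma graded_act_strand:
  assumes g: "graded q cls"
  shows "(\<And>s. f s \<in> cls (\<pi> (concat s))) \<Longrightarrow> flips \<pi> \<Longrightarrow> act (xr (sig 1 q)) i f s \<in> cls (\<pi> (concat s))"
proof (induction i arbitrary: f \<pi> s)
  case 0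
  show ?case
  proof (cases "\<exists>x y s'. s = x # y # s'")
    case True
    then obtain x y s' where s: "s = x # y # s'" by blast
    define h where "h z = f (take (length y) z # drop (length y) z # s')" for z
    have "xr (sig 1 q) (\<lambda>u v. f (u # v # s')) x y = xr (sig 1 q) (\<lambda>u v. h (u @ v)) x y"
      by (rule fl2_cong[OF fl2_xr[OF lin2_sig]]) (auto simp: h_def blists_def)
    also have "\<dots> = actw (sig 1 q) (sig 1 q) (pos (wd (length x) (length y))) h (x @ y)"
      using actw_xr[OF lin2_sig, of 1 q "sig 1 q" x y h "[]"] by simp
    also have "\<dots> \<in> cls (\<pi> (x @ y @ concat s'))"
    proof -
      have "graded_fun cls (\<lambda>z. \<pi> ([] @ z @ concat s')) h"
        unfolding graded_fun_def
      proof
        fix z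
        have "concat (take (length y) z # drop (length y) z # s') = [] @ z @ concat s'" by (simp flip: append.assoc)
        then show "h z \<in> cls (\<pi> ([] @ z @ concat s'))" using 0(1) unfolding h_def by metis
      qed
      from graded_actw[OF g this flips_context[OF 0(2)]]
      have "\<forall>z. actw (sig 1 q) (sig 1 q) (pos (wd (length x) (length y))) h z \<in> cls (\<pi> ([] @ z @ concat s'))"
        by (simp add: graded_fun_def)
      from spec[OF this, of "x @ y"] show ?thesis by simp
    qed
    finally show ?thesis by (simp add: s)
  next
    case False
    then have "act (xr (sig 1 q)) 0 f s = f s" by (cases "(xr (sig 1 q), 0 :: nat, f, s)" rule: act.cases) auto
    then show ?thesis using 0 by simp
  qed
next
  case (Suc i)
  show ?case
  proof (cases s)
    case Nil then show ?thesis using Suc.prems(1)[of "[]"] by simp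
  next
    case (Cons x s')
    have "act (xr (sig 1 q)) i (\<lambda>s. f (x # s)) s' \<in> cls ((\<lambda>z. \<pi> (x @ z @ [])) (concat s'))"
    proof (rule Suc.IH)
      fix s show "f (x # s) \<in> cls (\<pi> (x @ concat s @ []))" using Suc.prems(1)[of "x # s"] by simp
    qed (rule flips_context[OF Suc.prems(2)])
    then show ?thesis by (simp add: Cons)
  qed
qed

lemma graded_actw_strand:
  assumes g: "graded q cls" "\<And>s. f s \<in> cls (\<pi> (concat s))" "flips \<pi>"
  shows "actw (xr (sig 1 q)) Q (pos w) f s \<in> cls (\<pi> (concat s))"
proof (induction w arbitrary: s)
  case (Cons i w) then show ?case using graded_act_strand[OF g(1) Cons g(3)] by (simp add: pos_def)
qed (simp add: pos_def g)

lemma flips_iv: "flips (\<lambda>z. even (iv z + c))"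
  unfolding flips_def
proof (intro allI impI)
  fix p s and x y :: bool assume "x \<noteq> y"
  then show "even (iv (p @ x # y # s) + c) = (\<not> even (iv (p @ y # x # s) + c))"
    using iv_swap[of p s] by (cases x; cases y) auto
qed

text \<open>Inversions between different cables depend only on the numbers of \<open>True\<close> in
  each, so sorting every cable removes exactly the inversions inside cables.\<close>

lemma iv_concat:
  "iv (concat s) = sum_list (map iv s) + iv (concat (map st s))"
proof (induction s)
  case (Cons x s)
  have "ones (concat s) = ones (concat (map st s))" by (induction s) auto
  then show ?case using Cons by (simp add: iv_append)
qed simp

definition sub_ring :: "'a::field set \<Rightarrow> bool" where
  "sub_ring Z \<longleftrightarrow> 0 \<in> Z \<and> 1 \<in> Z \<and> (\<forall>x\<in>Z. \<forall>y\<in>Z. x + y \<in> Z \<and> x * y \<in> Z \<and> x - y \<in> Z)"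

lemma sub_ringD: "sub_ring Z \<Longrightarrow> 0 \<in> Z" "sub_ring Z \<Longrightarrow> 1 \<in> Z" "sub_ring Z \<Longrightarrow> x \<in> Z \<Longrightarrow> y \<in> Z \<Longrightarrow> x + y \<in> Z"
  "sub_ring Z \<Longrightarrow> x \<in> Z \<Longrightarrow> y \<in> Z \<Longrightarrow> x * y \<in> Z" "sub_ring Z \<Longrightarrow> x \<in> Z \<Longrightarrow> y \<in> Z \<Longrightarrow> x - y \<in> Z"
  by (auto simp: sub_ring_def)

lemma sub_ring_power: "sub_ring Z \<Longrightarrow> x \<in> Z \<Longrightarrow> x ^ n \<in> Z"
  by (induction n) (auto intro: sub_ringD)

lemma sub_ring_sum: "sub_ring Z \<Longrightarrow> (\<And>i. i \<in> I \<Longrightarrow> f i \<in> Z) \<Longrightarrow> sum f I \<in> Z"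
  by (induction I rule: infinite_finite_induct) (auto intro: sub_ringD)

lemma graded_const: "sub_ring Z \<Longrightarrow> q \<in> Z \<Longrightarrow> graded q (\<lambda>_. Z)"
  unfolding graded_def by (auto intro!: sub_ringD)

text \<open>The two classes are the even and the odd powers of \<open>q\<close>, with coefficients
  in \<open>Z\<close>.\<close>

lemma graded_parity:
  assumes Z: "sub_ring Z" "q * q \<in> Z"
  shows "graded q (\<lambda>b. if b then Z else {q * x |x. x \<in> Z})"
proof -
  have 1: "0 \<in> {q * x |x. x \<in> Z}" using sub_ringD(1)[OF Z(1)] by force
  have 2: "a + b \<in> {q * x |x. x \<in> Z}" if ab: "a \<in> {q * x |x. x \<in> Z}" "b \<in> {q * x |x. x \<in> Z}" for a b
  proof -
    obtain x y where "a = q * x" "b = q * y" "x \<in> Z" "y \<in> Z" using ab by blast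
    then have "a + b = q * (x + y)" "x + y \<in> Z" using sub_ringD(3)[OF Z(1)] by (auto simp: algebra_simps)
    then show ?thesis by blast
  qed
  have 3: "(1 - q * q) * x \<in> Z" if "x \<in> Z" for x
    using that Z by (auto intro!: sub_ringD)
  have 4: "(1 - q * q) * a \<in> {q * x |x. x \<in> Z}" if a: "a \<in> {q * x |x. x \<in> Z}" for a
  proof -
    obtain x where "a = q * x" "x \<in> Z" using a by blast
    then have "(1 - q * q) * a = q * ((1 - q * q) * x)" by simp
    then show ?thesis using 3[OF \<open>x \<in> Z\<close>] by blast
  qed
  have 5: "q * a \<in> Z" if a: "a \<in> {q * x |x. x \<in> Z}" for a
  proof -
    obtain x where "a = q * x" "x \<in> Z" using a by blast
    then have "q * a = (q * q) * x" by simp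
    then show ?thesis using sub_ringD(4)[OF Z(1) Z(2) \<open>x \<in> Z\<close>] by (simp only:)
  qed
  have 6: "q * a \<in> {q * x |x. x \<in> Z}" if "a \<in> Z" for a using that by blast
  show ?thesis unfolding graded_def
    using 1 2 3 4 5 6 sub_ringD(1)[OF Z(1)] sub_ringD(3)[OF Z(1)] by (simp split: if_split)
qed

section \<open>The trace of a positive braid with a full twist\<close>

context
  fixes q :: "'a::field" and N n :: nat and v' :: "nat list" and Q :: "(bool list, 'a) pair_op" and m :: nat and v :: "nat list"
  assumes q: "q \<noteq> 0" and Q: "strand_op Q"
  defines "m \<equiv> N * Suc n" and "v \<equiv> concat (replicate (Suc n) [0..<n]) @ v'"
begin

definition MM :: "(bool list list \<Rightarrow> 'a) \<Rightarrow> bool list list \<Rightarrow> 'a" where "MM = mop q N n v Q"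

text \<open>A path from a state back to itself has total change zero of the inversion number, so
  only even powers of \<open>q\<close> occur. This makes the result a polynomial in t and not just
  in its square root.\<close>

lemma diag_parity:
  assumes Z: "sub_ring Z" "q * q \<in> Z" and s: "s \<in> ST N (Suc n)"
  shows "MM (unit_fun s) s \<in> Z"
proof -
  define cls where "cls = (\<lambda>b. if b then Z else {q * x |x. x \<in> Z})"
  define \<pi> where "\<pi> z = even (iv z + iv (concat s))" for z
  \<comment> \<open>Set to zero outside the relevant states, because
    \<open>graded_actw_strand\<close> quantifies over all lists.\<close>
  define f where "f s' = (if s' \<in> ST N (Suc n) then symp q N (Suc n) (unit_fun s) s' else 0)" for s'
  have g: "graded q cls" unfolding cls_def by (rule graded_parity[OF Z])
  have qj: "q ^ j \<in> cls (even j)" for j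
  proof -
    have "(q * q) ^ k \<in> Z" for k by (rule sub_ring_power[OF Z])
    moreover have "q ^ (2 * k) = (q * q) ^ k" for k by (simp add: power_mult power2_eq_square)
    ultimately have 1: "q ^ (2 * k) \<in> Z" for k by simp
    show ?thesis
    proof (cases "even j")
      case True then show ?thesis using 1 by (auto simp: cls_def elim!: evenE)
    next
      case False then show ?thesis using 1 by (force simp: cls_def elim!: oddE)
    qed
  qed
  have "f s' \<in> cls (\<pi> (concat s'))" for s'
  proof (cases "s' \<in> ST N (Suc n) \<and> map st s' = s")
    case True
    then have "f s' = q ^ sum_list (map iv s')" by (simp add: f_def symp_explicit unit_fun_def)
    moreover have "iv (concat s') = sum_list (map iv s') + iv (concat s)" using True iv_concat[of s'] by simp
    then have "\<pi> (concat s') = even (sum_list (map iv s'))" by (cases "even (iv (concat s))") (simp_all add: \<pi>_def)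
    ultimately show ?thesis using qj by simp
  next
    case False
    then have "f s' = 0" by (auto simp: f_def symp_explicit unit_fun_def)
    then show ?thesis using gradedD(1)[OF g] by simp
  qed
  then have "actw (xr (sig 1 q)) Q (pos v) f s \<in> cls (\<pi> (concat s))"
  proof (rule graded_actw_strand[OF g])
    have "\<pi> = (\<lambda>z. even (iv z + iv (concat s)))" by (rule ext) (rule \<pi>_def)
    then show "flips \<pi>" by (simp only: flips_iv)
  qed
  moreover have "actw (xr (sig 1 q)) Q (pos v) f s = MM (unit_fun s) s"
    unfolding MM_def mop_def[OF q Q] using fl_cong[OF fl_bop[OF q Q s, of v], of f "symp q N (Suc n) (unit_fun s)"]
    by (simp add: f_def bop_def[OF q Q])
  ultimately show ?thesis by (simp add: cls_def \<pi>_def)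
qed

text \<open>After the full twist every cap carries \<open>q ^ (2 * m)\<close> with an integral
  cofactor, and \<open>sort_ideal\<close> turns this into a comparison with the sorted
  state.\<close>

lemma mop_divisible:
  assumes Z: "sub_ring Z" "q \<in> Z" and s: "s \<in> ST N (Suc n)" and s': "s' \<in> ST N (Suc n)"
    and s0: "s0 \<in> ST N (Suc n)" "concat s0 = st (concat s')"
  shows "\<exists>z\<in>Z. MM (unit_fun s) s' - q ^ iv (concat s') * MM (unit_fun s) s0 = q ^ (2 * m) * z"
proof -
  define f where "f = bop q v' Q (symp q N (Suc n) (unit_fun s))"
  \<comment> \<open>The function obtained from the letters \<open>v'\<close>, now read on all
    \<open>m\<close> points at once. The value zero at other lengths keeps it integral
    everywhere.\<close>
  define F where "F z = (if length z = m then f (chunks N (Suc n) z) else 0)" for z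
  have Ff: "F (concat t) = f t" if "t \<in> ST N (Suc n)" for t
    using ST_replicate(2)[OF that] chunks_concat[OF that] by (simp add: F_def m_def)
  have sf: "symp_fun q N (Suc n) f" unfolding f_def by (rule bop_symp_fun[OF q Q symp_fun_symp])
  have sF: "symp_fun q N (Suc n) (\<lambda>s. F (concat s))"
    unfolding symp_fun_def
  proof
    fix s assume s: "s \<in> ST N (Suc n)"
    show "F (concat s) = q ^ sum_list (map iv s) * F (concat (map st s))"
      unfolding Ff[OF s] Ff[OF map_st_ST[OF s]] by (rule symp_funD[OF sf s])
  qed
  have gF: "graded_fun (\<lambda>_. Z) (\<lambda>z. even (iv z + 0)) F"
  proof -
    have "f t \<in> Z" if t: "t \<in> ST N (Suc n)" for t
    proof -
      define h where "h s' = (if s' \<in> ST N (Suc n) then symp q N (Suc n) (unit_fun s) s' else 0)" for s'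
      have "h s' \<in> Z" for s' using Z
        by (auto simp: h_def symp_explicit unit_fun_def intro!: sub_ringD sub_ring_power)
      then have "actw (xr (sig 1 q)) Q (pos v') h t \<in> (\<lambda>_. Z) ((\<lambda>z. even (iv z + 0)) (concat t))"
        by (intro graded_actw_strand[OF graded_const[OF Z]]) (use flips_iv[of 0] in auto)
      moreover have "actw (xr (sig 1 q)) Q (pos v') h t = f t"
        unfolding f_def using fl_cong[OF fl_bop[OF q Q t, of v'], of h "symp q N (Suc n) (unit_fun s)"]
        by (simp add: h_def bop_def[OF q Q])
      ultimately show ?thesis by simp
    qed
    then show ?thesis using Z by (simp add: graded_fun_def F_def m_def chunks_ST sub_ringD del: chunks.simps)
  qed
  define G where "G = (rot q ^^ m) F"
  have MG: "MM (unit_fun s) t = G (concat t)" if t: "t \<in> ST N (Suc n)" for t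
  proof -
    have "MM (unit_fun s) t = actw (xr (sig 1 q)) Q (pos (concat (replicate (Suc n) [0..<n]))) f t"
      by (simp add: MM_def mop_def[OF q Q] bop_def[OF q Q] v_def pos_append actw_append f_def)
    also have "\<dots> = actw (xr (sig 1 q)) Q (pos (concat (replicate (Suc n) [0..<n]))) (\<lambda>s. F (concat s)) t"
      using fl_cong[OF fl_bop[OF q Q t, of "concat (replicate (Suc n) [0..<n])"], of f "\<lambda>s. F (concat s)"]
      by (simp add: Ff bop_def[OF q Q])
    also have "\<dots> = G (concat t)" unfolding G_def m_def by (rule strand_full_twist[OF q Q sF t])
    finally show ?thesis .
  qed
  define I where "I = {q ^ (2 * m) * z |z. z \<in> Z}"
  have I: "q_ideal q I"
    unfolding q_ideal_def I_def
  proof (intro conjI ballI)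
    show "0 \<in> {q ^ (2 * m) * z |z. z \<in> Z}" using sub_ringD(1)[OF Z(1)] by force
    fix a assume "a \<in> {q ^ (2 * m) * z |z. z \<in> Z}"
    then obtain z where z: "a = q ^ (2 * m) * z" "z \<in> Z" by blast
    have "q * a = q ^ (2 * m) * (q * z)" "q * z \<in> Z" using z Z by (auto intro: sub_ringD)
    then show "q * a \<in> {q ^ (2 * m) * z |z. z \<in> Z}" by blast
    fix b assume "b \<in> {q ^ (2 * m) * z |z. z \<in> Z}"
    then obtain y where y: "b = q ^ (2 * m) * y" "y \<in> Z" by blast
    have "a + b = q ^ (2 * m) * (z + y)" "z + y \<in> Z" using z y Z by (auto intro: sub_ringD simp: algebra_simps)
    then show "a + b \<in> {q ^ (2 * m) * z |z. z \<in> Z}" by blast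
  qed
  let ?z = "concat s'"
  have lz: "length ?z = m" using ST_replicate(2)[OF s'] by (simp add: m_def)
  have "G ?z - symz q m G ?z \<in> I"
  proof (rule sort_ideal[OF I])
    fix i and y :: "bool list" assume i: "Suc i < m" and y: "Suc (Suc (length y)) = length ?z"
    have "graded_fun (\<lambda>_. Z) (\<lambda>z. even (iv z + 0)) (cap q i F)"
    proof -
      have "cap q i F z \<in> Z" if "\<And>z. F z \<in> Z" for i z and F :: "bool list \<Rightarrow> 'a"
        using that Z by (induction q i F z rule: cap.induct) (auto intro!: sub_ringD)
      then show ?thesis using gF by (simp add: graded_fun_def)
    qed
    from graded_rots[OF graded_const[OF Z] this flips_iv, of "length y"]
    have "(rot q ^^ length y) (cap q i F) y \<in> Z" by (simp add: graded_fun_def)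
    moreover have "cap q i G y = q ^ (2 * m) * (rot q ^^ length y) (cap q i F) y"
      using cap_full_twist[of i y q F] i y lz by (simp add: G_def)
    ultimately show "cap q i G y \<in> I" by (auto simp: I_def)
  qed (simp add: lz)
  moreover have "symz q m G ?z = q ^ iv ?z * G (st ?z)"
    by (rule symz_full) (simp add: lz blists_def)
  ultimately show ?thesis using MG[OF s'] MG[OF s0(1)] s0(2) by (auto simp: I_def)
qed

lemma cap_out: "length x < i \<Longrightarrow> cap q i f x = 0"
  by (induction i arbitrary: x f) (auto split: list.split, case_tac x, auto)

text \<open>Such an \<open>F\<close> is killed by caps even across the borders of cables, hence the
  elementary crossings that make up a crossing of cables all fix it.\<close>

lemma act_xr_fixed:
  "(\<And>p s. F (p @ False # True # s) = q * F (p @ True # False # s)) \<Longrightarrow>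
   act (xr (sig 1 q)) i (\<lambda>s. F (concat s)) s = F (concat s)"
proof (induction i arbitrary: F s)
  case 0
  show ?case
  proof (cases "\<exists>x y s'. s = x # y # s'")
    case True
    then obtain x y s' where s: "s = x # y # s'" by blast
    let ?G = "\<lambda>z. F (z @ concat s')"
    have c: "cap q i ?G z = 0" for i z
    proof (cases "i \<le> length z")
      case True
      then have "z = take i z @ drop i z" "length (take i z) = i" by auto
      then show ?thesis using cap_append[of q "take i z" ?G "drop i z"] 0[of "take i z" "drop i z @ concat s'"] by simp
    next
      case False then show ?thesis using cap_out by simp
    qed
    have "xr (sig 1 q) (\<lambda>u v. ?G (u @ v)) x y = actw (sig 1 q) (sig 1 q) (pos (wd (length x) (length y))) ?G (x @ y)"
      using actw_xr[OF lin2_sig, of 1 q "sig 1 q" x y ?G "[]"] by simp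
    also have "\<dots> = ?G (x @ y)"
      by (rule cap_zero_actw[OF lin2_sig]) (use c in auto)
    finally show ?thesis by (simp add: s)
  next
    case False
    then show ?thesis by (cases "(xr (sig 1 q), 0 :: nat, \<lambda>s. F (concat s), s)" rule: act.cases) auto
  qed
next
  case (Suc i)
  show ?case
  proof (cases s)
    case (Cons x s')
    have "act (xr (sig 1 q)) i (\<lambda>s. (\<lambda>z. F (x @ z)) (concat s)) s' = F (x @ concat s')"
      by (rule Suc.IH) (use Suc.prems[of "x @ _"] in simp)
    then show ?thesis by (simp add: Cons)
  qed simp
qed

text \<open>
  The difference between a state and \<open>q ^ iv\<close> times its sorted form factors through cups.  Pulling a cap
  through the full twist on \<open>m\<close> points costs \<open>q ^ (2 * m)\<close>, and a state with a cup contains a \<open>True\<close>,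
  so that its weight contributes a further \<open>q\<^sup>2\<close>.
\<close>

lemma trace_estimate:
  assumes Z: "sub_ring Z" "q \<in> Z"
  shows "\<exists>h\<in>Z. (\<Sum>s\<in>ST N (Suc n). q ^ (2 * ones (concat s)) * MM (unit_fun s) s) = (\<Sum>k\<le>m. q ^ (2 * k)) + q ^ (2 * Suc m) * h"
proof -
  let ?S = "ST N (Suc n)"
  define s0 where "s0 k = chunks N (Suc n) (xk m k)" for k
  have s0: "s0 k \<in> ?S" "concat (s0 k) = xk m k" if "k \<le> m" for k
  proof -
    have "length (xk m k) = N * Suc n" using that by (simp add: xk_def m_def[symmetric] del: mult_Suc_right)
    then show "s0 k \<in> ?S" "concat (s0 k) = xk m k" unfolding s0_def by (rule chunks_ST, rule concat_chunks)
  qed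
  have lc: "length (concat s) = m" if "s \<in> ?S" for s using ST_replicate(2)[OF that] by (simp add: m_def)
  have ol: "ones (concat s) \<le> m" if "s \<in> ?S" for s using ones_le[of "concat s"] lc[OF that] by simp
  have sc: "st (concat s) = xk m (ones (concat s))" if "s \<in> ?S" for s
    by (rule st_xk) (simp add: blists_def lc[OF that])
  \<comment> \<open>The weight vector with \<open>k\<close> entries \<open>True\<close> in the
    symmetric power of all \<open>m\<close> points.\<close>
  define F where "F k z = (if ones z = k then q ^ iv z else 0)" for k z
  define D where "D s = MM (unit_fun s) s - q ^ iv (concat s) * MM (unit_fun s) (s0 (ones (concat s)))" for s
  \<comment> \<open>The braid and the projections fix this weight vector, and its value at the
    sorted state is 1. These are the terms of the leading part.\<close>
  have MF: "MM (\<lambda>s. F k (concat s)) (s0 k) = 1" if k: "k \<le> m" for k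
  proof -
    have sy: "symp_fun q N (Suc n) (\<lambda>s. F k (concat s))"
      unfolding symp_fun_def
    proof
      fix s :: "bool list list"
      have "ones (concat s) = ones (concat (map st s))" by (induction s) auto
      then show "F k (concat s) = q ^ sum_list (map iv s) * F k (concat (map st s))"
        using iv_concat[of s] by (simp add: F_def power_add)
    qed
    have "actw (xr (sig 1 q)) Q (pos w) (\<lambda>s. F k (concat s)) = (\<lambda>s. F k (concat s))" for w
    proof (induction w)
      case (Cons i w)
      have "act (xr (sig 1 q)) i (\<lambda>s. F k (concat s)) s = F k (concat s)" for s
        by (rule act_xr_fixed) (simp add: F_def iv_swap)
      then have "act (xr (sig 1 q)) i (\<lambda>s. F k (concat s)) = (\<lambda>s. F k (concat s))" by (rule ext)
      moreover have "actw (xr (sig 1 q)) Q (pos (i # w)) (\<lambda>s. F k (concat s)) = act (xr (sig 1 q)) i (actw (xr (sig 1 q)) Q (pos w) (\<lambda>s. F k (concat s)))"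
        by (simp add: pos_def)
      ultimately show ?case unfolding Cons by simp
    qed (simp add: pos_def)
    moreover have "MM (\<lambda>s. F k (concat s)) (s0 k) = bop q v Q (\<lambda>s. F k (concat s)) (s0 k)"
      unfolding MM_def mop_def[OF q Q] by (rule fl_cong[OF fl_bop[OF q Q s0(1)[OF k]]]) (rule symp_fixed[OF sy])
    ultimately show ?thesis using s0(2)[OF k] by (simp add: bop_def[OF q Q] F_def)
  qed
  have "\<exists>h\<in>Z. q ^ (2 * ones (concat s)) * D s = q ^ (2 * Suc m) * h" if s: "s \<in> ?S" for s
  proof (cases "ones (concat s) = 0")
    \<comment> \<open>The single state without \<open>True\<close> could not supply the further
      factor \<open>q * q\<close>, but it is sorted already, so its difference is zero.\<close>
    case True
    have z: "concat s = replicate (length (concat s)) False" if "ones (concat s) = 0"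
    proof -
      have "ones z = 0 \<Longrightarrow> z = replicate (length z) False" for z by (induction z) (auto split: if_splits)
      then show ?thesis using that by blast
    qed
    have c: "concat s = xk m 0" using z[OF True] lc[OF s] by (simp add: xk_def)
    have "s0 0 = chunks N (Suc n) (concat s)" unfolding s0_def c ..
    then have "s0 0 = s" using chunks_concat[OF s] by simp
    then have "D s = 0" using True c by (simp add: D_def)
    then show ?thesis using sub_ringD(1)[OF Z(1)] by (intro bexI[of _ 0]) auto
  next
    case False
    then obtain j where j: "ones (concat s) = Suc j" by (cases "ones (concat s)") auto
    obtain z where z: "z \<in> Z" "D s = q ^ (2 * m) * z"
      using mop_divisible[OF Z s s s0(1)[OF ol[OF s]]] s0(2)[OF ol[OF s]] sc[OF s] by (auto simp: D_def)
    have "q ^ (2 * ones (concat s)) * D s = q ^ (2 * Suc m) * (q ^ (2 * j) * z)"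
      unfolding z j by (simp add: power_add algebra_simps)
    then show ?thesis using z Z by (intro bexI[of _ "q ^ (2 * j) * z"]) (auto intro!: sub_ringD sub_ring_power)
  qed
  then obtain h where h: "\<And>s. s \<in> ?S \<Longrightarrow> h s \<in> Z" "\<And>s. s \<in> ?S \<Longrightarrow> q ^ (2 * ones (concat s)) * D s = q ^ (2 * Suc m) * h s" by metis
  have "(\<Sum>s\<in>?S. q ^ (2 * ones (concat s)) * MM (unit_fun s) s) =
     (\<Sum>s\<in>?S. q ^ (2 * ones (concat s)) * D s) + (\<Sum>s\<in>?S. q ^ (2 * ones (concat s)) * (q ^ iv (concat s) * MM (unit_fun s) (s0 (ones (concat s)))))"
    unfolding sum.distrib[symmetric] by (rule sum.cong[OF HOL.refl]) (simp add: D_def algebra_simps)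
  also have "(\<Sum>s\<in>?S. q ^ (2 * ones (concat s)) * D s) = q ^ (2 * Suc m) * (\<Sum>s\<in>?S. h s)"
    unfolding sum_distrib_left by (rule sum.cong[OF HOL.refl]) (rule h(2))
  also have "(\<Sum>s\<in>?S. q ^ (2 * ones (concat s)) * (q ^ iv (concat s) * MM (unit_fun s) (s0 (ones (concat s))))) =
     (\<Sum>s\<in>?S. \<Sum>k\<le>m. q ^ (2 * k) * (MM (unit_fun s) (s0 k) * F k (concat s)))"
  proof (rule sum.cong[OF HOL.refl])
    fix s assume s: "s \<in> ?S"
    have "(\<Sum>k\<le>m. q ^ (2 * k) * (MM (unit_fun s) (s0 k) * F k (concat s))) =
      (\<Sum>k\<le>m. if k = ones (concat s) then q ^ (2 * ones (concat s)) * (q ^ iv (concat s) * MM (unit_fun s) (s0 (ones (concat s)))) else 0)"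
      by (rule sum.cong[OF HOL.refl]) (auto simp: F_def)
    also have "\<dots> = q ^ (2 * ones (concat s)) * (q ^ iv (concat s) * MM (unit_fun s) (s0 (ones (concat s))))"
      using ol[OF s] by simp
    finally show "q ^ (2 * ones (concat s)) * (q ^ iv (concat s) * MM (unit_fun s) (s0 (ones (concat s)))) =
      (\<Sum>k\<le>m. q ^ (2 * k) * (MM (unit_fun s) (s0 k) * F k (concat s)))" ..
  qed
  also have "\<dots> = (\<Sum>k\<le>m. \<Sum>s\<in>?S. q ^ (2 * k) * (MM (unit_fun s) (s0 k) * F k (concat s)))" by (rule sum.swap)
  also have "\<dots> = (\<Sum>k\<le>m. q ^ (2 * k))"
  proof (rule sum.cong[OF HOL.refl])
    fix k assume "k \<in> {..m}"
    then have k: "k \<le> m" by simp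
    \<comment> \<open>With the weight vector as coefficients, the entries of \<open>MM\<close> sum
      up to its value on this vector.\<close>
    have "(\<Sum>s\<in>?S. MM (unit_fun s) (s0 k) * F k (concat s)) = MM (\<lambda>s. F k (concat s)) (s0 k)"
      unfolding MM_def by (rule fl_kernel[OF fl_mop[OF q Q s0(1)[OF k]], symmetric])
    then show "(\<Sum>s\<in>?S. q ^ (2 * k) * (MM (unit_fun s) (s0 k) * F k (concat s))) = q ^ (2 * k)"
      by (simp add: sum_distrib_left[symmetric] MF[OF k])
  qed
  finally have "(\<Sum>s\<in>?S. q ^ (2 * ones (concat s)) * MM (unit_fun s) s) = (\<Sum>k\<le>m. q ^ (2 * k)) + q ^ (2 * Suc m) * (\<Sum>s\<in>?S. h s)"
    by (simp only: add.commute)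
  moreover have "(\<Sum>s\<in>?S. h s) \<in> Z" by (rule sub_ring_sum[OF Z(1)]) (rule h(1))
  ultimately show ?thesis by blast
qed

end

section \<open>Uniqueness of the Markov trace\<close>

text \<open>In \<open>f m w\<close> the word \<open>w\<close> lists Temperley-Lieb generators on
  \<open>m\<close> points, numbered from 0. The last two clauses remove a free strand and the last
  generator.\<close>

definition markov :: "'a::comm_ring_1 \<Rightarrow> (nat \<Rightarrow> nat list \<Rightarrow> 'a) \<Rightarrow> bool" where
  "markov d f \<longleftrightarrow> f 0 [] = 1 \<and>
    (\<forall>m u v. f m (u @ v) = f m (v @ u)) \<and>
    (\<forall>m u v i. Suc i < m \<longrightarrow> f m (u @ [i, i] @ v) = d * f m (u @ [i] @ v)) \<and>
    (\<forall>m u v i. Suc (Suc i) < m \<longrightarrow> f m (u @ [i, Suc i, i] @ v) = f m (u @ [i] @ v)) \<and>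
    (\<forall>m u v i. Suc (Suc i) < m \<longrightarrow> f m (u @ [Suc i, i, Suc i] @ v) = f m (u @ [Suc i] @ v)) \<and>
    (\<forall>m u v i j. Suc (Suc i) \<le> j \<longrightarrow> f m (u @ [i, j] @ v) = f m (u @ [j, i] @ v)) \<and>
    (\<forall>m w. (\<forall>i\<in>set w. Suc i < m) \<longrightarrow> f (Suc m) w = d * f m w) \<and>
    (\<forall>m w. (\<forall>i\<in>set w. i < m) \<longrightarrow> f (Suc (Suc m)) (m # w) = f (Suc m) w)"

text \<open>The index counts the closed loops removed on the way, so that the loop value itself
  stays out of the relation.\<close>

inductive tl_eq :: "nat \<Rightarrow> nat \<Rightarrow> nat list \<Rightarrow> nat list \<Rightarrow> bool" for M where
  tl_refl: "tl_eq M 0 u u"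
| tl_trans: "tl_eq M k u v \<Longrightarrow> tl_eq M l v w \<Longrightarrow> tl_eq M (k + l) u w"
| tl_context: "tl_eq M k u v \<Longrightarrow> tl_eq M k (a @ u @ b) (a @ v @ b)"
| tl_square: "i < M \<Longrightarrow> tl_eq M (Suc 0) [i, i] [i]"
| tl_up: "Suc i < M \<Longrightarrow> tl_eq M 0 [i, Suc i, i] [i]"
| tl_down: "Suc i < M \<Longrightarrow> tl_eq M 0 [Suc i, i, Suc i] [Suc i]"
| tl_far: "Suc (Suc i) \<le> j \<Longrightarrow> tl_eq M 0 [i, j] [j, i]"
| tl_far': "Suc (Suc i) \<le> j \<Longrightarrow> tl_eq M 0 [j, i] [i, j]"

lemma tl_eq_mono: "tl_eq M k u v \<Longrightarrow> M \<le> M' \<Longrightarrow> tl_eq M' k u v"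
  by (induction rule: tl_eq.induct) (auto intro: tl_eq.intros)

lemma tl_eq_markov:
  assumes f: "markov d f"
  shows "tl_eq M k u v \<Longrightarrow> M < m \<Longrightarrow> f m (a @ u @ b) = d ^ k * f m (a @ v @ b)"
proof (induction arbitrary: a b rule: tl_eq.induct)
  case (tl_context k u v a' b')
  then show ?case using tl_context.IH[of "a @ a'" "b' @ b"] by simp
next
  case (tl_square i)
  then show ?case using f unfolding markov_def by auto
next
  case (tl_up i)
  then show ?case using f unfolding markov_def by auto
next
  case (tl_down i)
  then show ?case using f unfolding markov_def by auto
next
  case (tl_far i j)
  have "f m (a @ [i, j] @ b) = f m (a @ [j, i] @ b)" using f tl_far unfolding markov_def by blast
  then show ?case by simp
next
  case (tl_far' i j)
  have "f m (a @ [i, j] @ b) = f m (a @ [j, i] @ b)" using f tl_far' unfolding markov_def by blast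
  then show ?case by simp
qed (auto simp: power_add mult.assoc)

lemma tl_commute: "(\<And>i. i \<in> set u \<Longrightarrow> Suc i < m) \<Longrightarrow> tl_eq M 0 (m # u) (u @ [m])"
proof (induction u)
  case Nil then show ?case using tl_refl[of M "[m]"] by simp
next
  case (Cons i u)
  have "tl_eq M 0 ([] @ [m, i] @ u) ([] @ [i, m] @ u)"
    by (rule tl_context, rule tl_far') (use Cons.prems[of i] in simp)
  moreover have "tl_eq M 0 ([i] @ (m # u) @ []) ([i] @ (u @ [m]) @ [])"
    by (rule tl_context) (use Cons in auto)
  ultimately show ?case using tl_trans[of M 0 _ _ 0] by fastforce
qed

text \<open>Jones' normal form: the highest generator is needed at most once. Between two copies of
  it the next lower one occurs at most once by induction; if it does not occur, the copies meet and
  \<open>tl_square\<close> applies, otherwise \<open>tl_down\<close> does.\<close>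

lemma tl_reduce:
  "set w \<subseteq> {..<Suc m} \<Longrightarrow> \<exists>l w'. tl_eq (Suc m) l w w' \<and>
     (set w' \<subseteq> {..<m} \<or> (\<exists>u v. w' = u @ [m] @ v \<and> set u \<subseteq> {..<m} \<and> set v \<subseteq> {..<m}))"
proof (induction m arbitrary: w)
  case 0
  then show ?case
  proof (induction w)
    case Nil then show ?case using tl_refl by force
  next
    case (Cons i w)
    then have i: "i = 0" by simp
    obtain l w' where w': "tl_eq (Suc 0) l w w'" "set w' \<subseteq> {..<0} \<or> (\<exists>u v. w' = u @ [0] @ v \<and> set u \<subseteq> {..<0} \<and> set v \<subseteq> {..<0})"
      using Cons by auto
    have c: "tl_eq (Suc 0) l (0 # w) (0 # w')" using tl_context[OF w'(1), of "[0]" "[]"] by simp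
    from w'(2) have "w' = [] \<or> w' = [0]" by auto
    then show ?case
    proof
      assume "w' = []" then show ?thesis using c i by force
    next
      assume "w' = [0]"
      then have "tl_eq (Suc 0) (l + Suc 0) (0 # w) [0]" using tl_trans[OF c, of "Suc 0" "[0]"] tl_square[of 0 "Suc 0"] by simp
      then show ?thesis using i by force
    qed
  qed
next
  case (Suc m)
  note IHm = Suc.IH
  from Suc.prems show ?case
  proof (induction w)
    case Nil then show ?case using tl_refl by force
  next
    case (Cons i w)
    let ?m = "Suc m" and ?M = "Suc (Suc m)"
    obtain l w' where w': "tl_eq ?M l w w'" "set w' \<subseteq> {..<?m} \<or> (\<exists>u v. w' = u @ [?m] @ v \<and> set u \<subseteq> {..<?m} \<and> set v \<subseteq> {..<?m})"
      using Cons by auto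
    have c: "tl_eq ?M l (i # w) (i # w')" using tl_context[OF w'(1), of "[i]" "[]"] by simp
    show ?case
    proof (cases "i = ?m")
      case False
      then have i: "i < ?m" using Cons.prems by auto
      from w'(2) show ?thesis
      proof (elim disjE exE conjE)
        assume "set w' \<subseteq> {..<?m}"
        then show ?thesis using c i by (intro exI[of _ l] exI[of _ "i # w'"]) auto
      next
        fix u v assume "w' = u @ [?m] @ v" "set u \<subseteq> {..<?m}" "set v \<subseteq> {..<?m}"
        then have "i # w' = (i # u) @ [?m] @ v \<and> set (i # u) \<subseteq> {..<?m} \<and> set v \<subseteq> {..<?m}" using i by auto
        then show ?thesis using c by blast
      qed
    next
      case i: True
      from w'(2) show ?thesis
      proof (elim disjE exE conjE)
        assume "set w' \<subseteq> {..<?m}"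
        then have "i # w' = [] @ [?m] @ w' \<and> set ([] :: nat list) \<subseteq> {..<?m} \<and> set w' \<subseteq> {..<?m}" using i by auto
        then show ?thesis using c by blast
      next
        fix u v assume uv: "w' = u @ [?m] @ v" "set u \<subseteq> {..<?m}" "set v \<subseteq> {..<?m}"
        obtain k u' where u': "tl_eq (Suc m) k u u'"
           "set u' \<subseteq> {..<m} \<or> (\<exists>a b. u' = a @ [m] @ b \<and> set a \<subseteq> {..<m} \<and> set b \<subseteq> {..<m})"
          using IHm[OF uv(2)] by blast
        have "tl_eq ?M k ([?m] @ u @ ([?m] @ v)) ([?m] @ u' @ ([?m] @ v))"
          by (rule tl_context[OF tl_eq_mono[OF u'(1)]]) simp
        then have c2: "tl_eq ?M (l + k) (i # w) (?m # u' @ [?m] @ v)" using tl_trans[OF c] i uv by simp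
        from u'(2) show ?thesis
        proof (elim disjE exE conjE)
          assume su: "set u' \<subseteq> {..<m}"
          have "tl_eq ?M 0 ([] @ (?m # u') @ ([?m] @ v)) ([] @ (u' @ [?m]) @ ([?m] @ v))"
            by (rule tl_context, rule tl_commute) (use su in auto)
          moreover have "tl_eq ?M (Suc 0) (u' @ [?m, ?m] @ v) (u' @ [?m] @ v)"
            by (rule tl_context, rule tl_square) simp
          ultimately have "tl_eq ?M (0 + Suc 0) (?m # u' @ [?m] @ v) (u' @ [?m] @ v)" using tl_trans[of ?M 0 "?m # u' @ [?m] @ v"] by fastforce
          from tl_trans[OF c2 this] show ?thesis using su uv by fastforce
        next
          fix a b assume ab: "u' = a @ [m] @ b" "set a \<subseteq> {..<m}" "set b \<subseteq> {..<m}"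
          have 1: "tl_eq ?M 0 ([] @ (?m # a) @ ([m] @ b @ [?m] @ v)) ([] @ (a @ [?m]) @ ([m] @ b @ [?m] @ v))"
            by (rule tl_context, rule tl_commute) (use ab in auto)
          \<comment> \<open>The commutation of \<open>tl_commute\<close> in the opposite
            direction.\<close>
          have bc: "tl_eq ?M 0 (b @ [?m]) (?m # b)"
          proof -
            have "(\<And>i. i \<in> set b \<Longrightarrow> Suc i < ?m) \<Longrightarrow> tl_eq ?M 0 (b @ [?m]) (?m # b)" for b
            proof (induction b)
              case Nil then show ?case using tl_refl[of ?M "[?m]"] by simp
            next
              case (Cons i b)
              have "tl_eq ?M 0 ([i] @ (b @ [?m]) @ []) ([i] @ (?m # b) @ [])"
                by (rule tl_context) (use Cons in auto)
              moreover have "tl_eq ?M 0 ([] @ [i, ?m] @ b) ([] @ [?m, i] @ b)"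
                by (rule tl_context, rule tl_far) (use Cons.prems[of i] in simp)
              ultimately show ?case using tl_trans[of ?M 0 "i # b @ [?m]" "i # ?m # b" 0] by simp
            qed
            then show ?thesis using ab by auto
          qed
          have 2: "tl_eq ?M 0 ((a @ [?m, m]) @ (b @ [?m]) @ v) ((a @ [?m, m]) @ (?m # b) @ v)"
            by (rule tl_context[OF bc])
          have 3: "tl_eq ?M 0 (a @ [?m, m, ?m] @ (b @ v)) (a @ [?m] @ (b @ v))"
            by (rule tl_context, rule tl_down) simp
          have "tl_eq ?M (0 + 0) (?m # u' @ [?m] @ v) ((a @ [?m, m]) @ (?m # b) @ v)"
            using tl_trans[OF 1[unfolded append.simps append.assoc] 2[unfolded append.simps append.assoc]] ab by simp
          from tl_trans[OF this, of 0 "a @ [?m] @ b @ v"] 3 have "tl_eq ?M 0 (?m # u' @ [?m] @ v) (a @ [?m] @ (b @ v))" by simp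
          from tl_trans[OF c2 this] show ?thesis using ab uv by fastforce
        qed
      qed
    qed
  qed
qed

text \<open>The exponent is chosen before \<open>f\<close> and \<open>d\<close>. So its value, once
  found for one Markov trace, holds for every other one.\<close>

lemma markov_unique:
  "set w \<subseteq> {..<m} \<Longrightarrow> \<exists>l. \<forall>(f :: nat \<Rightarrow> nat list \<Rightarrow> 'a::comm_ring_1) d. markov d f \<longrightarrow> f (Suc m) w = d ^ l"
proof (induction m arbitrary: w)
  case 0
  then have w: "w = []" by simp
  have "f (Suc 0) w = d ^ 1" if "markov d f" for d :: 'a and f
  proof -
    have "f (Suc 0) [] = d * f 0 []" "f 0 [] = 1" using that unfolding markov_def by (metis empty_iff empty_set)+
    then show ?thesis by (simp add: w)
  qed
  then show ?case by blast
next
  case (Suc m)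
  obtain k w' where w': "tl_eq (Suc m) k w w'"
    "set w' \<subseteq> {..<m} \<or> (\<exists>u v. w' = u @ [m] @ v \<and> set u \<subseteq> {..<m} \<and> set v \<subseteq> {..<m})"
    using tl_reduce[OF Suc.prems] by blast
  have 1: "f (Suc (Suc m)) w = d ^ k * f (Suc (Suc m)) w'" if "markov d f" for f and d :: 'a
    using tl_eq_markov[OF that w'(1), of "Suc (Suc m)" "[]" "[]"] by simp
  from w'(2) show ?case
  proof (elim disjE exE conjE)
    assume s: "set w' \<subseteq> {..<m}"
    obtain l where l: "\<And>(f :: nat \<Rightarrow> nat list \<Rightarrow> 'a) d. markov d f \<Longrightarrow> f (Suc m) w' = d ^ l" using Suc.IH[OF s] by blast
    have 2: "f (Suc (Suc m)) w' = d * f (Suc m) w'" if "markov d f" for f and d :: 'a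
      using that s unfolding markov_def by (metis Suc_mono lessThan_iff subsetD)
    have "f (Suc (Suc m)) w = d ^ (k + Suc l)" if "markov d f" for f and d :: 'a
      unfolding 1[OF that] 2[OF that] l[OF that] by (simp add: power_add)
    then show ?thesis by blast
  next
    fix u v assume uv: "w' = u @ [m] @ v" "set u \<subseteq> {..<m}" "set v \<subseteq> {..<m}"
    obtain l where l: "\<And>(f :: nat \<Rightarrow> nat list \<Rightarrow> 'a) d. markov d f \<Longrightarrow> f (Suc m) (v @ u) = d ^ l"
      using Suc.IH[of "v @ u"] uv by auto
    have 2: "f (Suc (Suc m)) w' = f (Suc m) (v @ u)" if f: "markov d f" for f and d :: 'a
    proof -
      have c: "\<forall>m u v. f m (u @ v) = f m (v @ u)" using f unfolding markov_def by (elim conjE)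
      have "f (Suc (Suc m)) (u @ ([m] @ v)) = f (Suc (Suc m)) (([m] @ v) @ u)" by (rule c[rule_format])
      also have "\<dots> = f (Suc (Suc m)) (m # (v @ u))" by simp
      also have "\<dots> = f (Suc m) (v @ u)"
      proof -
        have "\<forall>i\<in>set (v @ u). i < m" using uv by auto
        then show ?thesis using f unfolding markov_def by blast
      qed
      finally show ?thesis using uv by simp
    qed
    have "f (Suc (Suc m)) w = d ^ (k + l)" if "markov d f" for f and d :: 'a
      unfolding 1[OF that] 2[OF that] l[OF that] by (simp add: power_add)
    then show ?thesis by blast
  qed
qed

section \<open>Vertex models for the Temperley--Lieb algebra\<close>

definition mt :: "(bool \<Rightarrow> 'a::field) \<Rightarrow> (bool, 'a) pair_op \<Rightarrow> nat \<Rightarrow> nat list \<Rightarrow> 'a" where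
  "mt \<kappa> e m w = tr (blists m) (\<lambda>f s. wtl \<kappa> s * actw e e (pos w) f s)"

text \<open>Conditions on a single generator that make \<open>mt\<close> a Markov trace. The last
  one says that closing the right point of \<open>e\<close> with the weight \<open>\<kappa>\<close>
  gives the identity.\<close>

definition tl_op :: "'a::field \<Rightarrow> (bool \<Rightarrow> 'a) \<Rightarrow> (bool, 'a) pair_op \<Rightarrow> bool" where
  "tl_op d \<kappa> e \<longleftrightarrow> lin2 e \<and> weight_op \<kappa> e \<and> \<kappa> True + \<kappa> False = d \<and>
    (\<forall>g x y. e (\<lambda>u v. e g u v) x y = d * e g x y) \<and>
    (\<forall>h x y z. e (\<lambda>u v. e (\<lambda>v' w. e (\<lambda>u' v''. h u' v'' w) u v') v z) x y = e (\<lambda>u v. h u v z) x y) \<and>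
    (\<forall>h x y z. e (\<lambda>v w. e (\<lambda>u' v'. e (\<lambda>v'' w'. h u' v'' w') v' w) x v) y z = e (\<lambda>v w. h x v w) y z) \<and>
    (\<forall>h y. (\<Sum>x\<in>UNIV. \<kappa> x * e (\<lambda>u v. if v = x then h u else 0) y x) = h y)"

lemma act_append_last: "Suc i < length s \<Longrightarrow> act R i f (s @ r) = act R i (\<lambda>s. f (s @ r)) s"
proof (induction i arbitrary: f s)
  case 0
  then obtain x y s' where "s = x # y # s'" by (cases s; cases "tl s") auto
  then show ?case by simp
next
  case (Suc i) then show ?case by (cases s) auto
qed

lemma act_length:
  assumes "lin2 R" "\<And>s. length s = n \<Longrightarrow> f s = g s" "length s = n" shows "act R i f s = act R i g s"
  by (rule fl_cong[OF fl_act_bool[OF assms(1)]]) (use assms in \<open>auto simp: blists_def\<close>)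

lemma actw_append_last:
  assumes "lin2 e"
  shows "\<forall>i\<in>set w. Suc i < length s \<Longrightarrow> actw e e (pos w) f (s @ r) = actw e e (pos w) (\<lambda>s. f (s @ r)) s"
proof (induction w arbitrary: s)
  case (Cons i w)
  have "act e i (actw e e (pos w) f) (s @ r) = act e i (\<lambda>s. actw e e (pos w) f (s @ r)) s"
    by (rule act_append_last) (use Cons in auto)
  also have "\<dots> = act e i (actw e e (pos w) (\<lambda>s. f (s @ r))) s"
    by (rule act_length[OF assms]) (use Cons in auto)
  finally show ?case by (simp add: pos_def)
qed (simp add: pos_def)

lemma sum_blists_last: "(\<Sum>s\<in>blists (Suc m). F s) = (\<Sum>s\<in>blists m. \<Sum>x\<in>UNIV. F (s @ [x]))"
proof -
  have "blists (Suc m) = (\<lambda>(s, x). s @ [x]) ` (blists m \<times> UNIV)"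
  proof
    show "blists (Suc m) \<subseteq> (\<lambda>(s, x). s @ [x]) ` (blists m \<times> UNIV)"
    proof
      fix z assume "z \<in> blists (Suc m)"
      then show "z \<in> (\<lambda>(s, x). s @ [x]) ` (blists m \<times> UNIV)"
        by (cases z rule: rev_cases) (auto simp: blists_def image_iff)
    qed
  qed (auto simp: blists_def)
  then show ?thesis
    by (simp add: sum.reindex inj_on_def sum.cartesian_product case_prod_beta comp_def)
qed

lemma wtl_wts: "wtl \<chi> = wts \<chi>" by (auto simp: wtl_def wts_def)

lemma actw_weight:
  assumes "lin2 e" "weight_op \<kappa> e"
  shows "actw e e (pos w) (\<lambda>s. wtl \<kappa> s * f s) s = wtl \<kappa> s * actw e e (pos w) f s"
proof (induction w arbitrary: s)
  case (Cons i w)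
  have "actw e e (pos w) (\<lambda>s. wtl \<kappa> s * f s) = (\<lambda>s. wtl \<kappa> s * actw e e (pos w) f s)" by (rule ext) (rule Cons)
  then show ?case using weight_act[OF assms(2) fl2_scale_app[OF lin2D[OF assms(1)]], of i "actw e e (pos w) f" s]
    by (simp add: pos_def wtl_wts)
qed (simp add: pos_def)

lemma mt_context:
  assumes e: "lin2 e" and "\<And>f s. length s = m \<Longrightarrow> actw e e (pos w) f s = c * actw e e (pos w') f s"
  shows "mt \<kappa> e m (u @ w @ v) = c * mt \<kappa> e m (u @ w' @ v)"
proof -
  have "actw e e (pos (u @ w @ v)) f s = c * actw e e (pos (u @ w' @ v)) f s" if "length s = m" for f s
  proof -
    have "actw e e (pos u) (actw e e (pos w) (actw e e (pos v) f)) s = actw e e (pos u) (\<lambda>s. c * actw e e (pos w') (actw e e (pos v) f) s) s"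
      by (rule actw_bool_cong[OF e e, of m]) (use assms that in auto)
    also have "\<dots> = c * actw e e (pos u) (actw e e (pos w') (actw e e (pos v) f)) s"
      by (rule fl_scale_app[OF fl_actw_bool[OF e e, of s "length s"]]) (simp add: blists_def)
    finally show ?thesis by (simp add: pos_append actw_append)
  qed
  then show ?thesis unfolding mt_def
    by (subst tr_scale[symmetric], intro tr_cong) (simp add: blists_def mult_ac)
qed

lemma act_three:
  assumes "\<And>h x y z. Z h x y z = Z' h x y z"
  and "\<And>f x y z s. act A' 0 (act B' (Suc 0) (act C' 0 f)) (x # y # z # s) = Z (\<lambda>a b c. f (a # b # c # s)) x y z"
  and "\<And>f x y z s. act D' 0 f (x # y # z # s) = Z' (\<lambda>a b c. f (a # b # c # s)) x y z"
  shows "Suc (Suc i) < length s \<Longrightarrow> act A' i (act B' (Suc i) (act C' i f)) s = act D' i f s"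
proof (induction i arbitrary: f s)
  case 0
  obtain x s1 where s1: "s = x # s1" "Suc 0 < length s1" using 0 by (cases s) auto
  obtain y s2 where s2: "s1 = y # s2" "0 < length s2" using s1 by (cases s1) auto
  obtain z s' where "s2 = z # s'" using s2 by (cases s2) auto
  with s1 s2 have "s = x # y # z # s'" by simp
  then show ?case using assms by simp
next
  case (Suc i)
  then obtain x s' where "s = x # s'" by (cases s) auto
  with Suc show ?case by simp
qed

lemma act_three':
  assumes "\<And>h x y z. Z h x y z = Z' h x y z"
  and "\<And>f x y z s. act A' (Suc 0) (act B' 0 (act C' (Suc 0) f)) (x # y # z # s) = Z (\<lambda>a b c. f (a # b # c # s)) x y z"
  and "\<And>f x y z s. act D' (Suc 0) f (x # y # z # s) = Z' (\<lambda>a b c. f (a # b # c # s)) x y z"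
  shows "Suc (Suc i) < length s \<Longrightarrow> act A' (Suc i) (act B' i (act C' (Suc i) f)) s = act D' (Suc i) f s"
proof (induction i arbitrary: f s)
  case 0
  obtain x s1 where s1: "s = x # s1" "Suc 0 < length s1" using 0 by (cases s) auto
  obtain y s2 where s2: "s1 = y # s2" "0 < length s2" using s1 by (cases s1) auto
  obtain z s' where "s2 = z # s'" using s2 by (cases s2) auto
  with s1 s2 have "s = x # y # z # s'" by simp
  then show ?case using assms by simp
next
  case (Suc i)
  then obtain x s' where "s = x # s'" by (cases s) auto
  with Suc show ?case by simp
qed

lemma act_far_bool:
  assumes "lin2 P" "lin2 Q"
  shows "Suc (Suc i) \<le> j \<Longrightarrow> act P i (act Q j f) s = act Q j (act P i f) s"
proof (induction i arbitrary: f s j)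
  case 0
  then have "j = Suc (Suc (j - 2))" by simp
  then obtain j' where j: "j = Suc (Suc j')" by blast
  show ?case
  proof (cases "\<exists>x y s'. s = x # y # s'")
    case True
    then obtain x y s' where s: "s = x # y # s'" by blast
    have "fl (blists (length s')) (\<lambda>f. act Q j' f s')"
      by (rule fl_act_bool[OF assms(2)]) (simp add: blists_def)
    then show ?thesis
      using fl2_swap[OF lin2D[OF assms(1)], of _ "\<lambda>f. act Q j' f s'" "\<lambda>u v s'. f (u # v # s')" x y]
      by (simp add: s j)
  next
    case False
    then have "act P 0 f s = f s" for f by (cases "(P, 0 :: nat, f, s)" rule: act.cases) auto
    moreover have "act Q j f s = f s" for f using False
      by (cases s; cases "tl s") (auto simp: j)
    ultimately show ?thesis by simp
  qed
next
  case (Suc i)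
  then have "j = Suc (j - 1)" "Suc (Suc i) \<le> j - 1" by auto
  then obtain j' where j: "j = Suc j'" "Suc (Suc i) \<le> j'" by blast
  show ?case by (cases s) (auto simp: j Suc.IH[OF j(2)])
qed

lemma act_square:
  assumes "\<And>g x y. e (\<lambda>u v. e g u v) x y = d * e g x y"
  shows "Suc i < length s \<Longrightarrow> act e i (act e i f) s = d * act e i f s"
proof (induction i arbitrary: f s)
  case 0
  then obtain x y s' where "s = x # y # s'" by (cases s; cases "tl s") auto
  then show ?case using assms by simp
next
  case (Suc i) then show ?case by (cases s) auto
qed

lemma markov_mt:
  assumes e: "tl_op d \<kappa> e"
  shows "markov d (mt \<kappa> e)"
proof -
  have l: "lin2 e" and w: "weight_op \<kappa> e" and \<kappa>: "\<kappa> True + \<kappa> False = d"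
    and sq: "\<And>g x y. e (\<lambda>u v. e g u v) x y = d * e g x y"
    and up: "\<And>h x y z. e (\<lambda>u v. e (\<lambda>v' w. e (\<lambda>u' v''. h u' v'' w) u v') v z) x y = e (\<lambda>u v. h u v z) x y"
    and down: "\<And>h x y z. e (\<lambda>v w. e (\<lambda>u' v'. e (\<lambda>v'' w'. h u' v'' w') v' w) x v) y z = e (\<lambda>v w. h x v w) y z"
    and pt: "\<And>h y. (\<Sum>x\<in>UNIV. \<kappa> x * e (\<lambda>u v. if v = x then h u else 0) y x) = h y"
    using e unfolding tl_op_def by blast+
  have c1: "mt \<kappa> e m (u @ v) = mt \<kappa> e m (v @ u)" for m u v
  proof -
    have "mt \<kappa> e m (u @ v) = tr (blists m) (\<lambda>f s. wtl \<kappa> s * actw e e (pos u) (actw e e (pos v) f) s)"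
      by (simp add: mt_def pos_append actw_append)
    also have "\<dots> = tr (blists m) (\<lambda>f. actw e e (pos v) (\<lambda>s. wtl \<kappa> s * actw e e (pos u) f s))"
      by (rule tr_cyclic[where X = "\<lambda>f s. wtl \<kappa> s * actw e e (pos u) f s"]) (auto intro!: fl_scale fl_actw_bool l)
    also have "\<dots> = mt \<kappa> e m (v @ u)"
      unfolding mt_def pos_append actw_append by (rule tr_cong) (rule actw_weight[OF l w])
    finally show ?thesis .
  qed
  have c2: "mt \<kappa> e m (u @ [i, i] @ v) = d * mt \<kappa> e m (u @ [i] @ v)" if "Suc i < m" for m u v i
    by (rule mt_context[OF l]) (use that act_square[of e d i, OF sq] in \<open>simp add: pos_def\<close>)
  have c3: "mt \<kappa> e m (u @ [i, Suc i, i] @ v) = 1 * mt \<kappa> e m (u @ [i] @ v)" if "Suc (Suc i) < m" for m u v i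
    by (rule mt_context[OF l])
       (use that act_three[where A' = e and B' = e and C' = e and D' = e, OF up] in \<open>simp add: pos_def\<close>)
  have c4: "mt \<kappa> e m (u @ [Suc i, i, Suc i] @ v) = 1 * mt \<kappa> e m (u @ [Suc i] @ v)" if "Suc (Suc i) < m" for m u v i
    by (rule mt_context[OF l])
       (use that act_three'[where A' = e and B' = e and C' = e and D' = e, OF down] in \<open>simp add: pos_def\<close>)
  have c5: "mt \<kappa> e m (u @ [i, j] @ v) = 1 * mt \<kappa> e m (u @ [j, i] @ v)" if "Suc (Suc i) \<le> j" for m u v i j
    by (rule mt_context[OF l]) (use that act_far_bool[OF l l] in \<open>simp add: pos_def\<close>)
  have c6: "mt \<kappa> e (Suc m) w = d * mt \<kappa> e m w" if w: "\<forall>i\<in>set w. Suc i < m" for m w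
  proof -
    have "mt \<kappa> e (Suc m) w = (\<Sum>s\<in>blists m. \<Sum>x\<in>UNIV. wtl \<kappa> s * \<kappa> x * actw e e (pos w) (unit_fun (s @ [x])) (s @ [x]))"
      unfolding mt_def tr_def sum_blists_last by simp
    also have "\<dots> = (\<Sum>s\<in>blists m. \<Sum>x\<in>UNIV. wtl \<kappa> s * \<kappa> x * actw e e (pos w) (unit_fun s) s)"
    proof (intro sum.cong HOL.refl)
      fix s x assume "s \<in> blists m"
      then have "actw e e (pos w) (unit_fun (s @ [x])) (s @ [x]) = actw e e (pos w) (\<lambda>t. unit_fun (s @ [x]) (t @ [x])) s"
        by (intro actw_append_last[OF l]) (use w in \<open>auto simp: blists_def\<close>)
      also have "(\<lambda>t. unit_fun (s @ [x]) (t @ [x])) = unit_fun s" by (auto simp: unit_fun_def)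
      finally show "wtl \<kappa> s * \<kappa> x * actw e e (pos w) (unit_fun (s @ [x])) (s @ [x]) = wtl \<kappa> s * \<kappa> x * actw e e (pos w) (unit_fun s) s" by simp
    qed
    also have "\<dots> = (\<Sum>s\<in>blists m. d * (wtl \<kappa> s * actw e e (pos w) (unit_fun s) s))"
      by (simp add: UNIV_bool \<kappa>[symmetric] algebra_simps)
    finally show ?thesis by (simp add: mt_def tr_def sum_distrib_left)
  qed
  have c7: "mt \<kappa> e (Suc (Suc m)) (m # w) = mt \<kappa> e (Suc m) w" if w: "\<forall>i\<in>set w. i < m" for m w
  proof -
    have top: "act e m f (s @ [y, x]) = e (\<lambda>u v. f (s @ [u, v])) y x" if "length s = m" for f s x y
      using act_shift[of e s 0 f "[y, x]"] that by simp
    have in1: "actw e e (pos w) (unit_fun (s @ [y, x])) (s @ [u, v]) = (if v = x then actw e e (pos w) (unit_fun (s @ [y])) (s @ [u]) else 0)"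
      if s: "length s = m" for s y x u v
    proof -
      have "actw e e (pos w) (unit_fun (s @ [y, x])) ((s @ [u]) @ [v]) = actw e e (pos w) (\<lambda>t. unit_fun (s @ [y, x]) (t @ [v])) (s @ [u])"
        by (intro actw_append_last[OF l]) (use w s in auto)
      also have "(\<lambda>t. unit_fun (s @ [y, x]) (t @ [v])) = (if v = x then unit_fun (s @ [y]) else (\<lambda>_. 0))"
        by (auto simp: unit_fun_def fun_eq_iff)
      also have "actw e e (pos w) (if v = x then unit_fun (s @ [y]) else (\<lambda>_. 0)) (s @ [u]) = (if v = x then actw e e (pos w) (unit_fun (s @ [y])) (s @ [u]) else 0)"
        using fl_zero_app[OF fl_actw_bool[OF l l, of "s @ [u]" "Suc m"]] s by (simp add: blists_def)
      finally show ?thesis by simp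
    qed
    have "mt \<kappa> e (Suc (Suc m)) (m # w) = (\<Sum>s\<in>blists m. \<Sum>y\<in>UNIV. \<Sum>x\<in>UNIV. wtl \<kappa> s * \<kappa> y * \<kappa> x * act e m (actw e e (pos w) (unit_fun (s @ [y, x]))) (s @ [y, x]))"
      unfolding mt_def tr_def sum_blists_last by (simp add: pos_def mult_ac)
    also have "\<dots> = (\<Sum>s\<in>blists m. \<Sum>y\<in>UNIV. wtl \<kappa> s * \<kappa> y * (\<Sum>x\<in>UNIV. \<kappa> x * e (\<lambda>u v. if v = x then actw e e (pos w) (unit_fun (s @ [y])) (s @ [u]) else 0) y x))"
      by (intro sum.cong HOL.refl) (simp add: top in1 blists_def sum_distrib_left mult_ac)
    also have "\<dots> = (\<Sum>s\<in>blists m. \<Sum>y\<in>UNIV. wtl \<kappa> s * \<kappa> y * actw e e (pos w) (unit_fun (s @ [y])) (s @ [y]))"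
      by (simp only: pt)
    also have "\<dots> = mt \<kappa> e (Suc m) w" unfolding mt_def tr_def sum_blists_last by simp
    finally show ?thesis .
  qed
  have c0: "mt \<kappa> e 0 [] = 1" by (simp add: mt_def tr_def pos_def unit_fun_def)
  show ?thesis unfolding markov_def
    by (intro conjI allI impI) (fact c0 c1 c2 c3[unfolded mult_1] c4[unfolded mult_1] c5[unfolded mult_1] c6 c7)+
qed

text \<open>A cup after a cap, with loop value \<open>- q - 1 / q\<close>; the crossing
  \<open>tw q\<close> is \<open>1 + q e\<close>.\<close>

definition quantum_e :: "'a::field \<Rightarrow> (bool, 'a) pair_op" where
  "quantum_e q g x y = (if x = y then 0 else if x then g False True - q * g True False else g True False - g False True / q)"

text \<open>A cup after a cap made of Kronecker deltas, with loop value 2, so that its trace counts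
  two-colourings of curves.\<close>

definition classical_e :: "(bool, 'a::field) pair_op" where
  "classical_e g x y = (if x = y then g True True + g False False else 0)"

lemma lin2_quantum_e: "lin2 (quantum_e q)"
  by (rule lin2I[where ?k1.0 = "\<lambda>x y. 0" and ?k4.0 = "\<lambda>x y. 0"
    and ?k2.0 = "\<lambda>x y. if x = y then 0 else if x then - q else 1"
    and ?k3.0 = "\<lambda>x y. if x = y then 0 else if x then 1 else - (1 / q)"]) (auto simp: quantum_e_def)

lemma lin2_classical_e: "lin2 classical_e"
  by (rule lin2I[where ?k1.0 = "\<lambda>x y. if x = y then 1 else 0" and ?k4.0 = "\<lambda>x y. if x = y then 1 else 0"
    and ?k2.0 = "\<lambda>x y. 0" and ?k3.0 = "\<lambda>x y. 0"]) (auto simp: classical_e_def)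

lemma tl_op_quantum: "q \<noteq> 0 \<Longrightarrow> tl_op (- q - 1 / q) (kp q) (quantum_e q)"
  unfolding tl_op_def
proof (intro conjI allI)
  assume q: "q \<noteq> 0"
  show "lin2 (quantum_e q)" by (rule lin2_quantum_e)
  show "weight_op (kp q) (quantum_e q)" using q by (auto simp: weight_op_def quantum_e_def kp_def field_simps)
  show "kp q True + kp q False = - q - 1 / q" by (simp add: kp_def)
  fix g x y show "quantum_e q (quantum_e q g) x y = (- q - 1 / q) * quantum_e q g x y"
    using q by (cases x; cases y) (simp_all add: quantum_e_def algebra_simps diff_divide_distrib add_divide_distrib)
next
  assume q: "q \<noteq> 0"
  fix h x y z
  show "quantum_e q (\<lambda>u v. quantum_e q (\<lambda>v' w. quantum_e q (\<lambda>u' v''. h u' v'' w) u v') v z) x y = quantum_e q (\<lambda>u v. h u v z) x y"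
    using q by (cases x; cases y; cases z) (simp_all add: quantum_e_def field_simps)
  show "quantum_e q (\<lambda>v w. quantum_e q (\<lambda>u' v'. quantum_e q (\<lambda>v'' w'. h u' v'' w') v' w) x v) y z = quantum_e q (\<lambda>v w. h x v w) y z"
    using q by (cases x; cases y; cases z) (simp_all add: quantum_e_def field_simps)
next
  assume q: "q \<noteq> 0"
  fix h y show "(\<Sum>x\<in>UNIV. kp q x * quantum_e q (\<lambda>u v. if v = x then h u else 0) y x) = h y"
    using q by (cases y) (simp_all add: UNIV_bool quantum_e_def kp_def field_simps)
qed

lemma tl_op_classical: "tl_op 2 (\<lambda>_. 1) classical_e"
  unfolding tl_op_def
  by (auto simp: lin2_classical_e weight_op_def classical_e_def UNIV_bool)

section \<open>State sums\<close>

definition smoothing :: "bool \<Rightarrow> 'e crossing \<Rightarrow> ('e \<times> 'e) set" where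
  "smoothing b x = (if b then A_smoothing x else B_smoothing x)"

definition smoothings :: "'e crossing list \<Rightarrow> bool list \<Rightarrow> ('e \<times> 'e) set" where
  "smoothings xs bs = (\<Union>(x, b)\<in>set (zip xs bs). smoothing b x)"

lemma smoothings_Nil [simp]: "smoothings [] bs = {}" "smoothings xs [] = {}"
  by (auto simp: smoothings_def)

lemma smoothings_Cons [simp]: "smoothings (x # xs) (b # bs) = smoothing b x \<union> smoothings xs bs"
  by (auto simp: smoothings_def)

lemma smoothings_snoc: "length xs = length bs \<Longrightarrow> smoothings (xs @ [x]) (bs @ [b]) = smoothing b x \<union> smoothings xs bs"
  by (auto simp: smoothings_def)

definition vertex_weight :: "'a::field \<Rightarrow> bool \<Rightarrow> 'a" where "vertex_weight A b = (if b then A else 1 / A)"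

lemma vertex_weight_simps: "vertex_weight A True = A" "vertex_weight A False = 1 / A"
  by (simp_all add: vertex_weight_def)

text \<open>The factor \<open>\<delta>\<close> turns the normalised exponent, one less than the
  number of curves, into the number of curves.\<close>

lemma bracket_aux_states:
  fixes A :: "'a::field"
  defines "\<delta> \<equiv> - (A powi 2) - A powi (- 2)"
  assumes "\<delta> \<noteq> 0"
  shows "\<delta> * bracket_aux A E xs R = (\<Sum>b\<in>blists (length xs). wtl (vertex_weight A) b * \<delta> ^ card (curves E (R \<union> smoothings xs b)))"
proof (induction xs arbitrary: R)
  case Nil
  have "\<delta> * \<delta> powi (int (card (curves E R)) - 1) = \<delta> ^ card (curves E R)"
    using assms(2) by (simp add: power_int_diff)
  then show ?case by (simp add: \<delta>_def)
next
  case (Cons x xs)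
  have "\<delta> * bracket_aux A E (x # xs) R = A * (\<delta> * bracket_aux A E xs (A_smoothing x \<union> R)) + (1 / A) * (\<delta> * bracket_aux A E xs (B_smoothing x \<union> R))"
    by (simp add: divide_inverse power_int_minus algebra_simps)
  then show ?case unfolding Cons
    by (simp add: sum_blists_Suc UNIV_bool vertex_weight_simps smoothing_def sum_distrib_left mult.assoc Un_ac add.commute)
qed

lemma bracket_aux_move: "bracket_aux A E (xs @ x # ys) R = bracket_aux A E (x # xs @ ys) R"
proof (induction xs arbitrary: R)
  case (Cons y xs)
  show ?case by (simp add: Cons[simplified] algebra_simps Un_left_commute)
qed simp

text \<open>The crossings of a cable are listed in an order different from the one in which they are
  met from bottom to top.\<close>

lemma bracket_aux_perm: "mset xs = mset ys \<Longrightarrow> bracket_aux A E xs R = bracket_aux A E ys R"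
proof (induction xs arbitrary: ys R)
  case (Cons x xs)
  then have "x \<in> set ys" by (metis list.set_intros(1) mset_eq_setD)
  then obtain y1 y2 where ys: "ys = y1 @ x # y2" by (meson split_list)
  have "mset xs = mset (y1 @ y2)" using Cons.prems ys by simp
  then have "bracket_aux A E xs R = bracket_aux A E (y1 @ y2) R" for R by (rule Cons.IH)
  then show ?case unfolding ys bracket_aux_move by simp
qed simp

subsection \<open>Counting curves by colourings\<close>

definition colourings :: "'e set \<Rightarrow> ('e \<times> 'e) set \<Rightarrow> ('e \<Rightarrow> bool) set" where
  "colourings E R = {\<phi> \<in> E \<rightarrow>\<^sub>E UNIV. \<forall>(x, y)\<in>R. \<phi> x = \<phi> y}"

lemma finite_colourings [simp]: "finite E \<Longrightarrow> finite (colourings E R)"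
  unfolding colourings_def by (rule finite_subset[of _ "E \<rightarrow>\<^sub>E UNIV"]) (auto intro: finite_PiE)

text \<open>Colourings that are constant along the gluings are arbitrary two-valued functions on the
  classes.\<close>

lemma card_colourings:
  assumes E: "finite E" and R: "R \<subseteq> E \<times> E"
  shows "card (colourings E R) = 2 ^ card (curves E R)"
proof -
  let ?r = "(R \<union> R\<inverse>)\<^sup>*"
  have sym: "(y, x) \<in> ?r" if "(x, y) \<in> ?r" for x y
  proof -
    have "sym ?r" by (rule sym_rtrancl) (auto simp: sym_def)
    then show ?thesis using that by (auto dest: symD)
  qed
  have cls: "?r `` {x} = ?r `` {y}" if "(x, y) \<in> ?r" for x y
    using that sym by (auto intro: rtrancl_trans)
  define G where "G \<psi> = (\<lambda>x\<in>E. \<psi> (?r `` {x}))" for \<psi> :: "'a set \<Rightarrow> bool"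
  have "bij_betw G (curves E R \<rightarrow>\<^sub>E UNIV) (colourings E R)"
    unfolding bij_betw_def
  proof
    show "inj_on G (curves E R \<rightarrow>\<^sub>E UNIV)"
    proof
      fix f g assume fg: "f \<in> curves E R \<rightarrow>\<^sub>E UNIV" "g \<in> curves E R \<rightarrow>\<^sub>E UNIV" "G f = G g"
      show "f = g"
      proof (rule PiE_ext[OF fg(1,2)])
        fix c assume "c \<in> curves E R"
        then obtain x where "x \<in> E" "c = ?r `` {x}" by (auto simp: curves_def elim!: quotientE)
        then show "f c = g c" using fun_cong[OF fg(3), of x] by (simp add: G_def)
      qed
    qed
    show "G ` (curves E R \<rightarrow>\<^sub>E UNIV) = colourings E R"
    proof
      show "G ` (curves E R \<rightarrow>\<^sub>E UNIV) \<subseteq> colourings E R"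
      proof
        fix \<phi> assume "\<phi> \<in> G ` (curves E R \<rightarrow>\<^sub>E UNIV)"
        then obtain f where f: "\<phi> = G f" by blast
        have "G f x = G f y" if "(x, y) \<in> R" for x y
        proof -
          have "(x, y) \<in> ?r" using that by blast
          then show ?thesis using cls[of x y] that R by (auto simp: G_def)
        qed
        then show "\<phi> \<in> colourings E R" by (auto simp: colourings_def f) (auto simp: G_def)
      qed
      show "colourings E R \<subseteq> G ` (curves E R \<rightarrow>\<^sub>E UNIV)"
      proof
        fix \<phi> assume \<phi>: "\<phi> \<in> colourings E R"
        have const: "y \<in> E \<and> \<phi> x = \<phi> y" if "(x, y) \<in> ?r" "x \<in> E" for x y
          using that
        proof (induction rule: rtrancl_induct)
          case (step y z)
          then have "y \<in> E" "\<phi> x = \<phi> y" "(y, z) \<in> R \<or> (z, y) \<in> R" by auto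
          then show ?case using \<phi> R by (auto simp: colourings_def)
        qed simp
        define f where "f = (\<lambda>c\<in>curves E R. \<phi> (SOME x. x \<in> c \<and> x \<in> E))"
        have "\<phi> = G f"
        proof
          fix x
          show "\<phi> x = G f x"
          proof (cases "x \<in> E")
            case True
            let ?y = "SOME y. y \<in> ?r `` {x} \<and> y \<in> E"
            have "?y \<in> ?r `` {x} \<and> ?y \<in> E" by (rule someI[of _ x]) (use True in auto)
            then have "\<phi> x = \<phi> ?y" using const[of x ?y] True by auto
            moreover have "?r `` {x} \<in> curves E R" using True by (auto simp: curves_def intro: quotientI)
            ultimately show ?thesis using True by (simp add: G_def f_def)
          next
            case False then show ?thesis using \<phi> by (auto simp: G_def colourings_def)
          qed
        qed
        moreover have "f \<in> curves E R \<rightarrow>\<^sub>E UNIV" by (auto simp: f_def)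
        ultimately show "\<phi> \<in> G ` (curves E R \<rightarrow>\<^sub>E UNIV)" by blast
      qed
    qed
  qed
  then have "card (colourings E R) = card (curves E R \<rightarrow>\<^sub>E (UNIV :: bool set))" by (simp add: bij_betw_same_card)
  also have "\<dots> = 2 ^ card (curves E R)"
  proof -
    have "curves E R = (\<lambda>x. ?r `` {x}) ` E" by (auto simp: curves_def quotient_def)
    then have "finite (curves E R)" using E by simp
    then show ?thesis by (simp add: card_PiE)
  qed
  finally show ?thesis .
qed

subsection \<open>Diagrams built from bottom to top\<close>

text \<open>
  \<open>built F0 E xs R F w\<close>: a part of a diagram with arcs \<open>E\<close>, crossings \<open>xs\<close> and bivalent vertices \<open>R\<close>
  has been drawn; it has the ends \<open>F0\<close> at the bottom and \<open>F\<close> at the top, each listed from left to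
  right, and represents the braid word \<open>w\<close>.
\<close>

inductive built :: "'e list \<Rightarrow> 'e set \<Rightarrow> 'e crossing list \<Rightarrow> ('e \<times> 'e) set \<Rightarrow> 'e list \<Rightarrow> (nat \<times> bool) list \<Rightarrow> bool" for F0 where
  start: "distinct F0 \<Longrightarrow> built F0 (set F0) [] {} F0 []"
| join: "built F0 E xs R (F1 @ x # F2) w \<Longrightarrow> y \<notin> E \<Longrightarrow> built F0 (insert y E) xs (insert (x, y) R) (F1 @ y # F2) w"
| cross: "built F0 E xs R (F1 @ x # y # F2) w \<Longrightarrow> u \<notin> E \<Longrightarrow> v \<notin> E \<Longrightarrow> u \<noteq> v \<Longrightarrow>
    c = (if s then Crossing True x v y u else Crossing False y u x v) \<Longrightarrow>
    built F0 (insert u (insert v E)) (xs @ [c]) R (F1 @ u # v # F2) (w @ [(length F1, s)])"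

text \<open>The smoothing with \<open>b = s\<close> is the oriented one, that is the identity; the
  other one contributes the generator at position \<open>p\<close>.\<close>

fun e_word :: "(nat \<times> bool) list \<Rightarrow> bool list \<Rightarrow> nat list" where
  "e_word ((p, s) # w) (b # bs) = (if b = s then e_word w bs else p # e_word w bs)"
| "e_word _ _ = []"

lemma e_word_snoc: "length w = length bs \<Longrightarrow> e_word (w @ [(p, s)]) (bs @ [b]) = e_word w bs @ (if b = s then [] else [p])"
proof (induction w bs rule: list_induct2)
  case (Cons x xs y ys) then show ?case by (cases x) simp
qed simp

lemma set_e_word: "set (e_word w bs) \<subseteq> fst ` set w"
  by (induction w bs rule: e_word.induct) auto

lemma built_props:
  "built F0 E xs R F w \<Longrightarrow> finite E \<and> set F \<subseteq> E \<and> set F0 \<subseteq> E \<and> R \<subseteq> E \<times> E \<and> length F = length F0 \<and>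
     length xs = length w \<and> (\<forall>b. length b = length xs \<longrightarrow> smoothings xs b \<subseteq> E \<times> E) \<and> (\<forall>(p, s)\<in>set w. Suc p < length F0)"
proof (induction rule: built.induct)
  case (cross E xs R F1 x y F2 w u v c s)
  let ?E = "insert u (insert v E)"
  have xy: "x \<in> E" "y \<in> E" using cross by auto
  have c: "smoothing b c \<subseteq> ?E \<times> ?E" for b
    using xy cross.hyps by (auto simp: smoothing_def A_smoothing_def B_smoothing_def oriented_smoothing_def disoriented_smoothing_def)
  have "smoothings (xs @ [c]) b \<subseteq> ?E \<times> ?E" if b: "length b = length (xs @ [c])" for b
  proof -
    obtain bs t where bs: "b = bs @ [t]" "length xs = length bs" using b by (cases b rule: rev_cases) auto
    have "smoothings xs bs \<subseteq> E \<times> E" using cross.IH bs by simp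
    then show ?thesis using c[of t] unfolding bs(1) smoothings_snoc[OF bs(2)] by blast
  qed
  then show ?case using cross.IH xy by auto
qed auto

lemma colourings_iff: "\<phi> \<in> colourings E R \<longleftrightarrow> (\<forall>x. x \<notin> E \<longrightarrow> \<phi> x = undefined) \<and> (\<forall>(x, y)\<in>R. \<phi> x = \<phi> y)"
  by (auto simp: colourings_def PiE_def extensional_def)

lemma colourings_join:
  assumes y: "y \<notin> E" and x: "x \<in> E" and R: "R \<subseteq> E \<times> E"
  shows "colourings (insert y E) (insert (x, y) R) = (\<lambda>\<phi>. \<phi>(y := \<phi> x)) ` colourings E R"
    and "inj_on (\<lambda>\<phi>. \<phi>(y := \<phi> x)) (colourings E R)"
proof -
  have ne: "a \<noteq> y \<and> b \<noteq> y" if "(a, b) \<in> R" for a b using that y R by auto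
  have upd: "(\<forall>(a, b)\<in>R. (\<phi>(y := c)) a = (\<phi>(y := c)) b) \<longleftrightarrow> (\<forall>(a, b)\<in>R. \<phi> a = \<phi> b)" for \<phi> and c :: bool
    using ne by fastforce
  have u: "\<phi> y = undefined" if "\<phi> \<in> colourings E R" for \<phi> using that y by (auto simp: colourings_def)
  show "inj_on (\<lambda>\<phi>. \<phi>(y := \<phi> x)) (colourings E R)"
  proof
    fix f g assume fg: "f \<in> colourings E R" "g \<in> colourings E R" "f(y := f x) = g(y := g x)"
    show "f = g"
    proof
      fix z show "f z = g z" using fun_cong[OF fg(3), of z] u[OF fg(1)] u[OF fg(2)] by (cases "z = y") auto
    qed
  qed
  show "colourings (insert y E) (insert (x, y) R) = (\<lambda>\<phi>. \<phi>(y := \<phi> x)) ` colourings E R"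
  proof
    show "(\<lambda>\<phi>. \<phi>(y := \<phi> x)) ` colourings E R \<subseteq> colourings (insert y E) (insert (x, y) R)"
      unfolding image_subset_iff
    proof
      fix \<phi> assume \<phi>: "\<phi> \<in> colourings E R"
      then show "\<phi>(y := \<phi> x) \<in> colourings (insert y E) (insert (x, y) R)"
        unfolding colourings_iff ball_simps(7) upd split_conv using y x by auto
    qed
    show "colourings (insert y E) (insert (x, y) R) \<subseteq> (\<lambda>\<phi>. \<phi>(y := \<phi> x)) ` colourings E R"
    proof
      fix \<phi> assume \<phi>: "\<phi> \<in> colourings (insert y E) (insert (x, y) R)"
      have "\<phi>(y := undefined) \<in> colourings E R" using \<phi> y unfolding colourings_iff upd by simp
      moreover have "\<phi> = (\<phi>(y := undefined))(y := (\<phi>(y := undefined)) x)" using \<phi> y x by (auto simp: colourings_def)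
      ultimately show "\<phi> \<in> (\<lambda>\<phi>. \<phi>(y := \<phi> x)) ` colourings E R" by blast
    qed
  qed
qed

text \<open>A disoriented smoothing demands equal colours below and adds a free common colour above,
  which is the matrix of \<open>classical_e\<close>.\<close>

lemma colourings_cup:
  assumes u: "u \<notin> E" "v \<notin> E" "u \<noteq> v" and xy: "x \<in> E" "y \<in> E" and R: "R \<subseteq> E \<times> E"
  shows "colourings (insert u (insert v E)) (insert (x, y) (insert (u, v) R)) =
      (\<lambda>(\<phi>, a). \<phi>(u := a, v := a)) ` ({\<phi> \<in> colourings E R. \<phi> x = \<phi> y} \<times> UNIV)"
    and "inj_on (\<lambda>(\<phi>, a). \<phi>(u := a, v := a)) ({\<phi> \<in> colourings E R. \<phi> x = \<phi> y} \<times> UNIV)"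
proof -
  have ne: "a \<noteq> u \<and> b \<noteq> u \<and> a \<noteq> v \<and> b \<noteq> v" if "(a, b) \<in> R" for a b using that u R by auto
  have upd: "(\<forall>(a, b)\<in>R. (\<phi>(u := c, v := d)) a = (\<phi>(u := c, v := d)) b) \<longleftrightarrow> (\<forall>(a, b)\<in>R. \<phi> a = \<phi> b)" for \<phi> and c d :: bool
    using ne by fastforce
  have un: "\<phi> u = undefined" "\<phi> v = undefined" if "\<phi> \<in> colourings E R" for \<phi> using that u by (auto simp: colourings_def)
  show "inj_on (\<lambda>(\<phi>, a). \<phi>(u := a, v := a)) ({\<phi> \<in> colourings E R. \<phi> x = \<phi> y} \<times> UNIV)"
  proof (rule inj_onI, clarify)
    fix f g :: "'a \<Rightarrow> bool" and a b assume fg: "f \<in> colourings E R" "g \<in> colourings E R" "f(u := a, v := a) = g(u := b, v := b)"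
    have "f = g"
    proof
      fix z show "f z = g z" using fun_cong[OF fg(3), of z] un[OF fg(1)] un[OF fg(2)] by (cases "z = u \<or> z = v") auto
    qed
    moreover have "a = b" using fun_cong[OF fg(3), of v] by simp
    ultimately show "f = g \<and> a = b" by simp
  qed
  show "colourings (insert u (insert v E)) (insert (x, y) (insert (u, v) R)) =
      (\<lambda>(\<phi>, a). \<phi>(u := a, v := a)) ` ({\<phi> \<in> colourings E R. \<phi> x = \<phi> y} \<times> UNIV)" (is "?L = ?R")
  proof
    show "?R \<subseteq> ?L"
    proof (rule image_subsetI)
      fix z assume z: "z \<in> {\<phi> \<in> colourings E R. \<phi> x = \<phi> y} \<times> (UNIV :: bool set)"
      obtain \<phi> a where za: "z = (\<phi>, a)" by force
      have 1: "\<phi> \<in> colourings E R" "\<phi> x = \<phi> y" using z za by auto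
      have 2: "\<forall>(p, r)\<in>R. (\<phi>(u := a, v := a)) p = (\<phi>(u := a, v := a)) r" unfolding upd using 1 by (simp add: colourings_iff)
      have 3: "x \<noteq> u" "x \<noteq> v" "y \<noteq> u" "y \<noteq> v" using u xy by auto
      have "\<phi>(u := a, v := a) \<in> ?L"
        unfolding colourings_iff
      proof
        show "\<forall>z. z \<notin> insert u (insert v E) \<longrightarrow> (\<phi>(u := a, v := a)) z = undefined" using 1(1) by (simp add: colourings_iff)
        show "\<forall>(p, r)\<in>insert (x, y) (insert (u, v) R). (\<phi>(u := a, v := a)) p = (\<phi>(u := a, v := a)) r"
          unfolding ball_simps(7) split_conv using 2 1(2) 3 u(3) by (simp only: fun_upd_apply) simp
      qed
      then show "(\<lambda>(\<phi>, a). \<phi>(u := a, v := a)) z \<in> ?L" by (simp only: za split_conv)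
    qed
    show "?L \<subseteq> ?R"
    proof
      fix \<phi> assume \<phi>: "\<phi> \<in> ?L"
      let ?\<psi> = "\<phi>(u := undefined, v := undefined)"
      have "?\<psi> \<in> colourings E R" using \<phi> u unfolding colourings_iff upd by simp
      moreover have e: "\<phi> x = \<phi> y" "\<phi> u = \<phi> v" using \<phi> by (simp_all add: colourings_iff)
      have "x \<noteq> u" "x \<noteq> v" "y \<noteq> u" "y \<noteq> v" using u xy by auto
      then have "?\<psi> x = ?\<psi> y" using e(1) by simp
      ultimately have "(?\<psi>, \<phi> u) \<in> {\<phi> \<in> colourings E R. \<phi> x = \<phi> y} \<times> UNIV" by blast
      moreover have "\<phi> = ?\<psi>(u := \<phi> u, v := \<phi> u)" using e(2) u(3) by (intro ext) (simp add: fun_upd_def)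
      ultimately show "\<phi> \<in> ?R" by (intro image_eqI[of _ _ "(?\<psi>, \<phi> u)"]) (simp_all only: split_conv)
    qed
  qed
qed

lemma colourings_swap: "colourings E (insert (x, y) R) = colourings E (insert (y, x) R)"
  by (auto simp: colourings_def)

lemma filter_image: "(\<And>\<phi>. m (g \<phi>) = m \<phi>) \<Longrightarrow> {\<phi> \<in> g ` C. m \<phi> = s} = g ` {\<phi> \<in> C. m \<phi> = s}"
  by auto

text \<open>A transfer matrix argument: the bottom ends have fixed colours, \<open>h\<close> is
  evaluated at the colours of the top ends, and each layer that is drawn contributes one
  operator.\<close>

lemma built_sum:
  fixes h :: "bool list \<Rightarrow> 'a::field"
  shows "built F0 E xs R F w \<Longrightarrow> length b = length w \<Longrightarrow> length s0 = length F0 \<Longrightarrow>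
    (\<Sum>\<phi>\<in>{\<phi> \<in> colourings E (R \<union> smoothings xs b). map \<phi> F0 = s0}. h (map \<phi> F)) = actw classical_e classical_e (pos (e_word w b)) h s0"
proof (induction arbitrary: b h rule: built.induct)
  case start
  define \<phi>0 where "\<phi>0 = (\<lambda>x. if x \<in> set F0 then the (map_of (zip F0 s0) x) else undefined)"
  have m: "map \<phi>0 F0 = s0"
    using start by (intro nth_equalityI) (auto simp: \<phi>0_def map_of_zip_nth)
  have "{\<phi> \<in> colourings (set F0) ({} \<union> smoothings [] b). map \<phi> F0 = s0} = {\<phi>0}"
  proof (rule set_eqI)
    fix \<phi>
    have "\<phi>0 \<in> colourings (set F0) {}" by (simp add: colourings_iff \<phi>0_def)
    moreover have "\<phi> = \<phi>0" if "\<phi> \<in> colourings (set F0) {}" "map \<phi> F0 = s0"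
    proof
      fix x show "\<phi> x = \<phi>0 x"
      proof (cases "x \<in> set F0")
        case True
        have "map \<phi> F0 = map \<phi>0 F0" using that(2) m by simp
        then show ?thesis using True by (simp only: map_eq_conv)
      qed (use that in \<open>simp add: colourings_iff \<phi>0_def\<close>)
    qed
    ultimately show "\<phi> \<in> {\<phi> \<in> colourings (set F0) ({} \<union> smoothings [] b). map \<phi> F0 = s0} \<longleftrightarrow> \<phi> \<in> {\<phi>0}"
      using m by auto
  qed
  then show ?case using m by (simp add: pos_def)
next
  case (join E xs R F1 x F2 w y)
  note p = built_props[OF join.hyps(1)]
  let ?R = "R \<union> smoothings xs b"
  let ?S = "{\<phi> \<in> colourings E ?R. map \<phi> F0 = s0}"
  have R: "?R \<subseteq> E \<times> E" and x: "x \<in> E" using p join.prems by auto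
  have yn: "y \<notin> set F0" "y \<notin> set F1" "y \<notin> set F2" using p join.hyps by auto
  have m0: "map (\<phi>(y := a)) F0 = map \<phi> F0" for \<phi> and a :: bool using yn by auto
  have "{\<phi> \<in> colourings (insert y E) (insert (x, y) R \<union> smoothings xs b). map \<phi> F0 = s0} = (\<lambda>\<phi>. \<phi>(y := \<phi> x)) ` ?S"
    unfolding Un_insert_left colourings_join(1)[OF join.hyps(2) x R] by (rule filter_image) (rule m0)
  moreover have "inj_on (\<lambda>\<phi>. \<phi>(y := \<phi> x)) ?S"
    by (rule inj_on_subset[OF colourings_join(2)[OF join.hyps(2) x R]]) auto
  moreover have "map (\<phi>(y := \<phi> x)) (F1 @ y # F2) = map \<phi> (F1 @ x # F2)" for \<phi> :: "'b \<Rightarrow> bool" using yn by auto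
  ultimately show ?case using join.IH[OF join.prems, of h] by (simp add: sum.reindex comp_def del: map_append)
next
  case (cross E xs R F1 x y F2 w u v c s)
  note p = built_props[OF cross.hyps(1)]
  obtain bs t where b: "b = bs @ [t]" "length bs = length w" using cross.prems(1) by (cases b rule: rev_cases) auto
  have lx: "length xs = length bs" using p b by simp
  let ?R = "R \<union> smoothings xs bs"
  let ?S = "{\<phi> \<in> colourings E ?R. map \<phi> F0 = s0}"
  have R: "?R \<subseteq> E \<times> E" and xy: "x \<in> E" "y \<in> E" using p lx by auto
  have un: "u \<notin> set F0" "u \<notin> set F1" "u \<notin> set F2" "v \<notin> set F0" "v \<notin> set F1" "v \<notin> set F2" using p cross.hyps by auto
  have m0: "map (\<phi>(u := a, v := a')) F0 = map \<phi> F0" for \<phi> and a a' :: bool using un by auto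
  have rel: "R \<union> smoothings (xs @ [c]) b = smoothing t c \<union> ?R" unfolding b(1) smoothings_snoc[OF lx] by auto
  have ew: "e_word (w @ [(length F1, s)]) b = e_word w bs @ (if t = s then [] else [length F1])"
    unfolding b(1) by (rule e_word_snoc) (simp add: b)
  show ?case
  proof (cases "t = s")
    case True
    have sm: "colourings E' (smoothing t c \<union> ?R) = colourings E' (insert (x, u) (insert (y, v) ?R))" for E'
      using True cross.hyps(5) by (cases s) (auto simp: smoothing_def A_smoothing_def B_smoothing_def oriented_smoothing_def insert_commute)
    have 1: "colourings (insert v E) (insert (y, v) ?R) = (\<lambda>\<phi>. \<phi>(v := \<phi> y)) ` colourings E ?R"
      "inj_on (\<lambda>\<phi>. \<phi>(v := \<phi> y)) (colourings E ?R)"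
      by (rule colourings_join[OF cross.hyps(3) xy(2) R])+
    have 2: "colourings (insert u (insert v E)) (insert (x, u) (insert (y, v) ?R)) = (\<lambda>\<phi>. \<phi>(u := \<phi> x)) ` colourings (insert v E) (insert (y, v) ?R)"
      "inj_on (\<lambda>\<phi>. \<phi>(u := \<phi> x)) (colourings (insert v E) (insert (y, v) ?R))"
      by (rule colourings_join; use cross.hyps xy R in auto)+
    let ?g = "\<lambda>\<phi>. (\<phi>(v := \<phi> y))(u := (\<phi>(v := \<phi> y)) x)"
    have 3: "colourings (insert u (insert v E)) (insert (x, u) (insert (y, v) ?R)) = ?g ` colourings E ?R"
      unfolding 2 1 image_image ..
    have i3: "inj_on ?g (colourings E ?R)"
      using comp_inj_on[OF 1(2) 2(2)[unfolded 1(1)]] by (simp add: comp_def)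
    have mg0: "map (?g \<phi>) F0 = map \<phi> F0" for \<phi> using un by auto
    have S': "{\<phi> \<in> colourings (insert u (insert v E)) (R \<union> smoothings (xs @ [c]) b). map \<phi> F0 = s0} = ?g ` ?S"
      unfolding rel sm 3 by (rule filter_image) (rule mg0)
    have mg: "map (?g \<phi>) (F1 @ u # v # F2) = map \<phi> (F1 @ x # y # F2)" for \<phi> :: "'b \<Rightarrow> bool"
      using un cross.hyps xy by auto
    have "inj_on ?g ?S" by (rule inj_on_subset[OF i3]) auto
    then have "(\<Sum>\<phi>\<in>?g ` ?S. h (map \<phi> (F1 @ u # v # F2))) = (\<Sum>\<phi>\<in>?S. h (map \<phi> (F1 @ x # y # F2)))"
      by (simp only: sum.reindex comp_def mg)
    then show ?thesis using cross.IH[OF b(2) cross.prems(2), of h] True unfolding S' ew by simp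
  next
    case False
    have sm: "colourings E' (smoothing t c \<union> ?R) = colourings E' (insert (x, y) (insert (u, v) ?R))" for E'
      using False cross.hyps(5) colourings_swap[of E' x y] colourings_swap[of E' u v] insert_commute[of "(x, y)" "(u, v)"] insert_commute[of "(y, x)" "(u, v)"]
        insert_commute[of "(x, y)" "(v, u)"] insert_commute[of "(y, x)" "(v, u)"]
      by (cases s) (auto simp: smoothing_def A_smoothing_def B_smoothing_def disoriented_smoothing_def colourings_def)
    let ?g = "\<lambda>(\<phi>, a). \<phi>(u := a, v := a)"
    note cc = colourings_cup[OF cross.hyps(2-4) xy R]
    let ?S2 = "{\<phi> \<in> ?S. \<phi> x = \<phi> y}"
    have S': "{\<phi> \<in> colourings (insert u (insert v E)) (R \<union> smoothings (xs @ [c]) b). map \<phi> F0 = s0} = ?g ` (?S2 \<times> UNIV)"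
      unfolding rel sm cc(1) using m0 by (auto simp: image_iff)
    have i: "inj_on ?g (?S2 \<times> UNIV)" by (rule inj_on_subset[OF cc(2)]) auto
    have mg: "map (\<phi>(u := a, v := a)) (F1 @ u # v # F2) = map \<phi> F1 @ a # a # map \<phi> F2" for \<phi> and a :: bool
      using un by auto
    have "(\<Sum>\<phi>\<in>?g ` (?S2 \<times> UNIV). h (map \<phi> (F1 @ u # v # F2))) = (\<Sum>\<phi>\<in>?S2. \<Sum>a\<in>UNIV. h (map \<phi> F1 @ a # a # map \<phi> F2))"
      unfolding sum.reindex[OF i] sum.cartesian_product by (rule sum.cong[OF HOL.refl]) (auto simp: mg simp del: map_append)
    also have "\<dots> = (\<Sum>\<phi>\<in>?S. act classical_e (length F1) h (map \<phi> (F1 @ x # y # F2)))"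
    proof -
      have a: "act classical_e (length F1) h (map \<phi> (F1 @ x # y # F2)) = (if \<phi> x = \<phi> y then \<Sum>a\<in>UNIV. h (map \<phi> F1 @ a # a # map \<phi> F2) else 0)" for \<phi>
        using act_shift[of classical_e "map \<phi> F1" 0 h "\<phi> x # \<phi> y # map \<phi> F2"]
        by (simp add: classical_e_def UNIV_bool add.commute)
      have "finite ?S" using p by (auto intro: finite_subset[OF _ finite_colourings])
      then show ?thesis unfolding a by (simp add: sum.inter_filter[symmetric])
    qed
    also have "\<dots> = actw classical_e classical_e (pos (e_word w bs)) (act classical_e (length F1) h) s0"
      by (rule cross.IH[OF b(2) cross.prems(2)])
    finally show ?thesis using False unfolding S' ew by (simp add: pos_append actw_append) (simp add: pos_def)
  qed
qed

text \<open>Gluing the top ends to the bottom ends amounts to taking the trace.\<close>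

lemma built_curves:
  assumes bu: "built F0 E xs R F w" and b: "length b = length w"
  shows "(2 :: 'a::field) ^ card (curves E (R \<union> smoothings xs b \<union> set (zip F F0))) = mt (\<lambda>_. 1) classical_e (length F0) (e_word w b)"
proof -
  note p = built_props[OF bu]
  let ?R = "R \<union> smoothings xs b" and ?m = "length F0"
  have R: "?R \<union> set (zip F F0) \<subseteq> E \<times> E"
  proof (intro Un_least)
    show "set (zip F F0) \<subseteq> E \<times> E" using p by (auto dest: set_zip_leftD set_zip_rightD)
  qed (use p b in auto)
  have lF: "length F = ?m" using p by simp
  let ?C = "colourings E ?R"
  have fin: "finite ?C" using p by simp
  have cl: "colourings E (?R \<union> set (zip F F0)) = {\<phi> \<in> ?C. map \<phi> F = map \<phi> F0}"
  proof -
    have "(\<forall>(x, y)\<in>set (zip F F0). \<phi> x = \<phi> y) \<longleftrightarrow> map \<phi> F = map \<phi> F0" for \<phi> :: "'b \<Rightarrow> bool"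
      using lF by (auto simp: list_eq_iff_nth_eq set_zip)
    then show ?thesis by (auto simp: colourings_def ball_Un)
  qed
  have wt: "wtl (\<lambda>_. 1) s = (1 :: 'a)" for s by (induction s) auto
  have "mt (\<lambda>_. 1) classical_e ?m (e_word w b) = (\<Sum>s0\<in>blists ?m. actw classical_e classical_e (pos (e_word w b)) (unit_fun s0 :: bool list \<Rightarrow> 'a) s0)"
    by (simp add: mt_def tr_def wt)
  also have "\<dots> = (\<Sum>s0\<in>blists ?m. \<Sum>\<phi>\<in>{\<phi> \<in> ?C. map \<phi> F0 = s0}. unit_fun s0 (map \<phi> F))"
    by (intro sum.cong HOL.refl built_sum[OF bu b, symmetric]) (simp add: blists_def)
  also have "\<dots> = (\<Sum>s0\<in>blists ?m. \<Sum>\<phi>\<in>{\<phi> \<in> ?C. map \<phi> F0 = s0}. (if map \<phi> F = map \<phi> F0 then 1 else 0))"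
    by (intro sum.cong HOL.refl) (auto simp: unit_fun_def)
  also have "\<dots> = (\<Sum>\<phi>\<in>?C. if map \<phi> F = map \<phi> F0 then 1 else 0)"
    by (rule sum.group[OF fin finite_blists]) (auto simp: blists_def)
  also have "\<dots> = of_nat (card {\<phi> \<in> ?C. map \<phi> F = map \<phi> F0})"
    using fin by (simp add: sum.inter_filter[symmetric])
  also have "\<dots> = of_nat (2 ^ card (curves E (?R \<union> set (zip F F0))))"
    unfolding cl[symmetric] using p by (simp add: card_colourings[OF _ R])
  finally show ?thesis by simp
qed

text \<open>Both vertex models give Markov traces, so their values are powers of the loop values
  with the same exponent. In the model with loop value 2 this exponent is the number of curves, and
  in characteristic zero a power of 2 determines its exponent.\<close>

lemma built_quantum:
  fixes q :: "'a::field_char_0"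
  assumes q: "q \<noteq> 0" and bu: "built F0 E xs R F w" and b: "length b = length w"
  shows "(- q - 1 / q) ^ card (curves E (R \<union> smoothings xs b \<union> set (zip F F0))) = mt (kp q) (quantum_e q) (length F0) (e_word w b)"
proof -
  have "\<exists>l. \<forall>(f :: nat \<Rightarrow> nat list \<Rightarrow> 'a) d. markov d f \<longrightarrow> f (length F0) (e_word w b) = d ^ l"
  proof (cases "length F0")
    \<comment> \<open>Without strands the word is empty; \<open>markov_unique\<close> only covers at
      least one strand.\<close>
    case 0
    then have "w = []" using built_props[OF bu] by (cases w) auto
    then show ?thesis unfolding 0 by (intro exI[of _ 0]) (simp add: markov_def)
  next
    case (Suc m)
    have "set (e_word w b) \<subseteq> {..<m}" using set_e_word[of w b] built_props[OF bu] Suc by fastforce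
    then show ?thesis unfolding Suc by (rule markov_unique)
  qed
  then obtain l where l: "\<And>(f :: nat \<Rightarrow> nat list \<Rightarrow> 'a) d. markov d f \<Longrightarrow> f (length F0) (e_word w b) = d ^ l" by blast
  have "(2 :: 'a) ^ card (curves E (R \<union> smoothings xs b \<union> set (zip F F0))) = 2 ^ l"
    unfolding built_curves[OF bu b] by (rule l[OF markov_mt[OF tl_op_classical]])
  then have "of_nat (2 ^ card (curves E (R \<union> smoothings xs b \<union> set (zip F F0)))) = (of_nat (2 ^ l) :: 'a)" by simp
  then have "(2 :: nat) ^ card (curves E (R \<union> smoothings xs b \<union> set (zip F F0))) = 2 ^ l" by (simp only: of_nat_eq_iff)
  then have "card (curves E (R \<union> smoothings xs b \<union> set (zip F F0))) = l" by simp
  then show ?thesis using l[OF markov_mt[OF tl_op_quantum[OF q]]] by simp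
qed

text \<open>Every crossing is expanded by the Kauffman relation: \<open>sig A q\<close> is
  \<open>A + e / A\<close> and \<open>sig' A q\<close> is \<open>1 / A + A e\<close>.\<close>

lemma actw_states:
  fixes A q :: "'a::field"
  assumes A: "A * A * q = 1"
  shows "\<forall>(p, t)\<in>set w. Suc p < length s \<Longrightarrow>
    actw (sig A q) (sig' A q) w f s = (\<Sum>b\<in>blists (length w). wtl (vertex_weight A) b * actw (quantum_e q) (quantum_e q) (pos (e_word w b)) f s)"
proof (induction w arbitrary: s)
  case Nil then show ?case by (simp add: pos_def)
next
  case (Cons l w)
  have nz: "A \<noteq> 0" "q \<noteq> 0" using A by auto
  have q: "q = 1 / (A * A)" using A nz by (auto simp: field_simps)
  obtain p t where l: "l = (p, t)" by force
  let ?X = "if t then sig A q else sig' A q" and ?e = "quantum_e q"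
  let ?c = "vertex_weight A t" and ?c' = "vertex_weight A (\<not> t)"
  have X: "?X g x y = ?c * g x y + ?c' * ?e g x y" for g x y
    using nz by (cases t; cases x; cases y) (simp_all add: sig_def sig'_def tw_def tw'_def quantum_e_def vertex_weight_def q field_simps)
  have aX: "act ?X p f s = ?c * f s + ?c' * act ?e p f s" if "Suc p < length s" for f s
    using that
  proof (induction p arbitrary: f s)
    case 0
    then obtain x y s' where "s = x # y # s'" by (cases s; cases "tl s") auto
    then show ?case using X by simp
  next
    case (Suc p) then show ?case by (cases s) auto
  qed
  let ?F = "\<lambda>b s. actw ?e ?e (pos (e_word w b)) f s"
  have IH: "actw (sig A q) (sig' A q) w f s' = (\<Sum>b\<in>blists (length w). wtl (vertex_weight A) b * ?F b s')" if "length s' = length s" for s'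
    by (rule Cons.IH) (use Cons.prems that in auto)
  have le: "lin2 ?e" by (rule lin2_quantum_e)
  have fe: "fl (blists (length s)) (\<lambda>f. act ?e p f s)" by (rule fl_act_bool[OF le]) (simp add: blists_def)
  have "actw (sig A q) (sig' A q) (l # w) f s = ?c * actw (sig A q) (sig' A q) w f s + ?c' * act ?e p (actw (sig A q) (sig' A q) w f) s"
    using aX[of s] Cons.prems by (simp add: l)
  also have "act ?e p (actw (sig A q) (sig' A q) w f) s = act ?e p (\<lambda>s'. \<Sum>b\<in>blists (length w). wtl (vertex_weight A) b * ?F b s') s"
    by (rule fl_cong[OF fe]) (simp add: IH blists_def)
  also have "\<dots> = (\<Sum>b\<in>blists (length w). act ?e p (\<lambda>s'. wtl (vertex_weight A) b * ?F b s') s)"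
    by (rule fl_sum_app[OF fe])
  also have "\<dots> = (\<Sum>b\<in>blists (length w). wtl (vertex_weight A) b * act ?e p (?F b) s)"
    by (intro sum.cong HOL.refl fl_scale_app[OF fe])
  finally have 1: "actw (sig A q) (sig' A q) (l # w) f s = ?c * (\<Sum>b\<in>blists (length w). wtl (vertex_weight A) b * ?F b s) +
     ?c' * (\<Sum>b\<in>blists (length w). wtl (vertex_weight A) b * act ?e p (?F b) s)" using IH[of s] by simp
  have 2: "actw ?e ?e (pos (e_word (l # w) (t # b))) f s = ?F b s" for b by (simp add: l)
  have 3: "actw ?e ?e (pos (e_word (l # w) ((\<not> t) # b))) f s = act ?e p (?F b) s" for b by (simp add: l pos_def)
  have 4: "(\<Sum>x\<in>UNIV. G x) = G t + G (\<not> t)" for G :: "bool \<Rightarrow> 'a" by (cases t) (simp_all add: UNIV_bool add.commute)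
  show ?case unfolding 1 list.size add_0_right add_Suc_right sum_blists_Suc 4 2 3
    by (simp add: sum_distrib_left mult.assoc)
qed

lemma bracket_built:
  fixes A :: "'a::field_char_0"
  assumes A: "A \<noteq> 0" and \<delta>: "- (A powi 2) - A powi (- 2) \<noteq> 0" and bu: "built F0 E xs R F w" and ys: "mset ys = mset xs"
  defines "q \<equiv> A powi (- 2)"
  shows "(- (A powi 2) - A powi (- 2)) * bracket_aux A E ys (R \<union> set (zip F F0)) =
    tr (blists (length F0)) (\<lambda>f s. kapl q s * actw (sig A q) (sig' A q) w f s)"
proof -
  have q: "q \<noteq> 0" and AAq: "A * A * q = 1" using A by (auto simp: q_def power_int_minus power2_eq_square field_simps)
  have d: "- (A powi 2) - A powi (- 2) = - q - 1 / q" using A by (simp add: q_def power_int_minus field_simps)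
  note p = built_props[OF bu]
  have "(- (A powi 2) - A powi (- 2)) * bracket_aux A E ys (R \<union> set (zip F F0)) = (- (A powi 2) - A powi (- 2)) * bracket_aux A E xs (R \<union> set (zip F F0))"
    by (simp only: bracket_aux_perm[OF ys])
  also have "\<dots> = (\<Sum>b\<in>blists (length xs). wtl (vertex_weight A) b * (- q - 1 / q) ^ card (curves E (R \<union> set (zip F F0) \<union> smoothings xs b)))"
    by (simp only: bracket_aux_states[OF \<delta>] d[symmetric])
  also have "\<dots> = (\<Sum>b\<in>blists (length w). wtl (vertex_weight A) b * mt (kp q) (quantum_e q) (length F0) (e_word w b))"
  proof (rule sum.cong)
    fix b assume "b \<in> blists (length w)"
    then have b: "length b = length w" by (simp add: blists_def)
    have "R \<union> set (zip F F0) \<union> smoothings xs b = R \<union> smoothings xs b \<union> set (zip F F0)" by auto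
    then show "wtl (vertex_weight A) b * (- q - 1 / q) ^ card (curves E (R \<union> set (zip F F0) \<union> smoothings xs b)) =
       wtl (vertex_weight A) b * mt (kp q) (quantum_e q) (length F0) (e_word w b)"
      by (simp only: built_quantum[OF q bu b])
  qed (use p in simp)
  also have "\<dots> = tr (blists (length F0)) (\<lambda>f s. \<Sum>b\<in>blists (length w). wtl (vertex_weight A) b * (kapl q s * actw (quantum_e q) (quantum_e q) (pos (e_word w b)) f s))"
    unfolding tr_sum tr_scale mt_def kapl_wtl ..
  also have "\<dots> = tr (blists (length F0)) (\<lambda>f s. kapl q s * actw (sig A q) (sig' A q) w f s)"
  proof (rule tr_cong)
    fix s f assume "s \<in> blists (length F0)"
    then have "\<forall>(p, t)\<in>set w. Suc p < length s" using p by (simp add: blists_def)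
    from actw_states[OF AAq this, of f]
    show "(\<Sum>b\<in>blists (length w). wtl (vertex_weight A) b * (kapl q s * actw (quantum_e q) (quantum_e q) (pos (e_word w b)) f s)) =
       kapl q s * actw (sig A q) (sig' A q) w f s"
      by (simp add: sum_distrib_left mult_ac)
  qed
  finally show ?thesis .
qed

section \<open>Cables of closed braids\<close>

text \<open>In a negative letter the overstrand starts on the right, hence the exchanged lengths
  under \<open>neg\<close>.\<close>

fun cable_letter :: "nat list \<Rightarrow> nat \<times> bool \<Rightarrow> (nat \<times> bool) list" where
  "cable_letter ls (i, b) =
     shift (sum_list (take i ls)) (if b then pos (wd (ls ! i) (ls ! Suc i)) else neg (wd (ls ! Suc i) (ls ! i)))"

fun cable_word :: "nat list \<Rightarrow> (nat \<times> bool) list \<Rightarrow> (nat \<times> bool) list" where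
  "cable_word ls [] = []"
| "cable_word ls (l # w) = cable_letter ls l @ cable_word (swp (fst l) ls) w"

lemma cable_word_snoc: "cable_word ls (w @ [l]) = cable_word ls w @ cable_letter (swps w ls) l"
  by (induction w arbitrary: ls) auto

lemma actw_cable_letter:
  assumes R: "lin2 R" "lin2 R'" and s: "map length s = ls" and i: "Suc i < length ls"
  shows "actw R R' (cable_letter ls (i, b)) f (concat s) = act (if b then xr R else xl R') i (\<lambda>s. f (concat s)) s"
proof -
  let ?p = "take i s" and ?x = "s ! i" and ?y = "s ! Suc i" and ?z = "drop (Suc (Suc i)) s"
  have l: "length ls = length s" using s by auto
  have sp: "s = ?p @ ?x # ?y # ?z" using i l by (metis Cons_nth_drop_Suc Suc_lessD append_take_drop_id)
  have lp: "sum_list (take i ls) = length (concat ?p)" by (simp add: s[symmetric] length_concat take_map)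
  have n: "ls ! i = length ?x" "ls ! Suc i = length ?y" using s i l by (metis Suc_lessD nth_map)+
  have c: "concat s = concat ?p @ ?x @ ?y @ concat ?z" by (subst sp) simp
  have a: "act X i g s = X (\<lambda>u v. g (?p @ u # v # ?z)) ?x ?y" for X and g :: "bool list list \<Rightarrow> 'a"
    using act_shift[of X ?p 0 g "?x # ?y # ?z"] i l by (subst sp) simp
  show ?thesis
    unfolding cable_letter.simps lp c actw_shift a n using actw_xr[OF R(1)] actw_xl[OF R(2)] by simp
qed

lemma actw_cable_word:
  assumes R: "lin2 R" "lin2 R'"
  shows "map length s = ls \<Longrightarrow> \<forall>(i, b)\<in>set w. Suc i < length ls \<Longrightarrow>
    actw R R' (cable_word ls w) f (concat s) = actw (xr R) (xl R') w (\<lambda>s. f (concat s)) s"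
proof (induction w arbitrary: s ls)
  case (Cons l w)
  obtain i b where l: "l = (i, b)" by force
  let ?X = "if b then xr R else xl R'"
  have X: "strand_op ?X" using R by (simp add: strand_op_xr strand_op_xl)
  have f: "fl (shapes (swp i ls)) (\<lambda>f. act ?X i f s)" by (rule fl_act_strand[OF X]) (use Cons.prems in \<open>simp add: shapes_def\<close>)
  have "actw R R' (cable_word ls (l # w)) f (concat s) = act ?X i (\<lambda>s. actw R R' (cable_word (swp i ls) w) f (concat s)) s"
    using Cons.prems by (simp add: l actw_append actw_cable_letter[OF R] del: cable_letter.simps)
  also have "\<dots> = act ?X i (actw (xr R) (xl R') w (\<lambda>s. f (concat s))) s"
    by (rule fl_cong[where \<phi> = "\<lambda>f. act ?X i f s", OF f]) (use Cons.prems in \<open>auto simp: shapes_def intro!: Cons.IH\<close>)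
  finally show ?case by (simp add: l)
qed simp

lemma bij_concat: "bij_betw concat (shapes ls) (blists (sum_list ls))"
  unfolding bij_betw_def
proof
  show "inj_on concat (shapes ls)"
  proof
    fix s t assume "s \<in> shapes ls" "t \<in> shapes ls" and c: "concat s = concat t"
    then have m: "map length s = map length t" by (simp add: shapes_def)
    then have l: "length s = length t" by (rule map_eq_imp_length_eq)
    have "\<forall>(x, y)\<in>set (zip s t). length x = length y"
      using m l by (auto simp: set_zip list_eq_iff_nth_eq)
    then show "s = t" using concat_injective[OF c l] by blast
  qed
  show "concat ` shapes ls = blists (sum_list ls)"
  proof
    show "concat ` shapes ls \<subseteq> blists (sum_list ls)" by (auto simp: shapes_def blists_def length_concat)
    show "blists (sum_list ls) \<subseteq> concat ` shapes ls"
    proof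
      fix x show "x \<in> blists (sum_list ls) \<Longrightarrow> x \<in> concat ` shapes ls"
      proof (induction ls arbitrary: x)
        case (Cons a ls)
        then have "drop a x \<in> blists (sum_list ls)" by (simp add: blists_def)
        then obtain s where "s \<in> shapes ls" "concat s = drop a x" using Cons.IH by force
        then show ?case using Cons.prems by (intro image_eqI[of _ _ "take a x # s"]) (auto simp: shapes_def blists_def)
      qed (simp add: blists_def)
    qed
  qed
qed

lemma kapl_concat: "kapl q (concat s) = kaps q s"
  by (induction s) auto

lemma tr_cable_word:
  assumes R: "lin2 R" "lin2 R'" and w: "\<forall>(i, b)\<in>set w. Suc i < length ls" "swps w ls = ls"
  shows "tr (blists (sum_list ls)) (\<lambda>f s. kapl q s * actw R R' (cable_word ls w) f s) =
    tr (shapes ls) (\<lambda>f s. kaps q s * actw (xr R) (xl R') w f s)"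
proof (rule tr_reindex[OF bij_concat finite_shapes])
  fix s assume s: "s \<in> shapes ls"
  show "fl (shapes ls) (\<lambda>f. kaps q s * actw (xr R) (xl R') w f s)"
    using fl_scale[OF fl_actw_strand[OF strand_op_xr[OF R(1)] strand_op_xl[OF R(2)] s, of w]] w(2) by simp
  fix f show "kapl q (concat s) * actw R R' (cable_word ls w) f (concat s) =
      kaps q s * actw (xr R) (xl R') w (\<lambda>s. f (concat s)) s"
    using actw_cable_word[OF R _ w(1)] s by (simp add: shapes_def kapl_concat)
qed

text \<open>The same word row by row, as the grid of a crossing is drawn.\<close>

lemma wd_concat: "wd a b = concat (map (\<lambda>i. map ((+) i) [0..<b]) (rev [0..<a]))"
proof (induction a)
  case (Suc a)
  have "[0..<Suc a] = 0 # map Suc [0..<a]" by (rule upt_Suc0)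
  moreover have "(+) (Suc x) = (\<lambda>y. Suc (x + y))" "(+) (0::nat) = (\<lambda>y. y)" for x by auto
  ultimately show ?case by (simp add: Suc map_concat comp_def rev_map del: upt_Suc)
qed simp

lemma built_eq: "built F0 E xs R F w \<Longrightarrow> E = E' \<Longrightarrow> xs = xs' \<Longrightarrow> R = R' \<Longrightarrow> F = F' \<Longrightarrow> w = w' \<Longrightarrow> built F0 E' xs' R' F' w'"
  by simp

lemma built_joins:
  "built F0 E xs R (F1 @ map f ys @ F2) w \<Longrightarrow> distinct ys \<Longrightarrow> inj_on g (set ys) \<Longrightarrow> g ` set ys \<inter> E = {} \<Longrightarrow>
   built F0 (E \<union> g ` set ys) xs (R \<union> (\<lambda>y. (f y, g y)) ` set ys) (F1 @ map g ys @ F2) w"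
proof (induction ys arbitrary: F1 E R)
  case (Cons y ys)
  have "built F0 (insert (g y) E) xs (insert (f y, g y) R) (F1 @ g y # map f ys @ F2) w"
    by (rule built.join) (use Cons.prems in auto)
  then have "built F0 (insert (g y) E) xs (insert (f y, g y) R) ((F1 @ [g y]) @ map f ys @ F2) w" by simp
  moreover have "g ` set ys \<inter> insert (g y) E = {}" using Cons.prems by (auto simp: inj_on_def)
  ultimately have "built F0 (insert (g y) E \<union> g ` set ys) xs (insert (f y, g y) R \<union> (\<lambda>y. (f y, g y)) ` set ys) ((F1 @ [g y]) @ map g ys @ F2) w"
    using Cons.prems by (intro Cons.IH) auto
  then show ?case by (rule built_eq) auto
qed simp

subsection \<open>Grids\<close>

lemma fresh_image:
  assumes "f ` S \<inter> E = {}" "f ` S \<inter> g ` T = {}" "inj_on f S" "x \<in> S" "S' \<subseteq> S" "T' \<subseteq> T" "x \<notin> S'"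
  shows "f x \<notin> E \<union> g ` T' \<union> f ` S'" "f x \<notin> E \<union> f ` S' \<union> g ` T'"
proof -
  have "f x \<notin> f ` S'" using assms(3-5,7) by (simp add: inj_on_image_mem_iff)
  moreover have "f x \<notin> E" using assms(1,4) by blast
  moreover have "f x \<notin> g ` T'" using assms(2,4,6) by blast
  ultimately show "f x \<notin> E \<union> g ` T' \<union> f ` S'" "f x \<notin> E \<union> f ` S' \<union> g ` T'" by auto
qed

text \<open>The overstrand with segments \<open>O'\<close> enters on the left and turns the strands
  \<open>X\<close> into \<open>Y\<close>; the counter \<open>c\<close> gives the crossings already
  drawn.\<close>

lemma built_row_pos:
  assumes bu: "built F0 E xs R (F1 @ O' 0 # map X [0..<b] @ F2) w"
    and fresh: "O' ` {1..b} \<inter> E = {}" "Y ` {..<b} \<inter> E = {}" "O' ` {1..b} \<inter> Y ` {..<b} = {}" "inj_on O' {1..b}" "inj_on Y {..<b}"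
  shows "c \<le> b \<Longrightarrow> built F0 (E \<union> O' ` {1..c} \<union> Y ` {..<c}) (xs @ map (\<lambda>j. Crossing True (O' j) (O' (Suc j)) (X j) (Y j)) [0..<c]) R
    (F1 @ map Y [0..<c] @ O' c # map X [c..<b] @ F2) (w @ map (\<lambda>j. (length F1 + j, True)) [0..<c])"
proof (induction c)
  case 0 show ?case using bu by simp
next
  case (Suc c)
  have e: "map X [c..<b] = X c # map X [Suc c..<b]" using Suc.prems by (simp add: upt_conv_Cons)
  have "built F0 (E \<union> O' ` {1..c} \<union> Y ` {..<c}) (xs @ map (\<lambda>j. Crossing True (O' j) (O' (Suc j)) (X j) (Y j)) [0..<c]) R
    ((F1 @ map Y [0..<c]) @ O' c # X c # map X [Suc c..<b] @ F2) (w @ map (\<lambda>j. (length F1 + j, True)) [0..<c])"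
    using Suc.IH Suc.prems e by simp
  then have "built F0 (insert (Y c) (insert (O' (Suc c)) (E \<union> O' ` {1..c} \<union> Y ` {..<c})))
     ((xs @ map (\<lambda>j. Crossing True (O' j) (O' (Suc j)) (X j) (Y j)) [0..<c]) @ [Crossing True (O' c) (O' (Suc c)) (X c) (Y c)]) R
    ((F1 @ map Y [0..<c]) @ Y c # O' (Suc c) # map X [Suc c..<b] @ F2) ((w @ map (\<lambda>j. (length F1 + j, True)) [0..<c]) @ [(length (F1 @ map Y [0..<c]), True)])"
  proof (rule built.cross)
    have sc: "Suc c \<in> {1..b}" "c \<in> {..<b}" "{1..c} \<subseteq> {1..b}" "{..<c} \<subseteq> {..<b}" using Suc.prems by auto
    show "Y c \<notin> E \<union> O' ` {1..c} \<union> Y ` {..<c}"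
      using fresh(3) by (intro fresh_image(1)[OF fresh(2) _ fresh(5) sc(2) sc(4) sc(3)]) auto
    show "O' (Suc c) \<notin> E \<union> O' ` {1..c} \<union> Y ` {..<c}"
      by (rule fresh_image(2)[OF fresh(1) fresh(3) fresh(4) sc(1) sc(3) sc(4)]) simp
    show "Y c \<noteq> O' (Suc c)" using fresh(3) sc by blast
  qed simp
  moreover have "{1..Suc c} = insert (Suc c) {1..c}" "{..<Suc c} = insert c {..<c}" by auto
  ultimately show ?case by (elim built_eq) auto
qed

text \<open>The overstrand enters on the right, so the indices descend and the finished part is
  \<open>b - c\<close> up to \<open>b - 1\<close>.\<close>

lemma built_row_neg:
  assumes bu: "built F0 E xs R (F1 @ map X [0..<b] @ O' b # F2) w"
    and fresh: "O' ` {..<b} \<inter> E = {}" "Y ` {..<b} \<inter> E = {}" "O' ` {..<b} \<inter> Y ` {..<b} = {}" "inj_on O' {..<b}" "inj_on Y {..<b}"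
  shows "c \<le> b \<Longrightarrow> built F0 (E \<union> O' ` {b - c..<b} \<union> Y ` {b - c..<b}) (xs @ map (\<lambda>j. Crossing False (O' (Suc j)) (O' j) (X j) (Y j)) (rev [b - c..<b])) R
    (F1 @ map X [0..<b - c] @ O' (b - c) # map Y [b - c..<b] @ F2) (w @ map (\<lambda>j. (length F1 + j, False)) (rev [b - c..<b]))"
proof (induction c)
  case 0 show ?case using bu by simp
next
  case (Suc c)
  define d where "d = b - Suc c"
  have d: "b - c = Suc d" "d < b" using Suc.prems by (auto simp: d_def)
  have rv: "rev [d..<b] = rev [Suc d..<b] @ [d]" using d by (simp add: upt_conv_Cons)
  have "built F0 (E \<union> O' ` {Suc d..<b} \<union> Y ` {Suc d..<b}) (xs @ map (\<lambda>j. Crossing False (O' (Suc j)) (O' j) (X j) (Y j)) (rev [Suc d..<b])) R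
    ((F1 @ map X [0..<d]) @ X d # O' (Suc d) # map Y [Suc d..<b] @ F2) (w @ map (\<lambda>j. (length F1 + j, False)) (rev [Suc d..<b]))"
    using Suc.IH Suc.prems unfolding d by simp
  then have "built F0 (insert (O' d) (insert (Y d) (E \<union> O' ` {Suc d..<b} \<union> Y ` {Suc d..<b})))
     ((xs @ map (\<lambda>j. Crossing False (O' (Suc j)) (O' j) (X j) (Y j)) (rev [Suc d..<b])) @ [Crossing False (O' (Suc d)) (O' d) (X d) (Y d)]) R
    ((F1 @ map X [0..<d]) @ O' d # Y d # map Y [Suc d..<b] @ F2) ((w @ map (\<lambda>j. (length F1 + j, False)) (rev [Suc d..<b])) @ [(length (F1 @ map X [0..<d]), False)])"
  proof (rule built.cross)
    have sc: "d \<in> {..<b}" "{Suc d..<b} \<subseteq> {..<b}" using d by auto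
    show "O' d \<notin> E \<union> O' ` {Suc d..<b} \<union> Y ` {Suc d..<b}"
      by (rule fresh_image(2)[OF fresh(1) fresh(3) fresh(4) sc(1) sc(2) sc(2)]) simp
    show "Y d \<notin> E \<union> O' ` {Suc d..<b} \<union> Y ` {Suc d..<b}"
      using fresh(3) by (intro fresh_image(1)[OF fresh(2) _ fresh(5) sc(1) sc(2) sc(2)]) auto
    show "O' d \<noteq> Y d" using fresh(3) sc by blast
  qed simp
  moreover have "{d..<b} = insert d {Suc d..<b}" "[d..<b] = d # [Suc d..<b]" using d by (auto simp: upt_conv_Cons)
  ultimately show ?case unfolding d_def[symmetric] by (elim built_eq) auto
qed

text \<open>The rightmost copy of the overstrand is next to the other cable and has to be drawn
  first; after \<open>c\<close> rows the copies from \<open>a - c\<close> on are finished.\<close>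

lemma built_grid_pos:
  assumes bu: "built F0 E xs R (F1 @ map (\<lambda>i. Over k i 0) [0..<a] @ map (\<lambda>j. Under k j a) [0..<b] @ F2) w"
    and fresh: "\<And>i j. Over k i j \<in> E \<Longrightarrow> j = 0" "\<And>i j. Under k j i \<in> E \<Longrightarrow> i = a"
  shows "c \<le> a \<Longrightarrow> built F0 (E \<union> {Over k i j | i j. a - c \<le> i \<and> i < a \<and> 1 \<le> j \<and> j \<le> b} \<union> {Under k j i | i j. j < b \<and> a - c \<le> i \<and> i < a})
     (xs @ concat (map (\<lambda>i. map (cable_crossing k True i) [0..<b]) (rev [a - c..<a]))) R
     (F1 @ map (\<lambda>i. Over k i 0) [0..<a - c] @ map (\<lambda>j. Under k j (a - c)) [0..<b] @ map (\<lambda>i. Over k i b) [a - c..<a] @ F2)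
     (w @ shift (length F1) (pos (concat (map (\<lambda>i. map ((+) i) [0..<b]) (rev [a - c..<a])))))"
proof (induction c)
  case 0 show ?case using bu by (rule built_eq) (auto simp: shift_def pos_def)
next
  case (Suc c)
  define d where "d = a - Suc c"
  have d: "a - c = Suc d" "d < a" using Suc.prems by (auto simp: d_def)
  let ?E = "E \<union> {Over k i j | i j. Suc d \<le> i \<and> i < a \<and> 1 \<le> j \<and> j \<le> b} \<union> {Under k j i | i j. j < b \<and> Suc d \<le> i \<and> i < a}"
  let ?xs = "xs @ concat (map (\<lambda>i. map (cable_crossing k True i) [0..<b]) (rev [Suc d..<a]))"
  let ?w = "w @ shift (length F1) (pos (concat (map (\<lambda>i. map ((+) i) [0..<b]) (rev [Suc d..<a]))))"
  have 1: "built F0 ?E ?xs R ((F1 @ map (\<lambda>i. Over k i 0) [0..<d]) @ Over k d 0 # map (\<lambda>j. Under k j (Suc d)) [0..<b] @ map (\<lambda>i. Over k i b) [Suc d..<a] @ F2) ?w"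
    using Suc.IH Suc.prems unfolding d by simp
  have 2: "built F0 (?E \<union> Over k d ` {1..b} \<union> (\<lambda>j. Under k j d) ` {..<b})
     (?xs @ map (\<lambda>j. Crossing True (Over k d j) (Over k d (Suc j)) (Under k j (Suc d)) (Under k j d)) [0..<b]) R
     ((F1 @ map (\<lambda>i. Over k i 0) [0..<d]) @ map (\<lambda>j. Under k j d) [0..<b] @ Over k d b # map (\<lambda>j. Under k j (Suc d)) [b..<b] @ map (\<lambda>i. Over k i b) [Suc d..<a] @ F2)
     (?w @ map (\<lambda>j. (length (F1 @ map (\<lambda>i. Over k i 0) [0..<d]) + j, True)) [0..<b])"
    by (rule built_row_pos[where O' = "Over k d" and X = "\<lambda>j. Under k j (Suc d)" and Y = "\<lambda>j. Under k j d", OF 1]) (use fresh d in \<open>fastforce simp: inj_on_def\<close>)+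
  have s0: "[d..<a] = d # [Suc d..<a]" using d by (simp add: upt_conv_Cons)
  have s1: "{Over k i j | i j. d \<le> i \<and> i < a \<and> 1 \<le> j \<and> j \<le> b} = {Over k i j | i j. Suc d \<le> i \<and> i < a \<and> 1 \<le> j \<and> j \<le> b} \<union> Over k d ` {1..b}"
    using d by (auto simp: Suc_le_eq order_le_less)
  have s2: "{Under k j i | i j. j < b \<and> d \<le> i \<and> i < a} = {Under k j i | i j. j < b \<and> Suc d \<le> i \<and> i < a} \<union> (\<lambda>j. Under k j d) ` {..<b}"
    using d by (auto simp: Suc_le_eq order_le_less)
  show ?case unfolding d_def[symmetric] s0 s1 s2
    by (rule built_eq[OF 2]) (simp_all add: cable_crossing_def[abs_def] pos_def shift_def comp_def Un_ac)
qed

text \<open>Here the overstrands come from the right, so the leftmost copy, number 0, is drawn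
  first.\<close>

lemma built_grid_neg:
  assumes bu: "built F0 E xs R (F1 @ map (\<lambda>j. Under k j 0) [0..<b] @ map (\<lambda>i. Over k i b) [0..<a] @ F2) w"
    and fresh: "\<And>i j. Over k i j \<in> E \<Longrightarrow> j = b" "\<And>i j. Under k j i \<in> E \<Longrightarrow> i = 0"
  shows "c \<le> a \<Longrightarrow> built F0 (E \<union> {Over k i j | i j. i < c \<and> j < b} \<union> {Under k j i | i j. j < b \<and> 1 \<le> i \<and> i \<le> c})
     (xs @ concat (map (\<lambda>i. map (cable_crossing k False i) (rev [0..<b])) [0..<c])) R
     (F1 @ map (\<lambda>i. Over k i 0) [0..<c] @ map (\<lambda>j. Under k j c) [0..<b] @ map (\<lambda>i. Over k i b) [c..<a] @ F2)
     (w @ shift (length F1) (map (\<lambda>p. (p, False)) (concat (map (\<lambda>i. rev (map ((+) i) [0..<b])) [0..<c]))))"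
proof (induction c)
  case 0 show ?case using bu by (rule built_eq) (auto simp: shift_def)
next
  case (Suc c)
  let ?E = "E \<union> {Over k i j | i j. i < c \<and> j < b} \<union> {Under k j i | i j. j < b \<and> 1 \<le> i \<and> i \<le> c}"
  let ?xs = "xs @ concat (map (\<lambda>i. map (cable_crossing k False i) (rev [0..<b])) [0..<c])"
  let ?w = "w @ shift (length F1) (map (\<lambda>p. (p, False)) (concat (map (\<lambda>i. rev (map ((+) i) [0..<b])) [0..<c])))"
  have 1: "built F0 ?E ?xs R ((F1 @ map (\<lambda>i. Over k i 0) [0..<c]) @ map (\<lambda>j. Under k j c) [0..<b] @ Over k c b # map (\<lambda>i. Over k i b) [Suc c..<a] @ F2) ?w"
    using Suc.IH Suc.prems upt_conv_Cons[of c a] by simp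
  have 2: "built F0 (?E \<union> Over k c ` {b - b..<b} \<union> (\<lambda>j. Under k j (Suc c)) ` {b - b..<b})
     (?xs @ map (\<lambda>j. Crossing False (Over k c (Suc j)) (Over k c j) (Under k j c) (Under k j (Suc c))) (rev [b - b..<b])) R
     ((F1 @ map (\<lambda>i. Over k i 0) [0..<c]) @ map (\<lambda>j. Under k j c) [0..<b - b] @ Over k c (b - b) # map (\<lambda>j. Under k j (Suc c)) [b - b..<b] @ map (\<lambda>i. Over k i b) [Suc c..<a] @ F2)
     (?w @ map (\<lambda>j. (length (F1 @ map (\<lambda>i. Over k i 0) [0..<c]) + j, False)) (rev [b - b..<b]))"
    by (rule built_row_neg[where O' = "Over k c" and X = "\<lambda>j. Under k j c" and Y = "\<lambda>j. Under k j (Suc c)", OF 1]) (use fresh Suc.prems in \<open>fastforce simp: inj_on_def\<close>)+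
  have s1: "{Over k i j | i j. i < Suc c \<and> j < b} = {Over k i j | i j. i < c \<and> j < b} \<union> Over k c ` {..<b}"
    by (auto simp: less_Suc_eq)
  have s2: "{Under k j i | i j. j < b \<and> 1 \<le> i \<and> i \<le> Suc c} = {Under k j i | i j. j < b \<and> 1 \<le> i \<and> i \<le> c} \<union> (\<lambda>j. Under k j (Suc c)) ` {..<b}"
    by (auto simp: le_Suc_eq)
  show ?case unfolding s1 s2
    by (rule built_eq[OF 2]) (simp_all add: cable_crossing_def[abs_def] shift_def comp_def rev_map Un_ac atLeast0LessThan)
qed

subsection \<open>Rows of arcs\<close>

definition row :: "(nat \<times> nat \<Rightarrow> 'b) \<Rightarrow> nat \<Rightarrow> nat \<Rightarrow> 'b list" where
  "row g n l = map (\<lambda>p. g (p, l)) [1..<Suc n]"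

lemma length_row [simp]: "length (row g n l) = n"
  by (simp add: row_def)

lemma nth_row: "p < n \<Longrightarrow> row g n l ! p = g (Suc p, l)"
  by (simp add: row_def del: upt_Suc)

lemma all_Suc_conv: "(\<forall>p<n. P (Suc p)) \<longleftrightarrow> (\<forall>p. 1 \<le> p \<longrightarrow> p \<le> n \<longrightarrow> P p)"
  by (metis Suc_le_eq Suc_le_mono One_nat_def le_0_eq not0_implies_Suc zero_less_Suc)

lemma row_eq_iff: "row g n l = row g n l' \<longleftrightarrow> (\<forall>p. 1 \<le> p \<longrightarrow> p \<le> n \<longrightarrow> g (p, l) = g (p, l'))"
  using all_Suc_conv[of n "\<lambda>p. g (p, l) = g (p, l')"] by (simp add: list_eq_iff_nth_eq nth_row)

lemma swp_row_iff:
  assumes "1 \<le> i" "i < n"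
  shows "swp (i - 1) (row g n l) = row g n (Suc l) \<longleftrightarrow>
    g (i, l) = g (Suc i, Suc l) \<and> g (Suc i, l) = g (i, Suc l) \<and>
    (\<forall>p. 1 \<le> p \<longrightarrow> p \<le> n \<longrightarrow> p \<noteq> i \<longrightarrow> p \<noteq> Suc i \<longrightarrow> g (p, l) = g (p, Suc l))"
proof -
  have "swp (i - 1) (row g n l) ! p = (if Suc p = i then g (Suc i, l) else if p = i then g (i, l) else g (Suc p, l))" if "p < n" for p
    using assms that by (subst nth_swp) (auto simp: nth_row)
  then have "swp (i - 1) (row g n l) = row g n (Suc l) \<longleftrightarrow>
     (\<forall>p<n. (if Suc p = i then g (Suc i, l) else if Suc p = Suc i then g (i, l) else g (Suc p, l)) = g (Suc p, Suc l))"
    by (simp add: list_eq_iff_nth_eq nth_row)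
  also have "\<dots> \<longleftrightarrow> (\<forall>p. 1 \<le> p \<longrightarrow> p \<le> n \<longrightarrow> (if p = i then g (Suc i, l) else if p = Suc i then g (i, l) else g (p, l)) = g (p, Suc l))"
    by (rule all_Suc_conv)
  finally have e: "swp (i - 1) (row g n l) = row g n (Suc l) \<longleftrightarrow>
    (\<forall>p. 1 \<le> p \<longrightarrow> p \<le> n \<longrightarrow> (if p = i then g (Suc i, l) else if p = Suc i then g (i, l) else g (p, l)) = g (p, Suc l))" .
  show ?thesis unfolding e
  proof (intro iffI conjI allI impI)
    assume H: "\<forall>p. 1 \<le> p \<longrightarrow> p \<le> n \<longrightarrow> (if p = i then g (Suc i, l) else if p = Suc i then g (i, l) else g (p, l)) = g (p, Suc l)"
    show "g (i, l) = g (Suc i, Suc l)" using H[rule_format, of "Suc i"] assms by (simp only: if_True if_False n_not_Suc_n Suc_n_not_n) simp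
    show "g (Suc i, l) = g (i, Suc l)" using H[rule_format, of i] assms by (simp only: if_True) simp
    fix p assume "1 \<le> p" "p \<le> n" "p \<noteq> i" "p \<noteq> Suc i"
    then show "g (p, l) = g (p, Suc l)" using H[rule_format, of p] by (simp only: if_False)
  next
    fix p assume H: "g (i, l) = g (Suc i, Suc l) \<and> g (Suc i, l) = g (i, Suc l) \<and>
      (\<forall>p. 1 \<le> p \<longrightarrow> p \<le> n \<longrightarrow> p \<noteq> i \<longrightarrow> p \<noteq> Suc i \<longrightarrow> g (p, l) = g (p, Suc l))" and p: "1 \<le> p" "p \<le> n"
    consider "p = i" | "p = Suc i" | "p \<noteq> i" "p \<noteq> Suc i" by blast
    then show "(if p = i then g (Suc i, l) else if p = Suc i then g (i, l) else g (p, l)) = g (p, Suc l)"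
      using H p by cases simp_all
  qed
qed

section \<open>Strands of a closed braid and functions constant along them\<close>

definition letters :: "nat \<Rightarrow> braid_word \<Rightarrow> bool" where
  "letters n w \<longleftrightarrow> (\<forall>(i, s)\<in>set w. 1 \<le> i \<and> i < n)"

lemma letters_nth: "letters n w \<Longrightarrow> l < length w \<Longrightarrow> 1 \<le> fst (w ! l) \<and> fst (w ! l) < n"
  unfolding letters_def by (drule bspec[of _ _ "w ! l"]) (auto simp: case_prod_beta)

lemma crossing_strands:
  "{(over_in (braid_crossing l x), over_out (braid_crossing l x)), (under_in (braid_crossing l x), under_out (braid_crossing l x))} =
   {((fst x, l), (Suc (fst x), Suc l)), ((Suc (fst x), l), (fst x, Suc l))}"
  by (cases x; cases "snd x") auto

lemma strand_rel_closure:
  "strand_rel (braid_closure n w) =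
    (\<Union>l<length w. {((fst (w ! l), l), (Suc (fst (w ! l)), Suc l)), ((Suc (fst (w ! l)), l), (fst (w ! l), Suc l))} \<union>
      {((p, l), (p, Suc l)) | p. 1 \<le> p \<and> p \<le> n \<and> p \<noteq> fst (w ! l) \<and> p \<noteq> Suc (fst (w ! l))}) \<union>
    {((p, length w), (p, 0)) | p. 1 \<le> p \<and> p \<le> n}"
  unfolding strand_rel_def braid_closure_def Let_def diagram.sel set_map set_upt UN_simps(10) crossing_strands
  by (auto simp: atLeast0LessThan)

text \<open>Turns constancy along strands into a condition on rows, to which \<open>swp\<close> and
  \<open>swps\<close> apply. It serves for the multiplicities of a cable, for
  \<open>component_of\<close> and for Boolean markings.\<close>

lemma strand_const_iff:
  assumes w: "letters n w"
  shows "(\<forall>(e, f)\<in>strand_rel (braid_closure n w). g e = g f) \<longleftrightarrow>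
    (\<forall>l<length w. swp (fst (w ! l) - 1) (row g n l) = row g n (Suc l)) \<and> row g n (length w) = row g n 0"
proof -
  have "(\<forall>l<length w. swp (fst (w ! l) - 1) (row g n l) = row g n (Suc l)) \<longleftrightarrow>
    (\<forall>l<length w. g (fst (w ! l), l) = g (Suc (fst (w ! l)), Suc l) \<and> g (Suc (fst (w ! l)), l) = g (fst (w ! l), Suc l) \<and>
    (\<forall>p. 1 \<le> p \<longrightarrow> p \<le> n \<longrightarrow> p \<noteq> fst (w ! l) \<longrightarrow> p \<noteq> Suc (fst (w ! l)) \<longrightarrow> g (p, l) = g (p, Suc l)))"

  proof (rule all_cong, rule swp_row_iff)
    fix l assume "l < length w"
    from letters_nth[OF w this] show "1 \<le> fst (w ! l)" "fst (w ! l) < n" by blast+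
  qed
  moreover have "row g n (length w) = row g n 0 \<longleftrightarrow> (\<forall>p. 1 \<le> p \<longrightarrow> p \<le> n \<longrightarrow> g (p, length w) = g (p, 0))"
    by (rule row_eq_iff)
  moreover have "(\<forall>(e, f)\<in>{(h p, h' p) | p. Q p}. g e = g f) \<longleftrightarrow> (\<forall>p. Q p \<longrightarrow> g (h p) = g (h' p))"
    for h h' :: "nat \<Rightarrow> nat \<times> nat" and Q by blast
  ultimately show ?thesis unfolding strand_rel_closure ball_Un ball_UN ball_simps split_conv
    by (simp only: lessThan_iff ball_simps Ball_def imp_conjL simp_thms conj_assoc)
qed

lemma swps_take:
  "\<forall>l<length w. swp (fst (w ! l) - 1) (row g n l) = row g n (Suc l) \<Longrightarrow> k \<le> length w \<Longrightarrow> swps (take k (zb w)) (row g n 0) = row g n k"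
proof (induction k)
  case (Suc k)
  then have "take (Suc k) (zb w) = take k (zb w) @ [(fst (w ! k) - 1, snd (w ! k))]"
    by (simp add: take_Suc_conv_app_nth zb_def case_prod_beta)
  then show ?case using Suc by (simp add: swps_append)
qed simp

subsection \<open>The cable drawn from bottom to top\<close>

definition copy_at :: "nat \<Rightarrow> nat \<times> nat \<Rightarrow> (nat \<times> nat) cable_arc" where
  "copy_at k = (\<lambda>(p, j). Copy (p, k) j)"

definition copies :: "(nat \<times> nat \<Rightarrow> nat) \<Rightarrow> nat \<Rightarrow> nat list \<Rightarrow> (nat \<times> nat) list" where
  "copies r k ps = concat (map (\<lambda>p. map (Pair p) [0..<r (p, k)]) ps)"

lemma set_copies: "set (copies r k ps) = {(p, j). p \<in> set ps \<and> j < r (p, k)}"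
  by (auto simp: copies_def)

lemma copies_simps:
  "copies r k [] = []" "copies r k (p # ps) = map (Pair p) [0..<r (p, k)] @ copies r k ps"
  "copies r k (ps @ qs) = copies r k ps @ copies r k qs"
  by (auto simp: copies_def)

lemma distinct_copies: "distinct ps \<Longrightarrow> distinct (copies r k ps)"
  by (induction ps) (auto simp: copies_simps distinct_map inj_on_def set_copies)

lemma inj_copy_at: "inj (copy_at k)"
  by (auto simp: inj_on_def copy_at_def)

definition front :: "(nat \<times> nat \<Rightarrow> nat) \<Rightarrow> nat \<Rightarrow> nat \<Rightarrow> (nat \<times> nat) cable_arc list" where
  "front r n k = map (copy_at k) (copies r k [1..<Suc n])"

lemma length_front: "length (front r n k) = sum_list (row r n k)"
  by (simp add: front_def copies_def row_def length_concat comp_def del: upt_Suc)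

text \<open>Strands that do not meet the crossing run straight up to the next level.\<close>

lemma built_up:
  assumes bu: "built F0 E xs R (F1 @ map (copy_at k) (copies r k ps) @ F2) w" and ps: "distinct ps" "\<forall>p\<in>set ps. r (p, Suc k) = r (p, k)"
    and E: "\<And>p j. p \<in> set ps \<Longrightarrow> Copy (p, Suc k) j \<notin> E"
  shows "built F0 (E \<union> {Copy (p, Suc k) j | p j. p \<in> set ps \<and> j < r (p, k)}) xs
    (R \<union> {(Copy (p, k) j, Copy (p, Suc k) j) | p j. p \<in> set ps \<and> j < r (p, k)}) (F1 @ map (copy_at (Suc k)) (copies r (Suc k) ps) @ F2) w"
proof -
  have "copies r (Suc k) ps = copies r k ps" using ps(2) by (simp add: copies_def cong: map_cong)
  moreover have "built F0 (E \<union> copy_at (Suc k) ` set (copies r k ps)) xs (R \<union> (\<lambda>y. (copy_at k y, copy_at (Suc k) y)) ` set (copies r k ps))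
      (F1 @ map (copy_at (Suc k)) (copies r k ps) @ F2) w"
    by (rule built_joins[OF bu distinct_copies[OF ps(1)] inj_on_subset[OF inj_copy_at]])
      (use E in \<open>auto simp: set_copies copy_at_def\<close>)
  ultimately show ?thesis by (elim built_eq) (auto simp: set_copies copy_at_def image_iff)
qed

lemma mset_concat_rev: "mset (concat (map f (rev xs))) = mset (concat (map f xs))"
  by (induction xs) auto

lemma mset_concat_map_rev: "mset (concat (map (\<lambda>i. map (f i) (rev ys)) xs)) = mset (concat (map (\<lambda>i. map (f i) ys) xs))"
  by (induction xs) (auto simp flip: rev_map)

text \<open>The incoming copies are joined to the outer segments of the grid, the grid is drawn, and
  its last segments are joined to the copies of the next level. The grid is drawn in an order other
  than that of \<open>cable_grid\<close>, so only the multisets agree.\<close>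

lemma built_crossing:
  fixes s :: bool and r :: "nat \<times> nat \<Rightarrow> nat" and i k :: nat
  defines "x \<equiv> braid_crossing k (i, s)"
  assumes bu: "built F0 E xs R (F1 @ map (Copy (i, k)) [0..<r (i, k)] @ map (Copy (Suc i, k)) [0..<r (Suc i, k)] @ F2) w"
    and E: "\<And>j j'. Over k j j' \<notin> E" "\<And>j j'. Under k j j' \<notin> E" "\<And>p j. Copy (p, Suc k) j \<notin> E"
    and r: "r (i, k) = r (Suc i, Suc k)" "r (Suc i, k) = r (i, Suc k)"
  shows "\<exists>ys. mset ys = mset (cable_grid r k x) \<and>
    built F0 (E \<union> cable_segments r k x \<union> Copy (i, Suc k) ` {..<r (i, Suc k)} \<union> Copy (Suc i, Suc k) ` {..<r (Suc i, Suc k)})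
     (xs @ ys) (R \<union> cable_joins r k x)
     (F1 @ map (Copy (i, Suc k)) [0..<r (i, Suc k)] @ map (Copy (Suc i, Suc k)) [0..<r (Suc i, Suc k)] @ F2)
     (w @ shift (length F1) (if s then pos (wd (r (i, k)) (r (Suc i, k))) else neg (wd (r (Suc i, k)) (r (i, k)))))"
proof (cases s)
  case True
  define a b where "a = r (i, k)" and "b = r (Suc i, k)"
  have rr: "r (i, k) = a" "r (Suc i, k) = b" "r (i, Suc k) = b" "r (Suc i, Suc k) = a" using r by (auto simp: a_def b_def)
  have x: "x = Crossing True (i, k) (Suc i, Suc k) (Suc i, k) (i, Suc k)" using True by (simp add: x_def)
  let ?E1 = "E \<union> (\<lambda>j. Over k j 0) ` set [0..<a]"
  let ?R1 = "R \<union> (\<lambda>j. (Copy (i, k) j, Over k j 0)) ` set [0..<a]"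
  have 1: "built F0 ?E1 xs ?R1 (F1 @ map (\<lambda>j. Over k j 0) [0..<a] @ map (Copy (Suc i, k)) [0..<b] @ F2) w"
    by (rule built_joins) (use bu E in \<open>auto simp: rr inj_on_def\<close>)
  let ?E2 = "?E1 \<union> (\<lambda>j. Under k j a) ` set [0..<b]"
  let ?R2 = "?R1 \<union> (\<lambda>j. (Copy (Suc i, k) j, Under k j a)) ` set [0..<b]"
  have "built F0 ?E2 xs ?R2 ((F1 @ map (\<lambda>j. Over k j 0) [0..<a]) @ map (\<lambda>j. Under k j a) [0..<b] @ F2) w"
    by (rule built_joins[where f = "Copy (Suc i, k)"]) (use 1 E in \<open>auto simp: inj_on_def\<close>)
  then have 2: "built F0 ?E2 xs ?R2 (F1 @ map (\<lambda>j. Over k j 0) [0..<a] @ map (\<lambda>j. Under k j a) [0..<b] @ F2) w" by simp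
  let ?E3 = "?E2 \<union> {Over k i j | i j. a - a \<le> i \<and> i < a \<and> 1 \<le> j \<and> j \<le> b} \<union> {Under k j i | i j. j < b \<and> a - a \<le> i \<and> i < a}"
  let ?ys = "concat (map (\<lambda>i. map (cable_crossing k True i) [0..<b]) (rev [a - a..<a]))"
  let ?w = "w @ shift (length F1) (pos (concat (map (\<lambda>i. map ((+) i) [0..<b]) (rev [a - a..<a]))))"
  have 3: "built F0 ?E3 (xs @ ?ys) ?R2
     (F1 @ map (\<lambda>i. Over k i 0) [0..<a - a] @ map (\<lambda>j. Under k j (a - a)) [0..<b] @ map (\<lambda>i. Over k i b) [a - a..<a] @ F2) ?w"
    by (rule built_grid_pos[OF 2]) (use E in auto)
  let ?E4 = "?E3 \<union> Copy (i, Suc k) ` set [0..<b]"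
  let ?R4 = "?R2 \<union> (\<lambda>j. (Under k j 0, Copy (i, Suc k) j)) ` set [0..<b]"
  have 4: "built F0 ?E4 (xs @ ?ys) ?R4 (F1 @ map (Copy (i, Suc k)) [0..<b] @ map (\<lambda>i. Over k i b) [0..<a] @ F2) ?w"
    by (rule built_joins) (use 3 E in \<open>auto simp: inj_on_def\<close>)
  let ?E5 = "?E4 \<union> Copy (Suc i, Suc k) ` set [0..<a]"
  let ?R5 = "?R4 \<union> (\<lambda>j. (Over k j b, Copy (Suc i, Suc k) j)) ` set [0..<a]"
  have 5: "built F0 ?E5 (xs @ ?ys) ?R5 ((F1 @ map (Copy (i, Suc k)) [0..<b]) @ map (Copy (Suc i, Suc k)) [0..<a] @ F2) ?w"
    by (rule built_joins[where f = "\<lambda>j. Over k j b"]) (use 4 E in \<open>auto simp: inj_on_def\<close>)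
  have m: "mset ?ys = mset (cable_grid r k x)"
    unfolding mset_concat_rev by (simp add: cable_grid_def x rr)
  have s1: "cable_segments r k x = (\<lambda>j. Over k j 0) ` set [0..<a] \<union> (\<lambda>j. Under k j a) ` set [0..<b] \<union>
      {Over k i j | i j. a - a \<le> i \<and> i < a \<and> 1 \<le> j \<and> j \<le> b} \<union> {Under k j i | i j. j < b \<and> a - a \<le> i \<and> i < a}"
  proof (rule set_eqI)
    fix z show "z \<in> cable_segments r k x \<longleftrightarrow> z \<in> (\<lambda>j. Over k j 0) ` set [0..<a] \<union> (\<lambda>j. Under k j a) ` set [0..<b] \<union>
      {Over k i j | i j. a - a \<le> i \<and> i < a \<and> 1 \<le> j \<and> j \<le> b} \<union> {Under k j i | i j. j < b \<and> a - a \<le> i \<and> i < a}"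
      by (cases z) (auto simp: cable_segments_def x rr Let_def)
  qed
  have s2: "cable_joins r k x = (\<lambda>j. (Copy (i, k) j, Over k j 0)) ` set [0..<a] \<union> (\<lambda>j. (Copy (Suc i, k) j, Under k j a)) ` set [0..<b] \<union>
      (\<lambda>j. (Under k j 0, Copy (i, Suc k) j)) ` set [0..<b] \<union> (\<lambda>j. (Over k j b, Copy (Suc i, Suc k) j)) ` set [0..<a]"
    by (auto simp: cable_joins_def x rr Let_def image_iff)
  show ?thesis
  proof (intro exI conjI)
    show "mset ?ys = mset (cable_grid r k x)" by (rule m)
    show "built F0 (E \<union> cable_segments r k x \<union> Copy (i, Suc k) ` {..<r (i, Suc k)} \<union> Copy (Suc i, Suc k) ` {..<r (Suc i, Suc k)})
     (xs @ ?ys) (R \<union> cable_joins r k x)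
     (F1 @ map (Copy (i, Suc k)) [0..<r (i, Suc k)] @ map (Copy (Suc i, Suc k)) [0..<r (Suc i, Suc k)] @ F2)
     (w @ shift (length F1) (if s then pos (wd (r (i, k)) (r (Suc i, k))) else neg (wd (r (Suc i, k)) (r (i, k)))))"
      unfolding s1 s2 by (rule built_eq[OF 5]) (simp_all add: rr True wd_concat Un_assoc atLeast0LessThan)
  qed
next
  case False
  define a b where "a = r (Suc i, k)" and "b = r (i, k)"
  have rr: "r (i, k) = b" "r (Suc i, k) = a" "r (i, Suc k) = a" "r (Suc i, Suc k) = b" using r by (auto simp: a_def b_def)
  have x: "x = Crossing False (Suc i, k) (i, Suc k) (i, k) (Suc i, Suc k)" using False by (simp add: x_def)
  let ?E1 = "E \<union> (\<lambda>j. Under k j 0) ` set [0..<b]"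
  let ?R1 = "R \<union> (\<lambda>j. (Copy (i, k) j, Under k j 0)) ` set [0..<b]"
  have 1: "built F0 ?E1 xs ?R1 (F1 @ map (\<lambda>j. Under k j 0) [0..<b] @ map (Copy (Suc i, k)) [0..<a] @ F2) w"
    by (rule built_joins) (use bu E in \<open>auto simp: rr inj_on_def\<close>)
  let ?E2 = "?E1 \<union> (\<lambda>j. Over k j b) ` set [0..<a]"
  let ?R2 = "?R1 \<union> (\<lambda>j. (Copy (Suc i, k) j, Over k j b)) ` set [0..<a]"
  have "built F0 ?E2 xs ?R2 ((F1 @ map (\<lambda>j. Under k j 0) [0..<b]) @ map (\<lambda>j. Over k j b) [0..<a] @ F2) w"
    by (rule built_joins[where f = "Copy (Suc i, k)"]) (use 1 E in \<open>auto simp: inj_on_def\<close>)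
  then have 2: "built F0 ?E2 xs ?R2 (F1 @ map (\<lambda>j. Under k j 0) [0..<b] @ map (\<lambda>j. Over k j b) [0..<a] @ F2) w" by simp
  let ?E3 = "?E2 \<union> {Over k i j | i j. i < a \<and> j < b} \<union> {Under k j i | i j. j < b \<and> 1 \<le> i \<and> i \<le> a}"
  let ?ys = "concat (map (\<lambda>i. map (cable_crossing k False i) (rev [0..<b])) [0..<a])"
  let ?w = "w @ shift (length F1) (map (\<lambda>p. (p, False)) (concat (map (\<lambda>i. rev (map ((+) i) [0..<b])) [0..<a])))"
  have 3: "built F0 ?E3 (xs @ ?ys) ?R2
     (F1 @ map (\<lambda>i. Over k i 0) [0..<a] @ map (\<lambda>j. Under k j a) [0..<b] @ map (\<lambda>i. Over k i b) [a..<a] @ F2) ?w"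
    by (rule built_grid_neg[OF 2]) (use E in auto)
  let ?E4 = "?E3 \<union> Copy (i, Suc k) ` set [0..<a]"
  let ?R4 = "?R2 \<union> (\<lambda>j. (Over k j 0, Copy (i, Suc k) j)) ` set [0..<a]"
  have 4: "built F0 ?E4 (xs @ ?ys) ?R4 (F1 @ map (Copy (i, Suc k)) [0..<a] @ map (\<lambda>j. Under k j a) [0..<b] @ F2) ?w"
    by (rule built_joins) (use 3 E in \<open>auto simp: inj_on_def\<close>)
  let ?E5 = "?E4 \<union> Copy (Suc i, Suc k) ` set [0..<b]"
  let ?R5 = "?R4 \<union> (\<lambda>j. (Under k j a, Copy (Suc i, Suc k) j)) ` set [0..<b]"
  have 5: "built F0 ?E5 (xs @ ?ys) ?R5 ((F1 @ map (Copy (i, Suc k)) [0..<a]) @ map (Copy (Suc i, Suc k)) [0..<b] @ F2) ?w"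
    by (rule built_joins[where f = "\<lambda>j. Under k j a"]) (use 4 E in \<open>auto simp: inj_on_def\<close>)
  have m: "mset ?ys = mset (cable_grid r k x)"
    unfolding mset_concat_map_rev by (simp add: cable_grid_def x rr)
  have s1: "cable_segments r k x = (\<lambda>j. Under k j 0) ` set [0..<b] \<union> (\<lambda>j. Over k j b) ` set [0..<a] \<union>
      {Over k i j | i j. i < a \<and> j < b} \<union> {Under k j i | i j. j < b \<and> 1 \<le> i \<and> i \<le> a}"
  proof (rule set_eqI)
    fix z show "z \<in> cable_segments r k x \<longleftrightarrow> z \<in> (\<lambda>j. Under k j 0) ` set [0..<b] \<union> (\<lambda>j. Over k j b) ` set [0..<a] \<union>
      {Over k i j | i j. i < a \<and> j < b} \<union> {Under k j i | i j. j < b \<and> 1 \<le> i \<and> i \<le> a}"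
      by (cases z) (auto simp: cable_segments_def x rr Let_def)
  qed
  have s2: "cable_joins r k x = (\<lambda>j. (Copy (i, k) j, Under k j 0)) ` set [0..<b] \<union> (\<lambda>j. (Copy (Suc i, k) j, Over k j b)) ` set [0..<a] \<union>
      (\<lambda>j. (Over k j 0, Copy (i, Suc k) j)) ` set [0..<a] \<union> (\<lambda>j. (Under k j a, Copy (Suc i, Suc k) j)) ` set [0..<b]"
    by (auto simp: cable_joins_def x rr Let_def image_iff)
  show ?thesis
  proof (intro exI conjI)
    show "mset ?ys = mset (cable_grid r k x)" by (rule m)
    show "built F0 (E \<union> cable_segments r k x \<union> Copy (i, Suc k) ` {..<r (i, Suc k)} \<union> Copy (Suc i, Suc k) ` {..<r (Suc i, Suc k)})
     (xs @ ?ys) (R \<union> cable_joins r k x)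
     (F1 @ map (Copy (i, Suc k)) [0..<r (i, Suc k)] @ map (Copy (Suc i, Suc k)) [0..<r (Suc i, Suc k)] @ F2)
     (w @ shift (length F1) (if s then pos (wd (r (i, k)) (r (Suc i, k))) else neg (wd (r (Suc i, k)) (r (i, k)))))"
      unfolding s1 s2 by (rule built_eq[OF 5]) (simp_all add: rr False wd_concat neg_def rev_concat rev_map comp_def Un_assoc atLeast0LessThan)
  qed
qed

lemma built_level:
  fixes s :: bool and r :: "nat \<times> nat \<Rightarrow> nat" and i k :: nat
  defines "x \<equiv> braid_crossing k (i, s)"
  assumes bu: "built F0 E xs R (front r n k) w"
    and E: "\<And>j j'. Over k j j' \<notin> E" "\<And>j j'. Under k j j' \<notin> E" "\<And>p j. Copy (p, Suc k) j \<notin> E"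
    and i: "1 \<le> i" "i < n" and r: "swp (i - 1) (row r n k) = row r n (Suc k)"
  shows "\<exists>ys. mset ys = mset (cable_grid r k x) \<and>
    built F0 (E \<union> cable_segments r k x \<union> {Copy (p, Suc k) j | p j. 1 \<le> p \<and> p \<le> n \<and> j < r (p, Suc k)})
     (xs @ ys) (R \<union> cable_joins r k x \<union> {(Copy (p, k) j, Copy (p, Suc k) j) | p j. p \<in> {1..n} - {i, Suc i} \<and> j < r (p, k)})
     (front r n (Suc k)) (w @ cable_letter (row r n k) (i - 1, s))"
proof -
  note r' = r[unfolded swp_row_iff[OF i]]
  let ?P = "[1..<i]" and ?Q = "[Suc (Suc i)..<Suc n]"
  have sp: "[1..<Suc n] = ?P @ i # Suc i # ?Q"
  proof -
    have "[1..<Suc n] = [1..<i] @ [i..<Suc n]" using i upt_add_eq_append[of 1 i "Suc n - i"] by (simp del: upt_Suc)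
    then show ?thesis using i by (simp add: upt_conv_Cons del: upt_Suc)
  qed
  have fr: "front r n l = map (copy_at l) (copies r l ?P) @ map (Copy (i, l)) [0..<r (i, l)] @ map (Copy (Suc i, l)) [0..<r (Suc i, l)] @
      map (copy_at l) (copies r l ?Q)" for l
    unfolding front_def sp by (simp add: copies_simps copy_at_def comp_def del: upt_Suc)
  let ?F1 = "map (copy_at k) (copies r k ?P)" and ?F2 = "map (copy_at k) (copies r k ?Q)"
  have rp: "\<forall>p\<in>set ?P. r (p, Suc k) = r (p, k)" "\<forall>p\<in>set ?Q. r (p, Suc k) = r (p, k)" using r' i by auto
  have len: "length ?F1 = sum_list (take (i - 1) (row r n k))"
    using i by (simp add: copies_def length_concat comp_def row_def take_map take_upt del: upt_Suc)
  have nt: "row r n k ! (i - 1) = r (i, k)" "row r n k ! Suc (i - 1) = r (Suc i, k)" using i by (simp_all add: nth_row)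
  let ?e = "E \<union> cable_segments r k x \<union> Copy (i, Suc k) ` {..<r (i, Suc k)} \<union> Copy (Suc i, Suc k) ` {..<r (Suc i, Suc k)}"
  let ?w = "w @ cable_letter (row r n k) (i - 1, s)"
  obtain ys where ys: "mset ys = mset (cable_grid r k x)" and 1: "built F0 ?e (xs @ ys) (R \<union> cable_joins r k x)
     (?F1 @ map (Copy (i, Suc k)) [0..<r (i, Suc k)] @ map (Copy (Suc i, Suc k)) [0..<r (Suc i, Suc k)] @ ?F2) ?w"
    using built_crossing[OF bu[unfolded fr] E, of s] r' unfolding x_def[symmetric] len cable_letter.simps nt by blast
  let ?e2 = "?e \<union> {Copy (p, Suc k) j | p j. p \<in> set ?P \<and> j < r (p, k)}"
  let ?m = "map (Copy (i, Suc k)) [0..<r (i, Suc k)] @ map (Copy (Suc i, Suc k)) [0..<r (Suc i, Suc k)]"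
  let ?r2 = "R \<union> cable_joins r k x \<union> {(Copy (p, k) j, Copy (p, Suc k) j) | p j. p \<in> set ?P \<and> j < r (p, k)}"
  have seg: "Copy e j \<notin> cable_segments r k x" for e j by (auto simp: cable_segments_def Let_def)
  have 2: "built F0 ?e2 (xs @ ys) ?r2 ([] @ map (copy_at (Suc k)) (copies r (Suc k) ?P) @ ?m @ ?F2) ?w"
    by (rule built_up) (use 1 E seg rp in auto)
  have 3: "built F0 (?e2 \<union> {Copy (p, Suc k) j | p j. p \<in> set ?Q \<and> j < r (p, k)}) (xs @ ys)
      (?r2 \<union> {(Copy (p, k) j, Copy (p, Suc k) j) | p j. p \<in> set ?Q \<and> j < r (p, k)})
      ((map (copy_at (Suc k)) (copies r (Suc k) ?P) @ ?m) @ map (copy_at (Suc k)) (copies r (Suc k) ?Q) @ []) ?w"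
    by (rule built_up) (use 2 E seg rp in auto)
  have s1: "{Copy (p, Suc k) j | p j. 1 \<le> p \<and> p \<le> n \<and> j < r (p, Suc k)} =
     Copy (i, Suc k) ` {..<r (i, Suc k)} \<union> Copy (Suc i, Suc k) ` {..<r (Suc i, Suc k)} \<union>
     {Copy (p, Suc k) j | p j. p \<in> set ?P \<and> j < r (p, k)} \<union> {Copy (p, Suc k) j | p j. p \<in> set ?Q \<and> j < r (p, k)}"
    (is "?L = ?M")
  proof (rule set_eqI)
    fix z
    have "1 \<le> p \<and> p \<le> n \<and> j < r (p, Suc k) \<longleftrightarrow> p = i \<and> j < r (i, Suc k) \<or> p = Suc i \<and> j < r (Suc i, Suc k) \<or>
      p \<in> set ?P \<and> j < r (p, k) \<or> p \<in> set ?Q \<and> j < r (p, k)" for p j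
    proof -
      have "1 \<le> p \<and> p \<le> n \<longleftrightarrow> p = i \<or> p = Suc i \<or> p \<in> set ?P \<or> p \<in> set ?Q" using i by auto
      then show ?thesis using rp i by auto
    qed
    then show "z \<in> ?L \<longleftrightarrow> z \<in> ?M" by blast
  qed
  have s2: "{(Copy (p, k) j, Copy (p, Suc k) j) | p j. p \<in> {1..n} - {i, Suc i} \<and> j < r (p, k)} =
    {(Copy (p, k) j, Copy (p, Suc k) j) | p j. p \<in> set ?P \<and> j < r (p, k)} \<union> {(Copy (p, k) j, Copy (p, Suc k) j) | p j. p \<in> set ?Q \<and> j < r (p, k)}"
  proof -
    have "p \<in> {1..n} - {i, Suc i} \<longleftrightarrow> p \<in> set ?P \<or> p \<in> set ?Q" for p using i by auto
    then show ?thesis by blast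
  qed
  show ?thesis
    by (intro exI conjI, rule ys, rule built_eq[OF 3]) (simp_all only: s1 s2 fr Un_assoc append_assoc append_Nil2)
qed

section \<open>The cable of a closed braid, assembled level by level\<close>

definition cable_arcs :: "(nat \<times> nat \<Rightarrow> nat) \<Rightarrow> nat \<Rightarrow> braid_word \<Rightarrow> nat \<Rightarrow> (nat \<times> nat) cable_arc set" where
  "cable_arcs r n w k = {Copy (p, l) j | p l j. 1 \<le> p \<and> p \<le> n \<and> l \<le> k \<and> j < r (p, l)} \<union>
     (\<Union>l<k. cable_segments r l (braid_crossing l (w ! l)))"

definition cable_links :: "(nat \<times> nat \<Rightarrow> nat) \<Rightarrow> nat \<Rightarrow> braid_word \<Rightarrow> nat \<Rightarrow> ((nat \<times> nat) cable_arc \<times> (nat \<times> nat) cable_arc) set" where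
  "cable_links r n w k = (\<Union>l<k. cable_joins r l (braid_crossing l (w ! l)) \<union>
     {(Copy (p, l) j, Copy (p, Suc l) j) | p j. p \<in> {1..n} - {fst (w ! l), Suc (fst (w ! l))} \<and> j < r (p, l)})"

lemma built_cable:
  assumes w: "letters n w" and r: "\<forall>l<length w. swp (fst (w ! l) - 1) (row r n l) = row r n (Suc l)"
  shows "k \<le> length w \<Longrightarrow> \<exists>xs. mset xs = mset (concat (map (\<lambda>l. cable_grid r l (braid_crossing l (w ! l))) [0..<k])) \<and>
    built (front r n 0) (cable_arcs r n w k) xs (cable_links r n w k) (front r n k) (cable_word (row r n 0) (take k (zb w)))"
proof (induction k)
  case 0
  have "distinct (front r n 0)" unfolding front_def
    using distinct_copies[of "[1..<Suc n]" r 0] inj_on_subset[OF inj_copy_at] by (simp add: distinct_map)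
  moreover have "set (front r n 0) = cable_arcs r n w 0"
    by (auto simp: front_def set_copies copy_at_def cable_arcs_def image_iff)
  ultimately have "built (front r n 0) (cable_arcs r n w 0) [] {} (front r n 0) []" using built.start by metis
  then show ?case by (intro exI[of _ "[]"]) (simp add: cable_links_def)
next
  case (Suc k)
  then obtain xs where xs: "mset xs = mset (concat (map (\<lambda>l. cable_grid r l (braid_crossing l (w ! l))) [0..<k]))"
    and bu: "built (front r n 0) (cable_arcs r n w k) xs (cable_links r n w k) (front r n k) (cable_word (row r n 0) (take k (zb w)))" by auto
  obtain i s where wk: "w ! k = (i, s)" by force
  have i: "1 \<le> i" "i < n" using letters_nth[OF w, of k] Suc.prems wk by auto
  have rk: "swp (i - 1) (row r n k) = row r n (Suc k)" using r[rule_format, of k] Suc.prems wk by simp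
  have tk: "take (Suc k) (zb w) = take k (zb w) @ [(i - 1, s)]"
    using Suc.prems wk by (simp add: take_Suc_conv_app_nth zb_def)
  have sw: "swps (take k (zb w)) (row r n 0) = row r n k" by (rule swps_take[OF r]) (use Suc.prems in simp)
  have E: "Over k j j' \<notin> cable_arcs r n w k" "Under k j j' \<notin> cable_arcs r n w k" "Copy (p, Suc k) j \<notin> cable_arcs r n w k" for p j j'
    by (auto simp: cable_arcs_def cable_segments_def Let_def)
  obtain ys where ys: "mset ys = mset (cable_grid r k (braid_crossing k (i, s)))" and 1:
    "built (front r n 0) (cable_arcs r n w k \<union> cable_segments r k (braid_crossing k (i, s)) \<union> {Copy (p, Suc k) j | p j. 1 \<le> p \<and> p \<le> n \<and> j < r (p, Suc k)})
     (xs @ ys) (cable_links r n w k \<union> cable_joins r k (braid_crossing k (i, s)) \<union> {(Copy (p, k) j, Copy (p, Suc k) j) | p j. p \<in> {1..n} - {i, Suc i} \<and> j < r (p, k)})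
     (front r n (Suc k)) (cable_word (row r n 0) (take k (zb w)) @ cable_letter (row r n k) (i - 1, s))"
    using built_level[OF bu E i rk, of s] by blast
  have e1: "cable_arcs r n w (Suc k) = cable_arcs r n w k \<union> cable_segments r k (braid_crossing k (i, s)) \<union> {Copy (p, Suc k) j | p j. 1 \<le> p \<and> p \<le> n \<and> j < r (p, Suc k)}"
  proof -
    have "{Copy (p, l) j | p l j. 1 \<le> p \<and> p \<le> n \<and> l \<le> Suc k \<and> j < r (p, l)} =
      {Copy (p, l) j | p l j. 1 \<le> p \<and> p \<le> n \<and> l \<le> k \<and> j < r (p, l)} \<union> {Copy (p, Suc k) j | p j. 1 \<le> p \<and> p \<le> n \<and> j < r (p, Suc k)}"
      by (auto simp: le_Suc_eq)
    then show ?thesis by (simp add: cable_arcs_def lessThan_Suc wk Un_ac)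
  qed
  have e2: "cable_links r n w (Suc k) = cable_links r n w k \<union> cable_joins r k (braid_crossing k (i, s)) \<union> {(Copy (p, k) j, Copy (p, Suc k) j) | p j. p \<in> {1..n} - {i, Suc i} \<and> j < r (p, k)}"
    by (simp add: cable_links_def lessThan_Suc wk Un_ac)
  show ?case
  proof (intro exI conjI)
    show "mset (xs @ ys) = mset (concat (map (\<lambda>l. cable_grid r l (braid_crossing l (w ! l))) [0..<Suc k]))"
      by (simp add: xs ys wk)
    show "built (front r n 0) (cable_arcs r n w (Suc k)) (xs @ ys) (cable_links r n w (Suc k)) (front r n (Suc k)) (cable_word (row r n 0) (take (Suc k) (zb w)))"
      unfolding e1 e2 tk cable_word_snoc sw by (rule 1)
  qed
qed

lemma letters_zb: "letters n w \<Longrightarrow> \<forall>(i, b)\<in>set (zb w). Suc i < n"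
  by (fastforce simp: letters_def zb_def)

text \<open>The arcs that close the braid pair the top ends with the bottom ends in order, which is
  the \<open>zip\<close> in \<open>bracket_built\<close>; the word of elementary crossings is then
  regrouped into crossings of cables.\<close>

theorem bracket_cable:
  fixes A :: "'a::field_char_0"
  assumes A: "A \<noteq> 0" and \<delta>: "- (A powi 2) - A powi (- 2) \<noteq> 0" and w: "letters n w"
    and r: "\<forall>(e, f)\<in>strand_rel (braid_closure n w). r e = r f"
  defines "q \<equiv> A powi (- 2)"
  shows "(- (A powi 2) - A powi (- 2)) * bracket A (cable r (braid_closure n w)) =
    tr (shapes (row r n 0)) (\<lambda>f s. kaps q s * actw (xr (sig A q)) (xl (sig' A q)) (zb w) f s)"
proof -
  let ?D = "braid_closure n w" and ?L = "length w"
  have r1: "\<forall>l<?L. swp (fst (w ! l) - 1) (row r n l) = row r n (Suc l)" and r2: "row r n ?L = row r n 0"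
    using strand_const_iff[OF w, of r] r by blast+
  obtain xs where xs: "mset xs = mset (concat (map (\<lambda>l. cable_grid r l (braid_crossing l (w ! l))) [0..<?L]))"
    and bu: "built (front r n 0) (cable_arcs r n w ?L) xs (cable_links r n w ?L) (front r n ?L) (cable_word (row r n 0) (take ?L (zb w)))"
    using built_cable[OF w r1, of ?L] by auto
  have tk: "take ?L (zb w) = zb w" by (simp add: zb_def)
  have sw: "swps (zb w) (row r n 0) = row r n 0" using swps_take[OF r1, of ?L] r2 tk by simp
  have cr: "crossings ?D = map (\<lambda>l. braid_crossing l (w ! l)) [0..<?L]" "arcs ?D = {1..n} \<times> {0..?L}"
    by (simp_all add: braid_closure_def Let_def)
  have C: "crossings (cable r ?D) = concat (map (\<lambda>l. cable_grid r l (braid_crossing l (w ! l))) [0..<?L])"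
    unfolding cable_def Let_def diagram.sel cr by (intro arg_cong[where f = concat] map_cong) auto
  have a: "arcs (cable r ?D) = cable_arcs r n w ?L"
  proof -
    have "{Copy e i | e i. e \<in> {1..n} \<times> {0..?L} \<and> i < r e} = {Copy (p, l) j | p l j. 1 \<le> p \<and> p \<le> n \<and> l \<le> ?L \<and> j < r (p, l)}"
      by force
    then show ?thesis by (simp add: cable_def Let_def cr cable_arcs_def)
  qed
  have cl: "set (zip (front r n ?L) (front r n 0)) = {(Copy (p, ?L) j, Copy (p, 0) j) | p j. p \<in> {1..n} \<and> j < r (p, ?L)}"
  proof -
    have "copies r 0 [1..<Suc n] = copies r ?L [1..<Suc n]"
      using r2 unfolding row_eq_iff by (auto simp: copies_def intro!: arg_cong[of _ _ concat] map_cong simp del: upt_Suc)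
    then show ?thesis
      by (auto simp: front_def zip_map_map zip_same_conv_map set_copies copy_at_def image_iff less_Suc_eq_le simp del: upt_Suc)
  qed
  have j: "joins (cable r ?D) = cable_links r n w ?L \<union> set (zip (front r n ?L) (front r n 0))"
  proof -
    have jD: "joins ?D = (\<Union>l<?L. {((p, l), (p, Suc l)) | p. p \<in> {1..n} - {fst (w ! l), Suc (fst (w ! l))}}) \<union> {((p, ?L), (p, 0)) | p. p \<in> {1..n}}"
      by (simp add: braid_closure_def Let_def)
    have f1: "(\<Union>(e, f)\<in>{((p, l), (p, Suc l)) | p. p \<in> S}. {(Copy e i, Copy f i) | i. i < r e}) =
        {(Copy (p, l) j, Copy (p, Suc l) j) | p j. p \<in> S \<and> j < r (p, l)}" for l S by blast
    have f2: "(\<Union>(e, f)\<in>{((p, ?L), (p, 0)) | p. p \<in> {1..n}}. {(Copy e i, Copy f i) | i. i < r e}) =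
        {(Copy (p, ?L) j, Copy (p, 0) j) | p j. p \<in> {1..n} \<and> j < r (p, ?L)}" by blast
    have "(\<Union>(e, f)\<in>joins ?D. {(Copy e i, Copy f i) | i. i < r e}) =
      (\<Union>l<?L. {(Copy (p, l) j, Copy (p, Suc l) j) | p j. p \<in> {1..n} - {fst (w ! l), Suc (fst (w ! l))} \<and> j < r (p, l)}) \<union>
       {(Copy (p, ?L) j, Copy (p, 0) j) | p j. p \<in> {1..n} \<and> j < r (p, ?L)}"
      unfolding jD UN_Un UN_UN_flatten by (rule arg_cong2[where f = "(\<union>)"]) (simp only: f1, rule f2)
    moreover have "joins (cable r ?D) = (\<Union>(e, f)\<in>joins ?D. {(Copy e i, Copy f i) | i. i < r e}) \<union> (\<Union>l<?L. cable_joins r l (braid_crossing l (w ! l)))"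
      unfolding cable_def Let_def diagram.sel cr by (rule arg_cong2[where f = "(\<union>)"]) auto
    ultimately show ?thesis
      unfolding cl cable_links_def UN_Un_distrib by (simp only: Un_assoc Un_commute Un_left_commute)
  qed
  have len: "length (front r n 0) = sum_list (row r n 0)" by (rule length_front)
  have "(- (A powi 2) - A powi (- 2)) * bracket A (cable r ?D) =
     tr (blists (sum_list (row r n 0))) (\<lambda>f s. kapl q s * actw (sig A q) (sig' A q) (cable_word (row r n 0) (zb w)) f s)"
    unfolding bracket_def C a j q_def
    using bracket_built[OF A \<delta> bu xs[symmetric]] unfolding tk len .
  also have "\<dots> = tr (shapes (row r n 0)) (\<lambda>f s. kaps q s * actw (xr (sig A q)) (xl (sig' A q)) (zb w) f s)"
    by (rule tr_cable_word[OF lin2_sig lin2_sig']) (use letters_zb[OF w] sw in simp_all)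
  finally show ?thesis .
qed

subsection \<open>Components of a closed braid\<close>

lemma component_of_eq: "(e, f) \<in> strand_rel D \<Longrightarrow> component_of D e = component_of D f"
proof -
  assume ef: "(e, f) \<in> strand_rel D"
  let ?r = "strand_rel D \<union> (strand_rel D)\<inverse>"
  have "(e, f) \<in> ?r" "(f, e) \<in> ?r" using ef by auto
  then have "(f, x) \<in> ?r\<^sup>* \<longleftrightarrow> (e, x) \<in> ?r\<^sup>*" for x by (meson converse_rtrancl_into_rtrancl)
  then show ?thesis by (auto simp: component_of_def)
qed

lemma component_const:
  assumes g: "\<forall>(e, f)\<in>strand_rel D. g e = g f" and c: "component_of D e = component_of D f"
  shows "g e = g f"
proof -
  let ?r = "strand_rel D \<union> (strand_rel D)\<inverse>"
  have "f \<in> component_of D e" unfolding c by (simp add: component_of_def)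
  then have "(e, f) \<in> ?r\<^sup>*" by (simp add: component_of_def)
  then show ?thesis by (induction rule: rtrancl_induct) (use g in auto)
qed

text \<open>For the last claim, a marking of the bottom row that the permutation fixes is pushed up
  through the word; this extends it to a function on the arcs that is constant along strands, hence
  on components.\<close>

lemma components_closure:
  assumes w: "letters n w"
  defines "D \<equiv> braid_closure n w"
  defines "cs \<equiv> row (component_of D) n 0"
  shows "swps (zb w) cs = cs" and "set cs = components D"
    and "\<And>b. length b = length cs \<Longrightarrow> swps (zb w) b = b \<Longrightarrow> \<forall>p<length cs. \<forall>p'<length cs. cs ! p = cs ! p' \<longrightarrow> b ! p = b ! p'"
proof -
  let ?L = "length w"
  have tk: "take ?L (zb w) = zb w" by (simp add: zb_def)
  have "\<forall>(e, f)\<in>strand_rel D. component_of D e = component_of D f" by clarify (rule component_of_eq)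
  then have r1: "\<forall>l<?L. swp (fst (w ! l) - 1) (row (component_of D) n l) = row (component_of D) n (Suc l)"
    and r2: "row (component_of D) n ?L = row (component_of D) n 0"
    unfolding D_def using strand_const_iff[OF w, of "component_of (braid_closure n w)"] by blast+
  show "swps (zb w) cs = cs" using swps_take[OF r1, of ?L] r2 tk by (simp add: cs_def)
  have rows: "set (row (component_of D) n l) = set cs" if "l \<le> ?L" for l
    unfolding swps_take[OF r1 that, symmetric] cs_def by (rule mset_eq_setD) simp
  have arcs: "arcs D = {1..n} \<times> {0..?L}" by (simp add: D_def braid_closure_def Let_def)
  have "components D = component_of D ` ({1..n} \<times> {0..?L})"
    unfolding components_def curves_def quotient_def component_of_def arcs by blast
  also have "\<dots> = (\<Union>l\<in>{0..?L}. set (row (component_of D) n l))"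
  proof -
    have "set (row g n l) = (\<lambda>p. g (p, l)) ` {1..n}" for g :: "nat \<times> nat \<Rightarrow> (nat \<times> nat) set" and l
      by (simp add: row_def atLeastLessThanSuc_atLeastAtMost del: upt_Suc)
    moreover have "g ` (A \<times> B) = (\<Union>l\<in>B. (\<lambda>p. g (p, l)) ` A)" for g :: "nat \<times> nat \<Rightarrow> (nat \<times> nat) set" and A B by auto
    ultimately show ?thesis by (simp only:)
  qed
  also have "\<dots> = set cs" using rows by auto
  finally show "set cs = components D" ..
  fix b :: "'b list" assume b: "length b = length cs" "swps (zb w) b = b"
  define g where "g = (\<lambda>(p, l). swps (take l (zb w)) b ! (p - 1))"
  have lb: "length b = n" using b(1) by (simp add: cs_def)
  have row: "row g n l = swps (take l (zb w)) b" for l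
    using lb by (intro nth_equalityI) (simp_all add: nth_row g_def length_swps)
  have gc: "\<forall>(e, f)\<in>strand_rel D. g e = g f" unfolding D_def strand_const_iff[OF w]
  proof (intro conjI allI impI)
    fix l assume l: "l < ?L"
    have "take (Suc l) (zb w) = take l (zb w) @ [(fst (w ! l) - 1, snd (w ! l))]"
      using l by (simp add: take_Suc_conv_app_nth zb_def case_prod_beta)
    then show "swp (fst (w ! l) - 1) (row g n l) = row g n (Suc l)" by (simp add: row swps_append)
  next
    show "row g n ?L = row g n 0" by (simp add: row tk b)
  qed
  have "b ! p = b ! p'" if p: "p < n" "p' < n" "cs ! p = cs ! p'" for p p'
  proof -
    have "component_of D (Suc p, 0) = component_of D (Suc p', 0)"
      using p(3) by (simp only: cs_def nth_row[OF p(1)] nth_row[OF p(2)])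
    from component_const[OF gc this] show ?thesis by (simp add: g_def)
  qed
  then show "\<forall>p<length cs. \<forall>p'<length cs. cs ! p = cs ! p' \<longrightarrow> b ! p = b ! p'"
    unfolding cs_def length_row by blast
qed

theorem bracket_S_trace:
  fixes A :: "'a::field_char_0"
  assumes A: "A \<noteq> 0" and \<delta>: "- (A powi 2) - A powi (- 2) \<noteq> 0" and w: "letters n w"
  defines "q \<equiv> A powi (- 2)"
  shows "(- (A powi 2) - A powi (- 2)) * bracket_S A N (braid_closure n w) =
    tr (ST N n) (\<lambda>f s. kaps q s * actw (xr (sig A q)) (xl (sig' A q)) (zb w) (symp q N n f) s)"
proof -
  let ?D = "braid_closure n w"
  define cs where "cs = row (component_of ?D) n 0"
  note cc = components_closure[OF w, folded cs_def]
  have q: "q \<noteq> 0" and AAq: "A * A * q = 1" using A by (auto simp: q_def power_int_minus power2_eq_square field_simps)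
  have P: "natural q (xr (sig A q))" by (rule natural_xr[OF AAq])
  have Q: "natural q (xl (sig' A q))"
    by (rule natural_inverse[OF P strand_op_xl[OF lin2_sig'] inverse_xr_xl[OF inverse_sig[OF q A]]])
  have rep: "map (\<lambda>C. x) cs = replicate n x" for x :: 'c by (simp add: map_replicate_const cs_def)
  have "(- (A powi 2) - A powi (- 2)) * bracket_S A N ?D =
    (\<Sum>j\<in>set cs \<rightarrow>\<^sub>E {0..N div 2}. (\<Prod>C\<in>set cs. (- 1) ^ j C * of_nat ((N - j C) choose j C)) *
      ((- (A powi 2) - A powi (- 2)) * bracket A (cable (\<lambda>e. N - 2 * j (component_of ?D e)) ?D)))"
    unfolding bracket_S_def cc(2) sum_distrib_left by (simp only: mult.left_commute)
  also have "\<dots> = (\<Sum>j\<in>set cs \<rightarrow>\<^sub>E {0..N div 2}. (\<Prod>C\<in>set cs. (- 1) ^ j C * of_nat ((N - j C) choose j C)) *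
      tr (shapes (map (\<lambda>C. N - 2 * j C) cs)) (\<lambda>f s. kaps q s * actw (xr (sig A q)) (xl (sig' A q)) (zb w) f s))"
  proof (intro sum.cong HOL.refl arg_cong2[where f = "(*)"])
    fix j :: "(nat \<times> nat) set \<Rightarrow> nat"
    have "\<forall>(e, f)\<in>strand_rel ?D. N - 2 * j (component_of ?D e) = N - 2 * j (component_of ?D f)" using component_of_eq by force
    moreover have "row (\<lambda>e. N - 2 * j (component_of ?D e)) n 0 = map (\<lambda>C. N - 2 * j C) cs" by (simp add: row_def cs_def del: upt_Suc)
    ultimately show "(- (A powi 2) - A powi (- 2)) * bracket A (cable (\<lambda>e. N - 2 * j (component_of ?D e)) ?D) =
      tr (shapes (map (\<lambda>C. N - 2 * j C) cs)) (\<lambda>f s. kaps q s * actw (xr (sig A q)) (xl (sig' A q)) (zb w) f s)"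
      using bracket_cable[OF A \<delta> w, of "\<lambda>e. N - 2 * j (component_of ?D e)"] unfolding q_def by simp
  qed
  also have "\<dots> = tr (shapes (map (\<lambda>C. N) cs)) (\<lambda>f s. kaps q s * actw (xr (sig A q)) (xl (sig' A q)) (zb w) (tens (map (\<lambda>C. symz q N) cs) f) s)"
    by (rule zc_sum[OF q P Q cc(1) cc(3)])
  finally show ?thesis unfolding rep ST_def symp_def .
qed

lemma braid_eq_letters: "braid_eq n u v \<Longrightarrow> letters n u \<longleftrightarrow> letters n v"
  by (induction rule: braid_eq.induct) (auto simp: letters_def)

text \<open>The abelianisation of the braid group. It gives the writhe of the closure of
  \<open>\<beta>\<close> from the positive word.\<close>

definition exponent_sum :: "braid_word \<Rightarrow> int" where
  "exponent_sum w = (\<Sum>(i, s)\<leftarrow>w. if s then 1 else - 1)"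

lemma braid_eq_exponent_sum: "braid_eq n u v \<Longrightarrow> exponent_sum u = exponent_sum v"
  by (induction rule: braid_eq.induct) (auto simp: exponent_sum_def)

lemma writhe_closure: "writhe (braid_closure n w) = exponent_sum w"
proof -
  have "is_positive (braid_crossing l x) = snd x" for l x by (cases x; cases "snd x") auto
  then have "writhe (braid_closure n w) = (\<Sum>l\<leftarrow>[0..<length w]. if snd (w ! l) then 1 else - 1)"
    by (simp add: writhe_def braid_closure_def Let_def comp_def)
  also have "\<dots> = (\<Sum>x\<leftarrow>w. if snd x then 1 else - 1)"
    by (rule arg_cong[of _ _ sum_list], rule nth_equalityI) auto
  also have "\<dots> = exponent_sum w" by (simp add: exponent_sum_def case_prod_unfold)
  finally show ?thesis .
qed

section \<open>Evaluation of the trace\<close>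

lemma ov_sig: "ov (sig c q) g a y = c ^ length y * ov (sig 1 q) g a y"
proof (induction y arbitrary: g a)
  case (Cons b y)
  have "sig c q (\<lambda>b' a'. k * h b' a') x z = (c * k) * sig 1 q h x z" for k h x z
    by (simp add: sig_def tw_def algebra_simps)
  then show ?case by (simp add: Cons)
qed simp

text \<open>Passage from the Kauffman to the Hecke normalisation: one factor \<open>c\<close> for
  each elementary crossing of the grid.\<close>

lemma xr_sig: "xr (sig c q) g x y = c ^ (length x * length y) * xr (sig 1 q) g x y"
proof (induction x arbitrary: g y)
  case (Cons a x)
  have F: "fl2 (blists (length y)) (blists (length x)) (\<lambda>g. xr (sig 1 q) g x y)" by (rule fl2_xr[OF lin2_sig])
  have "xr (sig c q) g (a # x) y = c ^ (length x * length y) * xr (sig 1 q) (\<lambda>u x'. ov (sig c q) (\<lambda>u' a'. g u' (a' # x')) a u) x y"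
    by (simp add: Cons)
  also have "xr (sig 1 q) (\<lambda>u x'. ov (sig c q) (\<lambda>u' a'. g u' (a' # x')) a u) x y =
      xr (sig 1 q) (\<lambda>u x'. c ^ length y * ov (sig 1 q) (\<lambda>u' a'. g u' (a' # x')) a u) x y"
    by (rule fl2_cong[where \<phi> = "\<lambda>g. xr (sig 1 q) g x y", OF F]) (subst ov_sig, simp add: blists_def)
  also have "\<dots> = c ^ length y * xr (sig 1 q) (\<lambda>u x'. ov (sig 1 q) (\<lambda>u' a'. g u' (a' # x')) a u) x y"
    by (rule fl2_scale_app[where \<phi> = "\<lambda>g. xr (sig 1 q) g x y", OF F])
  finally show ?case by (simp add: power_add mult_ac)
qed simp

lemma act_xr_sig: "s \<in> ST N n \<Longrightarrow> Suc i < n \<Longrightarrow> act (xr (sig c q)) i f s = c ^ (N * N) * act (xr (sig 1 q)) i f s"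
proof (induction i arbitrary: s n f)
  case 0
  obtain n' where "n = Suc (Suc 0 + n')" using less_imp_Suc_add[OF 0(2)] by blast
  then have n: "n = Suc (Suc n')" by simp
  obtain x y s' where s: "s = x # y # s'" "length x = N" "length y = N"
    using 0(1) unfolding n ST_Suc blists_def by auto
  have "act (xr (sig c q)) 0 f s = c ^ (length x * length y) * xr (sig 1 q) (\<lambda>u v. f (u # v # s')) x y"
    unfolding s(1) act.simps by (rule xr_sig)
  then show ?case unfolding s by simp
next
  case (Suc i)
  obtain n' where n: "n = Suc n'" using Suc.prems(2) by (cases n) auto
  obtain x s' where s: "s = x # s'" "s' \<in> ST N n'" using Suc.prems(1) unfolding n ST_Suc by auto
  show ?case unfolding s(1) act.simps by (rule Suc.IH[OF s(2)]) (use Suc.prems n in simp)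
qed

lemma actw_xr_sig:
  "\<forall>i\<in>set v. Suc i < n \<Longrightarrow> s \<in> ST N n \<Longrightarrow>
   actw (xr (sig c q)) Q (pos v) f s = (c ^ (N * N)) ^ length v * actw (xr (sig 1 q)) Q (pos v) f s"
proof (induction v arbitrary: s)
  case Nil then show ?case by (simp add: pos_def)
next
  case (Cons i v)
  let ?P = "xr (sig 1 q)"
  have "swp i (replicate n N) = replicate n N" by (rule nth_equalityI) (use Cons.prems in \<open>simp_all add: nth_swp\<close>)
  then have F: "fl (ST N n) (\<lambda>f. act ?P i f s)"
    using fl_act_strand[OF strand_op_xr[OF lin2_sig], of s "replicate n N" i 1 q] Cons.prems by (simp add: ST_def)
  have "actw (xr (sig c q)) Q (pos (i # v)) f s = c ^ (N * N) * act ?P i (actw (xr (sig c q)) Q (pos v) f) s"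
    using act_xr_sig[OF Cons.prems(2), of i] Cons.prems(1) by (simp add: pos_def)
  also have "act ?P i (actw (xr (sig c q)) Q (pos v) f) s = act ?P i (\<lambda>s. (c ^ (N * N)) ^ length v * actw ?P Q (pos v) f s) s"
    by (rule fl_cong[where \<phi> = "\<lambda>f. act ?P i f s", OF F]) (use Cons in simp)
  also have "\<dots> = (c ^ (N * N)) ^ length v * act ?P i (actw ?P Q (pos v) f) s"
    by (rule fl_scale_app[where \<phi> = "\<lambda>f. act ?P i f s", OF F])
  finally show ?case by (simp add: pos_def)
qed

text \<open>Multiplied by \<open>- q\<close>, the weight of \<open>True\<close> becomes
  \<open>q * q\<close> and that of \<open>False\<close> becomes 1.\<close>

lemma kapl_scaled: "q \<noteq> 0 \<Longrightarrow> (- q) ^ length x * kapl q x = q ^ (2 * ones x)"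
proof (induction x)
  case (Cons a x)
  have "(- q) ^ length (a # x) * kapl q (a # x) = ((- q) * kp q a) * ((- q) ^ length x * kapl q x)" by simp
  also have "\<dots> = q ^ (2 * ones (a # x))" using Cons by (auto simp: kp_def power2_eq_square)
  finally show ?case .
qed simp

lemma kaps_scaled:
  assumes "q \<noteq> 0" "s \<in> ST N n" shows "(- q) ^ (N * n) * kaps q s = q ^ (2 * ones (concat s))"
proof -
  have "length (concat s) = N * n" using assms(2) by (simp add: ST_def shapes_def length_concat sum_list_replicate)
  then show ?thesis using kapl_scaled[OF assms(1), of "concat s"] by (simp add: kapl_concat)
qed

text \<open>The sum 1 + t + ... + t^m for \<open>t = q * q\<close>.\<close>

definition geo :: "'a::field \<Rightarrow> nat \<Rightarrow> 'a" where "geo q m = (\<Sum>k\<le>m. q ^ (2 * k))"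

lemma kapl_xk_sum: "q \<noteq> 0 \<Longrightarrow> (- q) ^ N * (\<Sum>k\<le>N. kapl q (xk N k)) = geo q N"
  unfolding sum_distrib_left geo_def
proof (rule sum.cong)
  fix k assume "q \<noteq> 0" "k \<in> {..N}"
  then show "(- q) ^ N * kapl q (xk N k) = q ^ (2 * k)"
    using kapl_scaled[of q "xk N k"] xk_blists[of k N] by (simp add: blists_def)
qed simp

lemma quantum_int_geo:
  assumes q: "q \<noteq> 0" "q * q \<noteq> 1" shows "q ^ N * quantum_int q (Suc N) = geo q N"
proof -
  have "geo q N = (\<Sum>k<Suc N. (q * q) ^ k)" by (simp add: geo_def power_mult power2_eq_square lessThan_Suc_atMost)
  also have "\<dots> = ((q * q) ^ Suc N - 1) / (q * q - 1)" by (rule geometric_sum[OF q(2)])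
  finally have g: "geo q N = ((q * q) ^ Suc N - 1) / (q * q - 1)" .
  have "q powi (- int (Suc N)) = inverse (q ^ Suc N)" by (simp only: power_int_minus power_int_of_nat)
  then have "quantum_int q (Suc N) = (q ^ Suc N - inverse (q ^ Suc N)) / (q - inverse q)"
    unfolding quantum_int_def by (simp only: power_int_of_nat power_int_minus power_int_1_right)
  then have "q ^ N * quantum_int q (Suc N) = (q * (q ^ N * (q ^ Suc N - inverse (q ^ Suc N)))) / (q * (q - inverse q))"
    using q(1) by simp
  also have "q * (q ^ N * (q ^ Suc N - inverse (q ^ Suc N))) = q ^ Suc N * (q ^ Suc N - inverse (q ^ Suc N))"
    by (simp add: mult.assoc)
  also have "\<dots> = (q * q) ^ Suc N - 1"
    unfolding right_diff_distrib power_mult_distrib using right_inverse[of "q ^ Suc N"] q(1) by (simp only: power_eq_0_iff simp_thms)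
  also have "q * (q - inverse q) = q * q - 1" using q(1) by (simp add: algebra_simps)
  finally show ?thesis unfolding g .
qed

lemma positive_exponent_sum: "\<forall>x\<in>set w. snd x \<Longrightarrow> exponent_sum w = int (length w)"
  by (induction w) (auto simp: exponent_sum_def)

text \<open>Combines the framing sign of the \<open>n * n + n + c\<close> crossings with the sign
  from rescaling the weights of \<open>n\<close> strands; \<open>n * n + n\<close> is even.\<close>

lemma sign_parity: "(- 1 :: 'a::field) ^ (N * (n * n + n + c)) * (- 1) ^ (N * n) = (- 1) ^ (N * (n + c))"
proof -
  have "even (N * (n * n + n + c) + N * n) \<longleftrightarrow> even (N * (n + c))" by (auto simp: algebra_simps)
  then show ?thesis unfolding power_add[symmetric] by (simp add: minus_one_power_iff)
qed

text \<open>With \<open>Suc n\<close> strands, \<open>n\<close> of them stay closed when one is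
  opened. The framing factor cancels the powers of \<open>A\<close> from the Hecke normalisation and
  leaves \<open>q ^ N\<close> per crossing; of this, \<open>q ^ (N * n)\<close> is spent on
  rescaling the weights of the closed strands, which leaves the exponent
  \<open>N * (n\<^sup>2 + c)\<close>.\<close>

theorem normalized_colored_jones_value:
  fixes A :: "'a::field_char_0" and n c N :: nat and \<beta> \<beta>' :: braid_word
  defines "q \<equiv> A powi (- 2)"
  assumes A: "A \<noteq> 0" and \<delta>: "- (A powi 2) - A powi (- 2) \<noteq> 0" and qq: "q * q \<noteq> 1" "geo q N \<noteq> 0"
    and cf: "\<And>k. k < N \<Longrightarrow> cfac q N k \<noteq> 0"
    and pos: "positive_braid_word (Suc n) \<beta>'" and c: "length \<beta>' = c"
    and eq: "braid_eq (Suc n) \<beta> (full_twist (Suc n) @ \<beta>')"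
    and Z: "sub_ring Z" "q \<in> Z" and Zt: "sub_ring Zt" "q * q \<in> Zt"
  shows "\<exists>G\<in>Zt. \<exists>h\<in>Z. geo q N * G = geo q (N * Suc n) + q ^ (2 * Suc (N * Suc n)) * h \<and>
    normalized_colored_jones A (Suc N) (braid_closure (Suc n) \<beta>) = (- 1) ^ (N * (n + c)) * q ^ (N * (n\<^sup>2 + c)) * G"
proof -
  define w0 where "w0 = full_twist (Suc n) @ \<beta>'"
  define v' where "v' = map (\<lambda>(i, s). i - 1) \<beta>'"
  define v where "v = concat (replicate (Suc n) [0..<n]) @ v'"
  define Q where "Q = xl (sig' A q)"
  let ?P = "xr (sig A q)" and ?P1 = "xr (sig 1 q)" and ?D = "braid_closure (Suc n) \<beta>" and ?S = "ST N (Suc n)"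
  have q: "q \<noteq> 0" using A by (simp add: q_def)
  have Q: "strand_op Q" unfolding Q_def by (rule strand_op_xl[OF lin2_sig'])
  have qA: "q = inverse (A ^ 2)" by (simp add: q_def power_int_minus)
  have true: "snd x" "1 \<le> fst x" "fst x < Suc n" if "x \<in> set w0" for x
  proof -
    have "\<exists>i. x = (i, True) \<and> 1 \<le> i \<and> i < Suc n" if "x \<in> set (full_twist (Suc n))"
      using that by (auto simp: full_twist_def simp del: upt_Suc replicate_Suc)
    then show "snd x" "1 \<le> fst x" "fst x < Suc n" using that pos by (auto simp: w0_def positive_braid_word_def)
  qed
  have let0: "letters (Suc n) w0" using true by (fastforce simp: letters_def)
  have let1: "letters (Suc n) \<beta>" using let0 braid_eq_letters[OF eq] by (simp add: w0_def)
  have zb: "zb w0 = pos v"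
  proof -
    have "map (\<lambda>i. (i, True)) [1..<Suc n] = map (\<lambda>i. (Suc i, True)) [0..<n]"
      unfolding One_nat_def map_Suc_upt[symmetric] map_map comp_def ..
    then have "zb (full_twist (Suc n)) = pos (concat (replicate (Suc n) [0..<n]))"
      by (simp add: zb_def pos_def full_twist_def map_concat comp_def del: upt_Suc)
    moreover have "zb \<beta>' = pos v'"
      using pos by (auto simp: zb_def pos_def v'_def positive_braid_word_def)
    ultimately show ?thesis by (simp add: w0_def v_def pos_append)
  qed
  have lv: "length v = n * n + n + c" by (simp add: v_def v'_def c length_concat sum_list_replicate)
  have lw: "length w0 = length v" using arg_cong[OF zb, of length] by (simp add: zb_def pos_def)
  have vr: "\<forall>i\<in>set v. Suc i < Suc n"
  proof
    fix i assume "i \<in> set v"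
    then have "(i, True) \<in> set (zb w0)" unfolding zb by (simp add: pos_def)
    then show "Suc i < Suc n" using letters_zb[OF let0] by blast
  qed
  have wr: "writhe ?D = int (length v)"
    using braid_eq_exponent_sum[OF eq] positive_exponent_sum[of w0] true lw by (simp add: writhe_closure w0_def)
  let ?M = "MM q N n v' Q"
  have M: "?M f s = actw ?P1 Q (pos v) (symp q N (Suc n) f) s" for f s
    unfolding MM_def[OF q Q] mop_def[OF q Q] bop_def[OF q Q] v_def ..
  define T where "T = tr ?S (\<lambda>f s. kaps q s * ?M f s)"
  have bS: "(- (A powi 2) - A powi (- 2)) * bracket_S A N ?D = (A ^ (N * N)) ^ length v * T"
  proof -
    have "(- (A powi 2) - A powi (- 2)) * bracket_S A N ?D = tr ?S (\<lambda>f s. kaps q s * actw ?P Q (zb \<beta>) (symp q N (Suc n) f) s)"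
      unfolding q_def Q_def by (rule bracket_S_trace[OF A \<delta> let1])
    also have "\<dots> = tr ?S (\<lambda>f s. (A ^ (N * N)) ^ length v * (kaps q s * ?M f s))"
    proof (rule tr_cong)
      fix s f assume s: "s \<in> ?S"
      then have "length s = Suc n" by (auto simp: ST_def shapes_def dest: arg_cong[where f = length])
      then have "actw ?P Q (zb \<beta>) (symp q N (Suc n) f) s = actw ?P Q (zb w0) (symp q N (Suc n) f) s"
        unfolding Q_def w0_def by (rule braid_eq_actw[OF q A eq])
      also have "\<dots> = (A ^ (N * N)) ^ length v * ?M f s" unfolding zb M by (rule actw_xr_sig[OF vr s])
      finally show "kaps q s * actw ?P Q (zb \<beta>) (symp q N (Suc n) f) s = (A ^ (N * N)) ^ length v * (kaps q s * ?M f s)"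
        by (simp only: mult.left_commute)
    qed
    finally show ?thesis unfolding tr_scale T_def .
  qed
  define K where "K = (\<Sum>k\<le>N. kapl q (xk N k))"
  let ?v = "concat (replicate (Suc n) [0..<n]) @ v'"
  define g where "g = gtr q N n ?v Q 0"
  have TK: "T = K * g" unfolding T_def K_def g_def MM_def[OF q Q] by (rule tr_open[OF q Q cf])
  \<comment> \<open>The closed strands carry rescaled weights, and the opened strand is held at
    weight 0; by \<open>gtr_const\<close> the other weights up to \<open>N\<close> would give the
    same value.\<close>
  define G where "G = (\<Sum>Y\<in>ST N n. q ^ (2 * ones (concat Y)) * ?M (unit_fun (xk N 0 # Y)) (xk N 0 # Y))"
  have Gg: "(- q) ^ (N * n) * g = G"
    unfolding g_def gtr_def[OF q Q] tr_def sum_distrib_left G_def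
  proof (rule sum.cong)
    fix Y assume Y: "Y \<in> ST N n"
    have s: "xk N 0 # Y \<in> ?S" using Y by (simp add: ST_Cons xk_blists)
    have "Mk q N n ?v Q 0 0 (unit_fun Y) Y = ?M (unit_fun (xk N 0 # Y)) (xk N 0 # Y)"
      unfolding Mk_def[OF q Q] MM_def[OF q Q]
    proof (rule fl_cong[where \<phi> = "\<lambda>f. mop q N n ?v Q f (xk N 0 # Y)", OF fl_mop[OF q Q s]])
      fix s assume "s \<in> ?S"
      then obtain x s' where "s = x # s'" by (auto simp: ST_Suc)
      then show "emb N 0 (unit_fun Y) s = (unit_fun (xk N 0 # Y) s :: 'a)" by (simp add: emb_def[OF q Q] unit_fun_def)
    qed
    then show "(- q) ^ (N * n) * (kaps q Y * Mk q N n ?v Q 0 0 (unit_fun Y) Y) =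
       q ^ (2 * ones (concat Y)) * ?M (unit_fun (xk N 0 # Y)) (xk N 0 # Y)"
      using kaps_scaled[OF q Y] by (simp only: mult.assoc[symmetric])
  qed simp
  have GZ: "G \<in> Zt"
  proof -
    have pw: "(q * q) ^ k \<in> Zt" for k using Zt by (induction k) (auto simp: sub_ring_def)
    have "q ^ (2 * ones (concat Y)) * ?M (unit_fun (xk N 0 # Y)) (xk N 0 # Y) \<in> Zt" if "Y \<in> ST N n" for Y
    proof -
      have "xk N 0 # Y \<in> ?S" using that by (simp add: ST_Cons xk_blists)
      then have "?M (unit_fun (xk N 0 # Y)) (xk N 0 # Y) \<in> Zt" by (rule diag_parity[OF q Q Zt])
      moreover have "q ^ (2 * ones (concat Y)) \<in> Zt" using pw[of "ones (concat Y)"] by (simp add: power_mult power2_eq_square)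
      ultimately show ?thesis using Zt(1) by (auto simp: sub_ring_def)
    qed
    then show ?thesis unfolding G_def by (rule sub_ring_sum[OF Zt(1)])
  qed
  have KN: "(- q) ^ N * K = geo q N" unfolding K_def by (rule kapl_xk_sum[OF q])
  obtain h where h: "h \<in> Z" and est: "(\<Sum>s\<in>?S. q ^ (2 * ones (concat s)) * ?M (unit_fun s) s) =
      geo q (N * Suc n) + q ^ (2 * Suc (N * Suc n)) * h"
    using trace_estimate[OF q Q Z] unfolding geo_def by blast
  have "geo q N * G = (- q) ^ (N * Suc n) * T"
    unfolding TK Gg[symmetric] KN[symmetric] by (simp add: power_add mult_ac)
  also have "\<dots> = (\<Sum>s\<in>?S. q ^ (2 * ones (concat s)) * ?M (unit_fun s) s)"
    unfolding T_def tr_def sum_distrib_left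
    by (rule sum.cong[OF HOL.refl]) (simp only: mult.assoc[symmetric] kaps_scaled[OF q])
  finally have 1: "geo q N * G = geo q (N * Suc n) + q ^ (2 * Suc (N * Suc n)) * h" unfolding est .
  let ?w = "length v"
  \<comment> \<open>The weight sum of the opened strand is, up to sign, the quantum integer of the
    normalisation, so it cancels.\<close>
  have qi: "quantum_int q (Suc N) = (- 1) ^ N * K"
  proof -
    have "q ^ N * quantum_int q (Suc N) = q ^ N * ((- 1) ^ N * K)"
      unfolding quantum_int_geo[OF q qq(1)] KN[symmetric] by (simp add: power_minus[of q] mult_ac)
    then show ?thesis using q by simp
  qed
  have K0: "K \<noteq> 0" using KN qq(2) by auto
  have "colored_jones A (Suc N) ?D = ((- 1) ^ (N * ?w) * q ^ (N * ?w)) * ((- 1) ^ N * T)"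
  proof -
    have e1: "(- 1 :: 'a) powi (int N - 1) = - ((- 1) ^ N)" by (simp add: power_int_diff)
    have "((- 1) ^ N * A ^ (N\<^sup>2 + 2 * N)) powi (- writhe ?D) = inverse (((- 1) ^ N * A ^ (N\<^sup>2 + 2 * N)) ^ ?w)"
      unfolding wr by (simp only: power_int_minus power_int_of_nat)
    also have "\<dots> = (- 1) ^ (N * ?w) * inverse ((A ^ (N * N)) ^ ?w) * q ^ (N * ?w)"
    proof -
      have "A ^ (N\<^sup>2 + 2 * N) = A ^ (N * N) * (A ^ 2) ^ N" by (simp only: power_add power2_eq_square[of N] power_mult)
      then have "((- 1) ^ N * A ^ (N\<^sup>2 + 2 * N)) ^ ?w = (- 1) ^ (N * ?w) * ((A ^ (N * N)) ^ ?w * (A ^ 2) ^ (N * ?w))"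
        by (simp only: power_mult_distrib power_mult[of _ N ?w])
      moreover have "inverse ((A ^ 2) ^ (N * ?w)) = q ^ (N * ?w)" unfolding qA by (simp only: power_inverse)
      moreover have "inverse ((- 1 :: 'a) ^ (N * ?w)) = (- 1) ^ (N * ?w)" by (simp flip: power_inverse)
      ultimately show ?thesis by (simp only: inverse_mult_distrib mult.assoc)
    qed
    finally have e2: "((- 1) ^ N * A ^ (N\<^sup>2 + 2 * N)) powi (- writhe ?D) = (- 1) ^ (N * ?w) * inverse ((A ^ (N * N)) ^ ?w) * q ^ (N * ?w)" .
    have "colored_jones A (Suc N) ?D = ((- 1) ^ (N * ?w) * q ^ (N * ?w)) * (- 1) ^ N * inverse ((A ^ (N * N)) ^ ?w) *
       ((- (A powi 2) - A powi (- 2)) * bracket_S A N ?D)"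
      unfolding colored_jones.simps e1 e2 by (simp add: algebra_simps)
    also have "\<dots> = ((- 1) ^ (N * ?w) * q ^ (N * ?w)) * ((- 1) ^ N * T)"
      unfolding bS using A by (simp add: field_simps)
    finally show ?thesis .
  qed
  then have "normalized_colored_jones A (Suc N) ?D = (- 1) ^ (N * ?w) * q ^ (N * ?w) * g"
    unfolding normalized_colored_jones_def q_def[symmetric] qi TK using K0 by simp
  also have "\<dots> = (- 1) ^ (N * ?w) * (- 1) ^ (N * n) * q ^ (N * (n\<^sup>2 + c)) * ((- q) ^ (N * n) * g)"
  proof -
    have e3: "q ^ (N * ?w) = q ^ (N * (n\<^sup>2 + c)) * q ^ (N * n)"
      unfolding lv power_add[symmetric] by (simp add: power2_eq_square algebra_simps)
    have e4: "(- 1) ^ (N * n) * (- q) ^ (N * n) = q ^ (N * n)" by (simp add: power_mult_distrib[symmetric])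
    show ?thesis unfolding e3 e4[symmetric] by (simp only: mult_ac)
  qed
  also have "\<dots> = (- 1) ^ (N * (n + c)) * q ^ (N * (n\<^sup>2 + c)) * G"
    unfolding Gg lv sign_parity ..
  finally show ?thesis using 1 GZ h by blast
qed

section \<open>Integral polynomials\<close>

text \<open>The form in which the theorem evaluates an integral polynomial at
  \<open>t_var\<close>.\<close>

definition ev :: "'a::comm_ring_1 \<Rightarrow> int poly \<Rightarrow> 'a" where "ev x p = poly (map_poly of_int p) x"

lemma ev_pCons [simp]: "ev x (pCons a p) = of_int a + x * ev x p"
  by (simp add: ev_def map_poly_pCons)

lemma ev_0 [simp]: "ev x 0 = 0" by (simp add: ev_def)
lemma ev_1 [simp]: "ev x 1 = 1" by (simp add: one_pCons)

lemma ev_add [simp]: "ev x (p + r) = ev x p + ev x r"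
  by (induction p r rule: poly_induct2) (auto simp: algebra_simps)

lemma ev_smult: "ev x (smult c p) = of_int c * ev x p"
  by (induction p) (auto simp: algebra_simps)

lemma ev_minus [simp]: "ev x (- p) = - ev x p"
  using ev_smult[of x "- 1" p] by simp

lemma ev_diff [simp]: "ev x (p - r) = ev x p - ev x r"
  using ev_add[of x p "- r"] by simp

lemma ev_mult [simp]: "ev x (p * r) = ev x p * ev x r"
  by (induction p) (auto simp: algebra_simps ev_smult)

lemma ev_sum [simp]: "ev x (\<Sum>i\<in>I. f i) = (\<Sum>i\<in>I. ev x (f i))"
  by (induction I rule: infinite_finite_induct) auto

lemma ev_monom [simp]: "ev x (monom 1 n) = x ^ n"
  by (induction n) (auto simp: monom_0 monom_Suc)

lemma ev_pcompose: "ev x (pcompose p r) = ev (ev x r) p"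
  by (induction p) (auto simp: pcompose_pCons)

lemma ev_poly: "ev y p = pcompose p y"
  by (induction p) (auto simp: pcompose_pCons of_int_poly)

lemma ev_to_fract: "ev (to_fract (y :: int poly)) p = to_fract (ev y p)"
proof -
  have "to_fract (of_int a) = (of_int a :: int poly fract)" for a :: int
  proof -
    have "to_fract (of_nat n) = (of_nat n :: int poly fract)" for n by (induction n) auto
    then show ?thesis by (cases a rule: int_diff_cases) simp
  qed
  then show ?thesis by (induction p) auto
qed

text \<open>Supplies the rings Z[q] and Z[q^2] of the integrality statements.\<close>

lemma sub_ring_ev: "sub_ring (range (ev x))" "x \<in> range (ev x)"
proof -
  show "sub_ring (range (ev x))"
    unfolding sub_ring_def
  proof (intro conjI ballI)
    show "0 \<in> range (ev x)" "1 \<in> range (ev x)" by (rule range_eqI, rule ev_0[symmetric], rule range_eqI, rule ev_1[symmetric])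
    fix a b assume "a \<in> range (ev x)" "b \<in> range (ev x)"
    then obtain p r where "a = ev x p" "b = ev x r" by blast
    then show "a + b \<in> range (ev x)" "a * b \<in> range (ev x)" "a - b \<in> range (ev x)"
      by (simp_all only: ev_add[symmetric] ev_mult[symmetric] ev_diff[symmetric] rangeI)
  qed
  show "x \<in> range (ev x)" using ev_monom[of x 1] by (metis power_one_right rangeI)
qed

lemma sqrt_t_eq: "sqrt_t = inverse (to_fract [:0, 0, 1:])"
proof -
  have "A_var ^ 2 = to_fract [:0, 0, 1:]" by (simp add: A_var_def power2_eq_square flip: to_fract_mult)
  then show ?thesis by (simp add: sqrt_t_def power_int_minus)
qed

text \<open>Transcendence of \<open>sqrt_t\<close>. It is the inverse of the square of the variable;
  reversing the coefficients of \<open>p\<close> clears denominators, and composing a nonzero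
  polynomial with a square of the variable does not give zero.\<close>

lemma ev_sqrt_t_eq_0: "ev sqrt_t p = 0 \<longleftrightarrow> p = 0"
proof
  assume 0: "ev sqrt_t p = 0"
  let ?y = "[:0, 0, 1:] :: int poly" and ?P = "map_poly of_int p :: int poly fract poly"
  have y: "to_fract ?y \<noteq> 0" by simp
  have r: "reflect_poly ?P = map_poly of_int (reflect_poly p)"
    by (rule poly_eqI) (simp add: coeff_reflect_poly coeff_map_poly degree_map_poly)
  have "poly (reflect_poly ?P) (to_fract ?y) = 0"
    unfolding poly_reflect_poly_nz[OF y] using 0 by (simp add: ev_def sqrt_t_eq)
  then have "to_fract (ev ?y (reflect_poly p)) = 0" unfolding r ev_to_fract[symmetric] by (simp add: ev_def)
  then have "pcompose (reflect_poly p) ?y = 0" unfolding ev_poly by simp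
  then have "reflect_poly p = 0" using pcompose_eq_0[of "reflect_poly p" ?y] by simp
  then show "p = 0" by simp
qed simp

lemma ev_sqrt_t_eq: "ev sqrt_t p = ev sqrt_t r \<longleftrightarrow> p = r"
  using ev_sqrt_t_eq_0[of "p - r"] by auto

section \<open>Comparison of low coefficients\<close>

lemma coeff_pcompose_square: "coeff (pcompose (p :: int poly) (monom 1 2)) (2 * k) = coeff p k"
proof (induction p arbitrary: k)
  case (pCons a p)
  then show ?case by (cases k) (simp_all add: pcompose_pCons coeff_monom_mult)
qed simp

text \<open>A polynomial with constant coefficient 1 is invertible as an integral power series, so
  multiplying by it cannot raise the order of vanishing at 0.\<close>

lemma coeff_zero_of_mult:
  fixes p u :: "int poly"
  assumes u: "coeff u 0 = 1" and p: "u * p = monom 1 M * r"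
  shows "k < M \<Longrightarrow> coeff p k = 0"
proof (induction k rule: less_induct)
  case (less k)
  have "0 = coeff (u * p) k" using less.prems by (simp add: p coeff_monom_mult)
  also have "\<dots> = (\<Sum>i\<le>k. coeff u i * coeff p (k - i))" by (rule coeff_mult)
  also have "\<dots> = coeff u 0 * coeff p k + (\<Sum>i\<in>{..k} - {0}. coeff u i * coeff p (k - i))"
    by (subst sum.remove[of _ 0]) auto
  also have "(\<Sum>i\<in>{..k} - {0}. coeff u i * coeff p (k - i)) = 0"
    by (rule sum.neutral) (use less in auto)
  finally show ?case using u by simp
qed

definition geo_poly :: "nat \<Rightarrow> int poly" where "geo_poly m = (\<Sum>k\<le>m. monom 1 (2 * k))"

lemma ev_geo_poly: "ev (x :: 'a::field) (geo_poly m) = geo x m" by (simp add: geo_poly_def geo_def)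

lemma coeff_geo_poly: "coeff (geo_poly m) 0 = 1"
  unfolding geo_poly_def coeff_sum by (subst sum.remove[of _ 0]) auto

text \<open>Division with remainder by \<open>Suc m\<close> writes each exponent below
  \<open>Suc m * Suc n\<close> in exactly one way.\<close>

lemma geo_poly_split: "(\<Sum>k\<le>m. monom (1::int) (2 * k)) * (\<Sum>i\<le>n. monom 1 (2 * (i * Suc m))) = (\<Sum>k<Suc m * Suc n. monom 1 (2 * k))"
proof (induction n)
  case 0 then show ?case by (simp add: lessThan_Suc_atMost)
next
  case (Suc n)
  have "{..<Suc m * Suc (Suc n)} = {..<Suc m * Suc n} \<union> (\<lambda>k. Suc m * Suc n + k) ` {..m}"
  proof (intro set_eqI iffI)
    fix x assume x: "x \<in> {..<Suc m * Suc (Suc n)}"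
    show "x \<in> {..<Suc m * Suc n} \<union> (\<lambda>k. Suc m * Suc n + k) ` {..m}"
    proof (cases "x < Suc m * Suc n")
      case False
      then have "x = Suc m * Suc n + (x - Suc m * Suc n)" "x - Suc m * Suc n \<le> m" using x by auto
      then show ?thesis by blast
    qed simp
  qed auto
  then have f1: "(\<Sum>k<Suc m * Suc (Suc n). monom (1::int) (2 * k)) =
      (\<Sum>k<Suc m * Suc n. monom 1 (2 * k)) + (\<Sum>k\<in>(\<lambda>k. Suc m * Suc n + k) ` {..m}. monom 1 (2 * k))"
    by (elim ssubst) (rule sum.union_disjoint, auto)
  have f2: "(\<Sum>k\<in>(\<lambda>k. Suc m * Suc n + k) ` {..m}. monom (1::int) (2 * k)) = (\<Sum>k\<le>m. monom 1 (2 * k)) * monom 1 (2 * (Suc n * Suc m))"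
    by (subst sum.reindex) (auto simp: inj_on_def sum_distrib_right mult_monom algebra_simps)
  show ?case unfolding f1 f2 sum.atMost_Suc distrib_left Suc ..
qed

text \<open>Multiplied by 1 + t + ... + t^N, both \<open>G\<close> and the sum over \<open>i\<close>
  become 1 + t + ... with all coefficients equal to 1 up to degree \<open>n * N\<close>. As the
  factor has constant coefficient 1, the difference \<open>R\<close> vanishes up to this degree as
  well.\<close>

theorem corollary4:
  fixes n c N :: nat and \<beta> \<beta>' :: braid_word
  assumes "n \<ge> 1"
    and "positive_braid_word n \<beta>'" and "length \<beta>' = c"
    and "braid_eq n \<beta> (full_twist n @ \<beta>')"
    and "int N > int n - 2"
  shows "\<exists>R :: int poly.
           (\<forall>k. coeff R k \<noteq> 0 \<longrightarrow> k \<ge> n * N + 1) \<and>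
           normalized_colored_jones A_var (N + 1) (braid_closure n \<beta>) =
             (- 1) ^ (N * (n + c + 1)) * sqrt_t ^ (N * ((n - 1)\<^sup>2 + c)) *
             ((\<Sum>i = 0..n - 1. t_var ^ (i * (N + 1))) + poly (map_poly of_int R) t_var)"
proof -
  obtain m where n: "n = Suc m" using assms(1) by (cases n) auto
  let ?q = sqrt_t and ?M = "N * Suc m"
  have A: "A_var \<noteq> 0" by (simp add: A_var_def)
  have q: "?q \<noteq> 0" using A by (simp add: sqrt_t_def)
  have t: "t_var = ?q * ?q" using A by (simp add: t_var_def sqrt_t_def flip: power_int_add)
  have nz: "ev ?q p \<noteq> 0" if "coeff p 0 \<noteq> 0" for p using that ev_sqrt_t_eq_0[of p] by auto
  have \<delta>: "- (A_var powi 2) - A_var powi (- 2) \<noteq> 0"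
  proof
    assume "- (A_var powi 2) - A_var powi (- 2) = 0"
    then have "- inverse ?q - ?q = 0" by (simp add: sqrt_t_def power_int_minus)
    then have "?q * (- inverse ?q - ?q) = 0" by (simp only: mult_zero_right)
    then have "ev ?q [:1, 0, 1:] = 0" using q by (simp add: algebra_simps)
    then show False using nz[of "[:1, 0, 1:]"] by simp
  qed
  have qq: "?q * ?q \<noteq> 1"
  proof
    assume "?q * ?q = 1"
    then have "ev ?q [:- 1, 0, 1:] = 0" by simp
    then show False using nz[of "[:- 1, 0, 1:]"] by simp
  qed
  have geo: "geo ?q k \<noteq> 0" for k using nz[of "geo_poly k"] by (simp add: coeff_geo_poly ev_geo_poly)
  have cf: "cfac ?q N k \<noteq> 0" if "k < N" for k
  proof -
    have "{..<N - k} = {..N - k - 1}" using that by auto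
    then have "(\<Sum>j<N - k. ?q ^ j * ?q ^ j) = geo ?q (N - k - 1)" by (simp add: geo_def mult_2 power_add)
    then show ?thesis using geo q by (simp add: cfac_def)
  qed
  obtain G h where "G \<in> range (ev (?q * ?q))" "h \<in> range (ev ?q)"
    and G: "geo ?q N * G = geo ?q ?M + ?q ^ (2 * Suc ?M) * h"
    and J: "normalized_colored_jones A_var (Suc N) (braid_closure (Suc m) \<beta>) = (- 1) ^ (N * (m + c)) * ?q ^ (N * (m\<^sup>2 + c)) * G"
    using normalized_colored_jones_value[OF A \<delta> qq[unfolded sqrt_t_def] geo[unfolded sqrt_t_def] cf[unfolded sqrt_t_def]
        assms(2)[unfolded n] assms(3) assms(4)[unfolded n] sub_ring_ev[of "A_var powi (- 2)"]
        sub_ring_ev[of "A_var powi (- 2) * A_var powi (- 2)"], folded sqrt_t_def] by blast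
  then obtain g hp where g: "G = ev (?q * ?q) g" and h: "h = ev ?q hp" by blast
  define S where "S = (\<Sum>i\<le>m. monom (1::int) (i * Suc N))"
  define R where "R = g - S"
  let ?X = "monom 1 2 :: int poly"
  \<comment> \<open>Substituting the square of the variable brings the polynomials in t and those in
    its square root to one variable, where \<open>ev_sqrt_t_eq\<close> compares
    coefficients.\<close>
  have evX: "ev (?q * ?q) p = ev ?q (pcompose p ?X)" for p by (simp add: ev_pcompose power2_eq_square)
  have SX: "geo_poly N * pcompose S ?X = (\<Sum>k<Suc N * Suc m. monom 1 (2 * k))"
  proof -
    have "ev ?q (pcompose S ?X) = ev ?q (\<Sum>i\<le>m. monom 1 (2 * (i * Suc N)))"
      unfolding S_def ev_pcompose ev_sum ev_monom by (simp only: power_mult)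
    then have "pcompose S ?X = (\<Sum>i\<le>m. monom 1 (2 * (i * Suc N)))" by (simp only: ev_sqrt_t_eq)
    then show ?thesis unfolding geo_poly_def using geo_poly_split by simp
  qed
  have gX: "geo_poly N * pcompose g ?X = geo_poly ?M + monom 1 (2 * Suc ?M) * hp"
  proof -
    have "ev ?q (geo_poly N * pcompose g ?X) = ev ?q (geo_poly ?M + monom 1 (2 * Suc ?M) * hp)"
      using G unfolding g h evX by (simp add: ev_geo_poly del: power_Suc)
    then show ?thesis by (simp only: ev_sqrt_t_eq)
  qed
  \<comment> \<open>The number of terms \<open>Suc N * Suc m\<close> exceeds \<open>Suc ?M\<close>
    by \<open>m\<close>; the surplus terms all have degree at least \<open>2 * Suc ?M\<close> in the
    square root of t.\<close>
  have "(\<Sum>k<Suc N * Suc m. monom (1::int) (2 * k)) = geo_poly ?M + monom 1 (2 * Suc ?M) * (\<Sum>k<m. monom 1 (2 * k))"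
  proof -
    have "(\<Sum>k<Suc ?M + j. monom (1::int) (2 * k)) = geo_poly ?M + monom 1 (2 * Suc ?M) * (\<Sum>k<j. monom 1 (2 * k))" for j
    proof (induction j)
      case 0 show ?case by (simp add: geo_poly_def lessThan_Suc_atMost)
    next
      case (Suc j)
      have "monom (1::int) (2 * (Suc ?M + j)) = monom 1 (2 * Suc ?M) * monom 1 (2 * j)" by (simp add: mult_monom algebra_simps)
      then show ?case using Suc by (simp add: distrib_left del: mult_Suc_right)
    qed
    moreover have "Suc N * Suc m = Suc ?M + m" by simp
    ultimately show ?thesis by metis
  qed
  then have "geo_poly N * pcompose R ?X = monom 1 (2 * Suc ?M) * (hp - (\<Sum>k<m. monom 1 (2 * k)))"
    using gX SX unfolding R_def pcompose_diff right_diff_distrib by simp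
  then have z: "coeff (pcompose R ?X) k = 0" if "k < 2 * Suc ?M" for k
    using coeff_zero_of_mult[OF coeff_geo_poly] that by blast
  have "coeff R k = 0" if "k < Suc ?M" for k
    using z[of "2 * k"] that by (simp only: coeff_pcompose_square mult_less_cancel1) simp
  then have "\<forall>k. coeff R k \<noteq> 0 \<longrightarrow> k \<ge> n * N + 1" unfolding n by (metis Suc_eq_plus1 mult.commute not_le)
  moreover have "G = (\<Sum>i = 0..n - 1. t_var ^ (i * (N + 1))) + poly (map_poly of_int R) t_var"
  proof -
    have "G = ev t_var S + ev t_var R" by (simp add: g t R_def)
    then show ?thesis by (simp add: S_def n atMost_atLeast0 flip: ev_def)
  qed
  moreover have "(- 1 :: int poly fract) ^ (N * (n + c + 1)) = (- 1) ^ (N * (m + c))"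
  proof -
    have "even (N * (n + c + 1)) \<longleftrightarrow> even (N * (m + c))" by (auto simp: n)
    then show ?thesis by (simp add: minus_one_power_iff)
  qed
  ultimately show ?thesis using J unfolding n by (intro exI[of _ R]) simp
qed

end
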